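(* Let $\mathbb{F}$ be a field. The linear map $S$ sending $\alpha$ to $(-1)^n\alpha^c$ for all compositions $\alpha\models n$, $n\ge0$, is the antipode of $\mathfrak{Comp}$. Consequently, the antipode of $G_0(\mathcal{H}_\bullet)$ is $\sigma\circ S\circ\iota$, which (for $\alpha\propto n$, $n\ge0$) sends $\mathbf{C}_\alpha$ to $(-1)^n\mathbf{C}_{\alpha^c}$ if $\alpha^c\propto n$ also holds, that is, if $\alpha\in\{22\cdots2,\ 122\cdots2,\ 22\cdots21,\ 122\cdots21\}$ (where the number of $2$'s may be zero), and sends $\mathbf{C}_\alpha$ to $0$ otherwise.
   Context: A composition of $n$ is a sequence $\alpha=(\alpha_1,\ldots,\alpha_\ell)$ of positive integers with sum $|\alpha|=n$ (empty composition $\emptyset$ for $n=0$), written $\alpha\models n$; let $\sigma_i:=\alpha_1+\cdots+\alpha_i$ and $D(\alpha):=\{\sigma_1,\ldots,\sigma_{\ell-1}\}\subseteq[n-1]$. $\alpha\mapsto D(\alpha)$ is a bijection from compositions of $n$ to subsets of $[n-1]$; $\alpha^c$ is the composition of $n$ with $D(\alpha^c)=[n-1]\setminus D(\alpha)$ (and $\emptyset^c=\emptyset$). Write $\alpha\propto n$ if $\alpha\models n$ and $\alpha_i>1$ whenever $1<i<\ell$. For nonempty $\alpha=(\alpha_1,\ldots,\alpha_\ell)$, $\beta=(\beta_1,\ldots,\beta_k)$: $\alpha\beta:=(\alpha_1,\ldots,\alpha_\ell,\beta_1,\ldots,\beta_k)$ and $\alpha\rhd\beta:=(\alpha_1,\ldots,\alpha_{\ell-1},\alpha_\ell+\beta_1,\beta_2,\ldots,\beta_k)$.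 For $0\le i\le|\alpha|$, let $r$ be the largest integer with $\sigma_r\le i$; $\alpha_{\le i}:=(\alpha_1,\ldots,\alpha_r,i-\sigma_r)$, omitting $i-\sigma_r$ if it is $0$, and $\alpha_{>i}:=(\sigma_{r+1}-i,\alpha_{r+2},\ldots,\alpha_\ell)$ (empty if $i=|\alpha|$). $\mathfrak{Comp}$ is the free $\mathbb{Z}$-module with basis all compositions, with product $\alpha\,\hat\otimes\,\beta:=\alpha\beta+\alpha\rhd\beta$ for nonempty $\alpha,\beta$ and unit $\emptyset$, and coproduct $\Delta(\alpha):=\sum_{0\le i\le|\alpha|}\alpha_{\le i}\otimes\alpha_{>i}$ with counit $\epsilon(\emptyset)=1$, $\epsilon(\alpha)=0$ for $\alpha\neq\emptyset$. It is an algebra and a coalgebra (not a bialgebra). $\mathcal{H}_0:=\mathbb{F}$ and, for $n\ge1$, $\mathcal{H}_n$ is the commutative $\mathbb{F}$-algebra generated by $x_1,\ldots,x_{n-1}$ with relations $x_i^2=x_i$ and $x_ix_{i+1}=0$. Its simple modules are the one-dimensional modules $\mathbf{C}_\alpha$, $\alpha\propto n$, on which $x_i$ acts by $1$ if $i\in D(\alpha)$ and by $0$ otherwise. $G_0(\mathcal{H}_\bullet):=\bigoplus_{n\ge0}G_0(\mathcal{H}_n)$, where $G_0(\mathcal{H}_n)$ is the Grothendieck group of finitely generated modules, is an algebra under induction of $\mathbf{C}_\alpha\otimes\mathbf{C}_\beta$ along $\mathcal{H}_m\otimes\mathcal{H}_n\hookrightarrow\mathcal{H}_{m+n}$ (image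 generated by $x_1,\ldots,x_{m-1},x_{m+1},\ldots,x_{m+n-1}$), with unit $\mathbf{C}_\emptyset$, and a coalgebra under $\Delta(\mathbf{C}_\alpha)$ = the sum over $0\le i\le m$ of the restrictions of $\mathbf{C}_\alpha$ to $\mathcal{H}_i\otimes\mathcal{H}_{m-i}$ ($\alpha\propto m$), with counit $\epsilon(\mathbf{C}_\emptyset)=1$, $\epsilon(\mathbf{C}_\alpha)=0$ for $\alpha\ne\emptyset$. $\sigma:\mathfrak{Comp}\twoheadrightarrow G_0(\mathcal{H}_\bullet)$ is the linear map with $\sigma(\alpha)=\mathbf{C}_\alpha$ if $\alpha\propto n$ and $\sigma(\alpha)=0$ otherwise ($\alpha\models n$); $\iota:G_0(\mathcal{H}_\bullet)\hookrightarrow\mathfrak{Comp}$ is the linear map with $\iota(\mathbf{C}_\alpha)=\alpha$. For $H$ that is simultaneously an algebra $(H,\mu,u)$ and a coalgebra $(H,\Delta,\epsilon)$ (no compatibility required), the antipode of $H$, if it exists, is the two-sided inverse of the identity map under the convolution product $f\star g:=\mu\circ(f\otimes g)\circ\Delta$ on linear endomorphisms of $H$, whose identity element is $u\circ\epsilon$. *)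

theory Defs
  imports "HOL-Algebra.Module" "HOL-Algebra.IntRing" "HOL-Algebra.QuotRing" "HOL-Algebra.Free_Abelian_Groups"
    "HOL-Library.Poly_Mapping"
begin

section \<open>Linear algebra over a commutative ring\<close>

text \<open>
  Modules are records of HOL-Algebra's type \<^typ>\<open>('r, 'a) module\<close>. Its multiplication and unit
  fields are meaningful only for algebras; a module that is not an algebra carries arbitrary values
  there, which no definition below inspects.
\<close>

definition mod_hom ::
  "('r, 'c) ring_scheme \<Rightarrow> ('r, 'a) module \<Rightarrow> ('r, 'b) module \<Rightarrow> ('a \<Rightarrow> 'b) set" where
  "mod_hom R M N = {h \<in> carrier M \<rightarrow> carrier N.
     (\<forall>x\<in>carrier M. \<forall>y\<in>carrier M. h (x \<oplus>\<^bsub>M\<^esub> y) = h x \<oplus>\<^bsub>N\<^esub> h y) \<and>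
     (\<forall>r\<in>carrier R. \<forall>x\<in>carrier M. h (r \<odot>\<^bsub>M\<^esub> x) = r \<odot>\<^bsub>N\<^esub> h x)}"

definition mod_iso ::
  "('r, 'c) ring_scheme \<Rightarrow> ('r, 'a) module \<Rightarrow> ('r, 'b) module \<Rightarrow> bool" where
  "mod_iso R M N \<longleftrightarrow> (\<exists>h\<in>mod_hom R M N. bij_betw h (carrier M) (carrier N))"

definition short_exact ::
  "('r, 'c) ring_scheme \<Rightarrow> ('r, 'a) module \<Rightarrow> ('r, 'b) module \<Rightarrow> ('r, 'd) module \<Rightarrow> bool" where
  "short_exact R L M N \<longleftrightarrow> (\<exists>f\<in>mod_hom R L M. \<exists>g\<in>mod_hom R M N.
     inj_on f (carrier L) \<and> f ` carrier L = {x \<in> carrier M. g x = \<zero>\<^bsub>N\<^esub>} \<and>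
     g ` carrier M = carrier N)"

definition fin_gen :: "('r, 'c) ring_scheme \<Rightarrow> ('r, 'a) module \<Rightarrow> bool" where
  "fin_gen R M \<longleftrightarrow> (\<exists>X. finite X \<and> X \<subseteq> carrier M \<and>
     (\<forall>U. submodule U R M \<and> X \<subseteq> U \<longrightarrow> U = carrier M))"

text \<open>
  The linear map \<open>M \<rightarrow> N\<close> with \<open>g i \<mapsto> v i\<close> for \<open>i \<in> I\<close>. It is used only where the \<open>g i\<close> span
  \<open>M\<close> and such a map exists (the \<open>g i\<close> form a basis, or are the pure tensors and \<open>v\<close> is bilinear),
  so that the choice is unique on the carrier of \<open>M\<close>.
\<close>

definition lin_ext ::
  "('r, 'c) ring_scheme \<Rightarrow> ('r, 'a) module \<Rightarrow> ('r, 'b) module \<Rightarrow>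
   'i set \<Rightarrow> ('i \<Rightarrow> 'a) \<Rightarrow> ('i \<Rightarrow> 'b) \<Rightarrow> 'a \<Rightarrow> 'b" where
  "lin_ext R M N I g v = (SOME h. h \<in> mod_hom R M N \<and> (\<forall>i\<in>I. h (g i) = v i))"

text \<open>HOL-Algebra's commutative groups are written multiplicatively.\<close>

definition Zmod :: "('a, 'm) monoid_scheme \<Rightarrow> (int, 'a) module" where
  "Zmod G = \<lparr>carrier = carrier G, monoid.mult = undefined, monoid.one = undefined,
     ring.zero = \<one>\<^bsub>G\<^esub>, add = (\<lambda>x y. x \<otimes>\<^bsub>G\<^esub> y), smult = (\<lambda>k x. x [^]\<^bsub>G\<^esub> k)\<rparr>"

definition restrict_scalars :: "('r \<Rightarrow> 's) \<Rightarrow> ('s, 'a) module \<Rightarrow> ('r, 'a) module" where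
  "restrict_scalars \<phi> M = \<lparr>carrier = carrier M, monoid.mult = monoid.mult M,
     monoid.one = monoid.one M, ring.zero = ring.zero M, add = add M, smult = (\<lambda>r x. \<phi> r \<odot>\<^bsub>M\<^esub> x)\<rparr>"


section \<open>Tensor products\<close>

definition tensor_rels ::
  "('r, 'c) ring_scheme \<Rightarrow> ('r, 'a) module \<Rightarrow> ('r, 'b) module \<Rightarrow> (('a \<times> 'b) \<Rightarrow>\<^sub>0 int) set" where
  "tensor_rels R M N =
     {frag_of (x \<oplus>\<^bsub>M\<^esub> x', y) - frag_of (x, y) - frag_of (x', y) |x x' y.
        x \<in> carrier M \<and> x' \<in> carrier M \<and> y \<in> carrier N} \<union>
     {frag_of (x, y \<oplus>\<^bsub>N\<^esub> y') - frag_of (x, y) - frag_of (x, y') |x y y'.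
        x \<in> carrier M \<and> y \<in> carrier N \<and> y' \<in> carrier N} \<union>
     {frag_of (r \<odot>\<^bsub>M\<^esub> x, y) - frag_of (x, r \<odot>\<^bsub>N\<^esub> y) |r x y.
        r \<in> carrier R \<and> x \<in> carrier M \<and> y \<in> carrier N}"

definition tensor_kernel ::
  "('r, 'c) ring_scheme \<Rightarrow> ('r, 'a) module \<Rightarrow> ('r, 'b) module \<Rightarrow> (('a \<times> 'b) \<Rightarrow>\<^sub>0 int) set" where
  "tensor_kernel R M N =
     generate (free_Abelian_group (carrier M \<times> carrier N)) (tensor_rels R M N)"

definition tens ::
  "('r, 'c) ring_scheme \<Rightarrow> ('r, 'a) module \<Rightarrow> ('r, 'b) module \<Rightarrow>
   'a \<Rightarrow> 'b \<Rightarrow> (('a \<times> 'b) \<Rightarrow>\<^sub>0 int) set" where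
  "tens R M N x y =
     tensor_kernel R M N #>\<^bsub>free_Abelian_group (carrier M \<times> carrier N)\<^esub> frag_of (x, y)"

definition tensor ::
  "('r, 'c) ring_scheme \<Rightarrow> ('r, 'a) module \<Rightarrow> ('r, 'b) module \<Rightarrow>
   ('r, (('a \<times> 'b) \<Rightarrow>\<^sub>0 int) set) module" where
  "tensor R M N =
    (let G = free_Abelian_group (carrier M \<times> carrier N); K = tensor_kernel R M N; Q = G Mod K in
     \<lparr>carrier = carrier Q, monoid.mult = undefined, monoid.one = undefined,
      ring.zero = \<one>\<^bsub>Q\<^esub>, add = (\<lambda>X Y. X \<otimes>\<^bsub>Q\<^esub> Y),
      smult = (\<lambda>r X. \<Union>p\<in>X. K #>\<^bsub>G\<^esub> frag_extend (\<lambda>(x, y). frag_of (r \<odot>\<^bsub>M\<^esub> x, y)) p)\<rparr>)"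

text \<open>The linear map on \<open>M \<otimes>\<^sub>R N\<close> induced by a bilinear map.\<close>

definition tensor_lift ::
  "('r, 'c) ring_scheme \<Rightarrow> ('r, 'a) module \<Rightarrow> ('r, 'b) module \<Rightarrow> ('r, 'd) module \<Rightarrow>
   ('a \<Rightarrow> 'b \<Rightarrow> 'd) \<Rightarrow> (('a \<times> 'b) \<Rightarrow>\<^sub>0 int) set \<Rightarrow> 'd" where
  "tensor_lift R M N P b = lin_ext R (tensor R M N) P (carrier M \<times> carrier N)
     (\<lambda>(x, y). tens R M N x y) (\<lambda>(x, y). b x y)"

definition tensor_map ::
  "('r, 'c) ring_scheme \<Rightarrow> ('r, 'a) module \<Rightarrow> ('r, 'b) module \<Rightarrow> ('r, 'd) module \<Rightarrow> ('r, 'e) module \<Rightarrow>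
   ('a \<Rightarrow> 'd) \<Rightarrow> ('b \<Rightarrow> 'e) \<Rightarrow> (('a \<times> 'b) \<Rightarrow>\<^sub>0 int) set \<Rightarrow> (('d \<times> 'e) \<Rightarrow>\<^sub>0 int) set" where
  "tensor_map R M N M' N' f g =
     tensor_lift R M N (tensor R M' N') (\<lambda>x y. tens R M' N' (f x) (g y))"

definition tensor_algebra ::
  "('r, 'c) ring_scheme \<Rightarrow> ('r, 'a) module \<Rightarrow> ('r, 'b) module \<Rightarrow>
   ('r, (('a \<times> 'b) \<Rightarrow>\<^sub>0 int) set) module" where
  "tensor_algebra R A B = (tensor R A B)
     \<lparr>monoid.mult := (\<lambda>X Y. tensor_lift R A B (tensor R A B) (\<lambda>a b.
        tensor_lift R A B (tensor R A B) (\<lambda>a' b'. tens R A B (a \<otimes>\<^bsub>A\<^esub> a') (b \<otimes>\<^bsub>B\<^esub> b')) Y) X),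
      monoid.one := tens R A B \<one>\<^bsub>A\<^esub> \<one>\<^bsub>B\<^esub>\<rparr>"

text \<open>A module over an \<open>R\<close>-algebra \<open>A\<close>, viewed as an \<open>R\<close>-module.\<close>

definition base_module :: "('r, 'a) module \<Rightarrow> ('a, 'u) module \<Rightarrow> ('r, 'u) module" where
  "base_module A M = restrict_scalars (\<lambda>r. r \<odot>\<^bsub>A\<^esub> \<one>\<^bsub>A\<^esub>) M"

text \<open>For an \<open>A\<close>-module \<open>M\<close> and a \<open>B\<close>-module \<open>N\<close>, the \<open>A \<otimes>\<^sub>R B\<close>-module \<open>M \<otimes>\<^sub>R N\<close>.\<close>

definition outer_tensor ::
  "('r, 'c) ring_scheme \<Rightarrow> ('r, 'a) module \<Rightarrow> ('r, 'b) module \<Rightarrow>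
   ('a, 'u) module \<Rightarrow> ('b, 'v) module \<Rightarrow>
   ((('a \<times> 'b) \<Rightarrow>\<^sub>0 int) set, (('u \<times> 'v) \<Rightarrow>\<^sub>0 int) set) module" where
  "outer_tensor R A B M N =
    (let M' = base_module A M; N' = base_module B N; P = tensor R M' N' in
     \<lparr>carrier = carrier P, monoid.mult = undefined, monoid.one = undefined,
      ring.zero = ring.zero P, add = add P,
      smult = (\<lambda>T Z. tensor_lift R A B P (\<lambda>a b.
        tensor_lift R M' N' P (\<lambda>u v. tens R M' N' (a \<odot>\<^bsub>M\<^esub> u) (b \<odot>\<^bsub>N\<^esub> v)) Z) T)\<rparr>)"

text \<open>The \<open>B\<close>-module \<open>B \<otimes>\<^sub>A M\<close>, for commutative rings \<open>A\<close>, \<open>B\<close> and a homomorphism \<open>\<phi> : A \<rightarrow> B\<close>.\<close>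

definition induced_module ::
  "('a, 'c) ring_scheme \<Rightarrow> ('b, 'd) ring_scheme \<Rightarrow> ('a \<Rightarrow> 'b) \<Rightarrow> ('a, 'u) module \<Rightarrow>
   ('b, (('b \<times> 'u) \<Rightarrow>\<^sub>0 int) set) module" where
  "induced_module A B \<phi> M =
    (let B' = \<lparr>carrier = carrier B, monoid.mult = monoid.mult B, monoid.one = monoid.one B,
               ring.zero = ring.zero B, add = add B, smult = (\<lambda>a b. \<phi> a \<otimes>\<^bsub>B\<^esub> b)\<rparr>;
         P = tensor A B' M in
     \<lparr>carrier = carrier P, monoid.mult = undefined, monoid.one = undefined,
      ring.zero = ring.zero P, add = add P,
      smult = (\<lambda>b. tensor_lift A B' M P (\<lambda>b' u. tens A B' M (b \<otimes>\<^bsub>B\<^esub> b') u))\<rparr>)"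


section \<open>Grothendieck groups of finitely generated modules\<close>

text \<open>
  Every finitely generated \<open>R\<close>-module is isomorphic to a quotient of some \<open>R\<^sup>k\<close>, whose elements are
  sets of functions from \<open>nat\<close> to \<open>R\<close>; so this set contains every isomorphism class. A short exact
  sequence with one end zero identifies the symbols of isomorphic modules.
\<close>

definition fg_modules :: "('r, 'c) ring_scheme \<Rightarrow> ('r, (nat \<Rightarrow> 'r) set) module set" where
  "fg_modules R = {M. module R M \<and> fin_gen R M}"

type_synonym 'r G0_elem = "(('r, (nat \<Rightarrow> 'r) set) module \<Rightarrow>\<^sub>0 int) set"

definition G0_kernel :: "('r, 'c) ring_scheme \<Rightarrow> 'r G0_elem" where
  "G0_kernel R = generate (free_Abelian_group (fg_modules R))
     {frag_of M - frag_of L - frag_of N |L M N.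
        L \<in> fg_modules R \<and> M \<in> fg_modules R \<and> N \<in> fg_modules R \<and> short_exact R L M N}"

definition G0 :: "('r, 'c) ring_scheme \<Rightarrow> 'r G0_elem monoid" where
  "G0 R = free_Abelian_group (fg_modules R) Mod G0_kernel R"

definition G0_class :: "('r, 'c) ring_scheme \<Rightarrow> ('r, 'u) module \<Rightarrow> 'r G0_elem" where
  "G0_class R M = G0_kernel R #>\<^bsub>free_Abelian_group (fg_modules R)\<^esub>
     frag_of (SOME M'. M' \<in> fg_modules R \<and> mod_iso R M M')"


section \<open>Antipodes\<close>

text \<open>
  A free \<open>\<int>\<close>-module \<open>H\<close> with product \<open>\<mu> : H \<otimes> H \<rightarrow> H\<close>, unit \<open>u : \<int> \<rightarrow> H\<close>, coproduct
  \<open>\<Delta> : H \<rightarrow> H \<otimes> H\<close> and counit \<open>\<epsilon> : H \<rightarrow> \<int>\<close>.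
\<close>

definition convolution ::
  "(int, 'h) module \<Rightarrow> ((('h \<times> 'h) \<Rightarrow>\<^sub>0 int) set \<Rightarrow> 'h) \<Rightarrow> ('h \<Rightarrow> (('h \<times> 'h) \<Rightarrow>\<^sub>0 int) set) \<Rightarrow>
   ('h \<Rightarrow> 'h) \<Rightarrow> ('h \<Rightarrow> 'h) \<Rightarrow> 'h \<Rightarrow> 'h" where
  "convolution H \<mu> \<Delta> f g = \<mu> \<circ> tensor_map \<Z> H H H H f g \<circ> \<Delta>"

definition is_antipode ::
  "(int, 'h) module \<Rightarrow> ((('h \<times> 'h) \<Rightarrow>\<^sub>0 int) set \<Rightarrow> 'h) \<Rightarrow> (int \<Rightarrow> 'h) \<Rightarrow>
   ('h \<Rightarrow> (('h \<times> 'h) \<Rightarrow>\<^sub>0 int) set) \<Rightarrow> ('h \<Rightarrow> int) \<Rightarrow> ('h \<Rightarrow> 'h) \<Rightarrow> bool" where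
  "is_antipode H \<mu> u \<Delta> \<epsilon> S \<longleftrightarrow> S \<in> mod_hom \<Z> H H \<and>
     (\<forall>x\<in>carrier H. convolution H \<mu> \<Delta> S id x = u (\<epsilon> x) \<and> convolution H \<mu> \<Delta> id S x = u (\<epsilon> x))"

definition Zself :: "(int, int) module" where
  "Zself = \<lparr>carrier = UNIV, monoid.mult = (*), monoid.one = 1, ring.zero = 0,
     add = (+), smult = (*)\<rparr>"


section \<open>Compositions\<close>

definition composition :: "nat \<Rightarrow> nat list \<Rightarrow> bool" where
  "composition n \<alpha> \<longleftrightarrow> (\<forall>a\<in>set \<alpha>. 0 < a) \<and> sum_list \<alpha> = n"

definition partial_sum :: "nat list \<Rightarrow> nat \<Rightarrow> nat" where
  "partial_sum \<alpha> i = sum_list (take i \<alpha>)"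

definition descents :: "nat list \<Rightarrow> nat set" where
  "descents \<alpha> = partial_sum \<alpha> ` {1..<length \<alpha>}"

definition comp_compl :: "nat list \<Rightarrow> nat list" where
  "comp_compl \<alpha> = (THE \<beta>. composition (sum_list \<alpha>) \<beta> \<and>
     descents \<beta> = {1..<sum_list \<alpha>} - descents \<alpha>)"

text \<open>The relation \<open>\<alpha> \<propto> n\<close>; list positions count from 0.\<close>

definition inner_gt1 :: "nat \<Rightarrow> nat list \<Rightarrow> bool" where
  "inner_gt1 n \<alpha> \<longleftrightarrow> composition n \<alpha> \<and> (\<forall>i. 0 < i \<and> i + 1 < length \<alpha> \<longrightarrow> 1 < \<alpha> ! i)"

definition near_concat :: "nat list \<Rightarrow> nat list \<Rightarrow> nat list" where
  "near_concat \<alpha> \<beta> = butlast \<alpha> @ (last \<alpha> + hd \<beta>) # tl \<beta>"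

definition cut_index :: "nat list \<Rightarrow> nat \<Rightarrow> nat" where
  "cut_index \<alpha> i = (GREATEST r. r \<le> length \<alpha> \<and> partial_sum \<alpha> r \<le> i)"

definition comp_upto :: "nat list \<Rightarrow> nat \<Rightarrow> nat list" where
  "comp_upto \<alpha> i = (let r = cut_index \<alpha> i in
     take r \<alpha> @ (if i = partial_sum \<alpha> r then [] else [i - partial_sum \<alpha> r]))"

definition comp_after :: "nat list \<Rightarrow> nat \<Rightarrow> nat list" where
  "comp_after \<alpha> i = (if i = sum_list \<alpha> then [] else
     let r = cut_index \<alpha> i in (partial_sum \<alpha> (r + 1) - i) # drop (r + 1) \<alpha>)"


section \<open>The algebra and coalgebra of compositions\<close>

definition compositions :: "nat list set" where
  "compositions = {\<alpha>. composition (sum_list \<alpha>) \<alpha>}"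

definition Comp :: "(int, nat list \<Rightarrow>\<^sub>0 int) module" where
  "Comp = Zmod (free_Abelian_group compositions)"

type_synonym comp_tensor = "(((nat list \<Rightarrow>\<^sub>0 int) \<times> (nat list \<Rightarrow>\<^sub>0 int)) \<Rightarrow>\<^sub>0 int) set"

definition comp_prod :: "nat list \<Rightarrow> nat list \<Rightarrow> nat list \<Rightarrow>\<^sub>0 int" where
  "comp_prod \<alpha> \<beta> = (if \<alpha> = [] then frag_of \<beta> else if \<beta> = [] then frag_of \<alpha>
     else frag_of (\<alpha> @ \<beta>) + frag_of (near_concat \<alpha> \<beta>))"

definition Comp_mult :: "comp_tensor \<Rightarrow> nat list \<Rightarrow>\<^sub>0 int" where
  "Comp_mult = lin_ext \<Z> (tensor \<Z> Comp Comp) Comp (compositions \<times> compositions)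
     (\<lambda>(\<alpha>, \<beta>). tens \<Z> Comp Comp (frag_of \<alpha>) (frag_of \<beta>)) (\<lambda>(\<alpha>, \<beta>). comp_prod \<alpha> \<beta>)"

definition Comp_unit :: "int \<Rightarrow> nat list \<Rightarrow>\<^sub>0 int" where
  "Comp_unit k = k \<odot>\<^bsub>Comp\<^esub> frag_of []"

definition Comp_comult :: "(nat list \<Rightarrow>\<^sub>0 int) \<Rightarrow> comp_tensor" where
  "Comp_comult = lin_ext \<Z> Comp (tensor \<Z> Comp Comp) compositions frag_of
     (\<lambda>\<alpha>. \<Oplus>\<^bsub>tensor \<Z> Comp Comp\<^esub>i\<in>{0..sum_list \<alpha>}.
        tens \<Z> Comp Comp (frag_of (comp_upto \<alpha> i)) (frag_of (comp_after \<alpha> i)))"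

definition Comp_counit :: "(nat list \<Rightarrow>\<^sub>0 int) \<Rightarrow> int" where
  "Comp_counit = lin_ext \<Z> Comp Zself compositions frag_of (\<lambda>\<alpha>. if \<alpha> = [] then 1 else 0)"

definition Comp_S :: "(nat list \<Rightarrow>\<^sub>0 int) \<Rightarrow> nat list \<Rightarrow>\<^sub>0 int" where
  "Comp_S = lin_ext \<Z> Comp Comp compositions frag_of
     (\<lambda>\<alpha>. (-1) ^ sum_list \<alpha> \<odot>\<^bsub>Comp\<^esub> frag_of (comp_compl \<alpha>))"


section \<open>The algebras \<open>\<H>\<^sub>n\<close>\<close>

text \<open>Polynomials in indeterminates indexed by \<open>nat\<close>, as finitely supported functions on monomials.\<close>

type_synonym 'f mpoly = "(nat \<Rightarrow>\<^sub>0 nat) \<Rightarrow>\<^sub>0 'f"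

definition Const :: "'f::field \<Rightarrow> 'f mpoly" where
  "Const c = Poly_Mapping.single 0 c"

definition Var :: "nat \<Rightarrow> 'f::field mpoly" where
  "Var i = Poly_Mapping.single (Poly_Mapping.single i 1) 1"

definition mp_eval :: "('f::field \<Rightarrow> 'b::comm_ring_1) \<Rightarrow> (nat \<Rightarrow> 'b) \<Rightarrow> 'f mpoly \<Rightarrow> 'b" where
  "mp_eval \<phi> s p = (\<Sum>m\<in>Poly_Mapping.keys p. \<phi> (Poly_Mapping.lookup p m) *
     (\<Prod>i\<in>Poly_Mapping.keys m. s i ^ Poly_Mapping.lookup m i))"

definition base_field :: "'f::field ring" where
  "base_field = \<lparr>carrier = UNIV, monoid.mult = (*), monoid.one = 1, ring.zero = 0, add = (+)\<rparr>"

definition poly_ring :: "nat \<Rightarrow> 'f::field mpoly ring" where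
  "poly_ring n = \<lparr>carrier = {p. \<forall>m\<in>Poly_Mapping.keys p. Poly_Mapping.keys m \<subseteq> {1..<n}},
     monoid.mult = (*), monoid.one = 1, ring.zero = 0, add = (+)\<rparr>"

definition H_ideal :: "nat \<Rightarrow> 'f::field mpoly set" where
  "H_ideal n = Idl\<^bsub>poly_ring n\<^esub>
     ({Var i * Var i - Var i |i. i \<in> {1..<n}} \<union>
      {Var i * Var (i + 1) |i. i \<in> {1..<n} \<and> i + 1 \<in> {1..<n}})"

text \<open>For \<open>n \<le> 1\<close> there are no indeterminates, and the algebra is the field itself.\<close>

definition Halg :: "nat \<Rightarrow> ('f::field, 'f mpoly set) module" where
  "Halg n = (let Q = poly_ring n Quot H_ideal n in
     \<lparr>carrier = carrier Q, monoid.mult = monoid.mult Q, monoid.one = monoid.one Q,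
      ring.zero = ring.zero Q, add = add Q,
      smult = (\<lambda>c X. \<Union>p\<in>X. H_ideal n +>\<^bsub>poly_ring n\<^esub> (Const c * p))\<rparr>)"

text \<open>The homomorphism into \<open>\<H>\<^sub>l\<close> with \<open>x\<^sub>i \<mapsto> x\<^bsub>k+i\<^esub>\<close>.\<close>

definition H_shift :: "nat \<Rightarrow> nat \<Rightarrow> 'f::field mpoly set \<Rightarrow> 'f mpoly set" where
  "H_shift l k X = (\<Union>p\<in>X. H_ideal l +>\<^bsub>poly_ring l\<^esub> mp_eval Const (\<lambda>i. Var (k + i)) p)"

type_synonym 'f HH_elem = "(('f mpoly set \<times> 'f mpoly set) \<Rightarrow>\<^sub>0 int) set"

definition HHalg :: "nat \<Rightarrow> nat \<Rightarrow> ('f::field, 'f HH_elem) module" where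
  "HHalg m n = tensor_algebra base_field (Halg m) (Halg n)"

definition H_embed :: "nat \<Rightarrow> nat \<Rightarrow> 'f::field HH_elem \<Rightarrow> 'f mpoly set" where
  "H_embed m n = tensor_lift base_field (Halg m) (Halg n) (Halg (m + n))
     (\<lambda>a b. H_shift (m + n) 0 a \<otimes>\<^bsub>Halg (m + n)\<^esub> H_shift (m + n) m b)"

text \<open>
  The module \<open>C\<^sub>\<alpha>\<close>: the class of a polynomial \<open>p\<close> acts by the value of \<open>p\<close> at the indicator function
  of \<open>D(\<alpha>)\<close>, which for \<open>\<alpha> \<propto> n\<close> is the same for all representatives \<open>p\<close>.
\<close>

definition Csimple :: "nat list \<Rightarrow> ('f::field mpoly set, 'f) module" where
  "Csimple \<alpha> = \<lparr>carrier = UNIV, monoid.mult = undefined, monoid.one = undefined,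
     ring.zero = 0, add = (+),
     smult = (\<lambda>X c. the_elem (mp_eval id (\<lambda>i. if i \<in> descents \<alpha> then 1 else 0) ` X) * c)\<rparr>"

definition Ctensor ::
  "nat list \<Rightarrow> nat list \<Rightarrow> ('f::field HH_elem, (('f \<times> 'f) \<Rightarrow>\<^sub>0 int) set) module" where
  "Ctensor \<alpha> \<beta> = outer_tensor base_field (Halg (sum_list \<alpha>)) (Halg (sum_list \<beta>))
     (Csimple \<alpha>) (Csimple \<beta>)"


section \<open>The algebra and coalgebra \<open>G\<^sub>0(\<H>\<^sub>\<bullet>)\<close>\<close>

type_synonym 'f GH_elem = "nat \<Rightarrow> 'f mpoly set G0_elem"
type_synonym 'f GH_tensor = "(('f GH_elem \<times> 'f GH_elem) \<Rightarrow>\<^sub>0 int) set"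

definition GH :: "(int, 'f::field GH_elem) module" where
  "GH = Zmod (sum_group UNIV (\<lambda>n. G0 (Halg n :: ('f, 'f mpoly set) module)))"

text \<open>The class of an \<open>\<H>\<^sub>n\<close>-module, in degree \<open>n\<close>.\<close>

definition GH_class :: "nat \<Rightarrow> ('f::field mpoly set, 'u) module \<Rightarrow> 'f GH_elem" where
  "GH_class n M = (\<lambda>k. if k = n then G0_class (Halg n :: ('f, 'f mpoly set) module) M
     else \<one>\<^bsub>G0 (Halg k :: ('f, 'f mpoly set) module)\<^esub>)"

definition Cclass :: "nat list \<Rightarrow> 'f::field GH_elem" where
  "Cclass \<alpha> = GH_class (sum_list \<alpha>) (Csimple \<alpha>)"

definition simple_index :: "nat list set" where
  "simple_index = {\<alpha>. inner_gt1 (sum_list \<alpha>) \<alpha>}"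

definition GH_mult :: "'f::field GH_tensor \<Rightarrow> 'f GH_elem" where
  "GH_mult = lin_ext \<Z> (tensor \<Z> GH GH) GH (simple_index \<times> simple_index)
     (\<lambda>(\<alpha>, \<beta>). tens \<Z> GH GH (Cclass \<alpha>) (Cclass \<beta>))
     (\<lambda>(\<alpha>, \<beta>). let m = sum_list \<alpha>; n = sum_list \<beta> in
        GH_class (m + n)
          (induced_module (HHalg m n) (Halg (m + n) :: ('f, 'f mpoly set) module)
             (H_embed m n) (Ctensor \<alpha> \<beta>)))"

definition GH_unit :: "int \<Rightarrow> 'f::field GH_elem" where
  "GH_unit k = k \<odot>\<^bsub>GH\<^esub> Cclass []"

text \<open>
  The simple \<open>\<H>\<^sub>i \<otimes> \<H>\<^sub>j\<close>-modules are the \<open>C\<^sub>\<alpha> \<otimes> C\<^sub>\<beta>\<close> with \<open>\<alpha> \<propto> i\<close> and \<open>\<beta> \<propto> j\<close>; this is the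
  resulting identification of \<open>G\<^sub>0(\<H>\<^sub>i \<otimes> \<H>\<^sub>j)\<close> with \<open>G\<^sub>0(\<H>\<^sub>i) \<otimes> G\<^sub>0(\<H>\<^sub>j)\<close>.
\<close>

definition GH_split :: "nat \<Rightarrow> nat \<Rightarrow> 'f::field HH_elem G0_elem \<Rightarrow> 'f GH_tensor" where
  "GH_split i j = lin_ext \<Z>
     (Zmod (G0 (HHalg i j :: ('f, 'f HH_elem) module))) (tensor \<Z> GH GH)
     ({\<alpha>. inner_gt1 i \<alpha>} \<times> {\<beta>. inner_gt1 j \<beta>})
     (\<lambda>(\<alpha>, \<beta>). G0_class (HHalg i j :: ('f, 'f HH_elem) module) (Ctensor \<alpha> \<beta>))
     (\<lambda>(\<alpha>, \<beta>). tens \<Z> GH GH (Cclass \<alpha>) (Cclass \<beta>))"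

definition GH_comult :: "'f::field GH_elem \<Rightarrow> 'f GH_tensor" where
  "GH_comult = lin_ext \<Z> GH (tensor \<Z> GH GH) simple_index Cclass
     (\<lambda>\<alpha>. let m = sum_list \<alpha> in
        \<Oplus>\<^bsub>tensor \<Z> GH GH\<^esub>i\<in>{0..m}. GH_split i (m - i)
          (G0_class (HHalg i (m - i) :: ('f, 'f HH_elem) module)
             (restrict_scalars (H_embed i (m - i)) (Csimple \<alpha>))))"

definition GH_counit :: "'f::field GH_elem \<Rightarrow> int" where
  "GH_counit = lin_ext \<Z> GH Zself simple_index Cclass (\<lambda>\<alpha>. if \<alpha> = [] then 1 else 0)"

definition GH_proj :: "(nat list \<Rightarrow>\<^sub>0 int) \<Rightarrow> 'f::field GH_elem" where
  "GH_proj = lin_ext \<Z> Comp GH compositions frag_of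
     (\<lambda>\<alpha>. if \<alpha> \<in> simple_index then Cclass \<alpha> else \<zero>\<^bsub>GH\<^esub>)"

definition GH_incl :: "'f::field GH_elem \<Rightarrow> nat list \<Rightarrow>\<^sub>0 int" where
  "GH_incl = lin_ext \<Z> GH Comp simple_index Cclass frag_of"

end

theory Submission
  imports Defs
begin

text \<open>
  If \<open>A\<close> and \<open>B\<close> are complementary subsets of \<open>[n-1]\<close>, the \<open>i\<close>-th product in the convolution is
  a sum of two compositions whose descent sets agree with \<open>A\<close> up to a point and with \<open>B\<close> after it,
  the switch being just before or just after \<open>i\<close>; with the signs \<open>(-1)\<^sup>i\<close> the sum telescopes to \<open>0\<close>.
  This is the antipode identity for \<open>Comp\<close>.

  The characters of \<open>\<H>\<^sub>n\<close>, indexed by the subsets of \<open>[n-1]\<close> without two consecutive elements,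
  identify \<open>\<H>\<^sub>n\<close> with \<open>\<F>\<^sup>I\<close>. Hence every finitely generated module is a direct sum of
  one-dimensional ones, \<open>G\<^sub>0\<close> is free on the classes \<open>Cclass \<alpha>\<close>, and inductions and restrictions are computed by
  comparing characters. It follows that \<open>GH_proj\<close> is multiplicative (two consecutive descents in a
  factor survive in both summands of the product) and that \<open>GH_incl\<close> is comultiplicative (cutting
  creates no consecutive descents), so that \<open>GH_proj\<close> carries the antipode identity of \<open>Comp\<close>, read on the simple
  indices, to the one for \<open>GH\<close>.
\<close>

section \<open>Quotients of free abelian groups\<close>

text \<open>Write sigma for \<open>GH_proj\<close>, iota for \<open>GH_incl\<close>, and mu, Delta
  for product and coproduct. The transfer is mu (sigma S iota \<otimes> id) Delta = sigma mu (S
  \<otimes> id) Delta iota, where sigma iota = id supplies the second factor. Neither map respects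
  both structures: (1,1) times itself contains (1,1,1,1), which G_0 does not see, and sigma kills
  (1,1,1) although its cut into (1) and (1,1) survives.

  The labour lies in the structure maps. They are choices \<open>lin_ext\<close>, opaque until a
  linear map with the prescribed values is exhibited; on G_0 this requires independence of the
  simple classes, hence multiplicities that are well defined and additive in short exact sequences.
  Instead of composition series, coordinates are used: functionals on which the algebra acts by
  characters (\<open>coord_module\<close>), counted by linear algebra. C_\<alpha>, outer tensor
  products, restricted and induced modules all receive such coordinates, and
  \<open>G0_class_coord\<close> reads off their classes.\<close>

locale free_quotient =
  fixes S :: "'s set" and rels :: "('s \<Rightarrow>\<^sub>0 int) set"
  assumes rels: "rels \<subseteq> carrier (free_Abelian_group S)"
begin

abbreviation "F \<equiv> free_Abelian_group S"

definition "K = generate F rels"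

text \<open>The group is written multiplicatively, while its elements are formal sums with
  \<open>+\<close>. Both the tensor product and the Grothendieck group are instances, with
  bilinearity and short exact sequences as relations.\<close>

abbreviation cls :: "('s \<Rightarrow>\<^sub>0 int) \<Rightarrow> ('s \<Rightarrow>\<^sub>0 int) set" where "cls p \<equiv> K #>\<^bsub>F\<^esub> p"

sublocale F: comm_group F by (rule abelian_free_Abelian_group)

lemma K_subgroup: "subgroup K F"
  unfolding K_def using rels by (rule F.generate_is_subgroup)

lemma K_normal: "K \<lhd> F"
  by (simp add: F.normal_iff_subgroup K_subgroup)

sublocale K: normal K F by (rule K_normal)

lemma quotient_comm_group: "comm_group (F Mod K)"
  by (rule F.abelian_FactGroup[OF K_subgroup])

lemma K_keys: "k \<in> K \<Longrightarrow> Poly_Mapping.keys k \<subseteq> S"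
  by (drule subsetD[OF K.subset]) simp

lemma mem_cls_iff:
  assumes "Poly_Mapping.keys p \<subseteq> S"
  shows "q \<in> cls p \<longleftrightarrow> q - p \<in> K"
proof
  assume "q \<in> cls p" then show "q - p \<in> K" by (auto simp: r_coset_def)
next
  assume "q - p \<in> K"
  then have "q = (q - p) \<otimes>\<^bsub>F\<^esub> p" by simp
  then show "q \<in> cls p" using \<open>q - p \<in> K\<close> unfolding r_coset_def by blast
qed

lemma cls_eq_iff:
  assumes "Poly_Mapping.keys p \<subseteq> S" "Poly_Mapping.keys q \<subseteq> S"
  shows "cls p = cls q \<longleftrightarrow> p - q \<in> K"
proof
  assume "cls p = cls q"
  then have "p \<in> cls q" using F.rcos_self[of p K] K_subgroup assms by simp
  then show "p - q \<in> K" using assms mem_cls_iff by simp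
next
  assume "p - q \<in> K"
  then have "p \<in> cls q" using assms mem_cls_iff by simp
  then show "cls p = cls q" using F.repr_independence[of p K q] K_subgroup assms by simp
qed

lemma cls_add:
  assumes "Poly_Mapping.keys p \<subseteq> S" "Poly_Mapping.keys q \<subseteq> S"
  shows "cls p \<otimes>\<^bsub>F Mod K\<^esub> cls q = cls (p + q)"
  using K.rcos_sum[of p q] assms by simp

lemma cls_closed [simp]: "Poly_Mapping.keys p \<subseteq> S \<Longrightarrow> cls p \<in> carrier (F Mod K)"
  by (auto simp: carrier_FactGroup)

lemma cls_zero: "cls 0 = K"
  using F.coset_join2[OF _ K_subgroup, of 0] K.one_closed by simp

lemma quotient_cases:
  assumes "X \<in> carrier (F Mod K)"
  obtains p where "Poly_Mapping.keys p \<subseteq> S" "X = cls p"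
  using assms by (auto simp: carrier_FactGroup)

lemma quotient_induct [consumes 1, case_names of add inv one]:
  assumes X: "X \<in> carrier (F Mod K)"
    and gen: "\<And>s. s \<in> S \<Longrightarrow> P (cls (frag_of s))"
    and add: "\<And>X Y. \<lbrakk>X \<in> carrier (F Mod K); Y \<in> carrier (F Mod K); P X; P Y\<rbrakk> \<Longrightarrow> P (X \<otimes>\<^bsub>F Mod K\<^esub> Y)"
    and inv: "\<And>X. \<lbrakk>X \<in> carrier (F Mod K); P X\<rbrakk> \<Longrightarrow> P (inv\<^bsub>F Mod K\<^esub> X)"
    and one: "P (\<one>\<^bsub>F Mod K\<^esub>)"
  shows "P X"
proof -
  interpret Q: comm_group "F Mod K" by (rule quotient_comm_group)
  obtain p where p: "Poly_Mapping.keys p \<subseteq> S" "X = cls p" using X quotient_cases by blast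
  have "P (cls p)" using p(1)
  proof (induction p rule: free_Abelian_group_induct[where S = S, consumes 1, case_names zero diff of])
    case zero then show ?case using one by (simp add: cls_zero)
  next
    case (diff x y)
    have "Poly_Mapping.keys (x - y) \<subseteq> S" using diff keys_diff[of x y] by auto
    then have c: "cls (x - y) \<in> carrier (F Mod K)" by simp
    \<comment> \<open>The induction on formal sums offers differences; solving
      \<open>(x - y) + y = x\<close> in the quotient turns a difference into a product with an
      inverse.\<close>
    have "cls (x - y) \<otimes>\<^bsub>F Mod K\<^esub> cls y = cls x"
      using cls_add[of "x - y" y] diff keys_diff[of x y] by fastforce
    then have "cls (x - y) = cls x \<otimes>\<^bsub>F Mod K\<^esub> inv\<^bsub>F Mod K\<^esub> (cls y)"
      using diff c by (subst Q.inv_solve_right) auto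
    then show ?case using diff by (simp only: add inv cls_closed Q.inv_closed)
  next
    case (of a) then show ?case by (rule gen)
  qed
  then show ?thesis using p by simp
qed

text \<open>A relation can be tested only after \<open>h\<close> has been extended to formal sums.
  So \<open>kill\<close> receives the extension \<open>h'\<close> with its values on generators and
  differences, from which the relations in use, being iterated differences of generators, can be
  computed.\<close>

lemma quotient_universal:
  fixes h :: "'s \<Rightarrow> 'p"
  assumes P: "comm_group P" and h: "\<And>s. s \<in> S \<Longrightarrow> h s \<in> carrier P"
    and kill: "\<And>h' r. \<lbrakk>h' \<in> hom F P; \<And>p q. \<lbrakk>Poly_Mapping.keys p \<subseteq> S; Poly_Mapping.keys q \<subseteq> S\<rbrakk> \<Longrightarrow>
          h' (p - q) = h' p \<otimes>\<^bsub>P\<^esub> inv\<^bsub>P\<^esub> h' q; \<And>s. s \<in> S \<Longrightarrow> h' (frag_of s) = h s; r \<in> rels\<rbrakk> \<Longrightarrow> h' r = \<one>\<^bsub>P\<^esub>"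
  obtains g where "g \<in> hom (F Mod K) P" "\<And>s. s \<in> S \<Longrightarrow> g (cls (frag_of s)) = h s"
proof -
  interpret P: comm_group P by fact
  have "h ` S \<subseteq> carrier P" using h by auto
  then obtain h' where h': "h' \<in> hom F P" "\<And>s. s \<in> S \<Longrightarrow> h' (frag_of s) = h s"
    using P.free_Abelian_group_universal by blast
  interpret gh: group_hom F P h' by unfold_locales (rule h'(1))
  have diff: "h' (p - q) = h' p \<otimes>\<^bsub>P\<^esub> inv\<^bsub>P\<^esub> h' q"
    if "Poly_Mapping.keys p \<subseteq> S" "Poly_Mapping.keys q \<subseteq> S" for p q
    using that gh.hom_inv[of q] gh.hom_mult[of p "- q"] by simp
  have "rels \<subseteq> kernel F P h'"
    using kill[OF h'(1) diff h'(2)] subsetD[OF rels] unfolding kernel_def by blast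
  then have "K \<subseteq> kernel F P h'"
    unfolding K_def by (intro F.generate_subgroup_incl gh.subgroup_kernel)
  from gh.FactGroup_universal_kernel[OF K_normal this]
  obtain g where g: "g \<in> hom (F Mod K) P" "\<And>x. x \<in> carrier F \<Longrightarrow> g (cls x) = h' x" by blast
  then show thesis using that h' by simp
qed

end

section \<open>Module homomorphisms\<close>

lemma mod_homI:
  assumes "\<And>x. x \<in> carrier M \<Longrightarrow> h x \<in> carrier N"
    and "\<And>x y. \<lbrakk>x \<in> carrier M; y \<in> carrier M\<rbrakk> \<Longrightarrow> h (x \<oplus>\<^bsub>M\<^esub> y) = h x \<oplus>\<^bsub>N\<^esub> h y"
    and "\<And>r x. \<lbrakk>r \<in> carrier R; x \<in> carrier M\<rbrakk> \<Longrightarrow> h (r \<odot>\<^bsub>M\<^esub> x) = r \<odot>\<^bsub>N\<^esub> h x"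
  shows "h \<in> mod_hom R M N"
  using assms by (auto simp: mod_hom_def)

lemma mod_hom_closed: "\<lbrakk>h \<in> mod_hom R M N; x \<in> carrier M\<rbrakk> \<Longrightarrow> h x \<in> carrier N"
  by (auto simp: mod_hom_def)

lemma mod_hom_add:
  "\<lbrakk>h \<in> mod_hom R M N; x \<in> carrier M; y \<in> carrier M\<rbrakk> \<Longrightarrow> h (x \<oplus>\<^bsub>M\<^esub> y) = h x \<oplus>\<^bsub>N\<^esub> h y"
  by (auto simp: mod_hom_def)

lemma mod_hom_smult:
  "\<lbrakk>h \<in> mod_hom R M N; r \<in> carrier R; x \<in> carrier M\<rbrakk> \<Longrightarrow> h (r \<odot>\<^bsub>M\<^esub> x) = r \<odot>\<^bsub>N\<^esub> h x"
  by (auto simp: mod_hom_def)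

text \<open>The only access to a \<open>lin_ext\<close>: once some linear map has the prescribed
  values, the chosen one is linear and has them too.\<close>

lemma lin_extI:
  assumes "\<exists>h\<in>mod_hom R M N. \<forall>i\<in>I. h (g i) = v i"
  shows "lin_ext R M N I g v \<in> mod_hom R M N" "i \<in> I \<Longrightarrow> lin_ext R M N I g v (g i) = v i"
proof -
  have "\<exists>h. h \<in> mod_hom R M N \<and> (\<forall>i\<in>I. h (g i) = v i)" using assms by blast
  from someI_ex[OF this, folded lin_ext_def]
  show "lin_ext R M N I g v \<in> mod_hom R M N" "i \<in> I \<Longrightarrow> lin_ext R M N I g v (g i) = v i" by auto
qed

section \<open>Tensor products\<close>

lemma tensor_rels_cases:
  assumes "h \<in> tensor_rels R M N"
  obtains (left) x x' y where "x \<in> carrier M" "x' \<in> carrier M" "y \<in> carrier N"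
      "h = frag_of (x \<oplus>\<^bsub>M\<^esub> x', y) - frag_of (x, y) - frag_of (x', y)" |
    (right) x y y' where "x \<in> carrier M" "y \<in> carrier N" "y' \<in> carrier N"
      "h = frag_of (x, y \<oplus>\<^bsub>N\<^esub> y') - frag_of (x, y) - frag_of (x, y')" |
    (scalar) t x y where "t \<in> carrier R" "x \<in> carrier M" "y \<in> carrier N"
      "h = frag_of (t \<odot>\<^bsub>M\<^esub> x, y) - frag_of (x, t \<odot>\<^bsub>N\<^esub> y)"
  using assms unfolding tensor_rels_def
  by (elim UnE CollectE exE conjE) (erule (3) left right scalar)+

lemma tensor_rels_leftI:
  "\<lbrakk>x \<in> carrier M; x' \<in> carrier M; y \<in> carrier N\<rbrakk> \<Longrightarrow>
    frag_of (x \<oplus>\<^bsub>M\<^esub> x', y) - frag_of (x, y) - frag_of (x', y) \<in> tensor_rels R M N"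
  unfolding tensor_rels_def by (rule UnI1, rule UnI1) blast

lemma tensor_rels_rightI:
  "\<lbrakk>x \<in> carrier M; y \<in> carrier N; y' \<in> carrier N\<rbrakk> \<Longrightarrow>
    frag_of (x, y \<oplus>\<^bsub>N\<^esub> y') - frag_of (x, y) - frag_of (x, y') \<in> tensor_rels R M N"
  unfolding tensor_rels_def by (rule UnI1, rule UnI2) blast

lemma tensor_rels_scalarI:
  "\<lbrakk>t \<in> carrier R; x \<in> carrier M; y \<in> carrier N\<rbrakk> \<Longrightarrow>
    frag_of (t \<odot>\<^bsub>M\<^esub> x, y) - frag_of (x, t \<odot>\<^bsub>N\<^esub> y) \<in> tensor_rels R M N"
  unfolding tensor_rels_def by (rule UnI2) blast

locale tensor_product =
  fixes R :: "('r, 'c) ring_scheme" and M :: "('r, 'a) module" and N :: "('r, 'b) module"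
  assumes M: "module R M" and N: "module R N"
begin

sublocale M: module R M by (rule M)
sublocale N: module R N by (rule N)

lemma tensor_rels_subset:
  "tensor_rels R M N \<subseteq> carrier (free_Abelian_group (carrier M \<times> carrier N))"
proof
  fix z assume "z \<in> tensor_rels R M N"
  then show "z \<in> carrier (free_Abelian_group (carrier M \<times> carrier N))"
    unfolding tensor_rels_def carrier_free_Abelian_group_iff
    by (elim UnE CollectE exE conjE; hypsubst;
        intro order.trans[OF keys_diff] Un_least; simp)
qed

sublocale FQ: free_quotient "carrier M \<times> carrier N" "tensor_rels R M N"
  by unfold_locales (rule tensor_rels_subset)

abbreviation "T \<equiv> tensor R M N"
abbreviation tns (infixl "\<otimes>\<^sub>t" 70) where "tns \<equiv> tens R M N"

lemma kernel_eq: "tensor_kernel R M N = FQ.K"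
  by (simp add: tensor_kernel_def FQ.K_def)

lemma tns_eq: "x \<otimes>\<^sub>t y = FQ.cls (frag_of (x, y))"
  by (simp add: tens_def kernel_eq)

lemma T_carrier: "carrier T = carrier (FQ.F Mod FQ.K)"
  and T_add: "X \<oplus>\<^bsub>T\<^esub> Y = X \<otimes>\<^bsub>FQ.F Mod FQ.K\<^esub> Y"
  and T_zero: "\<zero>\<^bsub>T\<^esub> = \<one>\<^bsub>FQ.F Mod FQ.K\<^esub>"
  by (simp_all add: tensor_def Let_def kernel_eq)

lemma T_abelian_group: "abelian_group T"
proof -
  interpret Q: comm_group "FQ.F Mod FQ.K" by (rule FQ.quotient_comm_group)
  show ?thesis
  proof (rule abelian_groupI)
    fix x assume "x \<in> carrier T"
    then show "\<exists>y\<in>carrier T. y \<oplus>\<^bsub>T\<^esub> x = \<zero>\<^bsub>T\<^esub>"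
      unfolding T_carrier T_add T_zero by (intro bexI[of _ "inv\<^bsub>FQ.F Mod FQ.K\<^esub> x"] Q.l_inv Q.inv_closed)
  next
    show "x \<oplus>\<^bsub>T\<^esub> y = y \<oplus>\<^bsub>T\<^esub> x" if "x \<in> carrier T" "y \<in> carrier T" for x y
      using that unfolding T_carrier T_add by (rule Q.m_comm)
  qed (simp_all only: T_carrier T_add T_zero Q.m_closed Q.one_closed Q.m_assoc Q.l_one)
qed

sublocale T: abelian_group T by (rule T_abelian_group)

lemma tns_closed [simp]: "\<lbrakk>x \<in> carrier M; y \<in> carrier N\<rbrakk> \<Longrightarrow> x \<otimes>\<^sub>t y \<in> carrier T"
  by (simp add: tns_eq T_carrier)

lemma rel_K: "r \<in> tensor_rels R M N \<Longrightarrow> r \<in> FQ.K"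
  unfolding FQ.K_def by (rule generate.incl)

lemma tns_add_left:
  assumes "x \<in> carrier M" "x' \<in> carrier M" "y \<in> carrier N"
  shows "(x \<oplus>\<^bsub>M\<^esub> x') \<otimes>\<^sub>t y = x \<otimes>\<^sub>t y \<oplus>\<^bsub>T\<^esub> x' \<otimes>\<^sub>t y"
proof -
  have "frag_of (x \<oplus>\<^bsub>M\<^esub> x', y) - (frag_of (x, y) + frag_of (x', y)) \<in> FQ.K"
    using rel_K[OF tensor_rels_leftI[OF assms]] by (simp add: diff_diff_eq)
  moreover have "Poly_Mapping.keys (frag_of (x, y) + frag_of (x', y)) \<subseteq> carrier M \<times> carrier N"
    using assms by (intro order.trans[OF keys_add]) auto
  ultimately show ?thesis
    unfolding tns_eq T_add using assms by (subst FQ.cls_add) (auto simp: FQ.cls_eq_iff)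
qed

lemma tns_add_right:
  assumes "x \<in> carrier M" "y \<in> carrier N" "y' \<in> carrier N"
  shows "x \<otimes>\<^sub>t (y \<oplus>\<^bsub>N\<^esub> y') = x \<otimes>\<^sub>t y \<oplus>\<^bsub>T\<^esub> x \<otimes>\<^sub>t y'"
proof -
  have "frag_of (x, y \<oplus>\<^bsub>N\<^esub> y') - (frag_of (x, y) + frag_of (x, y')) \<in> FQ.K"
    using rel_K[OF tensor_rels_rightI[OF assms]] by (simp add: diff_diff_eq)
  moreover have "Poly_Mapping.keys (frag_of (x, y) + frag_of (x, y')) \<subseteq> carrier M \<times> carrier N"
    using assms by (intro order.trans[OF keys_add]) auto
  ultimately show ?thesis
    unfolding tns_eq T_add using assms by (subst FQ.cls_add) (auto simp: FQ.cls_eq_iff)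
qed

lemma tns_balanced:
  assumes "r \<in> carrier R" "x \<in> carrier M" "y \<in> carrier N"
  shows "(r \<odot>\<^bsub>M\<^esub> x) \<otimes>\<^sub>t y = x \<otimes>\<^sub>t (r \<odot>\<^bsub>N\<^esub> y)"
proof -
  have "frag_of (r \<odot>\<^bsub>M\<^esub> x, y) - frag_of (x, r \<odot>\<^bsub>N\<^esub> y) \<in> FQ.K"
    by (rule rel_K[OF tensor_rels_scalarI[OF assms]])
  then show ?thesis
    unfolding tns_eq using assms by (auto simp: FQ.cls_eq_iff)
qed

lemma tns_zero_left: "y \<in> carrier N \<Longrightarrow> \<zero>\<^bsub>M\<^esub> \<otimes>\<^sub>t y = \<zero>\<^bsub>T\<^esub>"
  using tns_add_left[of "\<zero>\<^bsub>M\<^esub>" "\<zero>\<^bsub>M\<^esub>" y] T.add.l_cancel_one[of "\<zero>\<^bsub>M\<^esub> \<otimes>\<^sub>t y" "\<zero>\<^bsub>M\<^esub> \<otimes>\<^sub>t y"] by simp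

lemma tns_minus_left:
  assumes "x \<in> carrier M" "y \<in> carrier N"
  shows "\<ominus>\<^bsub>T\<^esub> (x \<otimes>\<^sub>t y) = (\<ominus>\<^bsub>M\<^esub> x) \<otimes>\<^sub>t y"
  using tns_add_left[of "\<ominus>\<^bsub>M\<^esub> x" x y] assms tns_zero_left[of y]
  by (simp add: M.M.l_neg T.minus_equality)

text \<open>Negatives of pure tensors are pure by \<open>tns_minus_left\<close>, so proving the
  claim for \<open>X\<close> and its negative together removes the case of inverses from the
  quotient induction.\<close>

lemma tensor_induct [consumes 1, case_names tens add]:
  assumes X: "X \<in> carrier T"
    and pure: "\<And>x y. \<lbrakk>x \<in> carrier M; y \<in> carrier N\<rbrakk> \<Longrightarrow> P (x \<otimes>\<^sub>t y)"
    and add: "\<And>X Y. \<lbrakk>X \<in> carrier T; Y \<in> carrier T; P X; P Y\<rbrakk> \<Longrightarrow> P (X \<oplus>\<^bsub>T\<^esub> Y)"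
  shows "P X"
proof -
  have inv_eq: "inv\<^bsub>FQ.F Mod FQ.K\<^esub> Y = \<ominus>\<^bsub>T\<^esub> Y" for Y
    by (simp add: a_inv_def m_inv_def T_carrier T_add T_zero)
  have X': "X \<in> carrier (FQ.F Mod FQ.K)" using X by (simp add: T_carrier)
  have "P X \<and> P (\<ominus>\<^bsub>T\<^esub> X)" using X'
  proof (induction X rule: FQ.quotient_induct)
    case (of s) then show ?case
      by (cases s) (auto simp: tns_eq[symmetric] tns_minus_left pure)
  next
    case (add X Y) then show ?case
      unfolding T_carrier[symmetric] T_add[symmetric]
      by (auto simp: T.minus_add intro!: assms(3))
  next
    case (inv X) then show ?case by (simp add: inv_eq T_carrier[symmetric])
  next
    case one
    have "P (\<zero>\<^bsub>M\<^esub> \<otimes>\<^sub>t \<zero>\<^bsub>N\<^esub>)" by (intro pure) auto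
    then show ?case unfolding T_zero[symmetric]
      by (simp add: tns_zero_left T.minus_equality[of "\<zero>\<^bsub>T\<^esub>" "\<zero>\<^bsub>T\<^esub>"])
  qed
  then show ?thesis ..
qed

text \<open>The scalar action on formal sums, before passing to the quotient, through the left
  factor; for pure tensors \<open>tns_balanced\<close> equates it with the action on the right
  factor.\<close>

definition scl :: "'r \<Rightarrow> ('a \<times> 'b \<Rightarrow>\<^sub>0 int) \<Rightarrow> ('a \<times> 'b \<Rightarrow>\<^sub>0 int)" where
  "scl r = frag_extend (\<lambda>(x, y). frag_of (r \<odot>\<^bsub>M\<^esub> x, y))"

lemma scl_add: "scl r (p + q) = scl r p + scl r q"
  and scl_diff: "scl r (p - q) = scl r p - scl r q"
  by (simp_all add: scl_def frag_extend_add frag_extend_diff)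

lemma scl_keys:
  assumes "r \<in> carrier R" "Poly_Mapping.keys p \<subseteq> carrier M \<times> carrier N"
  shows "Poly_Mapping.keys (scl r p) \<subseteq> carrier M \<times> carrier N"
  unfolding scl_def using assms by (intro order.trans[OF keys_frag_extend]) fastforce

text \<open>Each kind of relation is mapped to a relation of the same kind. For the balancing
  relations this uses commutativity of \<open>R\<close>, to interchange \<open>r\<close> and
  \<open>t\<close>.\<close>

lemma scl_K:
  assumes r: "r \<in> carrier R" and k: "k \<in> FQ.K"
  shows "scl r k \<in> FQ.K"
  using k unfolding FQ.K_def
proof (induction rule: generate.induct)
  case one then show ?case using FQ.K.one_closed by (simp add: scl_def FQ.K_def)
next
  have *: "scl r h \<in> tensor_rels R M N" if "h \<in> tensor_rels R M N" for h
  proof -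
    from that show ?thesis
    proof (cases rule: tensor_rels_cases)
      case (left x x' y)
      then have "scl r h = frag_of (r \<odot>\<^bsub>M\<^esub> x \<oplus>\<^bsub>M\<^esub> r \<odot>\<^bsub>M\<^esub> x', y) - frag_of (r \<odot>\<^bsub>M\<^esub> x, y) - frag_of (r \<odot>\<^bsub>M\<^esub> x', y)"
        using r by (simp add: scl_def frag_extend_diff M.smult_r_distr)
      then show ?thesis using left r by (simp add: tensor_rels_leftI)
    next
      case (right x y y')
      then have "scl r h = frag_of (r \<odot>\<^bsub>M\<^esub> x, y \<oplus>\<^bsub>N\<^esub> y') - frag_of (r \<odot>\<^bsub>M\<^esub> x, y) - frag_of (r \<odot>\<^bsub>M\<^esub> x, y')"
        using r by (simp add: scl_def frag_extend_diff)
      then show ?thesis using right r by (simp add: tensor_rels_rightI)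
    next
      case (scalar t x y)
      then have "r \<odot>\<^bsub>M\<^esub> (t \<odot>\<^bsub>M\<^esub> x) = t \<odot>\<^bsub>M\<^esub> (r \<odot>\<^bsub>M\<^esub> x)"
        using r by (metis M.smult_assoc1 M.R.m_comm)
      then have "scl r h = frag_of (t \<odot>\<^bsub>M\<^esub> (r \<odot>\<^bsub>M\<^esub> x), y) - frag_of (r \<odot>\<^bsub>M\<^esub> x, t \<odot>\<^bsub>N\<^esub> y)"
        using r scalar by (simp add: scl_def frag_extend_diff)
      then show ?thesis using scalar r by (simp add: tensor_rels_scalarI)
    qed
  qed
  {
    case (incl h) then show ?case by (intro generate.incl *)
  next
    case (inv h)
    then have "Poly_Mapping.keys h \<subseteq> carrier M \<times> carrier N"
      using subsetD[OF FQ.rels] by simp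
    moreover have "Poly_Mapping.keys (scl r h) \<subseteq> carrier M \<times> carrier N"
      using subsetD[OF FQ.rels *[OF inv]] by simp
    ultimately have "inv\<^bsub>FQ.F\<^esub> h = - h" "inv\<^bsub>FQ.F\<^esub> (scl r h) = - scl r h"
      by (simp_all only: inv_free_Abelian_group)
    then show ?case
      using generate.inv[OF *[OF inv], of FQ.F] by (simp add: scl_def frag_extend_minus)
  next
    case (eng h1 h2) then show ?case using generate.eng by (fastforce simp: scl_add)
  }
qed

text \<open>In \<open>tensor\<close> a scalar acts by a union over all representatives of a coset.
  By \<open>scl_K\<close> the cosets in this union coincide, so it is a single coset.\<close>

lemma T_smult_cls:
  assumes r: "r \<in> carrier R" and p: "Poly_Mapping.keys p \<subseteq> carrier M \<times> carrier N"
  shows "r \<odot>\<^bsub>T\<^esub> FQ.cls p = FQ.cls (scl r p)"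
proof -
  have "FQ.cls (scl r q) = FQ.cls (scl r p)" if "q \<in> FQ.cls p" for q
  proof -
    have qp: "q - p \<in> FQ.K" using that p by (simp add: FQ.mem_cls_iff)
    have q: "Poly_Mapping.keys q \<subseteq> carrier M \<times> carrier N"
      using FQ.K_keys[OF qp] p keys_add[of "q - p" p] by fastforce
    show ?thesis
      using scl_K[OF r qp] scl_keys[OF r] p q by (simp add: FQ.cls_eq_iff scl_diff)
  qed
  moreover have "p \<in> FQ.cls p" using p FQ.K.one_closed by (simp add: FQ.mem_cls_iff)
  ultimately have "(\<Union>q\<in>FQ.cls p. FQ.cls (scl r q)) = FQ.cls (scl r p)" by blast
  then show ?thesis by (simp add: tensor_def Let_def kernel_eq scl_def)
qed

lemma T_smult_tns:
  assumes "r \<in> carrier R" "x \<in> carrier M" "y \<in> carrier N"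
  shows "r \<odot>\<^bsub>T\<^esub> (x \<otimes>\<^sub>t y) = (r \<odot>\<^bsub>M\<^esub> x) \<otimes>\<^sub>t y"
  unfolding tns_eq using assms by (simp add: T_smult_cls) (simp add: scl_def)

lemma T_cases:
  assumes "X \<in> carrier T"
  obtains p where "Poly_Mapping.keys p \<subseteq> carrier M \<times> carrier N" "X = FQ.cls p"
  using assms FQ.quotient_cases unfolding T_carrier by blast

lemma T_smult_closed: "\<lbrakk>r \<in> carrier R; X \<in> carrier T\<rbrakk> \<Longrightarrow> r \<odot>\<^bsub>T\<^esub> X \<in> carrier T"
  by (elim T_cases) (simp add: T_smult_cls T_carrier scl_keys)

lemma T_smult_add:
  assumes r: "r \<in> carrier R" and XY: "X \<in> carrier T" "Y \<in> carrier T"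
  shows "r \<odot>\<^bsub>T\<^esub> (X \<oplus>\<^bsub>T\<^esub> Y) = r \<odot>\<^bsub>T\<^esub> X \<oplus>\<^bsub>T\<^esub> r \<odot>\<^bsub>T\<^esub> Y"
proof -
  obtain p q where pq: "Poly_Mapping.keys p \<subseteq> carrier M \<times> carrier N" "X = FQ.cls p"
    "Poly_Mapping.keys q \<subseteq> carrier M \<times> carrier N" "Y = FQ.cls q"
    using T_cases XY by metis
  have "Poly_Mapping.keys (p + q) \<subseteq> carrier M \<times> carrier N"
    using pq by (intro order.trans[OF keys_add]) auto
  then show ?thesis
    using pq r unfolding T_add by (simp only: T_smult_cls FQ.cls_add scl_keys scl_add)
qed

lemma T_module: "module R T"
proof (rule moduleI)
  show "cring R" by (rule M.R.is_cring)
  show "abelian_group T" by (rule T_abelian_group)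
next
  fix r X assume "r \<in> carrier R" "X \<in> carrier T"
  then show "r \<odot>\<^bsub>T\<^esub> X \<in> carrier T" by (rule T_smult_closed)
next
  fix r X Y assume "r \<in> carrier R" "X \<in> carrier T" "Y \<in> carrier T"
  then show "r \<odot>\<^bsub>T\<^esub> (X \<oplus>\<^bsub>T\<^esub> Y) = r \<odot>\<^bsub>T\<^esub> X \<oplus>\<^bsub>T\<^esub> r \<odot>\<^bsub>T\<^esub> Y" by (rule T_smult_add)
next
  fix r s X assume rs: "r \<in> carrier R" "s \<in> carrier R" and X: "X \<in> carrier T"
  show "(r \<oplus>\<^bsub>R\<^esub> s) \<odot>\<^bsub>T\<^esub> X = r \<odot>\<^bsub>T\<^esub> X \<oplus>\<^bsub>T\<^esub> s \<odot>\<^bsub>T\<^esub> X" using X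
  proof (induction X rule: tensor_induct)
    case (tens x y) then show ?case using rs
      by (simp add: T_smult_tns M.smult_l_distr tns_add_left)
  next
    case (add X Y) then show ?case using rs
      by (simp add: T_smult_add T_smult_closed T.add.m_ac)
  qed
  show "(r \<otimes>\<^bsub>R\<^esub> s) \<odot>\<^bsub>T\<^esub> X = r \<odot>\<^bsub>T\<^esub> (s \<odot>\<^bsub>T\<^esub> X)" using X
  proof (induction X rule: tensor_induct)
    case (tens x y) then show ?case using rs
      by (simp add: T_smult_tns M.smult_assoc1)
  next
    case (add X Y) then show ?case using rs
      by (simp add: T_smult_add T_smult_closed)
  qed
next
  fix X assume X: "X \<in> carrier T"
  show "\<one>\<^bsub>R\<^esub> \<odot>\<^bsub>T\<^esub> X = X" using X
    by (induction X rule: tensor_induct) (simp_all add: T_smult_tns T_smult_add)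
qed

sublocale Tm: module R T by (rule T_module)

text \<open>The universal property of the quotient group yields an additive map with the right
  values; its compatibility with scalars is then an identity to be checked on pure tensors.\<close>

lemma tensor_hom_exists:
  fixes P :: "('r, 'd) module"
  assumes P: "module R P"
    and closed: "\<And>x y. \<lbrakk>x \<in> carrier M; y \<in> carrier N\<rbrakk> \<Longrightarrow> b x y \<in> carrier P"
    and add_left: "\<And>x x' y. \<lbrakk>x \<in> carrier M; x' \<in> carrier M; y \<in> carrier N\<rbrakk> \<Longrightarrow> b (x \<oplus>\<^bsub>M\<^esub> x') y = b x y \<oplus>\<^bsub>P\<^esub> b x' y"
    and add_right: "\<And>x y y'. \<lbrakk>x \<in> carrier M; y \<in> carrier N; y' \<in> carrier N\<rbrakk> \<Longrightarrow> b x (y \<oplus>\<^bsub>N\<^esub> y') = b x y \<oplus>\<^bsub>P\<^esub> b x y'"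
    and smult_left: "\<And>r x y. \<lbrakk>r \<in> carrier R; x \<in> carrier M; y \<in> carrier N\<rbrakk> \<Longrightarrow> b (r \<odot>\<^bsub>M\<^esub> x) y = r \<odot>\<^bsub>P\<^esub> b x y"
    and smult_right: "\<And>r x y. \<lbrakk>r \<in> carrier R; x \<in> carrier M; y \<in> carrier N\<rbrakk> \<Longrightarrow> b x (r \<odot>\<^bsub>N\<^esub> y) = r \<odot>\<^bsub>P\<^esub> b x y"
  shows "\<exists>h\<in>mod_hom R T P. \<forall>x\<in>carrier M. \<forall>y\<in>carrier N. h (x \<otimes>\<^sub>t y) = b x y"
proof -
  interpret P: module R P by (rule P)
  have cg: "comm_group (add_monoid P)" by (rule P.M.a_comm_group)
  obtain g where g: "g \<in> hom (FQ.F Mod FQ.K) (add_monoid P)"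
    "\<And>s. s \<in> carrier M \<times> carrier N \<Longrightarrow> g (FQ.cls (frag_of s)) = (\<lambda>(x, y). b x y) s"
  proof (rule FQ.quotient_universal[OF cg, of "\<lambda>(x, y). b x y"])
    fix s assume "s \<in> carrier M \<times> carrier N"
    then show "(case s of (x, y) \<Rightarrow> b x y) \<in> carrier (add_monoid P)" using closed by auto
  next
    fix h r
    assume diff: "\<And>p q. \<lbrakk>Poly_Mapping.keys p \<subseteq> carrier M \<times> carrier N; Poly_Mapping.keys q \<subseteq> carrier M \<times> carrier N\<rbrakk>
          \<Longrightarrow> h (p - q) = h p \<otimes>\<^bsub>add_monoid P\<^esub> inv\<^bsub>add_monoid P\<^esub> h q"
      and of: "\<And>s. s \<in> carrier M \<times> carrier N \<Longrightarrow> h (frag_of s) = (case s of (x, y) \<Rightarrow> b x y)"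
      and r: "r \<in> tensor_rels R M N"
    have of': "h (frag_of (x, y)) = b x y" if "x \<in> carrier M" "y \<in> carrier N" for x y
      using of[of "(x, y)"] that by simp
    have diff': "h (p - q) = h p \<ominus>\<^bsub>P\<^esub> h q"
      if "Poly_Mapping.keys p \<subseteq> carrier M \<times> carrier N" "Poly_Mapping.keys q \<subseteq> carrier M \<times> carrier N" for p q
      using diff[OF that] by (simp add: a_minus_def a_inv_def)
    have keys2: "Poly_Mapping.keys (frag_of s - frag_of t) \<subseteq> carrier M \<times> carrier N"
      if "s \<in> carrier M \<times> carrier N" "t \<in> carrier M \<times> carrier N" for s t
      using that by (intro order.trans[OF keys_diff]) auto
    from r have "h r = \<zero>\<^bsub>P\<^esub>"
    proof (cases rule: tensor_rels_cases)
      case (left x x' y)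
      then have "h r = (b x y \<oplus>\<^bsub>P\<^esub> b x' y) \<ominus>\<^bsub>P\<^esub> b x y \<ominus>\<^bsub>P\<^esub> b x' y"
        by (simp add: diff' keys2 of' add_left)
      also have "\<dots> = \<zero>\<^bsub>P\<^esub>"
        using closed left by (simp add: a_minus_def P.M.a_ac P.M.r_neg P.M.r_neg1)
      finally show ?thesis .
    next
      case (right x y y')
      then have "h r = (b x y \<oplus>\<^bsub>P\<^esub> b x y') \<ominus>\<^bsub>P\<^esub> b x y \<ominus>\<^bsub>P\<^esub> b x y'"
        by (simp add: diff' keys2 of' add_right)
      also have "\<dots> = \<zero>\<^bsub>P\<^esub>"
        using closed right by (simp add: a_minus_def P.M.a_ac P.M.r_neg P.M.r_neg1)
      finally show ?thesis .
    next
      case (scalar t x y) then show ?thesis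
        using closed by (simp add: diff' of' smult_left smult_right a_minus_def P.M.r_neg)
    qed
    then show "h r = \<one>\<^bsub>add_monoid P\<^esub>" by simp
  qed (use that in blast)
  have gt: "g (x \<otimes>\<^sub>t y) = b x y" if "x \<in> carrier M" "y \<in> carrier N" for x y
    using g(2)[of "(x, y)"] that by (simp add: tns_eq)
  have gc: "g X \<in> carrier P" if "X \<in> carrier T" for X
    using g(1) that by (auto simp: hom_def T_carrier)
  have ga: "g (X \<oplus>\<^bsub>T\<^esub> Y) = g X \<oplus>\<^bsub>P\<^esub> g Y" if "X \<in> carrier T" "Y \<in> carrier T" for X Y
    using g(1) that by (auto simp: hom_def T_carrier T_add)
  have "g \<in> mod_hom R T P"
  proof (rule mod_homI)
    fix r X assume r: "r \<in> carrier R" and X: "X \<in> carrier T"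
    show "g (r \<odot>\<^bsub>T\<^esub> X) = r \<odot>\<^bsub>P\<^esub> g X" using X
    proof (induction X rule: tensor_induct)
      case (tens x y) then show ?case using r by (simp add: T_smult_tns gt smult_left)
    next
      case (add X Y) then show ?case using r
        by (simp add: T_smult_add T_smult_closed ga gc P.smult_r_distr)
    qed
  qed (auto simp: gc ga)
  then show ?thesis using gt by blast
qed

text \<open>Pure tensors generate additively, so the target enters through an arbitrary addition
  \<open>pl\<close>.\<close>

lemma tensor_hom_eqI:
  assumes "\<And>X Y. \<lbrakk>X \<in> carrier T; Y \<in> carrier T\<rbrakk> \<Longrightarrow> h (X \<oplus>\<^bsub>T\<^esub> Y) = pl (h X) (h Y)"
    and "\<And>X Y. \<lbrakk>X \<in> carrier T; Y \<in> carrier T\<rbrakk> \<Longrightarrow> h' (X \<oplus>\<^bsub>T\<^esub> Y) = pl (h' X) (h' Y)"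
    and "\<And>x y. \<lbrakk>x \<in> carrier M; y \<in> carrier N\<rbrakk> \<Longrightarrow> h (x \<otimes>\<^sub>t y) = h' (x \<otimes>\<^sub>t y)"
    and "X \<in> carrier T"
  shows "h X = h' X"
  using assms(4) by (induction X rule: tensor_induct) (simp_all add: assms)

lemma tensor_lift:
  fixes P :: "('r, 'd) module"
  assumes P: "module R P"
    and closed: "\<And>x y. \<lbrakk>x \<in> carrier M; y \<in> carrier N\<rbrakk> \<Longrightarrow> b x y \<in> carrier P"
    and add_left: "\<And>x x' y. \<lbrakk>x \<in> carrier M; x' \<in> carrier M; y \<in> carrier N\<rbrakk> \<Longrightarrow> b (x \<oplus>\<^bsub>M\<^esub> x') y = b x y \<oplus>\<^bsub>P\<^esub> b x' y"
    and add_right: "\<And>x y y'. \<lbrakk>x \<in> carrier M; y \<in> carrier N; y' \<in> carrier N\<rbrakk> \<Longrightarrow> b x (y \<oplus>\<^bsub>N\<^esub> y') = b x y \<oplus>\<^bsub>P\<^esub> b x y'"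
    and smult_left: "\<And>r x y. \<lbrakk>r \<in> carrier R; x \<in> carrier M; y \<in> carrier N\<rbrakk> \<Longrightarrow> b (r \<odot>\<^bsub>M\<^esub> x) y = r \<odot>\<^bsub>P\<^esub> b x y"
    and smult_right: "\<And>r x y. \<lbrakk>r \<in> carrier R; x \<in> carrier M; y \<in> carrier N\<rbrakk> \<Longrightarrow> b x (r \<odot>\<^bsub>N\<^esub> y) = r \<odot>\<^bsub>P\<^esub> b x y"
  shows "tensor_lift R M N P b \<in> mod_hom R T P"
    "\<lbrakk>x \<in> carrier M; y \<in> carrier N\<rbrakk> \<Longrightarrow> tensor_lift R M N P b (x \<otimes>\<^sub>t y) = b x y"
proof -
  obtain h where "h \<in> mod_hom R T P" "\<forall>x\<in>carrier M. \<forall>y\<in>carrier N. h (x \<otimes>\<^sub>t y) = b x y"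
    using tensor_hom_exists[OF assms] by blast
  then have ex: "\<exists>h\<in>mod_hom R T P. \<forall>i\<in>carrier M \<times> carrier N. h ((\<lambda>(x, y). x \<otimes>\<^sub>t y) i) = (\<lambda>(x, y). b x y) i"
    by (intro bexI[of _ h]) auto
  show "tensor_lift R M N P b \<in> mod_hom R T P"
    unfolding tensor_lift_def by (rule lin_extI(1)[OF ex])
  show "\<lbrakk>x \<in> carrier M; y \<in> carrier N\<rbrakk> \<Longrightarrow> tensor_lift R M N P b (x \<otimes>\<^sub>t y) = b x y"
    unfolding tensor_lift_def using lin_extI(2)[OF ex, of "(x, y)"] by simp
qed

text \<open>The linear map \<open>h\<close> shows that the choice in \<open>tensor_lift\<close> is
  possible, and pure tensors determine the outcome. A lift is thus computed by naming the map that
  it must be.\<close>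

lemma tensor_lift_eq:
  assumes h: "h \<in> mod_hom R T P"
    and v: "\<And>x y. \<lbrakk>x \<in> carrier M; y \<in> carrier N\<rbrakk> \<Longrightarrow> h (x \<otimes>\<^sub>t y) = b x y"
    and X: "X \<in> carrier T"
  shows "tensor_lift R M N P b X = h X"
proof -
  have ex: "\<exists>h\<in>mod_hom R T P. \<forall>i\<in>carrier M \<times> carrier N. h ((\<lambda>(x, y). x \<otimes>\<^sub>t y) i) = (\<lambda>(x, y). b x y) i"
    using h v by (intro bexI[of _ h]) auto
  have l: "tensor_lift R M N P b \<in> mod_hom R T P"
    unfolding tensor_lift_def by (rule lin_extI(1)[OF ex])
  have lv: "tensor_lift R M N P b (x \<otimes>\<^sub>t y) = b x y" if "x \<in> carrier M" "y \<in> carrier N" for x y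
    unfolding tensor_lift_def using lin_extI(2)[OF ex, of "(x, y)"] that by simp
  show ?thesis
    by (rule tensor_hom_eqI[where pl = "add P"]) (auto simp: mod_hom_add[OF l] mod_hom_add[OF h] lv v X)
qed

end

section \<open>Abelian groups as \<open>\<int>\<close>-modules\<close>

lemma Zmod_simps [simp]:
  "carrier (Zmod G) = carrier G" "x \<oplus>\<^bsub>Zmod G\<^esub> y = x \<otimes>\<^bsub>G\<^esub> y" "\<zero>\<^bsub>Zmod G\<^esub> = \<one>\<^bsub>G\<^esub>"
  "k \<odot>\<^bsub>Zmod G\<^esub> x = x [^]\<^bsub>G\<^esub> k"
  by (simp_all add: Zmod_def)

lemma Zmod_abelian_group: "comm_group G \<Longrightarrow> abelian_group (Zmod G)"
proof -
  assume "comm_group G"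
  then interpret comm_group G .
  show ?thesis
  proof (rule abelian_groupI)
    fix x assume "x \<in> carrier (Zmod G)"
    then show "\<exists>y\<in>carrier (Zmod G). y \<oplus>\<^bsub>Zmod G\<^esub> x = \<zero>\<^bsub>Zmod G\<^esub>"
      by (intro bexI[of _ "inv\<^bsub>G\<^esub> x"]) auto
  qed (auto simp: m_ac)
qed

lemma Zmod_module: "comm_group G \<Longrightarrow> module \<Z> (Zmod G)"
proof -
  assume G: "comm_group G"
  then interpret comm_group G .
  show ?thesis
    by (rule moduleI)
      (auto simp: int.is_cring Zmod_abelian_group[OF G] int_pow_mult int_pow_distrib int_pow_pow mult.commute)
qed

text \<open>Integer multiples are iterated sums, so additivity implies linearity. The induction runs
  upwards and downwards from 0, the downward step by cancelling \<open>h x\<close>.\<close>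

lemma Zmod_hom_iff:
  assumes M: "module \<Z> M" and N: "module \<Z> N"
  shows "h \<in> mod_hom \<Z> M N \<longleftrightarrow> h \<in> hom (add_monoid M) (add_monoid N)"
proof
  assume "h \<in> mod_hom \<Z> M N" then show "h \<in> hom (add_monoid M) (add_monoid N)"
    by (auto simp: mod_hom_def hom_def)
next
  assume h: "h \<in> hom (add_monoid M) (add_monoid N)"
  interpret M: module \<Z> M by (rule M)
  interpret N: module \<Z> N by (rule N)
  have hc: "\<And>x. x \<in> carrier M \<Longrightarrow> h x \<in> carrier N"
    and ha: "\<And>x y. \<lbrakk>x \<in> carrier M; y \<in> carrier M\<rbrakk> \<Longrightarrow> h (x \<oplus>\<^bsub>M\<^esub> y) = h x \<oplus>\<^bsub>N\<^esub> h y"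
    using h by (auto simp: hom_def)
  have h0: "h \<zero>\<^bsub>M\<^esub> = \<zero>\<^bsub>N\<^esub>"
    using ha[of "\<zero>\<^bsub>M\<^esub>" "\<zero>\<^bsub>M\<^esub>"] hc[of "\<zero>\<^bsub>M\<^esub>"] N.M.add.l_cancel_one[of "h \<zero>\<^bsub>M\<^esub>" "h \<zero>\<^bsub>M\<^esub>"] by simp
  show "h \<in> mod_hom \<Z> M N"
  proof (rule mod_homI)
    fix r :: int and x assume x: "x \<in> carrier M"
    have step: "(i + 1) \<odot>\<^bsub>M\<^esub> x = i \<odot>\<^bsub>M\<^esub> x \<oplus>\<^bsub>M\<^esub> x" "(i + 1) \<odot>\<^bsub>N\<^esub> h x = i \<odot>\<^bsub>N\<^esub> h x \<oplus>\<^bsub>N\<^esub> h x" for i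
      using M.smult_l_distr[of i 1 x] N.smult_l_distr[of i 1 "h x"] M.smult_one[of x] N.smult_one[of "h x"] x hc[OF x]
      by simp_all
    show "h (r \<odot>\<^bsub>M\<^esub> x) = r \<odot>\<^bsub>N\<^esub> h x"
    proof (induction r rule: int_induct[where k = 0])
      case base
      then show ?case using h0 x hc[OF x] M.smult_l_null[of x] N.smult_l_null[of "h x"] by simp
    next
      case (step1 i)
      then show ?case by (simp add: step ha x hc)
    next
      case (step2 i)
      have "h ((i - 1) \<odot>\<^bsub>M\<^esub> x) \<oplus>\<^bsub>N\<^esub> h x = (i - 1) \<odot>\<^bsub>N\<^esub> h x \<oplus>\<^bsub>N\<^esub> h x"
        using step(1)[of "i - 1"] step(2)[of "i - 1"] step2 ha[of "(i - 1) \<odot>\<^bsub>M\<^esub> x" x] x by simp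
      then show ?case using x hc by simp
    qed
  qed (auto simp: hc ha)
qed

section \<open>Split algebras and their modules\<close>

lemma base_field_simps [simp]:
  "carrier (base_field :: 'f::field ring) = UNIV"
  "x \<otimes>\<^bsub>base_field\<^esub> y = x * y" "x \<oplus>\<^bsub>base_field\<^esub> y = x + y"
  "\<one>\<^bsub>base_field\<^esub> = (1 :: 'f)" "\<zero>\<^bsub>base_field\<^esub> = (0 :: 'f)"
  by (simp_all add: base_field_def)

lemma base_field_cring: "cring (base_field :: 'f::field ring)"
proof (rule cringI)
  show "abelian_group (base_field :: 'f ring)"
  proof (rule abelian_groupI)
    fix x :: 'f
    show "\<exists>y\<in>carrier base_field. y \<oplus>\<^bsub>base_field\<^esub> x = \<zero>\<^bsub>base_field\<^esub>"
      by (intro bexI[of _ "- x"]) auto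
  qed auto
  show "Group.comm_monoid (base_field :: 'f ring)"
    by (rule comm_monoidI) auto
qed (auto simp: algebra_simps)

text \<open>One definition covers the field over itself (\<chi> the identity, \<open>Fmod\<close>)
  and the simple modules of a split algebra, in particular \<open>Csimple\<close> (see
  \<open>Csimple_eq\<close>).\<close>

definition char_module :: "('a \<Rightarrow> 'f) \<Rightarrow> ('a, 'f::field) module" where
  "char_module \<chi> = \<lparr>carrier = UNIV, monoid.mult = undefined, monoid.one = undefined,
     ring.zero = 0, add = (+), smult = (\<lambda>a c. \<chi> a * c)\<rparr>"

lemma char_module_simps [simp]:
  "carrier (char_module \<chi>) = UNIV" "x \<oplus>\<^bsub>char_module \<chi>\<^esub> y = x + y" "\<zero>\<^bsub>char_module \<chi>\<^esub> = 0"
  "a \<odot>\<^bsub>char_module \<chi>\<^esub> x = \<chi> a * x"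
  by (simp_all add: char_module_def)

text \<open>An algebra isomorphic to \<open>\<F>\<^sup>I\<close> through its characters.\<close>

locale split_algebra =
  fixes A :: "('f::field, 'a) module" and I :: "'i set" and \<chi> :: "'i \<Rightarrow> 'a \<Rightarrow> 'f"
  assumes finite_I: "finite I"
    and mult_closed: "\<And>a b. \<lbrakk>a \<in> carrier A; b \<in> carrier A\<rbrakk> \<Longrightarrow> a \<otimes>\<^bsub>A\<^esub> b \<in> carrier A"
    and add_closed: "\<And>a b. \<lbrakk>a \<in> carrier A; b \<in> carrier A\<rbrakk> \<Longrightarrow> a \<oplus>\<^bsub>A\<^esub> b \<in> carrier A"
    and one_closed: "\<one>\<^bsub>A\<^esub> \<in> carrier A"
    and zero_closed: "\<zero>\<^bsub>A\<^esub> \<in> carrier A"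
    and smult_closed: "\<And>c a. a \<in> carrier A \<Longrightarrow> c \<odot>\<^bsub>A\<^esub> a \<in> carrier A"
    and chi_mult: "\<And>i a b. \<lbrakk>i \<in> I; a \<in> carrier A; b \<in> carrier A\<rbrakk> \<Longrightarrow> \<chi> i (a \<otimes>\<^bsub>A\<^esub> b) = \<chi> i a * \<chi> i b"
    and chi_add: "\<And>i a b. \<lbrakk>i \<in> I; a \<in> carrier A; b \<in> carrier A\<rbrakk> \<Longrightarrow> \<chi> i (a \<oplus>\<^bsub>A\<^esub> b) = \<chi> i a + \<chi> i b"
    and chi_one: "\<And>i. i \<in> I \<Longrightarrow> \<chi> i \<one>\<^bsub>A\<^esub> = 1"
    and chi_zero: "\<And>i. i \<in> I \<Longrightarrow> \<chi> i \<zero>\<^bsub>A\<^esub> = 0"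
    and chi_smult: "\<And>i c a. \<lbrakk>i \<in> I; a \<in> carrier A\<rbrakk> \<Longrightarrow> \<chi> i (c \<odot>\<^bsub>A\<^esub> a) = c * \<chi> i a"
    and chi_inj: "\<And>a b. \<lbrakk>a \<in> carrier A; b \<in> carrier A; \<And>i. i \<in> I \<Longrightarrow> \<chi> i a = \<chi> i b\<rbrakk> \<Longrightarrow> a = b"
    and chi_surj: "\<And>v. \<exists>a\<in>carrier A. \<forall>i\<in>I. \<chi> i a = v i"
begin

text \<open>The inverse of the isomorphism with \<F>^I, unique by \<open>chi_inj\<close>. So
  \<open>emb c\<close> is \<open>c\<close> times the unit, and \<open>idem i\<close> is the
  primitive idempotent belonging to \<open>i\<close>.\<close>

definition el :: "('i \<Rightarrow> 'f) \<Rightarrow> 'a" where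
  "el v = (SOME a. a \<in> carrier A \<and> (\<forall>i\<in>I. \<chi> i a = v i))"

lemma el_closed [simp]: "el v \<in> carrier A"
  and chi_el [simp]: "i \<in> I \<Longrightarrow> \<chi> i (el v) = v i"
proof -
  have "\<exists>a. a \<in> carrier A \<and> (\<forall>i\<in>I. \<chi> i a = v i)" using chi_surj[of v] by blast
  from someI_ex[OF this, folded el_def]
  show "el v \<in> carrier A" "i \<in> I \<Longrightarrow> \<chi> i (el v) = v i" by auto
qed

abbreviation emb :: "'f \<Rightarrow> 'a" where "emb c \<equiv> el (\<lambda>_. c)"

abbreviation idem :: "'i \<Rightarrow> 'a" where "idem i \<equiv> el (\<lambda>j. if j = i then 1 else 0)"

text \<open>The axioms are inherited from the field: both sides of each law have equal characters,
  and \<open>chi_inj\<close> applies. The ring and module axioms below are obtained in the same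
  way.\<close>

lemma A_abelian_group: "abelian_group A"
proof (rule abelian_groupI)
  fix x assume "x \<in> carrier A"
  then have "el (\<lambda>i. - \<chi> i x) \<oplus>\<^bsub>A\<^esub> x = \<zero>\<^bsub>A\<^esub>"
    by (intro chi_inj) (simp_all add: add_closed zero_closed chi_add chi_zero)
  then show "\<exists>y\<in>carrier A. y \<oplus>\<^bsub>A\<^esub> x = \<zero>\<^bsub>A\<^esub>" using el_closed by blast
qed (auto intro!: chi_inj simp: add_closed zero_closed chi_add chi_zero)

lemma A_cring: "cring A"
proof (rule cringI)
  show "abelian_group A" by (rule A_abelian_group)
  show "Group.comm_monoid A"
    by (rule comm_monoidI) (auto intro!: chi_inj simp: mult_closed one_closed chi_mult chi_one)
next
  fix x y z assume "x \<in> carrier A" "y \<in> carrier A" "z \<in> carrier A"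
  then show "(x \<oplus>\<^bsub>A\<^esub> y) \<otimes>\<^bsub>A\<^esub> z = x \<otimes>\<^bsub>A\<^esub> z \<oplus>\<^bsub>A\<^esub> y \<otimes>\<^bsub>A\<^esub> z"
    by (intro chi_inj) (auto simp: mult_closed add_closed chi_mult chi_add algebra_simps)
qed

sublocale A: cring A by (rule A_cring)

lemma A_module: "module base_field A"
  by (rule moduleI)
    (auto intro!: chi_inj simp: base_field_cring A_abelian_group smult_closed add_closed chi_smult chi_add algebra_simps)

end

text \<open>
  Coordinates on an \<open>A\<close>-module: linear functionals that identify it with the direct sum over
  \<open>k \<in> K\<close> of the one-dimensional modules with characters \<open>\<chi> (\<kappa> k)\<close>.
\<close>

locale coord_module = split_algebra A I \<chi>
  for A :: "('f::field, 'a) module" and I :: "'i set" and \<chi> :: "'i \<Rightarrow> 'a \<Rightarrow> 'f" +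
  fixes M :: "('a, 'm) module" and K :: "'k set" and \<kappa> :: "'k \<Rightarrow> 'i" and \<theta> :: "'k \<Rightarrow> 'm \<Rightarrow> 'f"
  assumes finite_K: "finite K"
    and kappa: "\<And>k. k \<in> K \<Longrightarrow> \<kappa> k \<in> I"
    and M_zero_closed: "\<zero>\<^bsub>M\<^esub> \<in> carrier M"
    and M_add_closed: "\<And>x y. \<lbrakk>x \<in> carrier M; y \<in> carrier M\<rbrakk> \<Longrightarrow> x \<oplus>\<^bsub>M\<^esub> y \<in> carrier M"
    and M_smult_closed: "\<And>a x. \<lbrakk>a \<in> carrier A; x \<in> carrier M\<rbrakk> \<Longrightarrow> a \<odot>\<^bsub>M\<^esub> x \<in> carrier M"
    and theta_zero: "\<And>k. k \<in> K \<Longrightarrow> \<theta> k \<zero>\<^bsub>M\<^esub> = 0"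
    and theta_add: "\<And>k x y. \<lbrakk>k \<in> K; x \<in> carrier M; y \<in> carrier M\<rbrakk> \<Longrightarrow> \<theta> k (x \<oplus>\<^bsub>M\<^esub> y) = \<theta> k x + \<theta> k y"
    and theta_smult: "\<And>k a x. \<lbrakk>k \<in> K; a \<in> carrier A; x \<in> carrier M\<rbrakk> \<Longrightarrow> \<theta> k (a \<odot>\<^bsub>M\<^esub> x) = \<chi> (\<kappa> k) a * \<theta> k x"
    and theta_inj: "\<And>x y. \<lbrakk>x \<in> carrier M; y \<in> carrier M; \<And>k. k \<in> K \<Longrightarrow> \<theta> k x = \<theta> k y\<rbrakk> \<Longrightarrow> x = y"
    and theta_surj: "\<And>v. \<exists>x\<in>carrier M. \<forall>k\<in>K. \<theta> k x = v k"
begin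

definition vec :: "('k \<Rightarrow> 'f) \<Rightarrow> 'm" where
  "vec v = (SOME x. x \<in> carrier M \<and> (\<forall>k\<in>K. \<theta> k x = v k))"

lemma vec_closed [simp]: "vec v \<in> carrier M"
  and theta_vec [simp]: "k \<in> K \<Longrightarrow> \<theta> k (vec v) = v k"
proof -
  have "\<exists>x. x \<in> carrier M \<and> (\<forall>k\<in>K. \<theta> k x = v k)" using theta_surj[of v] by blast
  from someI_ex[OF this, folded vec_def]
  show "vec v \<in> carrier M" "k \<in> K \<Longrightarrow> \<theta> k (vec v) = v k" by auto
qed

abbreviation bas :: "'k \<Rightarrow> 'm" where "bas k \<equiv> vec (\<lambda>l. if l = k then 1 else 0)"

lemma M_abelian_group: "abelian_group M"
proof (rule abelian_groupI)
  fix x assume "x \<in> carrier M"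
  then have "vec (\<lambda>k. - \<theta> k x) \<oplus>\<^bsub>M\<^esub> x = \<zero>\<^bsub>M\<^esub>"
    by (intro theta_inj) (simp_all add: M_add_closed M_zero_closed theta_add theta_zero)
  then show "\<exists>y\<in>carrier M. y \<oplus>\<^bsub>M\<^esub> x = \<zero>\<^bsub>M\<^esub>" using vec_closed by blast
qed (auto intro!: theta_inj simp: M_add_closed M_zero_closed theta_add theta_zero)

lemma M_module: "module A M"
  by (rule moduleI)
    (auto intro!: theta_inj simp: A_cring M_abelian_group M_smult_closed M_add_closed theta_smult theta_add
      mult_closed add_closed one_closed kappa chi_add chi_mult chi_one algebra_simps)

text \<open>Induction on a finite set of indices outside which the coordinates vanish, removing one
  index at a time.\<close>

lemma coord_induct [consumes 1, case_names zero step]: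
  assumes x: "x \<in> carrier M"
    and zero: "P \<zero>\<^bsub>M\<^esub>"
    and step: "\<And>y c k. \<lbrakk>y \<in> carrier M; k \<in> K; P y\<rbrakk> \<Longrightarrow> P (y \<oplus>\<^bsub>M\<^esub> emb c \<odot>\<^bsub>M\<^esub> bas k)"
  shows "P x"
proof -
  have "P x" if "S \<subseteq> K" "x \<in> carrier M" "\<And>k. k \<in> K - S \<Longrightarrow> \<theta> k x = 0" for S x
    using finite_subset[OF that(1) finite_K] that
  proof (induction S arbitrary: x rule: finite_induct)
    case empty
    then have "x = \<zero>\<^bsub>M\<^esub>" by (intro theta_inj) (auto simp: M_zero_closed theta_zero)
    then show ?case using zero by simp
  next
    case (insert k S)
    let ?y = "vec (\<lambda>l. if l = k then 0 else \<theta> l x)"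
    have "x = ?y \<oplus>\<^bsub>M\<^esub> emb (\<theta> k x) \<odot>\<^bsub>M\<^esub> bas k"
      using insert.prems
      by (intro theta_inj) (auto simp: M_add_closed M_smult_closed theta_add theta_smult kappa)
    moreover have "P ?y" using insert.prems by (intro insert.IH) auto
    ultimately show ?case using step[of ?y k "\<theta> k x"] insert.prems by auto
  qed
  from this[of K x] x show ?thesis by simp
qed

lemma M_fin_gen: "fin_gen A M"
  unfolding fin_gen_def
proof (intro exI conjI allI impI)
  show "finite (bas ` K)" using finite_K by simp
  show "bas ` K \<subseteq> carrier M" by auto
  fix U assume U: "submodule U A M \<and> bas ` K \<subseteq> U"
  then interpret submodule U A M by simp
  show "U = carrier M"
  proof
    show "U \<subseteq> carrier M" using subset by simp
    show "carrier M \<subseteq> U"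
    proof
      fix x assume "x \<in> carrier M"
      then show "x \<in> U"
      proof (induction x rule: coord_induct)
        case zero then show ?case using one_closed by simp
      next
        case (step y c k)
        then have "emb c \<odot>\<^bsub>M\<^esub> bas k \<in> U" using U smult_closed by auto
        then show ?case using m_closed[of y] step by simp
      qed
    qed
  qed
qed

text \<open>Linearity is taken over the scalars \<open>emb c\<close>, so that the functional may be
  a coordinate from a second coordinate system on the same module, as in
  \<open>coord_count_le\<close>.\<close>

lemma functional_expand:
  assumes x: "x \<in> carrier M" and zero: "f \<zero>\<^bsub>M\<^esub> = (0 :: 'f)"
    and add: "\<And>x y. \<lbrakk>x \<in> carrier M; y \<in> carrier M\<rbrakk> \<Longrightarrow> f (x \<oplus>\<^bsub>M\<^esub> y) = f x + f y"
    and smult: "\<And>c x. x \<in> carrier M \<Longrightarrow> f (emb c \<odot>\<^bsub>M\<^esub> x) = c * f x"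
  shows "f x = (\<Sum>k\<in>K. \<theta> k x * f (bas k))"
  using x
proof (induction x rule: coord_induct)
  case zero then show ?case by (simp add: assms theta_zero)
next
  case (step y c k)
  then have "(\<Sum>l\<in>K. \<theta> l (y \<oplus>\<^bsub>M\<^esub> emb c \<odot>\<^bsub>M\<^esub> bas k) * f (bas l)) =
      (\<Sum>l\<in>K. \<theta> l y * f (bas l) + (if l = k then c * f (bas k) else 0))"
    by (intro sum.cong) (auto simp: theta_add theta_smult M_smult_closed kappa algebra_simps)
  then show ?case using step finite_K by (simp add: add smult M_smult_closed sum.distrib)
qed

lemma coord_reindex:
  assumes "bij_betw p K' K"
  shows "coord_module A I \<chi> M K' (\<lambda>k. \<kappa> (p k)) (\<lambda>k. \<theta> (p k))"
proof
  have p: "\<And>k. k \<in> K' \<Longrightarrow> p k \<in> K" using assms by (auto simp: bij_betw_def)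
  show "finite K'" using assms finite_K bij_betw_finite by blast
  show "\<exists>x\<in>carrier M. \<forall>k\<in>K'. \<theta> (p k) x = v k" for v
    using p bij_betw_inv_into_left[OF assms]
    by (intro bexI[of _ "vec (\<lambda>k. v (inv_into K' p k))"]) auto
  show "x = y" if "x \<in> carrier M" "y \<in> carrier M" "\<And>k. k \<in> K' \<Longrightarrow> \<theta> (p k) x = \<theta> (p k) y" for x y
    using that assms by (intro theta_inj) (auto simp: bij_betw_def)
qed (use assms in \<open>auto simp: bij_betw_def kappa M_zero_closed M_add_closed M_smult_closed theta_zero theta_add theta_smult\<close>)

lemma coord_transfer:
  assumes M': "module A M'" and h: "h \<in> mod_hom A M' M" and bij: "bij_betw h (carrier M') (carrier M)"
  shows "coord_module A I \<chi> M' K \<kappa> (\<lambda>k x. \<theta> k (h x))"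
proof -
  interpret M': module A M' by fact
  have h0: "h \<zero>\<^bsub>M'\<^esub> = \<zero>\<^bsub>M\<^esub>"
    using mod_hom_smult[OF h, of "\<zero>\<^bsub>A\<^esub>" "\<zero>\<^bsub>M'\<^esub>"] module.smult_l_null[OF M_module] mod_hom_closed[OF h]
    by simp
  show ?thesis
  proof
    show "\<exists>x\<in>carrier M'. \<forall>k\<in>K. \<theta> k (h x) = v k" for v
      using bij_betw_inv_into_right[OF bij] bij_betw_inv_into[OF bij]
      by (intro bexI[of _ "inv_into (carrier M') h (vec v)"]) (auto simp: bij_betw_def)
    show "x = y" if "x \<in> carrier M'" "y \<in> carrier M'" "\<And>k. k \<in> K \<Longrightarrow> \<theta> k (h x) = \<theta> k (h y)" for x y
      using that theta_inj[of "h x" "h y"] mod_hom_closed[OF h] bij by (auto simp: bij_betw_def inj_on_def)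
  qed (use mod_hom_closed[OF h] in \<open>auto simp: finite_K kappa h0 theta_zero mod_hom_add[OF h] theta_add mod_hom_smult[OF h] theta_smult\<close>)
qed

end

text \<open>Both modules are \<F>^K with \<open>A\<close> acting on coordinate \<open>k\<close> by
  the character \<kappa> k; the isomorphism matches coordinates.\<close>

lemma coord_module_iso:
  assumes "coord_module A I \<chi> M K \<kappa> \<theta>" "coord_module A I \<chi> M' K \<kappa> \<theta>'"
  shows "mod_iso A M M'"
proof -
  interpret M: coord_module A I \<chi> M K \<kappa> \<theta> by fact
  interpret M': coord_module A I \<chi> M' K \<kappa> \<theta>' by fact
  let ?h = "\<lambda>x. M'.vec (\<lambda>k. \<theta> k x)"
  have "?h \<in> mod_hom A M M'"
    by (rule mod_homI) (auto intro!: M'.theta_inj simp: M'.M_add_closed M'.M_smult_closed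
        M.theta_add M'.theta_add M.theta_smult M'.theta_smult)
  moreover have "bij_betw ?h (carrier M) (carrier M')"
  proof (rule bij_betwI)
    show "(\<lambda>x. M.vec (\<lambda>k. \<theta>' k x)) \<in> carrier M' \<rightarrow> carrier M" by simp
  qed (auto intro!: M.theta_inj M'.theta_inj)
  ultimately show ?thesis unfolding mod_iso_def by blast
qed

lemma mod_iso_sym:
  assumes M: "module A M" and N: "module A N" and "mod_iso A M N"
  shows "mod_iso A N M"
proof -
  interpret M: module A M by fact
  interpret N: module A N by fact
  obtain h where h: "h \<in> mod_hom A M N" "bij_betw h (carrier M) (carrier N)"
    using assms by (auto simp: mod_iso_def)
  let ?g = "inv_into (carrier M) h"
  have g: "bij_betw ?g (carrier N) (carrier M)" using h(2) by (rule bij_betw_inv_into)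
  then have gc: "\<And>x. x \<in> carrier N \<Longrightarrow> ?g x \<in> carrier M" by (auto simp: bij_betw_def)
  have hg: "\<And>x. x \<in> carrier N \<Longrightarrow> h (?g x) = x" using h(2) bij_betw_inv_into_right by fast
  have gh: "\<And>x. x \<in> carrier M \<Longrightarrow> ?g (h x) = x" using h(2) bij_betw_inv_into_left by fast
  have "?g \<in> mod_hom A N M"
  proof (rule mod_homI)
    fix x y assume "x \<in> carrier N" "y \<in> carrier N"
    then have "h (?g x \<oplus>\<^bsub>M\<^esub> ?g y) = x \<oplus>\<^bsub>N\<^esub> y" by (simp add: mod_hom_add[OF h(1)] gc hg)
    then show "?g (x \<oplus>\<^bsub>N\<^esub> y) = ?g x \<oplus>\<^bsub>M\<^esub> ?g y"
      using gh[of "?g x \<oplus>\<^bsub>M\<^esub> ?g y"] \<open>x \<in> carrier N\<close> \<open>y \<in> carrier N\<close> gc by simp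
  next
    fix r x assume "r \<in> carrier A" "x \<in> carrier N"
    then have "h (r \<odot>\<^bsub>M\<^esub> ?g x) = r \<odot>\<^bsub>N\<^esub> x" by (simp add: mod_hom_smult[OF h(1)] gc hg)
    then show "?g (r \<odot>\<^bsub>N\<^esub> x) = r \<odot>\<^bsub>M\<^esub> ?g x"
      using gh[of "r \<odot>\<^bsub>M\<^esub> ?g x"] \<open>r \<in> carrier A\<close> \<open>x \<in> carrier N\<close> gc by simp
  qed (rule gc)
  then show ?thesis using g unfolding mod_iso_def by blast
qed

lemma (in split_algebra) char_module_coord:
  "i \<in> I \<Longrightarrow> coord_module A I \<chi> (char_module (\<chi> i)) {()} (\<lambda>_. i) (\<lambda>_ c. c)"
  by unfold_locales auto

text \<open>An element of \<open>M\<close> is encoded by its finite coordinate vector, embedded in \<open>A\<^sup>\<nat>\<close>.\<close>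

lemma (in coord_module) fg_copy:
  "\<exists>M'\<in>fg_modules A. mod_iso A M M'"
proof -
  define n where "n = card K"
  obtain p where p: "bij_betw p {..<n} K"
    using ex_bij_betw_nat_finite[OF finite_K] unfolding n_def atLeast0LessThan by blast
  have pK: "\<And>l. l < n \<Longrightarrow> p l \<in> K" using p by (auto simp: bij_betw_def)
  \<comment> \<open>The singleton matches the carrier type of \<open>fg_modules\<close>, whose
    elements are sets of functions; entries from \<open>n\<close> on are padded with zero.\<close>
  define j where "j x = {\<lambda>l::nat. if l < n then emb (\<theta> (p l) x) else \<zero>\<^bsub>A\<^esub>}" for x
  have inj: "inj_on j (carrier M)"
  proof (rule inj_onI)
    fix x y assume xy: "x \<in> carrier M" "y \<in> carrier M" "j x = j y"
    then have fe: "(\<lambda>l. if l < n then emb (\<theta> (p l) x) else \<zero>\<^bsub>A\<^esub>) = (\<lambda>l. if l < n then emb (\<theta> (p l) y) else \<zero>\<^bsub>A\<^esub>)"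
      unfolding j_def by simp
    have eq: "emb (\<theta> (p l) x) = emb (\<theta> (p l) y)" if "l < n" for l
      using fun_cong[OF fe, of l] that by simp
    show "x = y"
    proof (rule theta_inj[OF xy(1,2)])
      fix k assume "k \<in> K"
      then obtain l where l: "l < n" "p l = k" using p by (auto simp: bij_betw_def)
      have "\<chi> (\<kappa> k) (emb (\<theta> (p l) x)) = \<chi> (\<kappa> k) (emb (\<theta> (p l) y))" using eq[OF l(1)] by simp
      then show "\<theta> k x = \<theta> k y" using kappa[OF \<open>k \<in> K\<close>] l by simp
    qed
  qed
  define j' where "j' = inv_into (carrier M) j"
  have j'j [simp]: "\<And>x. x \<in> carrier M \<Longrightarrow> j' (j x) = x" unfolding j'_def using inj by simp
  define M' :: "('a, (nat \<Rightarrow> 'a) set) module" where "M' = \<lparr>carrier = j ` carrier M, monoid.mult = undefined, monoid.one = undefined,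
     ring.zero = j \<zero>\<^bsub>M\<^esub>, add = (\<lambda>X Y. j (j' X \<oplus>\<^bsub>M\<^esub> j' Y)), smult = (\<lambda>a X. j (a \<odot>\<^bsub>M\<^esub> j' X))\<rparr>"
  have M': "carrier M' = j ` carrier M" "\<zero>\<^bsub>M'\<^esub> = j \<zero>\<^bsub>M\<^esub>" "X \<oplus>\<^bsub>M'\<^esub> Y = j (j' X \<oplus>\<^bsub>M\<^esub> j' Y)"
    "a \<odot>\<^bsub>M'\<^esub> X = j (a \<odot>\<^bsub>M\<^esub> j' X)" for X Y a
    by (simp_all add: M'_def)
  have c: "coord_module A I \<chi> M' K \<kappa> (\<lambda>k X. \<theta> k (j' X))"
  proof
    show "\<exists>x\<in>carrier M'. \<forall>k\<in>K. \<theta> k (j' x) = v k" for v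
      by (rule bexI[of _ "j (vec v)"]) (auto simp: M')
    show "x = y" if xy: "x \<in> carrier M'" "y \<in> carrier M'" and eq: "\<And>k. k \<in> K \<Longrightarrow> \<theta> k (j' x) = \<theta> k (j' y)" for x y
    proof -
      obtain u w where "x = j u" "y = j w" "u \<in> carrier M" "w \<in> carrier M" using xy by (auto simp: M')
      then show ?thesis using eq theta_inj[of u w] by auto
    qed
  qed (auto simp: M' finite_K kappa M_zero_closed M_add_closed M_smult_closed theta_zero theta_add theta_smult)
  interpret M': coord_module A I \<chi> M' K \<kappa> "\<lambda>k X. \<theta> k (j' X)" by (rule c)
  have "M' \<in> fg_modules A" unfolding fg_modules_def using M'.M_module M'.M_fin_gen by simp
  moreover have "mod_iso A M M'" by (rule coord_module_iso[OF _ c]) unfold_locales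
  ultimately show ?thesis by blast
qed

subsection \<open>Dimensions\<close>

text \<open>Gaussian elimination: a homogeneous system with equations \<open>T\<close> and more
  unknowns \<open>J\<close> than equations has a nonzero solution. One equation and one unknown are
  removed at each step.\<close>

lemma nontrivial_solution:
  fixes a :: "'j \<Rightarrow> 't \<Rightarrow> 'f::field"
  assumes "finite T" "finite J" "card T < card J"
  shows "\<exists>c. (\<exists>j\<in>J. c j \<noteq> 0) \<and> (\<forall>t\<in>T. (\<Sum>j\<in>J. c j * a j t) = 0)"
  using assms
proof (induction T arbitrary: J a rule: finite_induct)
  case empty
  then have "J \<noteq> {}" by auto
  then show ?case by (intro exI[of _ "\<lambda>_. 1"]) auto
next
  case (insert t T)
  show ?case
  proof (cases "\<exists>j\<in>J. a j t \<noteq> 0")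
    case False
    have "\<exists>c. (\<exists>j\<in>J. c j \<noteq> 0) \<and> (\<forall>t\<in>T. (\<Sum>j\<in>J. c j * a j t) = 0)"
      using insert by (intro insert.IH) auto
    then show ?thesis using False by auto
  next
    case True
    then obtain j0 where j0: "j0 \<in> J" "a j0 t \<noteq> 0" by blast
    \<comment> \<open>The coefficients that remain after equation \<open>t\<close> has been used to
      eliminate the unknown at \<open>j0\<close>.\<close>
    define b where "b j s = a j s - a j t / a j0 t * a j0 s" for j s
    have "\<exists>c. (\<exists>j\<in>J - {j0}. c j \<noteq> 0) \<and> (\<forall>s\<in>T. (\<Sum>j\<in>J - {j0}. c j * b j s) = 0)"
      using insert j0 by (intro insert.IH) auto
    then obtain c where c: "\<exists>j\<in>J - {j0}. c j \<noteq> 0" "\<And>s. s \<in> T \<Longrightarrow> (\<Sum>j\<in>J - {j0}. c j * b j s) = 0" by blast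
    \<comment> \<open>The value at \<open>j0\<close> is dictated by equation
      \<open>t\<close>.\<close>
    define c' where "c' = c(j0 := - (\<Sum>j\<in>J - {j0}. c j * a j t) / a j0 t)"
    have split: "(\<Sum>j\<in>J. c' j * a j s) = c' j0 * a j0 s + (\<Sum>j\<in>J - {j0}. c j * a j s)" for s
    proof -
      have "(\<Sum>j\<in>J - {j0}. c' j * a j s) = (\<Sum>j\<in>J - {j0}. c j * a j s)"
        by (intro sum.cong) (auto simp: c'_def)
      then show ?thesis using sum.remove[OF insert.prems(1) j0(1), of "\<lambda>j. c' j * a j s"] by simp
    qed
    have "(\<Sum>j\<in>J. c' j * a j t) = 0" unfolding split using j0(2) by (simp add: c'_def)
    moreover have "(\<Sum>j\<in>J. c' j * a j s) = 0" if "s \<in> T" for s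
    proof -
      have "c' j0 * a j0 s = - (\<Sum>j\<in>J - {j0}. c j * (a j t / a j0 t * a j0 s))"
        using j0(2) by (simp add: c'_def sum_distrib_right sum_divide_distrib mult_ac sum_distrib_left)
      then have "c' j0 * a j0 s + (\<Sum>j\<in>J - {j0}. c j * a j s) = (\<Sum>j\<in>J - {j0}. c j * b j s)"
        by (simp add: b_def right_diff_distrib sum_subtractf)
      then show ?thesis unfolding split using c(2)[OF that] by simp
    qed
    moreover have "\<exists>j\<in>J. c' j \<noteq> 0" using c(1) by (auto simp: c'_def)
    ultimately show ?thesis by (intro exI[of _ c']) auto
  qed
qed

text \<open>The count is the dimension of the part of \<open>M\<close> on which
  \<open>idem i\<close> acts as the identity. If \<open>K'\<close> had more indices of character
  \<open>i\<close>, a nontrivial combination of the corresponding basis vectors would have all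
  \<theta>-coordinates zero.\<close>

lemma coord_count_le:
  assumes "coord_module A I \<chi> M K \<kappa> \<theta>" "coord_module A I \<chi> M K' \<kappa>' \<theta>'"
  shows "card {k \<in> K'. \<kappa>' k = i} \<le> card {k \<in> K. \<kappa> k = i}"
proof (rule ccontr)
  interpret M: coord_module A I \<chi> M K \<kappa> \<theta> by fact
  interpret M': coord_module A I \<chi> M K' \<kappa>' \<theta>' by fact
  define J where "J = {k \<in> K'. \<kappa>' k = i}"
  define T where "T = {k \<in> K. \<kappa> k = i}"
  assume "\<not> card {k \<in> K'. \<kappa>' k = i} \<le> card {k \<in> K. \<kappa> k = i}"
  then have "card T < card J" by (simp add: J_def T_def)
  moreover have "finite J" "finite T" using M.finite_K M'.finite_K by (auto simp: J_def T_def)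
  ultimately obtain c where c: "\<exists>j\<in>J. c j \<noteq> 0" "\<And>t. t \<in> T \<Longrightarrow> (\<Sum>j\<in>J. c j * \<theta> t (M'.bas j)) = 0"
    using nontrivial_solution[of T J "\<lambda>j t. \<theta> t (M'.bas j)"] by blast
  let ?x = "M'.vec (\<lambda>k. if k \<in> J then c k else 0)"
  have "\<theta> k ?x = 0" if k: "k \<in> K" for k
  proof (cases "\<kappa> k = i")
    case True
    have "\<theta> k ?x = (\<Sum>j\<in>K'. \<theta>' j ?x * \<theta> k (M'.bas j))"
      by (rule M'.functional_expand) (use k in \<open>auto simp: M.theta_zero M.theta_add M.theta_smult M.kappa\<close>)
    also have "\<dots> = (\<Sum>j\<in>J. c j * \<theta> k (M'.bas j))"
      using M'.finite_K by (intro sum.mono_neutral_cong_right) (auto simp: J_def)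
    finally show ?thesis using c(2) k True by (simp add: T_def)
  next
    case False
    \<comment> \<open>The vector lies in the part of character \<open>i\<close>, so
      \<open>idem i\<close> fixes it; but \<open>idem i\<close> multiplies coordinate
      \<open>k\<close> by its value at a different character, which is 0.\<close>
    have "M.idem i \<odot>\<^bsub>M\<^esub> ?x = ?x"
      by (rule M'.theta_inj) (auto simp: M'.M_smult_closed M'.theta_smult M'.kappa J_def)
    then have "\<theta> k ?x = \<chi> (\<kappa> k) (M.idem i) * \<theta> k ?x" using M.theta_smult[OF k, of "M.idem i" ?x] by simp
    then show ?thesis using False M.kappa[OF k] by simp
  qed
  then have "?x = \<zero>\<^bsub>M\<^esub>" by (intro M.theta_inj) (auto simp: M.M_zero_closed M.theta_zero)
  then have "\<forall>k\<in>K'. \<theta>' k ?x = 0" by (simp add: M'.theta_zero)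
  then show False using c(1) by (auto simp: J_def)
qed

lemma coord_count_unique:
  assumes "coord_module A I \<chi> M K \<kappa> \<theta>" "coord_module A I \<chi> M K' \<kappa>' \<theta>'"
  shows "card {k \<in> K'. \<kappa>' k = i} = card {k \<in> K. \<kappa> k = i}"
  using coord_count_le[OF assms] coord_count_le[OF assms(2,1)] by (rule antisym)

section \<open>Linear combinations, and bases of finitely generated modules\<close>

context split_algebra
begin

text \<open>Field scalars act through \<open>emb\<close>, the module structure being over
  \<open>A\<close>.\<close>

definition lincomb :: "('a, 'm) module \<Rightarrow> 'k set \<Rightarrow> ('k \<Rightarrow> 'm) \<Rightarrow> ('k \<Rightarrow> 'f) \<Rightarrow> 'm" where
  "lincomb M K b c = (\<Oplus>\<^bsub>M\<^esub>k\<in>K. emb (c k) \<odot>\<^bsub>M\<^esub> b k)"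

lemma emb_add: "emb (x + y) = emb x \<oplus>\<^bsub>A\<^esub> emb y"
  by (rule chi_inj) (auto simp: chi_add)

lemma emb_mult: "emb (x * y) = emb x \<otimes>\<^bsub>A\<^esub> emb y"
  by (rule chi_inj) (auto simp: chi_mult)

lemma emb_zero: "emb 0 = \<zero>\<^bsub>A\<^esub>"
  by (rule chi_inj) (auto simp: chi_zero)

lemma emb_one: "emb 1 = \<one>\<^bsub>A\<^esub>"
  by (rule chi_inj) (auto simp: chi_one)

context
  fixes M :: "('a, 'm) module" and K :: "'k set" and b :: "'k \<Rightarrow> 'm"
  assumes M: "module A M" and K: "finite K" and b: "\<And>k. k \<in> K \<Longrightarrow> b k \<in> carrier M"
begin

interpretation M: module A M by (rule M)

lemma lincomb_closed: "lincomb M K b c \<in> carrier M"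
  unfolding lincomb_def using b by (intro M.M.finsum_closed) auto

lemma lincomb_add: "lincomb M K b (\<lambda>k. c k + d k) = lincomb M K b c \<oplus>\<^bsub>M\<^esub> lincomb M K b d"
proof -
  have "lincomb M K b (\<lambda>k. c k + d k) = (\<Oplus>\<^bsub>M\<^esub>k\<in>K. emb (c k) \<odot>\<^bsub>M\<^esub> b k \<oplus>\<^bsub>M\<^esub> emb (d k) \<odot>\<^bsub>M\<^esub> b k)"
    unfolding lincomb_def using b by (intro M.M.finsum_cong') (auto simp: emb_add M.smult_l_distr)
  then show ?thesis unfolding lincomb_def using b by (subst (asm) M.M.finsum_addf) auto
qed

lemma lincomb_smult:
  assumes a: "a \<in> carrier A"
    and eig: "\<And>k. k \<in> K \<Longrightarrow> a \<odot>\<^bsub>M\<^esub> b k = emb (e k) \<odot>\<^bsub>M\<^esub> b k"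
  shows "a \<odot>\<^bsub>M\<^esub> lincomb M K b c = lincomb M K b (\<lambda>k. e k * c k)"
proof -
  have "a \<odot>\<^bsub>M\<^esub> lincomb M K b c = (\<Oplus>\<^bsub>M\<^esub>k\<in>K. a \<odot>\<^bsub>M\<^esub> (emb (c k) \<odot>\<^bsub>M\<^esub> b k))"
    unfolding lincomb_def using a b K by (subst M.finsum_smult_ldistr) auto
  also have "\<dots> = lincomb M K b (\<lambda>k. e k * c k)"
    unfolding lincomb_def
  proof (intro M.M.finsum_cong')
    fix k assume k: "k \<in> K"
    have "a \<odot>\<^bsub>M\<^esub> (emb (c k) \<odot>\<^bsub>M\<^esub> b k) = emb (c k) \<odot>\<^bsub>M\<^esub> (a \<odot>\<^bsub>M\<^esub> b k)"
      using a b[OF k] M.smult_assoc1[of a "emb (c k)" "b k"] M.smult_assoc1[of "emb (c k)" a "b k"]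
      by (simp add: A.m_comm)
    also have "\<dots> = emb (e k * c k) \<odot>\<^bsub>M\<^esub> b k"
      using b[OF k] by (simp add: eig[OF k] mult.commute[of "e k"] emb_mult M.smult_assoc1)
    finally show "a \<odot>\<^bsub>M\<^esub> (emb (c k) \<odot>\<^bsub>M\<^esub> b k) = emb (e k * c k) \<odot>\<^bsub>M\<^esub> b k" .
  qed (use b in auto)
  finally show ?thesis .
qed

lemma lincomb_scale: "emb t \<odot>\<^bsub>M\<^esub> lincomb M K b c = lincomb M K b (\<lambda>k. t * c k)"
  by (rule lincomb_smult) auto

lemma lincomb_zero: "lincomb M K b (\<lambda>_. 0) = \<zero>\<^bsub>M\<^esub>"
proof -
  have "lincomb M K b (\<lambda>_. 0) = (\<Oplus>\<^bsub>M\<^esub>k\<in>K. \<zero>\<^bsub>M\<^esub>)"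
    unfolding lincomb_def using b by (intro M.M.finsum_cong') (auto simp: emb_zero)
  then show ?thesis by simp
qed

lemma lincomb_cong: "(\<And>k. k \<in> K \<Longrightarrow> c k = d k) \<Longrightarrow> lincomb M K b c = lincomb M K b d"
  unfolding lincomb_def using b by (intro M.M.finsum_cong') auto

lemma lincomb_mono_neutral:
  assumes "K' \<subseteq> K" "\<And>k. k \<in> K - K' \<Longrightarrow> c k = 0"
  shows "lincomb M K b c = lincomb M K' b c"
  unfolding lincomb_def using b assms K
  by (intro M.M.add.finprod_mono_neutral_cong_right) (auto simp: emb_zero)

lemma lincomb_unit:
  assumes "k \<in> K"
  shows "lincomb M K b (\<lambda>l. if l = k then 1 else 0) = b k"
proof -
  have "lincomb M K b (\<lambda>l. if l = k then 1 else 0) = lincomb M {k} b (\<lambda>l. if l = k then 1 else 0)"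
    using assms by (intro lincomb_mono_neutral) auto
  also have "\<dots> = b k" unfolding lincomb_def using b[OF assms] by (simp add: emb_one)
  finally show ?thesis .
qed

text \<open>Coordinates are the coefficients of a chosen expansion. Independence makes them unique,
  hence additive, and the eigenvector property \<open>eig\<close> turns the action of
  \<open>A\<close> into characters.\<close>

lemma basis_imp_coord:
  assumes kappa: "\<And>k. k \<in> K \<Longrightarrow> \<kappa> k \<in> I"
    and eig: "\<And>a k. \<lbrakk>a \<in> carrier A; k \<in> K\<rbrakk> \<Longrightarrow> a \<odot>\<^bsub>M\<^esub> b k = emb (\<chi> (\<kappa> k) a) \<odot>\<^bsub>M\<^esub> b k"
    and span: "\<And>x. x \<in> carrier M \<Longrightarrow> \<exists>c. x = lincomb M K b c"
    and indep: "\<And>c k. \<lbrakk>lincomb M K b c = \<zero>\<^bsub>M\<^esub>; k \<in> K\<rbrakk> \<Longrightarrow> c k = 0"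
  shows "\<exists>\<theta>. coord_module A I \<chi> M K \<kappa> \<theta>"
proof -
  define \<theta> where "\<theta> k x = (SOME c. x = lincomb M K b c) k" for k x
  have uniq: "c k = d k" if "lincomb M K b c = lincomb M K b d" "k \<in> K" for c d k
  proof -
    have "lincomb M K b (\<lambda>k. c k + (-1) * d k) = lincomb M K b (\<lambda>k. d k + (-1) * d k)"
      by (simp only: lincomb_add that)
    also have "\<dots> = \<zero>\<^bsub>M\<^esub>" by (simp add: lincomb_zero)
    finally have "c k + (-1) * d k = 0" using that(2) by (rule indep)
    then show ?thesis by simp
  qed
  have lc: "lincomb M K b (\<lambda>k. \<theta> k x) = x" if "x \<in> carrier M" for x
    unfolding \<theta>_def using someI_ex[OF span[OF that]] by simp
  have \<theta>: "\<theta> k (lincomb M K b c) = c k" if "k \<in> K" for k c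
    using lc[OF lincomb_closed] that by (rule uniq)
  have "coord_module A I \<chi> M K \<kappa> \<theta>"
  proof
    show "\<theta> k \<zero>\<^bsub>M\<^esub> = 0" if "k \<in> K" for k
      using \<theta>[OF that, of "\<lambda>_. 0"] by (simp add: lincomb_zero)
    show "\<theta> k (x \<oplus>\<^bsub>M\<^esub> y) = \<theta> k x + \<theta> k y" if "k \<in> K" "x \<in> carrier M" "y \<in> carrier M" for k x y
      using \<theta>[OF that(1), of "\<lambda>k. \<theta> k x + \<theta> k y"] by (simp add: lincomb_add lc that)
    show "\<theta> k (a \<odot>\<^bsub>M\<^esub> x) = \<chi> (\<kappa> k) a * \<theta> k x" if "k \<in> K" "a \<in> carrier A" "x \<in> carrier M" for k a x
      using \<theta>[OF that(1), of "\<lambda>k. \<chi> (\<kappa> k) a * \<theta> k x"] lincomb_smult[OF that(2) eig, of "\<lambda>k. \<theta> k x"] that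
      by (simp add: lc)
    show "x = y" if "x \<in> carrier M" "y \<in> carrier M" "\<And>k. k \<in> K \<Longrightarrow> \<theta> k x = \<theta> k y" for x y
      using lincomb_cong[of "\<lambda>k. \<theta> k x" "\<lambda>k. \<theta> k y"] that(3) lc[OF that(1)] lc[OF that(2)] by simp
    show "\<exists>x\<in>carrier M. \<forall>k\<in>K. \<theta> k x = v k" for v
      by (rule bexI[of _ "lincomb M K b v"]) (auto simp: \<theta> lincomb_closed)
  qed (auto simp: K kappa)
  then show ?thesis by blast
qed

end

text \<open>The idempotents applied to the generators give eigenvectors that still span, because the
  idempotents sum to the unit. A spanning subset of least cardinality is then a basis. It serves as
  its own index set, so \<open>K\<close> consists of elements of \<open>M\<close>, as
  \<open>mdim\<close> requires.\<close>

lemma fg_module_coord: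
  assumes M: "module A M" and fg: "fin_gen A M"
  shows "\<exists>(K :: 'm set) \<kappa> \<theta>. coord_module A I \<chi> (M :: ('a, 'm) module) K \<kappa> \<theta>"
proof -
  interpret M: module A M by (rule M)
  obtain X where X: "finite X" "X \<subseteq> carrier M"
    and gen: "\<And>U. \<lbrakk>submodule U A M; X \<subseteq> U\<rbrakk> \<Longrightarrow> U = carrier M"
    using fg unfolding fin_gen_def by blast
  define E where "E = (\<lambda>(i, x). idem i \<odot>\<^bsub>M\<^esub> x) ` (I \<times> X)"
  have finE: "finite E" unfolding E_def using X finite_I by simp
  have EM: "E \<subseteq> carrier M" unfolding E_def using X by auto
  have ex: "\<exists>i. i \<in> I \<and> (\<forall>a\<in>carrier A. a \<odot>\<^bsub>M\<^esub> e = emb (\<chi> i a) \<odot>\<^bsub>M\<^esub> e)" if e: "e \<in> E" for e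
  proof -
    obtain i x where ix: "i \<in> I" "x \<in> X" "e = idem i \<odot>\<^bsub>M\<^esub> x" using e unfolding E_def by auto
    have "a \<odot>\<^bsub>M\<^esub> e = emb (\<chi> i a) \<odot>\<^bsub>M\<^esub> e" if "a \<in> carrier A" for a
    proof -
      \<comment> \<open>Multiplying an idempotent by \<open>a\<close> only scales it by the
        character value; hence its image in \<open>M\<close> consists of eigenvectors.\<close>
      have "a \<otimes>\<^bsub>A\<^esub> idem i = emb (\<chi> i a) \<otimes>\<^bsub>A\<^esub> idem i"
        using that by (intro chi_inj) (auto simp: chi_mult)
      moreover have "x \<in> carrier M" using ix X by auto
      ultimately show ?thesis
        using M.smult_assoc1[OF that el_closed, of x] M.smult_assoc1[OF el_closed el_closed, of x]
        by (metis ix(3))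
    qed
    then show ?thesis using ix(1) by blast
  qed
  define \<kappa> where "\<kappa> e = (SOME i. i \<in> I \<and> (\<forall>a\<in>carrier A. a \<odot>\<^bsub>M\<^esub> e = emb (\<chi> i a) \<odot>\<^bsub>M\<^esub> e))" for e
  have "\<kappa> e \<in> I \<and> (\<forall>a\<in>carrier A. a \<odot>\<^bsub>M\<^esub> e = emb (\<chi> (\<kappa> e) a) \<odot>\<^bsub>M\<^esub> e)" if "e \<in> E" for e
    unfolding \<kappa>_def by (rule someI_ex[OF ex[OF that]])
  then have \<kappa>: "\<And>e. e \<in> E \<Longrightarrow> \<kappa> e \<in> I"
    "\<And>e a. \<lbrakk>e \<in> E; a \<in> carrier A\<rbrakk> \<Longrightarrow> a \<odot>\<^bsub>M\<^esub> e = emb (\<chi> (\<kappa> e) a) \<odot>\<^bsub>M\<^esub> e" by blast+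
  let ?spans = "\<lambda>B. B \<subseteq> E \<and> (\<forall>x\<in>carrier M. \<exists>c. x = lincomb M B id c)"
  have lcE: "\<And>e. e \<in> E \<Longrightarrow> id e \<in> carrier M" using EM by auto
  have "?spans E"
  proof -
    let ?U = "range (lincomb M E id)"
    have sub: "submodule ?U A M"
    proof (rule M.submoduleI)
      show "?U \<subseteq> carrier M" using lincomb_closed[where b = id and K = E, OF M finE lcE] by auto
      show z: "\<zero>\<^bsub>M\<^esub> \<in> ?U" using rangeI[of "lincomb M E id" "\<lambda>_. 0"] by (simp only: lincomb_zero[where b = id and K = E, OF M finE lcE])
      show add: "x \<oplus>\<^bsub>M\<^esub> y \<in> ?U" if "x \<in> ?U" "y \<in> ?U" for x y
      proof -
        from that obtain c d where "x = lincomb M E id c" "y = lincomb M E id d" by blast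
        then have "x \<oplus>\<^bsub>M\<^esub> y = lincomb M E id (\<lambda>k. c k + d k)" by (simp only: lincomb_add[where b = id and K = E, OF M finE lcE])
        then show ?thesis by blast
      qed
      show sm: "a \<odot>\<^bsub>M\<^esub> x \<in> ?U" if "a \<in> carrier A" "x \<in> ?U" for a x
      proof -
        from that obtain c where "x = lincomb M E id c" by blast
        then have "a \<odot>\<^bsub>M\<^esub> x = lincomb M E id (\<lambda>e. \<chi> (\<kappa> e) a * c e)"
          using lincomb_smult[where b = id and K = E and e = "\<lambda>e. \<chi> (\<kappa> e) a" and c = c, OF M finE lcE that(1)] \<kappa>(2)[OF _ that(1)] by simp
        then show ?thesis by simp
      qed
      show "\<ominus>\<^bsub>M\<^esub> x \<in> ?U" if "x \<in> ?U" for x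
      proof -
        have "x \<in> carrier M" using that lincomb_closed[where b = id and K = E, OF M finE lcE] by auto
        then have "\<ominus>\<^bsub>M\<^esub> x = (\<ominus>\<^bsub>A\<^esub> \<one>\<^bsub>A\<^esub>) \<odot>\<^bsub>M\<^esub> x" using M.smult_l_minus[of "\<one>\<^bsub>A\<^esub>" x] by simp
        then show ?thesis using sm[OF _ that, of "\<ominus>\<^bsub>A\<^esub> \<one>\<^bsub>A\<^esub>"] by simp
      qed
    qed
    define U where "U = ?U"
    have subU: "submodule U A M" using sub by (simp only: U_def)
    have "x \<in> U" if x: "x \<in> X" for x
    proof -
      have xM: "x \<in> carrier M" using x X by auto
      have mem: "idem i \<odot>\<^bsub>M\<^esub> x \<in> U" if "i \<in> I" for i
      proof -
        have "idem i \<odot>\<^bsub>M\<^esub> x \<in> E" unfolding E_def using that x by (intro image_eqI[of _ _ "(i, x)"]) auto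
        then have "lincomb M E id (\<lambda>l. if l = idem i \<odot>\<^bsub>M\<^esub> x then 1 else 0) = id (idem i \<odot>\<^bsub>M\<^esub> x)"
          by (intro lincomb_unit[where b = id and K = E, OF M finE]) (use EM in auto)
        then show ?thesis unfolding U_def id_apply[of "idem i \<odot>\<^bsub>M\<^esub> x"]
          by (intro image_eqI[where x = "\<lambda>l. if l = idem i \<odot>\<^bsub>M\<^esub> x then 1 else 0", OF _ UNIV_I]) (rule sym)
      qed
      \<comment> \<open>The element with the indicator of \<open>J\<close> as characters is the
        partial sum of the idempotents over \<open>J\<close>; for \<open>J = I\<close> it is the
        unit.\<close>
      have "el (\<lambda>i. if i \<in> J then 1 else 0) \<odot>\<^bsub>M\<^esub> x \<in> U" if "J \<subseteq> I" for J
        using finite_subset[OF that finite_I] that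
      proof (induction J rule: finite_induct)
        case empty
        have "el (\<lambda>i. if i \<in> {} then 1 else 0) \<odot>\<^bsub>M\<^esub> x = \<zero>\<^bsub>M\<^esub>" using xM by (simp add: emb_zero)
        then show ?case using submodule.axioms(1)[OF subU, THEN subgroup.one_closed] by (simp only: monoid.simps)
      next
        case (insert i J)
        have "el (\<lambda>l. if l \<in> insert i J then 1 else 0) = idem i \<oplus>\<^bsub>A\<^esub> el (\<lambda>i. if i \<in> J then 1 else 0)"
          using insert.hyps by (intro chi_inj) (auto simp: chi_add)
        then show ?case
          using insert mem[of i] xM subgroup.m_closed[OF submodule.axioms(1)[OF subU]]
          by (simp add: M.smult_l_distr)
      qed
      from this[of I] have "el (\<lambda>i. if i \<in> I then 1 else 0) \<odot>\<^bsub>M\<^esub> x \<in> U" by simp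
      moreover have "el (\<lambda>i. if i \<in> I then 1 else 0) = \<one>\<^bsub>A\<^esub>" by (rule chi_inj) (auto simp: chi_one)
      ultimately show ?thesis using xM by simp
    qed
    then have "U = carrier M" by (intro gen[OF subU]) auto
    then show ?thesis unfolding U_def by auto
  qed
  then obtain B where B: "?spans B" and min: "\<And>B'. ?spans B' \<Longrightarrow> card B \<le> card B'"
    using ex_has_least_nat[of ?spans E card] by blast
  have finB: "finite B" using B finE finite_subset by blast
  have lcB: "\<And>e. e \<in> B \<Longrightarrow> id e \<in> carrier M" using B EM by auto
  have "\<exists>\<theta>. coord_module A I \<chi> M B \<kappa> \<theta>"
  proof (rule basis_imp_coord[where b = id and K = B, OF M finB lcB])
    fix c b0 assume c: "lincomb M B id c = \<zero>\<^bsub>M\<^esub>" and b0: "b0 \<in> B"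
    show "c b0 = 0"
    proof (rule ccontr)
      assume nz: "c b0 \<noteq> 0"
      have "\<exists>d. x = lincomb M (B - {b0}) id d" if "x \<in> carrier M" for x
      proof -
        from B that obtain d where d: "x = lincomb M B id d" by blast
        let ?t = "- (d b0 / c b0)"
        have "lincomb M B id (\<lambda>k. d k + ?t * c k) = x \<oplus>\<^bsub>M\<^esub> emb ?t \<odot>\<^bsub>M\<^esub> \<zero>\<^bsub>M\<^esub>"
          by (simp only: lincomb_add[where b = id and K = B, OF M finB lcB] lincomb_scale[where b = id and K = B, OF M finB lcB, symmetric] c d[symmetric])
        also have "\<dots> = x" using that by simp
        finally have "lincomb M B id (\<lambda>k. d k + ?t * c k) = x" .
        moreover have "lincomb M B id (\<lambda>k. d k + ?t * c k) = lincomb M (B - {b0}) id (\<lambda>k. d k + ?t * c k)"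
          by (rule lincomb_mono_neutral[where b = id and K = B, OF M finB lcB]) (use nz in auto)
        ultimately show ?thesis by metis
      qed
      then have "?spans (B - {b0})" using B by fast
      then have "card B \<le> card (B - {b0})" by (rule min)
      then show False using card_Diff1_less[OF finB b0] by simp
    qed
  qed (use B \<kappa> in auto)
  then show ?thesis by blast
qed

text \<open>The multiplicity of the character \<open>i\<close>. A choice cannot range over all index
  types, so \<open>K\<close> is taken among subsets of the element type; \<open>mdim_eq\<close> then
  evaluates it from coordinates with any index type.\<close>

definition mdim :: "('a, 'm) module \<Rightarrow> 'i \<Rightarrow> nat" where
  "mdim M i = (SOME n. \<exists>(K :: 'm set) \<kappa> \<theta>. coord_module A I \<chi> M K \<kappa> \<theta> \<and> n = card {k \<in> K. \<kappa> k = i})"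

lemma mdim_eq:
  assumes c: "coord_module A I \<chi> (M :: ('a, 'm) module) (K :: 'k set) \<kappa> \<theta>"
  shows "mdim M i = card {k \<in> K. \<kappa> k = i}"
proof -
  interpret M: coord_module A I \<chi> M K \<kappa> \<theta> by fact
  have "\<exists>n. \<exists>(K :: 'm set) \<kappa> \<theta>. coord_module A I \<chi> M K \<kappa> \<theta> \<and> n = card {k \<in> K. \<kappa> k = i}"
    using fg_module_coord[OF M.M_module M.M_fin_gen] by blast
  from someI_ex[OF this, folded mdim_def]
  show ?thesis using coord_count_unique[OF c] by auto
qed

end

subsection \<open>Short exact sequences\<close>

lemma mod_hom_zero:
  assumes "module A M" "module A N" "h \<in> mod_hom A M N"
  shows "h \<zero>\<^bsub>M\<^esub> = \<zero>\<^bsub>N\<^esub>"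
proof -
  interpret M: module A M by fact
  interpret N: module A N by fact
  show ?thesis
    using mod_hom_smult[OF assms(3), of "\<zero>\<^bsub>A\<^esub>" "\<zero>\<^bsub>M\<^esub>"] mod_hom_closed[OF assms(3), of "\<zero>\<^bsub>M\<^esub>"] by simp
qed

lemma mod_hom_finsum:
  assumes M: "module A M" and N: "module A N" and h: "h \<in> mod_hom A M N"
    and "finite J" "\<And>j. j \<in> J \<Longrightarrow> u j \<in> carrier M"
  shows "h (\<Oplus>\<^bsub>M\<^esub>j\<in>J. u j) = (\<Oplus>\<^bsub>N\<^esub>j\<in>J. h (u j))"
proof -
  interpret M: module A M by fact
  interpret N: module A N by fact
  show ?thesis using assms(4,5)
  proof (induction J rule: finite_induct)
    case empty then show ?case by (simp add: mod_hom_zero[OF M N h])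
  next
    case (insert j J)
    then have "u \<in> J \<rightarrow> carrier M" "(\<lambda>j. h (u j)) \<in> J \<rightarrow> carrier N" by (auto simp: mod_hom_closed[OF h])
    then show ?case using insert by (simp add: mod_hom_add[OF h] mod_hom_closed[OF h])
  qed
qed

lemma (in split_algebra) mod_hom_lincomb:
  assumes M: "module A M" and N: "module A N" and h: "h \<in> mod_hom A M N"
    and K: "finite K" and b: "\<And>k. k \<in> K \<Longrightarrow> b k \<in> carrier M"
  shows "h (lincomb M K b c) = lincomb N K (\<lambda>k. h (b k)) c"
proof -
  interpret M: module A M by fact
  interpret N: module A N by fact
  have "h (lincomb M K b c) = (\<Oplus>\<^bsub>N\<^esub>k\<in>K. h (emb (c k) \<odot>\<^bsub>M\<^esub> b k))"
    unfolding lincomb_def by (rule mod_hom_finsum[OF M N h K]) (simp add: b)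
  also have "\<dots> = lincomb N K (\<lambda>k. h (b k)) c"
    unfolding lincomb_def
    by (intro N.M.finsum_cong') (auto simp: mod_hom_smult[OF h] b mod_hom_closed[OF h])
  finally show ?thesis .
qed

context coord_module
begin

lemma theta_finsum:
  assumes "finite J" "\<And>j. j \<in> J \<Longrightarrow> u j \<in> carrier M" "k \<in> K"
  shows "\<theta> k (\<Oplus>\<^bsub>M\<^esub>j\<in>J. u j) = (\<Sum>j\<in>J. \<theta> k (u j))"
proof -
  interpret M: module A M by (rule M_module)
  show ?thesis using assms(1,2)
  proof (induction J rule: finite_induct)
    case empty then show ?case by (simp add: theta_zero assms(3))
  next
    case (insert j J)
    then have "u \<in> J \<rightarrow> carrier M" by auto
    then show ?case using insert by (simp add: theta_add assms(3) M.M.finsum_closed)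
  qed
qed

lemma theta_lincomb: "k \<in> K \<Longrightarrow> \<theta> k (lincomb M K bas c) = c k"
  unfolding lincomb_def
  by (subst theta_finsum) (auto simp: finite_K M_smult_closed theta_smult kappa if_distrib[of "\<lambda>t. _ * t"] cong: if_cong)

lemma bas_eig: "\<lbrakk>a \<in> carrier A; k \<in> K\<rbrakk> \<Longrightarrow> a \<odot>\<^bsub>M\<^esub> bas k = emb (\<chi> (\<kappa> k) a) \<odot>\<^bsub>M\<^esub> bas k"
  by (rule theta_inj) (auto simp: M_smult_closed theta_smult kappa)

lemma lincomb_theta: "x \<in> carrier M \<Longrightarrow> lincomb M K bas (\<lambda>k. \<theta> k x) = x"
  by (rule theta_inj) (auto simp: theta_lincomb lincomb_closed[OF M_module finite_K])

end

text \<open>Every such sequence splits: the basis of \<open>L\<close> is carried along, that of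
  \<open>N\<close> is lifted to eigenvectors, and together they form a basis of \<open>M\<close>.
  The index set is the disjoint sum, so multiplicities add.\<close>

lemma (in split_algebra) ses_coord:
  assumes M: "module A M"
    and L: "coord_module A I \<chi> L KL \<kappa>L \<theta>L" and N: "coord_module A I \<chi> N KN \<kappa>N \<theta>N"
    and ses: "short_exact A L M N"
  shows "\<exists>\<theta>. coord_module A I \<chi> M (KL <+> KN) (case_sum \<kappa>L \<kappa>N) \<theta>"
proof -
  interpret M: module A M by (rule M)
  interpret L: coord_module A I \<chi> L KL \<kappa>L \<theta>L by (rule L)
  interpret N: coord_module A I \<chi> N KN \<kappa>N \<theta>N by (rule N)
  interpret Lm: module A L by (rule L.M_module)
  interpret Nm: module A N by (rule N.M_module)
  obtain f g where f: "f \<in> mod_hom A L M" and g: "g \<in> mod_hom A M N" and inj: "inj_on f (carrier L)"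
    and ex: "f ` carrier L = {x \<in> carrier M. g x = \<zero>\<^bsub>N\<^esub>}" and surj: "g ` carrier M = carrier N"
    using ses unfolding short_exact_def by blast
  note fc = mod_hom_closed[OF f] and gc = mod_hom_closed[OF g]
  have gf: "g (f x) = \<zero>\<^bsub>N\<^esub>" if "x \<in> carrier L" for x using ex that by blast
  define y where "y k = (SOME m. m \<in> carrier M \<and> g m = N.bas k)" for k
  have y: "y k \<in> carrier M" "g (y k) = N.bas k" for k
  proof -
    have "N.bas k \<in> g ` carrier M" unfolding surj by simp
    then have "\<exists>m. m \<in> carrier M \<and> g m = N.bas k" by auto
    from someI_ex[OF this, folded y_def] show "y k \<in> carrier M" "g (y k) = N.bas k" by auto
  qed
  define bL where "bL k = f (L.bas k)" for k
  \<comment> \<open>The idempotent turns the arbitrary preimage \<open>y k\<close> into an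
    eigenvector of character \<kappa>N k and leaves its image \<open>N.bas k\<close>
    unchanged.\<close>
  define bN where "bN k = idem (\<kappa>N k) \<odot>\<^bsub>M\<^esub> y k" for k
  have bL: "\<And>k. k \<in> KL \<Longrightarrow> bL k \<in> carrier M" by (simp add: bL_def fc)
  have bN: "\<And>k. k \<in> KN \<Longrightarrow> bN k \<in> carrier M" by (simp add: bN_def y)
  have gbN: "g (bN k) = N.bas k" if "k \<in> KN" for k
    using that by (intro N.theta_inj)
      (auto simp: bN_def mod_hom_smult[OF g] y N.M_smult_closed N.theta_smult N.kappa)
  let ?K = "KL <+> KN" and ?b = "case_sum bL bN"
  have fin: "finite ?K" using L.finite_K N.finite_K by simp
  have b: "\<And>k. k \<in> ?K \<Longrightarrow> ?b k \<in> carrier M" using bL bN by auto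
  have split: "lincomb M ?K ?b c = lincomb M KL bL (\<lambda>k. c (Inl k)) \<oplus>\<^bsub>M\<^esub> lincomb M KN bN (\<lambda>k. c (Inr k))" for c
  proof -
    have "lincomb M ?K ?b c = (\<Oplus>\<^bsub>M\<^esub>k\<in>Inl ` KL. emb (c k) \<odot>\<^bsub>M\<^esub> ?b k) \<oplus>\<^bsub>M\<^esub> (\<Oplus>\<^bsub>M\<^esub>k\<in>Inr ` KN. emb (c k) \<odot>\<^bsub>M\<^esub> ?b k)"
      unfolding lincomb_def Plus_def using L.finite_K N.finite_K bL bN
      by (intro M.M.finsum_Un_disjoint) auto
    moreover have "(\<Oplus>\<^bsub>M\<^esub>k\<in>Inl ` KL. emb (c k) \<odot>\<^bsub>M\<^esub> ?b k) = lincomb M KL bL (\<lambda>k. c (Inl k))"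
      unfolding lincomb_def using bL by (subst M.M.finsum_reindex) auto
    moreover have "(\<Oplus>\<^bsub>M\<^esub>k\<in>Inr ` KN. emb (c k) \<odot>\<^bsub>M\<^esub> ?b k) = lincomb M KN bN (\<lambda>k. c (Inr k))"
      unfolding lincomb_def using bN by (subst M.M.finsum_reindex) auto
    ultimately show ?thesis by simp
  qed
  have fL: "f (lincomb L KL L.bas c) = lincomb M KL bL c" for c
    unfolding bL_def by (rule mod_hom_lincomb[OF L.M_module M f L.finite_K]) simp
  have gN: "g (lincomb M KN bN c) = lincomb N KN N.bas c" for c
  proof -
    have "g (lincomb M KN bN c) = lincomb N KN (\<lambda>k. g (bN k)) c"
      by (rule mod_hom_lincomb[OF M N.M_module g N.finite_K bN])
    also have "\<dots> = lincomb N KN N.bas c"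
      unfolding lincomb_def by (rule Nm.M.finsum_cong') (auto simp: gbN)
    finally show ?thesis .
  qed
  have lcL: "lincomb L KL L.bas c \<in> carrier L" for c by (rule lincomb_closed[OF L.M_module L.finite_K]) simp
  have lcN: "lincomb M KN bN c \<in> carrier M" for c by (rule lincomb_closed[OF M N.finite_K bN])
  show ?thesis
  proof (rule basis_imp_coord[OF M fin b])
    fix k assume "k \<in> ?K" then show "case_sum \<kappa>L \<kappa>N k \<in> I" using L.kappa N.kappa by auto
  next
    fix a k assume a: "a \<in> carrier A" and k: "k \<in> ?K"
    show "a \<odot>\<^bsub>M\<^esub> ?b k = emb (\<chi> (case_sum \<kappa>L \<kappa>N k) a) \<odot>\<^bsub>M\<^esub> ?b k"
    proof (cases k)
      case (Inl l)
      then show ?thesis using k a L.bas_eig[of a l]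
        by (auto simp: bL_def mod_hom_smult[OF f, symmetric])
    next
      case (Inr l)
      then have "a \<otimes>\<^bsub>A\<^esub> idem (\<kappa>N l) = emb (\<chi> (\<kappa>N l) a) \<otimes>\<^bsub>A\<^esub> idem (\<kappa>N l)"
        using k a N.kappa[of l] by (intro chi_inj) (auto simp: mult_closed chi_mult)
      then have "a \<odot>\<^bsub>M\<^esub> bN l = emb (\<chi> (\<kappa>N l) a) \<odot>\<^bsub>M\<^esub> bN l"
        unfolding bN_def M.smult_assoc1[OF a el_closed y(1), symmetric]
          M.smult_assoc1[OF el_closed el_closed y(1), symmetric] by simp
      then show ?thesis using Inr by simp
    qed
  next
    fix x assume x: "x \<in> carrier M"
    \<comment> \<open>A preimage of \<open>g x\<close> in the span of the \<open>bN\<close>; the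
      difference of \<open>x\<close> and \<open>w\<close> is in the kernel of \<open>g\<close> and
      hence comes from \<open>L\<close>.\<close>
    define w where "w = lincomb M KN bN (\<lambda>k. \<theta>N k (g x))"
    have w: "w \<in> carrier M" and gw: "g w = g x"
      using lcN gN N.lincomb_theta[OF gc[OF x]] by (simp_all add: w_def)
    have gxw: "g (x \<ominus>\<^bsub>M\<^esub> w) \<oplus>\<^bsub>N\<^esub> g w = \<zero>\<^bsub>N\<^esub> \<oplus>\<^bsub>N\<^esub> g w"
      using x w gw mod_hom_add[OF g, of "x \<ominus>\<^bsub>M\<^esub> w" w] gc
      by (simp add: a_minus_def M.M.a_assoc M.M.l_neg)
    have "g (x \<ominus>\<^bsub>M\<^esub> w) = \<zero>\<^bsub>N\<^esub>"
      by (rule Nm.M.add.right_cancel[THEN iffD1, OF _ _ _ gxw]) (use x w gc in auto)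
    then have "x \<ominus>\<^bsub>M\<^esub> w \<in> f ` carrier L" unfolding ex using x w by simp
    then obtain l where l: "l \<in> carrier L" "x \<ominus>\<^bsub>M\<^esub> w = f l" by auto
    have "x = f l \<oplus>\<^bsub>M\<^esub> w" using x w l(2)[symmetric] by (simp add: a_minus_def M.M.a_assoc M.M.l_neg)
    also have "\<dots> = lincomb M ?K ?b (case_sum (\<lambda>k. \<theta>L k l) (\<lambda>k. \<theta>N k (g x)))"
      using fL[of "\<lambda>k. \<theta>L k l"] L.lincomb_theta[OF l(1)] by (simp add: split w_def)
    finally show "\<exists>c. x = lincomb M ?K ?b c" by blast
  next
    fix c k assume c0: "lincomb M ?K ?b c = \<zero>\<^bsub>M\<^esub>" and k: "k \<in> ?K"
    have "g (lincomb M ?K ?b c) = \<zero>\<^bsub>N\<^esub>" using c0 mod_hom_zero[OF M N.M_module g] by simp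
    then have N0: "lincomb N KN N.bas (\<lambda>k. c (Inr k)) = \<zero>\<^bsub>N\<^esub>"
      unfolding split fL[symmetric] using lcL lcN gN
      by (simp add: mod_hom_add[OF g] fc gf lincomb_closed[OF N.M_module N.finite_K])
    have r: "c (Inr l) = 0" if "l \<in> KN" for l
      using N.theta_lincomb[OF that, of "\<lambda>k. c (Inr k)"] N.theta_zero[OF that] by (simp add: N0)
    have "lincomb M KN bN (\<lambda>k. c (Inr k)) = lincomb M KN bN (\<lambda>_. 0)"
      using r by (intro lincomb_cong[OF M N.finite_K bN]) auto
    then have "f (lincomb L KL L.bas (\<lambda>k. c (Inl k))) = \<zero>\<^bsub>M\<^esub>"
      using c0 unfolding split fL[symmetric] using fc[OF lcL] by (simp add: lincomb_zero[OF M N.finite_K bN])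
    then have "lincomb L KL L.bas (\<lambda>k. c (Inl k)) = \<zero>\<^bsub>L\<^esub>"
      using inj_onD[OF inj, of "lincomb L KL L.bas (\<lambda>k. c (Inl k))" "\<zero>\<^bsub>L\<^esub>"] lcL mod_hom_zero[OF L.M_module M f] by simp
    then have l: "c (Inl l) = 0" if "l \<in> KL" for l
      using L.theta_lincomb[OF that, of "\<lambda>k. c (Inl k)"] L.theta_zero[OF that] by simp
    show "c k = 0" using k l r by auto
  qed
qed

lemma (in split_algebra) mdim_ses:
  fixes L :: "('a, 'l) module" and M :: "('a, 'm) module" and N :: "('a, 'n) module"
  assumes L: "module A L" "fin_gen A L" and M: "module A M" and N: "module A N" "fin_gen A N"
    and ses: "short_exact A L M N"
  shows "mdim M i = mdim L i + mdim N i"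
proof -
  obtain KL :: "'l set" and \<kappa>L \<theta>L where cL: "coord_module A I \<chi> L KL \<kappa>L \<theta>L"
    using fg_module_coord[OF L] by blast
  obtain KN :: "'n set" and \<kappa>N \<theta>N where cN: "coord_module A I \<chi> N KN \<kappa>N \<theta>N"
    using fg_module_coord[OF N] by blast
  interpret L: coord_module A I \<chi> L KL \<kappa>L \<theta>L by (rule cL)
  interpret N: coord_module A I \<chi> N KN \<kappa>N \<theta>N by (rule cN)
  obtain \<theta> where "coord_module A I \<chi> M (KL <+> KN) (case_sum \<kappa>L \<kappa>N) \<theta>"
    using ses_coord[OF M cL cN ses] by blast
  then have "mdim M i = card {k \<in> KL <+> KN. case_sum \<kappa>L \<kappa>N k = i}" by (rule mdim_eq)
  also have "{k \<in> KL <+> KN. case_sum \<kappa>L \<kappa>N k = i} = {k \<in> KL. \<kappa>L k = i} <+> {k \<in> KN. \<kappa>N k = i}" by auto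
  also have "card \<dots> = mdim L i + mdim N i"
    using L.finite_K N.finite_K by (simp add: card_Plus mdim_eq[OF cL] mdim_eq[OF cN])
  finally show ?thesis .
qed

section \<open>The Grothendieck group of a split algebra\<close>

context split_algebra
begin

sublocale G: free_quotient "fg_modules A"
  "{frag_of M - frag_of L - frag_of N |L M N.
     L \<in> fg_modules A \<and> M \<in> fg_modules A \<and> N \<in> fg_modules A \<and> short_exact A L M N}"
proof
  show "{frag_of M - frag_of L - frag_of N |L M N.
     L \<in> fg_modules A \<and> M \<in> fg_modules A \<and> N \<in> fg_modules A \<and> short_exact A L M N}
    \<subseteq> carrier (free_Abelian_group (fg_modules A))"
    unfolding subset_iff carrier_free_Abelian_group_iff
    by (clarify; drule set_mp[OF keys_diff]; auto dest!: set_mp[OF keys_diff])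
qed

lemma G0_kernel_eq: "G0_kernel A = G.K"
  by (simp add: G0_kernel_def G.K_def)

lemma G0_eq: "G0 A = G.F Mod G.K"
  by (simp add: G0_def G0_kernel_eq)

lemma G0_comm_group: "comm_group (G0 A)"
  unfolding G0_eq by (rule G.quotient_comm_group)

sublocale G0: comm_group "G0 A" by (rule G0_comm_group)

text \<open>For modules that already lie in \<open>fg_modules\<close>; \<open>G0_class\<close>
  passes to a chosen isomorphic copy there.\<close>

definition mod_class :: "('a, (nat \<Rightarrow> 'a) set) module \<Rightarrow> 'a G0_elem" where
  "mod_class M = G.cls (frag_of M)"

lemma mod_class_closed: "M \<in> fg_modules A \<Longrightarrow> mod_class M \<in> carrier (G0 A)"
  by (simp add: mod_class_def G0_eq)

lemma mod_class_ses:
  assumes "L \<in> fg_modules A" "M \<in> fg_modules A" "N \<in> fg_modules A" "short_exact A L M N"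
  shows "mod_class M = mod_class L \<otimes>\<^bsub>G0 A\<^esub> mod_class N"
proof -
  have "frag_of M - frag_of L - frag_of N \<in> G.K"
    unfolding G.K_def using assms by (intro generate.incl) blast
  then have "frag_of M - (frag_of L + frag_of N) \<in> G.K" by (simp add: diff_diff_eq)
  moreover have "Poly_Mapping.keys (frag_of L + frag_of N) \<subseteq> fg_modules A"
    using assms by (intro order.trans[OF keys_add]) auto
  ultimately have "G.cls (frag_of M) = G.cls (frag_of L + frag_of N)"
    using assms by (simp add: G.cls_eq_iff)
  then show ?thesis using assms unfolding mod_class_def G0_eq by (subst G.cls_add) auto
qed

lemma coord_fg: "coord_module A I \<chi> M K \<kappa> \<theta> \<Longrightarrow> M \<in> fg_modules A"
  by (simp add: fg_modules_def coord_module.M_module coord_module.M_fin_gen)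

lemma fg_coord:
  assumes "M \<in> fg_modules A"
  obtains K \<kappa> \<theta> where "coord_module A I \<chi> M (K :: (nat \<Rightarrow> 'a) set set) \<kappa> \<theta>"
  using assms fg_module_coord unfolding fg_modules_def by blast

lemma zero_module_coord:
  assumes "module A M" "carrier N = {\<zero>\<^bsub>M\<^esub>}" "\<zero>\<^bsub>N\<^esub> = \<zero>\<^bsub>M\<^esub>" "add N = add M" "smult N = smult M"
  shows "coord_module A I \<chi> N {} \<kappa> \<theta>"
proof -
  interpret M: module A M by fact
  show ?thesis by unfold_locales (auto simp: assms)
qed

text \<open>For the zero module the sequence M -> M -> M of identities is short exact, so its class
  equals its own square and is neutral.\<close>

lemma mod_class_zero:
  assumes M: "coord_module A I \<chi> M {} \<kappa> \<theta>"
  shows "mod_class M = \<one>\<^bsub>G0 A\<^esub>"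
proof -
  interpret M: coord_module A I \<chi> M "{}" \<kappa> \<theta> by (rule M)
  have c: "carrier M = {\<zero>\<^bsub>M\<^esub>}" using M.theta_inj M.M_zero_closed by auto
  have id: "id \<in> mod_hom A M M" by (rule mod_homI) auto
  have "short_exact A M M M" unfolding short_exact_def
    using c by (intro bexI[of _ id] id) auto
  then have "mod_class M = mod_class M \<otimes>\<^bsub>G0 A\<^esub> mod_class M" using mod_class_ses coord_fg[OF M] by blast
  then show ?thesis using G0.l_cancel_one'[of "mod_class M" "mod_class M"] mod_class_closed[OF coord_fg[OF M]] by simp
qed

text \<open>An isomorphism is a short exact sequence with zero right end, and that end contributes
  the neutral class.\<close>

lemma mod_class_iso:
  assumes M: "M \<in> fg_modules A" and M': "M' \<in> fg_modules A" and iso: "mod_iso A M M'"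
  shows "mod_class M = mod_class M'"
proof -
  \<comment> \<open>Shrinking the carrier of \<open>M'\<close> keeps its type, so the zero module
    \<open>Z\<close> belongs to \<open>fg_modules\<close>.\<close>
  define Z where "Z = M'\<lparr>carrier := {\<zero>\<^bsub>M'\<^esub>}\<rparr>"
  have mM': "module A M'" and mM: "module A M" using M M' by (auto simp: fg_modules_def)
  interpret M': module A M' by (rule mM')
  have Z: "coord_module A I \<chi> Z {} (\<lambda>_. undefined) (\<lambda>_ _. 0)"
    by (rule zero_module_coord[OF mM']) (auto simp: Z_def)
  obtain h where h: "h \<in> mod_hom A M M'" "bij_betw h (carrier M) (carrier M')"
    using iso unfolding mod_iso_def by blast
  have z: "(\<lambda>_. \<zero>\<^bsub>M'\<^esub>) \<in> mod_hom A M' Z" by (rule mod_homI) (auto simp: Z_def)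
  have "short_exact A M M' Z"
    unfolding short_exact_def
    using h(2) by (intro bexI[OF _ h(1)] bexI[OF _ z]) (auto simp: bij_betw_def Z_def)
  then have "mod_class M' = mod_class M \<otimes>\<^bsub>G0 A\<^esub> mod_class Z" using mod_class_ses M M' coord_fg[OF Z] by blast
  then show ?thesis using mod_class_closed[OF M] by (simp add: mod_class_zero[OF Z])
qed

text \<open>Coordinates move along the isomorphism to the chosen copy with the same \<open>K\<close>
  and \<kappa>, and these determine the class; which copy was chosen does not affect the
  result.\<close>

lemma G0_class_copy:
  assumes "coord_module A I \<chi> M K \<kappa> \<theta>"
  obtains M' \<theta>' where "M' \<in> fg_modules A" "G0_class A M = mod_class M'" "coord_module A I \<chi> M' K \<kappa> \<theta>'"
proof -
  interpret M: coord_module A I \<chi> M K \<kappa> \<theta> by fact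
  define M' where "M' = (SOME M'. M' \<in> fg_modules A \<and> mod_iso A M M')"
  have "\<exists>M'. M' \<in> fg_modules A \<and> mod_iso A M M'" using M.fg_copy by blast
  from someI_ex[OF this, folded M'_def] have M': "M' \<in> fg_modules A" "mod_iso A M M'" by auto
  have mM': "module A M'" using M' by (simp add: fg_modules_def)
  obtain h where "h \<in> mod_hom A M' M" "bij_betw h (carrier M') (carrier M)"
    using mod_iso_sym[OF M.M_module mM' M'(2)] unfolding mod_iso_def by blast
  then have "coord_module A I \<chi> M' K \<kappa> (\<lambda>k x. \<theta> k (h x))" by (rule M.coord_transfer[OF mM'])
  moreover have "G0_class A M = mod_class M'" by (simp add: G0_class_def M'_def mod_class_def G0_kernel_eq)
  ultimately show thesis using that M'(1) by blast
qed

definition simple_class :: "'i \<Rightarrow> 'a G0_elem" where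
  "simple_class i = G0_class A (char_module (\<chi> i))"

lemma simple_class_closed: "i \<in> I \<Longrightarrow> simple_class i \<in> carrier (G0 A)"
  unfolding simple_class_def using G0_class_copy[OF char_module_coord] mod_class_closed by metis

lemma mod_class_one_dim:
  assumes M: "coord_module A I \<chi> M {k} \<kappa> \<theta>"
  shows "mod_class M = simple_class (\<kappa> k)"
proof -
  interpret M: coord_module A I \<chi> M "{k}" \<kappa> \<theta> by (rule M)
  have "\<kappa> k \<in> I" by (simp add: M.kappa)
  from G0_class_copy[OF char_module_coord[OF this]] obtain M' \<theta>'
    where M': "M' \<in> fg_modules A" "simple_class (\<kappa> k) = mod_class M'"
      "coord_module A I \<chi> M' {()} (\<lambda>_. \<kappa> k) \<theta>'"
    unfolding simple_class_def by blast
  have "coord_module A I \<chi> M {()} (\<lambda>_. \<kappa> k) (\<lambda>_. \<theta> k)"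
    by (rule M.coord_reindex) (simp add: bij_betw_def)
  then have "mod_iso A M M'" using M'(3) by (rule coord_module_iso)
  then show ?thesis using mod_class_iso[OF coord_fg[OF M] M'(1)] M'(2) by simp
qed

text \<open>The vectors supported at one index form a one-dimensional submodule; projecting it away
  leaves a module with one index fewer.\<close>

lemma mod_class_coord:
  assumes "coord_module A I \<chi> M K \<kappa> \<theta>"
  shows "mod_class M = (\<Otimes>\<^bsub>G0 A\<^esub>k\<in>K. simple_class (\<kappa> k))"
proof -
  have "finite K" using assms by (rule coord_module.finite_K)
  then show ?thesis using assms
  proof (induction K arbitrary: M rule: finite_induct)
    case empty then show ?case by (simp add: mod_class_zero)
  next
    case (insert k0 K)
    interpret M: coord_module A I \<chi> M "insert k0 K" \<kappa> \<theta> by (rule insert.prems)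
    interpret Mm: module A M by (rule M.M_module)
    define L where "L = M\<lparr>carrier := {x \<in> carrier M. \<forall>k\<in>K. \<theta> k x = 0}\<rparr>"
    \<comment> \<open>A complementary submodule that stands in for the quotient of \<open>M\<close>
      by \<open>L\<close>, so that all three terms keep the type demanded by
      \<open>fg_modules\<close>; \<open>?g\<close> is the projection onto it.\<close>
    define N where "N = M\<lparr>carrier := {x \<in> carrier M. \<theta> k0 x = 0}\<rparr>"
    have cL: "coord_module A I \<chi> L {k0} \<kappa> \<theta>"
    proof
      show "\<exists>x\<in>carrier L. \<forall>k\<in>{k0}. \<theta> k x = v k" for v
        using insert.hyps by (intro bexI[of _ "M.vec (\<lambda>k. if k = k0 then v k0 else 0)"]) (auto simp: L_def)
      show "x = y" if "x \<in> carrier L" "y \<in> carrier L" "\<And>k. k \<in> {k0} \<Longrightarrow> \<theta> k x = \<theta> k y" for x y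
        using that by (intro M.theta_inj) (auto simp: L_def)
    qed (auto simp: L_def M.kappa M.theta_zero M.theta_add M.theta_smult)
    have cN: "coord_module A I \<chi> N K \<kappa> \<theta>"
    proof
      show "\<exists>x\<in>carrier N. \<forall>k\<in>K. \<theta> k x = v k" for v
        using insert.hyps by (intro bexI[of _ "M.vec (\<lambda>k. if k = k0 then 0 else v k)"]) (auto simp: N_def)
      show "x = y" if "x \<in> carrier N" "y \<in> carrier N" "\<And>k. k \<in> K \<Longrightarrow> \<theta> k x = \<theta> k y" for x y
        using that by (intro M.theta_inj) (auto simp: N_def)
    qed (use insert.hyps in \<open>auto simp: N_def M.kappa M.theta_zero M.theta_add M.theta_smult\<close>)
    have f: "id \<in> mod_hom A L M" by (rule mod_homI) (auto simp: L_def)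
    let ?g = "\<lambda>x. M.vec (\<lambda>k. if k = k0 then 0 else \<theta> k x)"
    have g: "?g \<in> mod_hom A M N"
    proof (rule mod_homI)
      fix x y assume "x \<in> carrier M" "y \<in> carrier M"
      then have "?g (x \<oplus>\<^bsub>M\<^esub> y) = ?g x \<oplus>\<^bsub>M\<^esub> ?g y" by (intro M.theta_inj) (auto simp: M.theta_add)
      then show "?g (x \<oplus>\<^bsub>M\<^esub> y) = ?g x \<oplus>\<^bsub>N\<^esub> ?g y" by (simp add: N_def)
    next
      fix a x assume "a \<in> carrier A" "x \<in> carrier M"
      then have "?g (a \<odot>\<^bsub>M\<^esub> x) = a \<odot>\<^bsub>M\<^esub> ?g x" by (intro M.theta_inj) (auto simp: M.theta_smult)
      then show "?g (a \<odot>\<^bsub>M\<^esub> x) = a \<odot>\<^bsub>N\<^esub> ?g x" by (simp add: N_def)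
    qed (simp add: N_def)
    have ker: "id ` carrier L = {x \<in> carrier M. ?g x = \<zero>\<^bsub>N\<^esub>}"
    proof -
      have "(\<forall>k\<in>K. \<theta> k x = 0) \<longleftrightarrow> ?g x = \<zero>\<^bsub>M\<^esub>" if "x \<in> carrier M" for x
      proof
        assume "\<forall>k\<in>K. \<theta> k x = 0"
        then show "?g x = \<zero>\<^bsub>M\<^esub>" by (intro M.theta_inj) (auto simp: M.theta_zero)
      next
        assume eq: "?g x = \<zero>\<^bsub>M\<^esub>"
        show "\<forall>k\<in>K. \<theta> k x = 0"
        proof
          fix k assume k: "k \<in> K"
          have "\<theta> k (?g x) = 0" using eq k by (simp add: M.theta_zero)
          then show "\<theta> k x = 0" using k insert.hyps by (auto split: if_splits)
        qed
      qed
      then show ?thesis by (auto simp: L_def N_def)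
    qed
    have surj: "?g ` carrier M = carrier N"
    proof
      show "?g ` carrier M \<subseteq> carrier N" using mod_hom_closed[OF g] by auto
      show "carrier N \<subseteq> ?g ` carrier M"
      proof
        fix x assume x: "x \<in> carrier N"
        then have "?g x = x" by (intro M.theta_inj) (auto simp: N_def)
        then show "x \<in> ?g ` carrier M" using x by (intro image_eqI[of _ _ x]) (auto simp: N_def)
      qed
    qed
    have "short_exact A L M N" unfolding short_exact_def
      using ker surj by (intro bexI[OF _ f] bexI[OF _ g]) auto
    then have "mod_class M = mod_class L \<otimes>\<^bsub>G0 A\<^esub> mod_class N"
      using mod_class_ses coord_fg[OF cL] coord_fg[OF cN] coord_fg[OF insert.prems] by blast
    also have "\<dots> = simple_class (\<kappa> k0) \<otimes>\<^bsub>G0 A\<^esub> (\<Otimes>\<^bsub>G0 A\<^esub>k\<in>K. simple_class (\<kappa> k))"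
      by (simp add: mod_class_one_dim[OF cL] insert.IH[OF cN])
    also have "\<dots> = (\<Otimes>\<^bsub>G0 A\<^esub>k\<in>insert k0 K. simple_class (\<kappa> k))"
      using insert.hyps M.kappa by (subst G0.finprod_insert) (auto simp: simple_class_closed)
    finally show ?case .
  qed
qed

theorem G0_class_coord:
  assumes "coord_module A I \<chi> M K \<kappa> \<theta>"
  shows "G0_class A M = (\<Otimes>\<^bsub>G0 A\<^esub>k\<in>K. simple_class (\<kappa> k))"
  using G0_class_copy[OF assms] mod_class_coord by metis

text \<open>The classes of modules generate, and each is a product of simple classes by
  \<open>mod_class_coord\<close>.\<close>

theorem G0_induct [consumes 1, case_names simple mult inv one]:
  assumes X: "X \<in> carrier (G0 A)"
    and simple: "\<And>i. i \<in> I \<Longrightarrow> P (simple_class i)"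
    and mult: "\<And>X Y. \<lbrakk>X \<in> carrier (G0 A); Y \<in> carrier (G0 A); P X; P Y\<rbrakk> \<Longrightarrow> P (X \<otimes>\<^bsub>G0 A\<^esub> Y)"
    and inv: "\<And>X. \<lbrakk>X \<in> carrier (G0 A); P X\<rbrakk> \<Longrightarrow> P (inv\<^bsub>G0 A\<^esub> X)"
    and one: "P \<one>\<^bsub>G0 A\<^esub>"
  shows "P X"
  using X unfolding G0_eq
proof (induction X rule: G.quotient_induct)
  case (of M)
  then obtain K \<kappa> \<theta> where c: "coord_module A I \<chi> M (K :: (nat \<Rightarrow> 'a) set set) \<kappa> \<theta>" by (rule fg_coord)
  interpret M: coord_module A I \<chi> M K \<kappa> \<theta> by (rule c)
  have "P (\<Otimes>\<^bsub>G0 A\<^esub>k\<in>J. simple_class (\<kappa> k))" if "J \<subseteq> K" for J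
    using finite_subset[OF that M.finite_K] that
  proof (induction J rule: finite_induct)
    case empty then show ?case by (simp add: one)
  next
    case (insert k J)
    then have "(\<lambda>k. simple_class (\<kappa> k)) \<in> J \<rightarrow> carrier (G0 A)" using M.kappa simple_class_closed by auto
    then show ?case using insert M.kappa
      by (subst G0.finprod_insert) (auto intro!: mult simple G0.finprod_closed simp: simple_class_closed)
  qed
  from this[of K] show ?case using mod_class_coord[OF c] by (simp add: mod_class_def)
qed (use mult inv one in \<open>simp_all add: G0_eq\<close>)

text \<open>The class of \<open>M\<close> is sent to the product of the \<open>v i\<close> raised to
  the multiplicities \<open>mdim M i\<close>; this respects the relations because
  \<open>mdim_ses\<close> makes multiplicities additive. Together with \<open>G0_induct\<close> it
  says that the simple classes are a basis.\<close>

theorem G0_universal: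
  assumes P: "comm_group P" and v: "\<And>i. i \<in> I \<Longrightarrow> v i \<in> carrier P"
  shows "\<exists>h\<in>hom (G0 A) P. \<forall>i\<in>I. h (simple_class i) = v i"
proof -
  interpret P: comm_group P by (rule P)
  define u where "u M = (\<Otimes>\<^bsub>P\<^esub>i\<in>I. v i [^]\<^bsub>P\<^esub> mdim M i)" for M :: "('a, (nat \<Rightarrow> 'a) set) module"
  have u: "u M \<in> carrier P" for M unfolding u_def using v by (intro P.finprod_closed) auto
  obtain h where h: "h \<in> hom (G.F Mod G.K) P" "\<And>M. M \<in> fg_modules A \<Longrightarrow> h (G.cls (frag_of M)) = u M"
  proof (rule G.quotient_universal[OF P, of u])
    fix h r
    assume diff: "\<And>p q. \<lbrakk>Poly_Mapping.keys p \<subseteq> fg_modules A; Poly_Mapping.keys q \<subseteq> fg_modules A\<rbrakk>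
          \<Longrightarrow> h (p - q) = h p \<otimes>\<^bsub>P\<^esub> inv\<^bsub>P\<^esub> h q"
      and of: "\<And>M. M \<in> fg_modules A \<Longrightarrow> h (frag_of M) = u M"
      and "r \<in> {frag_of M - frag_of L - frag_of N |L M N.
     L \<in> fg_modules A \<and> M \<in> fg_modules A \<and> N \<in> fg_modules A \<and> short_exact A L M N}"
    then obtain L M N where LMN: "L \<in> fg_modules A" "M \<in> fg_modules A" "N \<in> fg_modules A"
      "short_exact A L M N" "r = frag_of M - frag_of L - frag_of N" by blast
    have "mdim M i = mdim L i + mdim N i" for i
      using LMN by (intro mdim_ses) (auto simp: fg_modules_def)
    then have "u M = (\<Otimes>\<^bsub>P\<^esub>i\<in>I. v i [^]\<^bsub>P\<^esub> mdim L i \<otimes>\<^bsub>P\<^esub> v i [^]\<^bsub>P\<^esub> mdim N i)"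
      unfolding u_def using v by (intro P.finprod_cong') (auto simp: P.nat_pow_mult)
    also have "\<dots> = u L \<otimes>\<^bsub>P\<^esub> u N" unfolding u_def using v by (intro P.finprod_multf) auto
    finally have "u M = u L \<otimes>\<^bsub>P\<^esub> u N" .
    moreover have "Poly_Mapping.keys (frag_of M - frag_of L) \<subseteq> fg_modules A"
      using LMN by (intro order.trans[OF keys_diff]) auto
    ultimately have "h r = (u L \<otimes>\<^bsub>P\<^esub> u N) \<otimes>\<^bsub>P\<^esub> inv\<^bsub>P\<^esub> u L \<otimes>\<^bsub>P\<^esub> inv\<^bsub>P\<^esub> u N"
      using LMN by (simp add: diff of)
    also have "\<dots> = (u L \<otimes>\<^bsub>P\<^esub> u N) \<otimes>\<^bsub>P\<^esub> inv\<^bsub>P\<^esub> (u L \<otimes>\<^bsub>P\<^esub> u N)"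
      using u by (simp add: P.m_assoc P.inv_mult)
    also have "\<dots> = \<one>\<^bsub>P\<^esub>" using u[of L] u[of N] by (simp del: P.inv_mult_group)
    finally show "h r = \<one>\<^bsub>P\<^esub>" .
  qed (use u in auto)
  have "h (simple_class i) = v i" if i: "i \<in> I" for i
  proof -
    obtain M \<theta> where M: "M \<in> fg_modules A" "simple_class i = mod_class M"
      "coord_module A I \<chi> M {()} (\<lambda>_. i) \<theta>"
      using G0_class_copy[OF char_module_coord[OF i]] unfolding simple_class_def by blast
    have "mdim M j = (if j = i then 1 else 0)" for j
      unfolding mdim_eq[OF M(3)] by (auto simp: card_eq_0_iff)
    then have "u M = (\<Otimes>\<^bsub>P\<^esub>j\<in>I. if j = i then v j else \<one>\<^bsub>P\<^esub>)"
      unfolding u_def using v by (intro P.finprod_cong') auto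
    also have "\<dots> = v i" using P.finprod_singleton[OF i finite_I, of v] v by (simp add: eq_commute[of i] cong: if_cong)
    finally show ?thesis using h(2)[OF M(1)] M(2) by (simp add: mod_class_def)
  qed
  then show ?thesis using h(1) unfolding G0_eq by blast
qed

end

section \<open>Compositions and their descent sets\<close>

lemma composition_Nil [simp]: "composition n [] \<longleftrightarrow> n = 0"
  by (auto simp: composition_def)

lemma composition_Cons: "composition n (a # \<alpha>) \<longleftrightarrow> 0 < a \<and> a \<le> n \<and> composition (n - a) \<alpha>"
  by (auto simp: composition_def)

lemma composition_append:
  "composition m \<alpha> \<Longrightarrow> composition n \<beta> \<Longrightarrow> composition (m + n) (\<alpha> @ \<beta>)"
  by (auto simp: composition_def)

lemma composition_eq_Nil_iff: "composition n \<alpha> \<Longrightarrow> \<alpha> = [] \<longleftrightarrow> n = 0"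
  by (cases \<alpha>) (auto simp: composition_def)

lemma composition_sum_list: "composition n \<alpha> \<Longrightarrow> sum_list \<alpha> = n"
  by (simp add: composition_def)

lemma descents_Nil [simp]: "descents [] = {}" and descents_single [simp]: "descents [a] = {}"
  by (auto simp: descents_def)

lemma descents_Cons:
  assumes "\<alpha> \<noteq> []"
  shows "descents (a # \<alpha>) = insert a ((+) a ` descents \<alpha>)"
proof -
  have "{1..<length (a # \<alpha>)} = insert 1 (Suc ` {1..<length \<alpha>})"
    using assms by (cases \<alpha>) (auto simp: image_Suc_atLeastLessThan)
  then have "descents (a # \<alpha>) = insert (partial_sum (a # \<alpha>) 1) ((\<lambda>i. partial_sum (a # \<alpha>) (Suc i)) ` {1..<length \<alpha>})"
    unfolding descents_def by (simp only: image_insert image_image)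
  then show ?thesis by (simp add: descents_def image_image partial_sum_def)
qed

lemma descents_bounds: "composition n \<alpha> \<Longrightarrow> descents \<alpha> \<subseteq> {1..<n}"
proof (induction \<alpha> arbitrary: n)
  case (Cons a \<alpha>)
  show ?case
  proof (cases "\<alpha> = []")
    case False
    have "descents \<alpha> \<subseteq> {1..<n - a}" using Cons by (simp add: composition_Cons)
    moreover have "a < n" using Cons.prems False by (cases \<alpha>) (auto simp: composition_def)
    ultimately show ?thesis using Cons.prems False by (fastforce simp: descents_Cons composition_Cons)
  qed simp
qed simp

lemma descents_Cons_iff:
  assumes "composition n \<alpha>" "\<alpha> \<noteq> []"
  shows "d \<in> descents (a # \<alpha>) \<longleftrightarrow> d = a \<or> a < d \<and> d - a \<in> descents \<alpha>"
proof -
  have "d \<in> (+) a ` descents \<alpha> \<longleftrightarrow> a < d \<and> d - a \<in> descents \<alpha>"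
  proof
    assume "a < d \<and> d - a \<in> descents \<alpha>"
    then show "d \<in> (+) a ` descents \<alpha>" by (intro image_eqI[of _ _ "d - a"]) auto
  qed (use descents_bounds[OF assms(1)] in auto)
  then show ?thesis using assms(2) by (simp add: descents_Cons)
qed

lemma descents_append:
  assumes "\<alpha> \<noteq> []" "\<beta> \<noteq> []"
  shows "descents (\<alpha> @ \<beta>) = descents \<alpha> \<union> {sum_list \<alpha>} \<union> (+) (sum_list \<alpha>) ` descents \<beta>"
  using assms(1)
proof (induction \<alpha>)
  case (Cons a \<alpha>)
  show ?case
  proof (cases "\<alpha> = []")
    case True then show ?thesis using assms by (simp add: descents_Cons)
  next
    case False
    then show ?thesis using Cons assms by (simp add: descents_Cons image_Un image_image add.assoc insert_commute)
  qed
qed simp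

lemma near_concat_Cons: "\<alpha> \<noteq> [] \<Longrightarrow> near_concat (a # \<alpha>) \<beta> = a # near_concat \<alpha> \<beta>"
  and near_concat_single: "near_concat [a] (b # \<beta>) = (a + b) # \<beta>"
  and near_concat_not_Nil [simp]: "near_concat \<alpha> \<beta> \<noteq> []"
  by (simp_all add: near_concat_def)

lemma descents_near_concat:
  assumes "\<alpha> \<noteq> []" "\<beta> \<noteq> []"
  shows "descents (near_concat \<alpha> \<beta>) = descents \<alpha> \<union> (+) (sum_list \<alpha>) ` descents \<beta>"
  using assms(1)
proof (induction \<alpha>)
  case (Cons a \<alpha>)
  show ?case
  proof (cases "\<alpha> = []")
    case True
    obtain b \<beta>' where \<beta>: "\<beta> = b # \<beta>'" using assms by (cases \<beta>) auto
    show ?thesis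
      by (cases "\<beta>' = []") (simp_all add: True \<beta> near_concat_single descents_Cons image_image add.assoc)
  next
    case False
    then show ?thesis using Cons assms by (simp add: near_concat_Cons descents_Cons image_Un image_image add.assoc)
  qed
qed simp

lemma composition_near_concat:
  assumes "\<alpha> \<noteq> []" "\<beta> \<noteq> []" "composition m \<alpha>" "composition n \<beta>"
  shows "composition (m + n) (near_concat \<alpha> \<beta>)"
  using assms(1,3)
proof (induction \<alpha> arbitrary: m)
  case (Cons a \<alpha>)
  show ?case
  proof (cases "\<alpha> = []")
    case True
    obtain b \<beta>' where \<beta>: "\<beta> = b # \<beta>'" using assms by (cases \<beta>) auto
    show ?thesis using Cons.prems assms by (auto simp: True \<beta> near_concat_single composition_def)
  next
    case False
    have a: "0 < a" "a \<le> m" "composition (m - a) \<alpha>" using Cons.prems by (auto simp: composition_Cons)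
    have "m + n - a = m - a + n" using a by simp
    then have "composition (m + n - a) (near_concat \<alpha> \<beta>)" using Cons.IH[OF False a(3)] by metis
    then show ?thesis using a False by (simp add: near_concat_Cons composition_Cons)
  qed
qed simp

text \<open>The least descent is the first part. It can therefore be read off, and removing it
  shifts the remaining descents to those of the tail.\<close>

lemma descents_inj:
  assumes "composition n \<alpha>" "composition n \<beta>" "descents \<alpha> = descents \<beta>"
  shows "\<alpha> = \<beta>"
  using assms
proof (induction \<alpha> arbitrary: n \<beta>)
  case Nil then show ?case using composition_eq_Nil_iff[of n \<beta>] by simp
next
  case (Cons a \<alpha>)
  then have "n \<noteq> 0" by (auto simp: composition_Cons)
  then obtain b \<beta>' where \<beta>: "\<beta> = b # \<beta>'" using Cons.prems by (cases \<beta>) auto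
  show ?case
  proof (cases "\<alpha> = [] \<or> \<beta>' = []")
    case True
    then have "\<alpha> = [] \<and> \<beta>' = []"
      using Cons.prems(3) unfolding \<beta> by (metis descents_Cons descents_single insert_not_empty)
    then show ?thesis using Cons.prems \<beta> by (auto simp: composition_def)
  next
    case False
    have ca: "composition (n - a) \<alpha>" and cb: "composition (n - b) \<beta>'" and pos: "0 < a" "0 < b"
      using Cons.prems \<beta> by (auto simp: composition_Cons)
    note da = descents_bounds[OF ca] and db = descents_bounds[OF cb]
    have eq: "insert a ((+) a ` descents \<alpha>) = insert b ((+) b ` descents \<beta>')"
      using Cons.prems(3) False unfolding \<beta> by (simp add: descents_Cons)
    \<comment> \<open>All other elements are at least as large as the first part, so the two
      memberships give both inequalities between \<open>a\<close> and \<open>b\<close>.\<close>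
    have "b \<in> insert a ((+) a ` descents \<alpha>)" "a \<in> insert b ((+) b ` descents \<beta>')" using eq by auto
    then have ab: "a = b" by auto
    have na: "a \<notin> (+) a ` descents \<alpha>" "b \<notin> (+) b ` descents \<beta>'" using da db by auto
    have "(+) a ` descents \<alpha> = (+) a ` descents \<beta>'" using eq na unfolding ab by (metis insert_ident)
    then have "descents \<alpha> = descents \<beta>'" by (simp add: inj_image_eq_iff)
    then show ?thesis using Cons.IH[OF ca] cb ab \<beta> by simp
  qed
qed

text \<open>The first part is the minimum of \<open>S\<close>; the tail comes from the other
  elements shifted down by it, as a composition of a smaller number.\<close>

lemma descents_surj:
  assumes "S \<subseteq> {1..<n}"
  shows "\<exists>\<alpha>. composition n \<alpha> \<and> descents \<alpha> = S"
  using assms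
proof (induction n arbitrary: S rule: less_induct)
  case (less n)
  show ?case
  proof (cases "S = {}")
    case True
    then show ?thesis
      by (cases "n = 0") (auto intro: exI[of _ "[]"] exI[of _ "[n]"] simp: composition_def)
  next
    case False
    have finS: "finite S" using less.prems finite_subset by blast
    define a where "a = Min S"
    have a: "a \<in> S" "\<And>s. s \<in> S \<Longrightarrow> a \<le> s" using finS False by (auto simp: a_def)
    then have an: "0 < a" "a < n" using less.prems by auto
    define S' where "S' = (\<lambda>s. s - a) ` (S - {a})"
    have "S' \<subseteq> {1..<n - a}" using a less.prems by (fastforce simp: S'_def)
    then obtain \<alpha> where \<alpha>: "composition (n - a) \<alpha>" "descents \<alpha> = S'" using less.IH[of "n - a"] an by auto
    have "\<alpha> \<noteq> []" using \<alpha>(1) an by auto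
    moreover have "(+) a ` S' = S - {a}"
    proof -
      have "a + (s - a) = s" if "s \<in> S" for s using a(2)[OF that] by simp
      then have "(\<lambda>s. a + (s - a)) ` (S - {a}) = (\<lambda>s. s) ` (S - {a})" by (intro image_cong) auto
      then show ?thesis by (simp add: S'_def image_image)
    qed
    ultimately have "descents (a # \<alpha>) = S" using a \<alpha> by (auto simp: descents_Cons)
    then show ?thesis using \<alpha> an by (intro exI[of _ "a # \<alpha>"]) (simp add: composition_Cons)
  qed
qed

text \<open>The inverse of \<alpha> -> D(\<alpha>) on subsets of [n-1]. It turns complements, cuts
  and products into operations on sets, in which the cancellation becomes visible.\<close>

definition comp_of :: "nat \<Rightarrow> nat set \<Rightarrow> nat list" where
  "comp_of n S = (THE \<alpha>. composition n \<alpha> \<and> descents \<alpha> = S)"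

lemma comp_of_eqI: "\<lbrakk>composition n \<alpha>; descents \<alpha> = S\<rbrakk> \<Longrightarrow> comp_of n S = \<alpha>"
  unfolding comp_of_def using descents_inj by (intro the_equality) auto

lemma comp_of:
  assumes "S \<subseteq> {1..<n}"
  shows "composition n (comp_of n S)" "descents (comp_of n S) = S"
  using descents_surj[OF assms] comp_of_eqI by auto

lemma comp_compl_eq: "composition n \<alpha> \<Longrightarrow> comp_compl \<alpha> = comp_of n ({1..<n} - descents \<alpha>)"
  by (simp add: comp_compl_def comp_of_def composition_sum_list)

lemma comp_compl:
  assumes "composition n \<alpha>"
  shows "composition n (comp_compl \<alpha>)" "descents (comp_compl \<alpha>) = {1..<n} - descents \<alpha>"
  unfolding comp_compl_eq[OF assms] by (rule comp_of; blast)+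

subsection \<open>Cutting a composition\<close>

lemma cut_index_eqI:
  assumes "r \<le> length \<alpha>" "partial_sum \<alpha> r \<le> i"
    and "\<And>s. \<lbrakk>s \<le> length \<alpha>; partial_sum \<alpha> s \<le> i\<rbrakk> \<Longrightarrow> s \<le> r"
  shows "cut_index \<alpha> i = r"
  unfolding cut_index_def using assms by (intro Greatest_equality) auto

lemma cut_index:
  fixes i :: nat
  shows "cut_index \<alpha> i \<le> length \<alpha>" "partial_sum \<alpha> (cut_index \<alpha> i) \<le> i"
    "\<lbrakk>s \<le> length \<alpha>; partial_sum \<alpha> s \<le> i\<rbrakk> \<Longrightarrow> s \<le> cut_index \<alpha> i"
proof -
  let ?P = "\<lambda>r. r \<le> length \<alpha> \<and> partial_sum \<alpha> r \<le> i"
  have "?P 0" by (simp add: partial_sum_def)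
  then have "?P (Greatest ?P)" by (rule GreatestI_nat) auto
  then show "cut_index \<alpha> i \<le> length \<alpha>" "partial_sum \<alpha> (cut_index \<alpha> i) \<le> i" by (auto simp: cut_index_def)
  show "s \<le> length \<alpha> \<Longrightarrow> partial_sum \<alpha> s \<le> i \<Longrightarrow> s \<le> cut_index \<alpha> i"
    unfolding cut_index_def using Greatest_le_nat[of ?P s "length \<alpha>"] by auto
qed

lemma cut_index_Cons_less:
  assumes "i < a"
  shows "cut_index (a # \<alpha>) i = 0"
proof (rule cut_index_eqI)
  fix s assume "s \<le> length (a # \<alpha>)" "partial_sum (a # \<alpha>) s \<le> i"
  then show "s \<le> 0" using assms by (cases s) (auto simp: partial_sum_def)
qed (auto simp: partial_sum_def)

lemma cut_index_Cons_ge: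
  assumes "a \<le> i"
  shows "cut_index (a # \<alpha>) i = Suc (cut_index \<alpha> (i - a))"
proof (rule cut_index_eqI)
  fix s assume s: "s \<le> length (a # \<alpha>)" "partial_sum (a # \<alpha>) s \<le> i"
  show "s \<le> Suc (cut_index \<alpha> (i - a))"
  proof (cases s)
    case (Suc t)
    then show ?thesis using s cut_index(3)[of t \<alpha> "i - a"] by (simp add: partial_sum_def)
  qed simp
qed (use cut_index(1,2)[of \<alpha> "i - a"] assms in \<open>auto simp: partial_sum_def\<close>)

text \<open>This recursion and the next remove \<open>GREATEST\<close> and open the cuts to list
  induction. A cut exactly at \<open>a\<close> falls into the second branch, as a cut of the tail at
  0.\<close>

lemma comp_upto_Cons:
  "comp_upto (a # \<alpha>) i = (if i < a then (if i = 0 then [] else [i]) else a # comp_upto \<alpha> (i - a))"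
  by (auto simp: comp_upto_def Let_def cut_index_Cons_less cut_index_Cons_ge partial_sum_def)

lemma comp_after_Cons:
  "comp_after (a # \<alpha>) i = (if i < a then (a - i) # \<alpha> else comp_after \<alpha> (i - a))"
  by (auto simp: comp_after_def Let_def cut_index_Cons_less cut_index_Cons_ge partial_sum_def)

lemma comp_upto_Nil [simp]: "comp_upto [] 0 = []" and comp_after_Nil [simp]: "comp_after [] 0 = []"
  by (simp_all add: comp_upto_def comp_after_def partial_sum_def)

text \<open>A descent at the cut \<open>i\<close> itself is lost on both sides: it is the end of one
  piece and the origin of the other. Hence the strict inequalities here and in
  \<open>comp_after\<close>.\<close>

lemma comp_upto:
  assumes "composition n \<alpha>" "i \<le> n"
  shows "composition i (comp_upto \<alpha> i) \<and> descents (comp_upto \<alpha> i) = {d \<in> descents \<alpha>. d < i}"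
  using assms
proof (induction \<alpha> arbitrary: n i)
  case (Cons a \<alpha>)
  have c: "composition (n - a) \<alpha>" "0 < a" "a \<le> n" using Cons.prems by (auto simp: composition_Cons)
  show ?case
  proof (cases "i < a")
    case True
    then show ?thesis
      by (cases "\<alpha> = []") (auto simp: comp_upto_Cons composition_def descents_Cons)
  next
    case False
    have IH: "composition (i - a) (comp_upto \<alpha> (i - a))"
      "descents (comp_upto \<alpha> (i - a)) = {d \<in> descents \<alpha>. d < i - a}"
      using Cons.IH[OF c(1), of "i - a"] Cons.prems False by auto
    have comp: "composition i (comp_upto (a # \<alpha>) i)"
      using IH(1) False c(2) by (simp add: comp_upto_Cons composition_Cons)
    moreover have "descents (comp_upto (a # \<alpha>) i) = {d \<in> descents (a # \<alpha>). d < i}"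
    proof (cases "i = a")
      \<comment> \<open>The prefix is the single part \<open>a\<close>, which is its total and
        therefore no descent, although it may be one of the whole composition.\<close>
      case True
      then have "comp_upto \<alpha> (i - a) = []" using composition_eq_Nil_iff[OF IH(1)] by simp
      then show ?thesis using True by (cases "\<alpha> = []") (auto simp: comp_upto_Cons descents_Cons)
    next
      case ia: False
      then have ne: "comp_upto \<alpha> (i - a) \<noteq> []" using False composition_eq_Nil_iff[OF IH(1)] by simp
      have ne': "\<alpha> \<noteq> []" using ia False Cons.prems(2) composition_eq_Nil_iff[OF c(1)] by auto
      have "descents (comp_upto (a # \<alpha>) i) = descents (a # comp_upto \<alpha> (i - a))"
        using False by (simp add: comp_upto_Cons)
      also have "\<dots> = {d \<in> descents (a # \<alpha>). d < i}"
      proof (rule Set.set_eqI)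
        fix d
        have "a < d \<Longrightarrow> d - a < i - a \<longleftrightarrow> d < i" using False by auto
        then show "d \<in> descents (a # comp_upto \<alpha> (i - a)) \<longleftrightarrow> d \<in> {d \<in> descents (a # \<alpha>). d < i}"
          unfolding descents_Cons_iff[OF IH(1) ne] mem_Collect_eq descents_Cons_iff[OF c(1) ne'] IH(2)
          using False ia by auto
      qed
      finally show ?thesis .
    qed
    ultimately show ?thesis by simp
  qed
qed simp

lemma comp_after:
  assumes "composition n \<alpha>" "i \<le> n"
  shows "composition (n - i) (comp_after \<alpha> i) \<and> descents (comp_after \<alpha> i) = {d. d > 0 \<and> d + i \<in> descents \<alpha>}"
  using assms
proof (induction \<alpha> arbitrary: n i)
  case (Cons a \<alpha>)
  have c: "composition (n - a) \<alpha>" "0 < a" "a \<le> n" using Cons.prems by (auto simp: composition_Cons)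
  note b = descents_bounds[OF c(1)]
  show ?case
  proof (cases "i < a")
    case True
    have "descents ((a - i) # \<alpha>) = {d. d > 0 \<and> d + i \<in> descents (a # \<alpha>)}"
    proof (cases "\<alpha> = []")
      case False
      have "d - (a - i) = d + i - a" for d using True by simp
      then show ?thesis using False True by (auto simp: descents_Cons_iff[OF c(1)] less_diff_conv2)
    qed auto
    then show ?thesis using True c by (auto simp: comp_after_Cons composition_Cons)
  next
    case False
    have IH: "composition (n - a - (i - a)) (comp_after \<alpha> (i - a))"
      "descents (comp_after \<alpha> (i - a)) = {d. d > 0 \<and> d + (i - a) \<in> descents \<alpha>}"
      using Cons.IH[OF c(1), of "i - a"] Cons.prems False by auto
    have "d + (i - a) \<in> descents \<alpha> \<longleftrightarrow> d + i \<in> descents (a # \<alpha>)" if "d > 0" for d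
    proof (cases "\<alpha> = []")
      case ne: False
      have "d + i - a = d + (i - a)" using False by simp
      then show ?thesis using that False by (auto simp: descents_Cons_iff[OF c(1) ne])
    qed auto
    then show ?thesis using IH False by (auto simp: comp_after_Cons)
  qed
qed simp

subsection \<open>Compositions with inner parts greater than one\<close>

text \<open>A part is the difference of two adjacent partial sums, so an inner part 1 is a pair of
  consecutive descents. With list positions counted from 0, \<open>\<alpha> ! i\<close> lies between
  the partial sums at \<open>i\<close> and \<open>i + 1\<close>, and the two bounds on
  \<open>i\<close> say that both are descents.\<close>

lemma inner_gt1_iff:
  "inner_gt1 n \<alpha> \<longleftrightarrow> composition n \<alpha> \<and> (\<forall>d\<in>descents \<alpha>. Suc d \<notin> descents \<alpha>)"
proof -
  have step: "partial_sum \<alpha> (Suc i) = partial_sum \<alpha> i + \<alpha> ! i" if "i < length \<alpha>" for i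
    using that by (simp add: partial_sum_def take_Suc_conv_app_nth)
  have mono: "partial_sum \<alpha> i \<le> partial_sum \<alpha> j" if "i \<le> j" for i j
    using that unfolding partial_sum_def by (metis le_add1 sum_list_append take_add le_add_diff_inverse)
  show ?thesis
  proof (cases "composition n \<alpha>")
    case True
    then have pos: "0 < \<alpha> ! i" if "i < length \<alpha>" for i using that by (auto simp: composition_def)
    have "(\<forall>i. 0 < i \<and> i + 1 < length \<alpha> \<longrightarrow> 1 < \<alpha> ! i) \<longleftrightarrow> (\<forall>d\<in>descents \<alpha>. Suc d \<notin> descents \<alpha>)"
    proof (intro iffI ballI allI impI notI)
      fix d assume gt: "\<forall>i. 0 < i \<and> i + 1 < length \<alpha> \<longrightarrow> 1 < \<alpha> ! i"
        and d: "d \<in> descents \<alpha>" "Suc d \<in> descents \<alpha>"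
      obtain i j where ij: "1 \<le> i" "i < length \<alpha>" "d = partial_sum \<alpha> i"
        "1 \<le> j" "j < length \<alpha>" "Suc d = partial_sum \<alpha> j"
        using d by (auto simp: descents_def)
      have "i < j" using ij mono[of j i] by (cases "i < j") auto
      then have "partial_sum \<alpha> (Suc i) \<le> partial_sum \<alpha> j" by (intro mono) simp
      moreover have "1 < \<alpha> ! i" using gt ij \<open>i < j\<close> by auto
      ultimately show False using step[of i] ij by simp
    next
      fix i assume nd: "\<forall>d\<in>descents \<alpha>. Suc d \<notin> descents \<alpha>" and i: "0 < i \<and> i + 1 < length \<alpha>"
      have "partial_sum \<alpha> i \<in> descents \<alpha>" "partial_sum \<alpha> (Suc i) \<in> descents \<alpha>"
        using i unfolding descents_def by (auto intro!: imageI)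
      then have "\<alpha> ! i \<noteq> 1" using nd step[of i] i by auto
      then show "1 < \<alpha> ! i" using pos[of i] i by linarith
    qed
    then show ?thesis using True by (simp add: inner_gt1_def)
  qed (simp add: inner_gt1_def)
qed

lemma inner_gt1_composition: "inner_gt1 n \<alpha> \<Longrightarrow> composition n \<alpha>"
  by (simp add: inner_gt1_def)

lemma inner_gt1_sum_list: "inner_gt1 n \<alpha> \<Longrightarrow> sum_list \<alpha> = n"
  by (simp add: inner_gt1_def composition_def)

lemma simple_index_iff: "\<alpha> \<in> simple_index \<longleftrightarrow> inner_gt1 (sum_list \<alpha>) \<alpha>"
  by (simp add: simple_index_def)

lemma inner_gt1_simple_index: "inner_gt1 n \<alpha> \<longleftrightarrow> \<alpha> \<in> simple_index \<and> sum_list \<alpha> = n"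
  by (auto simp: simple_index_def inner_gt1_sum_list)

lemma simple_index_compositions: "\<alpha> \<in> simple_index \<Longrightarrow> \<alpha> \<in> compositions"
  by (simp add: simple_index_iff compositions_def inner_gt1_composition)

lemma finite_compositions: "finite {\<alpha>. composition n \<alpha>}"
proof (rule inj_on_finite)
  show "inj_on descents {\<alpha>. composition n \<alpha>}" by (auto intro!: inj_onI descents_inj)
  show "descents ` {\<alpha>. composition n \<alpha>} \<subseteq> Pow {1..<n}" using descents_bounds by blast
qed simp

lemma finite_inner_gt1: "finite {\<alpha>. inner_gt1 n \<alpha>}"
  by (rule finite_subset[OF _ finite_compositions[of n]]) (auto simp: inner_gt1_def)

lemma inner_gt1_upto:
  assumes "inner_gt1 n \<alpha>" "i \<le> n"
  shows "inner_gt1 i (comp_upto \<alpha> i)" "inner_gt1 (n - i) (comp_after \<alpha> i)"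
  using comp_upto[OF inner_gt1_composition[OF assms(1)] assms(2)]
    comp_after[OF inner_gt1_composition[OF assms(1)] assms(2)] assms
  by (auto simp: inner_gt1_iff)

text \<open>A part \<open>a\<close> produces a run of \<open>a - 1\<close> consecutive non-descents.
  The left side, which forbids consecutive elements in the complement of the descent set, limits
  every run to length 1.\<close>

lemma compl_no_gap_iff:
  assumes "composition n \<alpha>"
  shows "(\<forall>j. 0 < j \<and> Suc j < n \<longrightarrow> j \<in> descents \<alpha> \<or> Suc j \<in> descents \<alpha>) \<longleftrightarrow> (\<forall>a\<in>set \<alpha>. a \<le> 2)"
  using assms
proof (induction \<alpha> arbitrary: n)
  case (Cons a \<alpha>)
  have c: "composition (n - a) \<alpha>" "0 < a" "a \<le> n" using Cons.prems by (auto simp: composition_Cons)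
  note IH = Cons.IH[OF c(1)]
  show ?case
  proof (cases "\<alpha> = []")
    case True
    then have "a = n" using Cons.prems by (simp add: composition_def)
    have "n \<le> 2" if "\<forall>j. j = 0 \<or> \<not> Suc j < n"
      using that[rule_format, of 1] by simp
    then show ?thesis using True \<open>a = n\<close> by auto
  next
    case False
    note D = descents_Cons_iff[OF c(1) False]
    have "a < n" using c False by (auto simp: composition_eq_Nil_iff)
    show ?thesis
    proof (intro iffI allI impI)
      assume H: "\<forall>j. 0 < j \<and> Suc j < n \<longrightarrow> j \<in> descents (a # \<alpha>) \<or> Suc j \<in> descents (a # \<alpha>)"
      \<comment> \<open>For \<open>a > 2\<close> both 1 and 2 would lie before the first
        descent.\<close>
      have "a \<le> 2" using H[rule_format, of 1] \<open>a < n\<close> unfolding D by (cases "a \<le> 2") auto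
      moreover have "\<forall>j. 0 < j \<and> Suc j < n - a \<longrightarrow> j \<in> descents \<alpha> \<or> Suc j \<in> descents \<alpha>"
      proof (intro allI impI)
        fix j assume "0 < j \<and> Suc j < n - a"
        then show "j \<in> descents \<alpha> \<or> Suc j \<in> descents \<alpha>" using H[rule_format, of "a + j"] unfolding D by auto
      qed
      ultimately show "\<forall>x\<in>set (a # \<alpha>). x \<le> 2" using IH by simp
    next
      fix j assume H: "\<forall>x\<in>set (a # \<alpha>). x \<le> 2" and j: "0 < j \<and> Suc j < n"
      have IH': "\<And>j. 0 < j \<and> Suc j < n - a \<Longrightarrow> j \<in> descents \<alpha> \<or> Suc j \<in> descents \<alpha>" using H IH by simp
      show "j \<in> descents (a # \<alpha>) \<or> Suc j \<in> descents (a # \<alpha>)"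
      proof (cases "j \<le> a")
        \<comment> \<open>For a part of size 1 or 2 and a positive \<open>j\<close> up to
          \<open>a\<close>, either \<open>j\<close> or \<open>Suc j\<close> equals
          \<open>a\<close>.\<close>
        case True then show ?thesis using H j unfolding D by (cases "j = a") auto
      next
        case False
        then show ?thesis using IH'[of "j - a"] j unfolding D by (auto simp: Suc_diff_le)
      qed
    qed
  qed
qed simp

lemma inner_gt1_compl_iff:
  assumes "inner_gt1 n \<alpha>"
  shows "inner_gt1 n (comp_compl \<alpha>) \<longleftrightarrow> (\<forall>a\<in>set \<alpha>. a \<le> 2)"
proof -
  have c: "composition n \<alpha>" using assms by (rule inner_gt1_composition)
  have "inner_gt1 n (comp_compl \<alpha>) \<longleftrightarrow> (\<forall>j. 0 < j \<and> Suc j < n \<longrightarrow> j \<in> descents \<alpha> \<or> Suc j \<in> descents \<alpha>)"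
    unfolding inner_gt1_iff comp_compl(2)[OF c] using comp_compl(1)[OF c] descents_bounds[OF c]
    by (auto simp: Suc_le_eq)
  then show ?thesis using compl_no_gap_iff[OF c] by simp
qed

text \<open>Parts of size at most 2 with inner parts above 1 leave 2 for the inner parts and 1 or 2
  for the ends. Fewer than two parts are treated apart, since the ends are then missing or
  coincide.\<close>

theorem inner_gt1_compl_classification:
  assumes "inner_gt1 n \<alpha>"
  shows "inner_gt1 n (comp_compl \<alpha>) \<longleftrightarrow>
    (\<exists>k. \<alpha> \<in> {replicate k 2, 1 # replicate k 2, replicate k 2 @ [1], 1 # replicate k 2 @ [1]})"
proof
  assume "inner_gt1 n (comp_compl \<alpha>)"
  then have le2: "\<forall>a\<in>set \<alpha>. a \<le> 2" using inner_gt1_compl_iff[OF assms] by simp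
  have pos: "\<forall>a\<in>set \<alpha>. 0 < a" using assms by (auto simp: inner_gt1_def composition_def)
  have part: "a = 1 \<or> a = 2" if "a \<in> set \<alpha>" for a using le2 pos that by force
  have inner: "\<alpha> ! i = 2" if "0 < i" "i + 1 < length \<alpha>" for i
  proof -
    have "1 < \<alpha> ! i" using assms that by (auto simp: inner_gt1_def)
    moreover have "\<alpha> ! i \<in> set \<alpha>" using that by simp
    ultimately show ?thesis using part by force
  qed
  consider "\<alpha> = []" | a where "\<alpha> = [a]" | a \<beta> b where "\<alpha> = a # \<beta> @ [b]"
    by (metis append_butlast_last_id list.exhaust)
  then show "\<exists>k. \<alpha> \<in> {replicate k 2, 1 # replicate k 2, replicate k 2 @ [1], 1 # replicate k 2 @ [1]}"
  proof cases
    case 1 then show ?thesis by (intro exI[of _ 0]) simp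
  next
    case 2
    show ?thesis
    proof (cases "a = 1")
      case True then show ?thesis using 2 by (intro exI[of _ 0]) simp
    next
      case False then show ?thesis using 2 part[of a] by (intro exI[of _ 1]) simp
    qed
  next
    case 3
    have "x = 2" if x: "x \<in> set \<beta>" for x
    proof -
      obtain j where "j < length \<beta>" "\<beta> ! j = x" using x by (auto simp: in_set_conv_nth)
      then show ?thesis using inner[of "Suc j"] 3 by (simp add: nth_append)
    qed
    then have "\<beta> = replicate (length \<beta>) 2" by (intro replicate_eqI) auto
    then obtain l where \<beta>: "\<beta> = replicate l 2" by blast
    have "a = 1 \<or> a = 2" "b = 1 \<or> b = 2" using part 3 by auto
    \<comment> \<open>An end equal to 2 is absorbed into the block of 2s; this accounts for the
      witnesses \<open>l\<close>, \<open>Suc l\<close> and \<open>Suc (Suc l)\<close>.\<close>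
    then consider "a = 1" "b = 1" | "a = 1" "b = 2" | "a = 2" "b = 1" | "a = 2" "b = 2" by blast
    then show ?thesis
    proof cases
      case 1 then show ?thesis using 3 \<beta> by (intro exI[of _ l]) simp
    next
      case 2 then show ?thesis using 3 \<beta> by (intro exI[of _ "Suc l"]) (simp add: replicate_append_same)
    next
      case A: 3 then show ?thesis using 3 \<beta> by (intro exI[of _ "Suc l"]) simp
    next
      case 4 then show ?thesis using 3 \<beta> by (intro exI[of _ "Suc (Suc l)"]) (simp add: replicate_append_same)
    qed
  qed
next
  assume "\<exists>k. \<alpha> \<in> {replicate k 2, 1 # replicate k 2, replicate k 2 @ [1], 1 # replicate k 2 @ [1]}"
  then have "\<forall>a\<in>set \<alpha>. a \<le> 2" by auto
  then show "inner_gt1 n (comp_compl \<alpha>)" using inner_gt1_compl_iff[OF assms] by simp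
qed

subsection \<open>The cancellation behind the antipode\<close>

text \<open>In terms of descent sets the two summands of the product differ only in the joint
  \<open>m\<close>.\<close>

lemma comp_prod_of:
  assumes A: "A \<subseteq> {1..<m}" and B: "B \<subseteq> {1..<n}" and "0 < m" "0 < n"
  shows "comp_prod (comp_of m A) (comp_of n B) =
    frag_of (comp_of (m + n) (A \<union> {m} \<union> (+) m ` B)) + frag_of (comp_of (m + n) (A \<union> (+) m ` B))"
proof -
  note a = comp_of[OF A] and b = comp_of[OF B]
  have ne: "comp_of m A \<noteq> []" "comp_of n B \<noteq> []"
    using assms composition_eq_Nil_iff[OF a(1)] composition_eq_Nil_iff[OF b(1)] by auto
  have "comp_of m A @ comp_of n B = comp_of (m + n) (A \<union> {m} \<union> (+) m ` B)"
    using composition_append[OF a(1) b(1)] descents_append[OF ne] a b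
    by (intro comp_of_eqI[symmetric]) (auto simp: composition_sum_list)
  moreover have "near_concat (comp_of m A) (comp_of n B) = comp_of (m + n) (A \<union> (+) m ` B)"
    using composition_near_concat[OF ne a(1) b(1)] descents_near_concat[OF ne] a b
    by (intro comp_of_eqI[symmetric]) (auto simp: composition_sum_list)
  ultimately show ?thesis using ne by (simp add: comp_prod_def)
qed

text \<open>
  If exactly one of \<open>A\<close> and \<open>B\<close> contains \<open>i\<close>, the two summands of the \<open>i\<close>-th product have the
  descent sets obtained by switching from \<open>A\<close> to \<open>B\<close> just before and just after \<open>i\<close>, so the
  alternating sum telescopes.
\<close>

lemma telescoping:
  assumes n: "0 < n" and AB: "A \<union> B = {1..<n}" "A \<inter> B = {}"
  shows "(\<Sum>i\<in>{0..n}. frag_cmul ((-1) ^ i)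
    (comp_prod (comp_of i {d \<in> A. d < i}) (comp_of (n - i) {d. d > 0 \<and> d + i \<in> B}))) = 0"
proof -
  define W where "W i = frag_of (comp_of n ({d \<in> A. d \<le> i} \<union> {d \<in> B. i < d}))" for i
  define t where "t i = comp_prod (comp_of i {d \<in> A. d < i}) (comp_of (n - i) {d. d > 0 \<and> d + i \<in> B})" for i
  have sub: "A \<subseteq> {1..<n}" "B \<subseteq> {1..<n}" using AB by auto
  have c0: "comp_of 0 {} = []" by (rule comp_of_eqI) auto
  \<comment> \<open>At \<open>0\<close> and at \<open>n\<close> one factor is empty and the product
    has a single term; these boundary terms are what lets the sum end at zero.\<close>
  have t0: "t 0 = W 0"
  proof -
    have "{d. d > 0 \<and> d \<in> B} = {d \<in> A. d \<le> 0} \<union> {d \<in> B. 0 < d}" using sub by auto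
    then show ?thesis by (simp add: t_def W_def comp_prod_def c0)
  qed
  have tn: "t n = W (n - 1)"
  proof -
    have "{d \<in> A. d < n} = {d \<in> A. d \<le> n - 1} \<union> {d \<in> B. n - 1 < d}" using sub n by auto
    moreover have "{d. d > 0 \<and> d + n \<in> B} = {}" using sub by auto
    ultimately have "t n = comp_prod (comp_of n ({d \<in> A. d \<le> n - 1} \<union> {d \<in> B. n - 1 < d})) (comp_of (n - n) {})"
      unfolding t_def by (simp only:)
    then show ?thesis by (simp add: W_def comp_prod_def c0)
  qed
  have ti: "t i = W (i - 1) + W i" if i: "0 < i" "i < n" for i
  proof -
    define X where "X = {d \<in> A. d < i} \<union> {d \<in> B. i < d}"
    have img: "(+) i ` {d. d > 0 \<and> d + i \<in> B} = {d \<in> B. i < d}"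
    proof
      show "{d \<in> B. i < d} \<subseteq> (+) i ` {d. d > 0 \<and> d + i \<in> B}"
      proof
        fix d assume "d \<in> {d \<in> B. i < d}"
        then show "d \<in> (+) i ` {d. d > 0 \<and> d + i \<in> B}" by (intro image_eqI[of _ _ "d - i"]) auto
      qed
    qed (auto simp: add.commute)
    have "t i = frag_of (comp_of (i + (n - i)) ({d \<in> A. d < i} \<union> {i} \<union> (+) i ` {d. d > 0 \<and> d + i \<in> B})) +
        frag_of (comp_of (i + (n - i)) ({d \<in> A. d < i} \<union> (+) i ` {d. d > 0 \<and> d + i \<in> B}))"
      unfolding t_def using sub i by (intro comp_prod_of) auto
    then have t: "t i = frag_of (comp_of n (insert i X)) + frag_of (comp_of n X)"
      using i by (simp add: img X_def)
    have le: "d \<le> i - 1 \<longleftrightarrow> d < i" "i - 1 < d \<longleftrightarrow> d = i \<or> i < d" for d using i by auto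
    show ?thesis
    proof (cases "i \<in> A")
      case True
      then have "i \<notin> B" using AB by auto
      then have "{d \<in> A. d \<le> i - 1} \<union> {d \<in> B. i - 1 < d} = X" unfolding le by (auto simp: X_def)
      moreover have "{d \<in> A. d \<le> i} \<union> {d \<in> B. i < d} = insert i X" using True by (auto simp: X_def)
      ultimately show ?thesis by (simp add: t W_def add.commute)
    next
      case False
      then have "i \<in> B" using AB i by auto
      then have "{d \<in> A. d \<le> i - 1} \<union> {d \<in> B. i - 1 < d} = insert i X" unfolding le by (auto simp: X_def)
      moreover have "{d \<in> A. d \<le> i} \<union> {d \<in> B. i < d} = X"
        using False by (auto simp: X_def le_less)
      ultimately show ?thesis by (simp add: t W_def)
    qed
  qed
  \<comment> \<open>Each new term cancels the surviving \<open>W\<close> and leaves the next one,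
    with sign; the boundary term at \<open>n\<close> removes the last.\<close>
  have part: "(\<Sum>i\<in>{0..k}. frag_cmul ((-1) ^ i) (t i)) = frag_cmul ((-1) ^ k) (W k)" if "k < n" for k
    using that
  proof (induction k)
    case 0 then show ?case by (simp add: t0)
  next
    case (Suc k)
    then show ?case using ti[of "Suc k"]
      by (simp add: frag_cmul_distrib2 minus_frag_cmul[symmetric] del: minus_frag_cmul)
  qed
  obtain k where k: "n = Suc k" using n by (cases n) auto
  have "(\<Sum>i\<in>{0..Suc k}. frag_cmul ((-1) ^ i) (t i)) = 0"
    using part[of k] tn unfolding k by (simp add: minus_frag_cmul[symmetric] del: minus_frag_cmul)
  then show ?thesis by (simp only: k t_def)
qed

section \<open>Polynomials\<close>

definition mon_eval :: "(nat \<Rightarrow> 'b::comm_ring_1) \<Rightarrow> (nat \<Rightarrow>\<^sub>0 nat) \<Rightarrow> 'b" where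
  "mon_eval s m = (\<Prod>i\<in>Poly_Mapping.keys m. s i ^ Poly_Mapping.lookup m i)"

lemma mon_eval_superset:
  assumes "finite U" "Poly_Mapping.keys m \<subseteq> U"
  shows "mon_eval s m = (\<Prod>i\<in>U. s i ^ Poly_Mapping.lookup m i)"
  unfolding mon_eval_def using assms by (intro prod.mono_neutral_left) (auto simp: in_keys_iff)

lemma mon_eval_add: "mon_eval s (m + m') = mon_eval s m * mon_eval s m'"
proof -
  let ?U = "Poly_Mapping.keys m \<union> Poly_Mapping.keys m'"
  have "mon_eval s (m + m') = (\<Prod>i\<in>?U. s i ^ Poly_Mapping.lookup (m + m') i)"
    using keys_add[of m m'] by (intro mon_eval_superset) auto
  then show ?thesis
    by (simp add: mon_eval_superset[of ?U m] mon_eval_superset[of ?U m'] lookup_add power_add prod.distrib)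
qed

lemma mon_eval_zero [simp]: "mon_eval s 0 = 1"
  and mon_eval_single [simp]: "mon_eval s (Poly_Mapping.single i 1) = s i"
  by (simp_all add: mon_eval_def)

lemma poly_eq_sum_single: "p = (\<Sum>m\<in>Poly_Mapping.keys p. Poly_Mapping.single m (Poly_Mapping.lookup p m))"
  by (rule poly_mapping_eqI) (simp add: lookup_sum lookup_single when_def in_keys_iff)

text \<open>Two instances are needed: \<open>ev\<close> evaluates polynomials in the field,
  \<open>cst\<close> substitutes polynomials for the variables.\<close>

locale coeff_hom =
  fixes \<phi> :: "'f::field \<Rightarrow> 'b::comm_ring_1"
  assumes zero: "\<phi> 0 = 0" and one: "\<phi> 1 = 1"
    and add: "\<And>x y. \<phi> (x + y) = \<phi> x + \<phi> y" and mult: "\<And>x y. \<phi> (x * y) = \<phi> x * \<phi> y"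
begin

lemma mp_eval_superset:
  assumes "finite U" "Poly_Mapping.keys p \<subseteq> U"
  shows "mp_eval \<phi> s p = (\<Sum>m\<in>U. \<phi> (Poly_Mapping.lookup p m) * mon_eval s m)"
  unfolding mp_eval_def mon_eval_def[symmetric] using assms
  by (intro sum.mono_neutral_left) (auto simp: in_keys_iff zero)

lemma mp_eval_add: "mp_eval \<phi> s (p + q) = mp_eval \<phi> s p + mp_eval \<phi> s q"
proof -
  let ?U = "Poly_Mapping.keys p \<union> Poly_Mapping.keys q"
  have "mp_eval \<phi> s (p + q) = (\<Sum>m\<in>?U. \<phi> (Poly_Mapping.lookup (p + q) m) * mon_eval s m)"
    using keys_add[of p q] by (intro mp_eval_superset) auto
  then show ?thesis
    by (simp add: mp_eval_superset[of ?U p] mp_eval_superset[of ?U q] lookup_add add distrib_right sum.distrib)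
qed

lemma mp_eval_zero [simp]: "mp_eval \<phi> s 0 = 0"
  by (simp add: mp_eval_def)

lemma mp_eval_single: "mp_eval \<phi> s (Poly_Mapping.single m c) = \<phi> c * mon_eval s m"
  using mp_eval_superset[of "{m}" "Poly_Mapping.single m c" s] by simp

lemma mp_eval_sum: "mp_eval \<phi> s (sum f J) = (\<Sum>j\<in>J. mp_eval \<phi> s (f j))"
  by (induction J rule: infinite_finite_induct) (simp_all add: mp_eval_add)

lemma mp_eval_mult: "mp_eval \<phi> s (p * q) = mp_eval \<phi> s p * mp_eval \<phi> s q"
proof -
  have s: "mp_eval \<phi> s (Poly_Mapping.single m c * Poly_Mapping.single m' c') =
      mp_eval \<phi> s (Poly_Mapping.single m c) * mp_eval \<phi> s (Poly_Mapping.single m' c')" for m c m' c'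
    by (simp add: mult_single mp_eval_single mult mon_eval_add mult_ac)
  have *: "mp_eval \<phi> s ((\<Sum>m\<in>K. Poly_Mapping.single m (c m)) * (\<Sum>m\<in>L. Poly_Mapping.single m (d m))) =
      mp_eval \<phi> s (\<Sum>m\<in>K. Poly_Mapping.single m (c m)) * mp_eval \<phi> s (\<Sum>m\<in>L. Poly_Mapping.single m (d m))" for K L c d
    by (simp only: sum_product mp_eval_sum s)
  show ?thesis
    using *[where K = "Poly_Mapping.keys p" and c = "Poly_Mapping.lookup p"
        and L = "Poly_Mapping.keys q" and d = "Poly_Mapping.lookup q"]
    by (simp only: poly_eq_sum_single[symmetric])
qed

lemma mp_eval_Const [simp]: "mp_eval \<phi> s (Const c) = \<phi> c"
  by (simp add: Const_def mp_eval_single)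

lemma mp_eval_one [simp]: "mp_eval \<phi> s 1 = 1"
  using mp_eval_single[of s 0 1] by (simp add: one)

lemma mp_eval_Var [simp]: "mp_eval \<phi> s (Var i) = s i"
  using mp_eval_single[of s "Poly_Mapping.single i 1" 1] unfolding Var_def by (simp only: one mon_eval_single mult_1)

lemma mp_eval_uminus: "mp_eval \<phi> s (- p) = - mp_eval \<phi> s p"
  using mp_eval_add[of s p "- p"] by (simp add: eq_neg_iff_add_eq_0 add.commute)

lemma mp_eval_diff: "mp_eval \<phi> s (p - q) = mp_eval \<phi> s p - mp_eval \<phi> s q"
  using mp_eval_add[of s p "- q"] by (simp add: mp_eval_uminus)

lemma mp_eval_prod: "mp_eval \<phi> s (prod f J) = (\<Prod>j\<in>J. mp_eval \<phi> s (f j))"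
  by (induction J rule: infinite_finite_induct) (simp_all add: mp_eval_mult)

lemma mp_eval_power: "mp_eval \<phi> s (p ^ k) = mp_eval \<phi> s p ^ k"
  by (induction k) (simp_all add: mp_eval_mult)

end

interpretation ev: coeff_hom "id :: 'f::field \<Rightarrow> 'f"
  by unfold_locales auto

interpretation cst: coeff_hom "Const :: 'f::field \<Rightarrow> 'f mpoly"
  by unfold_locales (simp_all add: Const_def single_add mult_single single_one)

text \<open>Evaluating after a substitution is evaluating at the pulled-back point. This is how
  characters are transported along shifts of the variables.\<close>

lemma mp_eval_compose:
  "mp_eval id t (mp_eval Const s p) = mp_eval id (\<lambda>i. mp_eval id t (s i)) (p :: 'f::field mpoly)"
proof -
  have "mp_eval id t (mon_eval s m) = mon_eval (\<lambda>i. mp_eval id t (s i)) m" for m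
    by (simp add: mon_eval_def ev.mp_eval_prod ev.mp_eval_power)
  then show ?thesis
    unfolding mp_eval_def[of Const] mp_eval_def[of id "\<lambda>i. mp_eval id t (s i)"] mon_eval_def[symmetric]
    by (simp add: ev.mp_eval_sum ev.mp_eval_mult)
qed

lemma mp_eval_cong:
  assumes "\<And>m i. \<lbrakk>m \<in> Poly_Mapping.keys p; i \<in> Poly_Mapping.keys m\<rbrakk> \<Longrightarrow> s i = t i"
  shows "mp_eval \<phi> s p = mp_eval \<phi> t p"
  unfolding mp_eval_def using assms by (intro sum.cong arg_cong2[of _ _ _ _ "(*)"] prod.cong) auto

section \<open>The polynomial ring in the variables below n\<close>

abbreviation pcarrier :: "nat \<Rightarrow> 'f::field mpoly set" where
  "pcarrier n \<equiv> carrier (poly_ring n)"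

lemma poly_ring_simps [simp]:
  "x \<otimes>\<^bsub>poly_ring n\<^esub> y = x * y" "x \<oplus>\<^bsub>poly_ring n\<^esub> y = x + y"
  "\<one>\<^bsub>poly_ring n\<^esub> = 1" "\<zero>\<^bsub>poly_ring n\<^esub> = 0"
  by (simp_all add: poly_ring_def)

lemma pcarrier_iff: "p \<in> pcarrier n \<longleftrightarrow> (\<forall>m\<in>Poly_Mapping.keys p. Poly_Mapping.keys m \<subseteq> {1..<n})"
  by (simp add: poly_ring_def)

lemma pcarrier_add: "\<lbrakk>p \<in> pcarrier n; q \<in> pcarrier n\<rbrakk> \<Longrightarrow> p + q \<in> pcarrier n"
  unfolding pcarrier_iff using keys_add[of p q] by blast

lemma pcarrier_uminus: "p \<in> pcarrier n \<Longrightarrow> - p \<in> pcarrier n"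
  unfolding pcarrier_iff by (simp add: in_keys_iff)

lemma pcarrier_diff: "\<lbrakk>p \<in> pcarrier n; q \<in> pcarrier n\<rbrakk> \<Longrightarrow> p - q \<in> pcarrier n"
  using pcarrier_add[of p n "- q"] pcarrier_uminus[of q n] by simp

lemma pcarrier_mult:
  assumes "p \<in> pcarrier n" "q \<in> pcarrier n"
  shows "p * q \<in> pcarrier n"
  unfolding pcarrier_iff
proof
  fix m assume "m \<in> Poly_Mapping.keys (p * q)"
  then obtain a b where "m = a + b" "a \<in> Poly_Mapping.keys p" "b \<in> Poly_Mapping.keys q"
    using keys_mult[of p q] by blast
  then show "Poly_Mapping.keys m \<subseteq> {1..<n}"
    using assms keys_add[of a b] unfolding pcarrier_iff by blast
qed

lemma pcarrier_Const [simp]: "Const c \<in> pcarrier n"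
  by (simp add: pcarrier_iff Const_def)

lemma pcarrier_zero [simp]: "0 \<in> pcarrier n"
  by (simp add: pcarrier_iff)

lemma pcarrier_one [simp]: "1 \<in> pcarrier n"
  using pcarrier_Const[of 1 n] by (simp add: cst.one)

lemma pcarrier_Var: "i \<in> {1..<n} \<Longrightarrow> Var i \<in> pcarrier n"
  by (simp add: pcarrier_iff Var_def)

lemma pcarrier_Var_subset: "\<lbrakk>S \<subseteq> {1..<n}; i \<in> S\<rbrakk> \<Longrightarrow> Var i \<in> pcarrier n"
  by (rule pcarrier_Var) blast

lemma pcarrier_prod: "(\<And>j. j \<in> J \<Longrightarrow> f j \<in> pcarrier n) \<Longrightarrow> prod f J \<in> pcarrier n"
  by (induction J rule: infinite_finite_induct) (auto simp: pcarrier_mult)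

lemma pcarrier_sum: "(\<And>j. j \<in> J \<Longrightarrow> f j \<in> pcarrier n) \<Longrightarrow> sum f J \<in> pcarrier n"
  by (induction J rule: infinite_finite_induct) (auto simp: pcarrier_add)

lemma single_eq_prod_Var:
  "Poly_Mapping.single m (c :: 'f::field) = Const c * (\<Prod>i\<in>Poly_Mapping.keys m. Var i ^ Poly_Mapping.lookup m i)"
proof -
  have pow: "(Var i :: 'f mpoly) ^ k = Poly_Mapping.single (Poly_Mapping.single i k) 1" for i k
    by (induction k) (simp_all add: Var_def mult_single single_add[symmetric])
  have "(\<Prod>i\<in>J. Poly_Mapping.single (f i) (1 :: 'f)) = Poly_Mapping.single (\<Sum>i\<in>J. f i) 1"
    for J and f :: "nat \<Rightarrow> nat \<Rightarrow>\<^sub>0 nat"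
    by (induction J rule: infinite_finite_induct) (simp_all add: mult_single)
  then show ?thesis
    using poly_eq_sum_single[of m] by (simp add: pow Const_def mult_single)
qed

lemma poly_induct [consumes 1, case_names Const Var add mult]:
  fixes p :: "'f::field mpoly"
  assumes p: "p \<in> pcarrier n"
    and Const: "\<And>c. P (Const c)" and Var: "\<And>i. i \<in> {1..<n} \<Longrightarrow> P (Var i)"
    and add: "\<And>p q. \<lbrakk>p \<in> pcarrier n; q \<in> pcarrier n; P p; P q\<rbrakk> \<Longrightarrow> P (p + q)"
    and mult: "\<And>p q. \<lbrakk>p \<in> pcarrier n; q \<in> pcarrier n; P p; P q\<rbrakk> \<Longrightarrow> P (p * q)"
  shows "P p"
proof -
  have one: "P 1" using Const[of 1] by (simp add: cst.one)
  have zero: "P 0" using Const[of 0] by (simp add: cst.zero)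
  have pow: "(Var i :: 'f mpoly) ^ k \<in> pcarrier n \<and> P (Var i ^ k)" if "i \<in> {1..<n}" for i k
  proof -
    have v: "Var i \<in> (pcarrier n :: 'f mpoly set)" using that by (rule pcarrier_Var)
    show ?thesis by (induction k) (auto simp: one pcarrier_mult v intro!: mult Var[OF that])
  qed
  have prd: "prod f J \<in> pcarrier n \<and> P (prod f J)" if "\<And>j. j \<in> J \<Longrightarrow> f j \<in> pcarrier n \<and> P (f j)"
    for f :: "nat \<Rightarrow> 'f mpoly" and J
    using that by (induction J rule: infinite_finite_induct) (auto simp: one pcarrier_mult mult)
  have single: "Poly_Mapping.single m c \<in> pcarrier n \<and> P (Poly_Mapping.single m c)"
    if "Poly_Mapping.keys m \<subseteq> {1..<n}" for m c
  proof -
    have "(\<Prod>i\<in>Poly_Mapping.keys m. (Var i :: 'f mpoly) ^ Poly_Mapping.lookup m i) \<in> pcarrier n \<and>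
        P (\<Prod>i\<in>Poly_Mapping.keys m. Var i ^ Poly_Mapping.lookup m i)"
      by (rule prd) (use that pow in blast)
    then show ?thesis unfolding single_eq_prod_Var by (auto intro!: mult pcarrier_mult Const)
  qed
  have sm: "sum f J \<in> pcarrier n \<and> P (sum f J)" if "\<And>j. j \<in> J \<Longrightarrow> f j \<in> pcarrier n \<and> P (f j)"
    for f :: "(nat \<Rightarrow>\<^sub>0 nat) \<Rightarrow> 'f mpoly" and J
    using that by (induction J rule: infinite_finite_induct) (auto simp: zero pcarrier_add add)
  have "P (\<Sum>m\<in>Poly_Mapping.keys p. Poly_Mapping.single m (Poly_Mapping.lookup p m))"
    by (rule sm[THEN conjunct2]) (use p single in \<open>auto simp: pcarrier_iff\<close>)
  then show ?thesis using poly_eq_sum_single[of p] by simp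
qed

lemma poly_ring_cring: "cring (poly_ring n :: 'f::field mpoly ring)"
proof (rule cringI)
  show "abelian_group (poly_ring n :: 'f mpoly ring)"
  proof (rule abelian_groupI)
    fix x :: "'f mpoly" assume "x \<in> pcarrier n"
    then show "\<exists>y\<in>pcarrier n. y \<oplus>\<^bsub>poly_ring n\<^esub> x = \<zero>\<^bsub>poly_ring n\<^esub>"
      by (intro bexI[of _ "- x"]) (auto simp: pcarrier_uminus)
  qed (auto simp: pcarrier_add add.assoc add.commute)
  show "Group.comm_monoid (poly_ring n :: 'f mpoly ring)"
    by (rule comm_monoidI) (auto simp: pcarrier_mult mult.assoc mult.commute)
qed (auto simp: distrib_right)

interpretation poly_ring: cring "poly_ring n" for n
  by (rule poly_ring_cring)

lemma poly_ring_minus: "p \<in> pcarrier n \<Longrightarrow> \<ominus>\<^bsub>poly_ring n\<^esub> p = - p"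
  by (rule poly_ring.minus_equality) (auto simp: pcarrier_uminus)

section \<open>The algebras \<open>\<H>\<^sub>n\<close> are split\<close>

definition H_gens :: "nat \<Rightarrow> 'f::field mpoly set" where
  "H_gens n = {Var i * Var i - Var i |i. i \<in> {1..<n}} \<union>
      {Var i * Var (i + 1) |i. i \<in> {1..<n} \<and> i + 1 \<in> {1..<n}}"

lemma H_ideal_eq: "H_ideal n = Idl\<^bsub>poly_ring n\<^esub> (H_gens n)"
  by (simp add: H_ideal_def H_gens_def)

lemma H_gens_subset: "H_gens n \<subseteq> pcarrier n"
  by (auto simp: H_gens_def intro!: pcarrier_diff pcarrier_mult pcarrier_Var)

lemma H_ideal_ideal: "ideal (H_ideal n) (poly_ring n)"
  unfolding H_ideal_eq by (rule poly_ring.genideal_ideal[OF H_gens_subset])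

lemmas H_ideal_additive = ideal.axioms(1)[OF H_ideal_ideal]

lemma H_ideal_abelian: "abelian_subgroup (H_ideal n) (poly_ring n)"
  by (intro abelian_subgroupI3 H_ideal_additive poly_ring.abelian_group_axioms)

lemma H_gens_ideal: "p \<in> H_gens n \<Longrightarrow> p \<in> H_ideal n"
  unfolding H_ideal_eq using poly_ring.genideal_self[OF H_gens_subset] by blast

lemma H_ideal_add: "\<lbrakk>p \<in> H_ideal n; q \<in> H_ideal n\<rbrakk> \<Longrightarrow> p + q \<in> H_ideal n"
  using additive_subgroup.a_closed[OF H_ideal_additive, of p n q] by simp

lemma H_ideal_mult: "\<lbrakk>p \<in> H_ideal n; q \<in> pcarrier n\<rbrakk> \<Longrightarrow> q * p \<in> H_ideal n"
  using ideal.I_l_closed[OF H_ideal_ideal, of p n q] by simp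

lemma H_ideal_pcarrier: "p \<in> H_ideal n \<Longrightarrow> p \<in> pcarrier n"
  using additive_subgroup.a_subset[OF H_ideal_additive] by blast

lemma H_ideal_zero: "0 \<in> H_ideal n"
  using additive_subgroup.zero_closed[OF H_ideal_additive, of n] by simp

lemma H_ideal_sum: "(\<And>j. j \<in> J \<Longrightarrow> f j \<in> H_ideal n) \<Longrightarrow> sum f J \<in> H_ideal n"
  by (induction J rule: infinite_finite_induct) (auto simp: H_ideal_add H_ideal_zero)

text \<open>Subsets of [n-1] are the 0-1 points, at which x_i^2 = x_i holds; the sparse ones satisfy
  x_i x_(i+1) = 0 as well. They are the descent sets of the \<alpha> with \<alpha> \<propto> n, by
  \<open>inner_gt1_sparse\<close>.\<close>

definition sparse :: "nat \<Rightarrow> nat set \<Rightarrow> bool" where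
  "sparse n S \<longleftrightarrow> S \<subseteq> {1..<n} \<and> (\<forall>i\<in>S. Suc i \<notin> S)"

abbreviation eval_at :: "nat set \<Rightarrow> 'f::field mpoly \<Rightarrow> 'f" where
  "eval_at S \<equiv> mp_eval id (\<lambda>i. if i \<in> S then 1 else 0)"

text \<open>The polynomial with value 1 at the point \<open>S\<close> and 0 at every other 0-1 point
  (\<open>eval_indic\<close>).\<close>

definition indic :: "nat \<Rightarrow> nat set \<Rightarrow> 'f::field mpoly" where
  "indic n S = (\<Prod>i\<in>S. Var i) * (\<Prod>i\<in>{1..<n} - S. 1 - Var i)"

lemma indic_pcarrier:
  assumes S: "S \<subseteq> {1..<n}"
  shows "indic n S \<in> pcarrier n"
  unfolding indic_def by (intro pcarrier_mult pcarrier_prod pcarrier_diff) (auto intro: pcarrier_Var pcarrier_Var_subset[OF S])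

text \<open>Expand the product of all x_i + (1 - x_i) = 1.\<close>

lemma sum_indic: "(\<Sum>S\<in>Pow {1..<n}. indic n S) = 1"
  using prod_add[of "{1..<n}" "\<lambda>i. Var i" "\<lambda>i. 1 - Var i"] by (simp add: indic_def)

lemma eval_indic:
  assumes "S \<subseteq> {1..<n}" "T \<subseteq> {1..<n}"
  shows "eval_at T (indic n S :: 'f::field mpoly) = (if S = T then 1 else 0)"
proof -
  have fin: "finite S" using assms finite_subset by blast
  have "eval_at T (indic n S :: 'f mpoly) =
      (\<Prod>i\<in>S. if i \<in> T then 1 else 0) * (\<Prod>i\<in>{1..<n} - S. 1 - (if i \<in> T then 1 else 0))"
    unfolding indic_def by (simp add: ev.mp_eval_mult ev.mp_eval_prod ev.mp_eval_diff)
  also have "\<dots> = (if S = T then 1 else 0)"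
  proof (cases "S = T")
    case False
    then consider i where "i \<in> S" "i \<notin> T" | i where "i \<in> {1..<n} - S" "i \<in> T" using assms by blast
    then show ?thesis
    proof cases
      case 1
      then have "(\<Prod>i\<in>S. if i \<in> T then 1 else (0 :: 'f)) = 0" using fin by (intro prod_zero) auto
      then show ?thesis using False by simp
    next
      case 2
      then have "(\<Prod>i\<in>{1..<n} - S. 1 - (if i \<in> T then 1 else (0 :: 'f))) = 0" by (intro prod_zero) auto
      then show ?thesis using False by simp
    qed
  qed auto
  finally show ?thesis .
qed

text \<open>Two consecutive elements of \<open>S\<close> supply the factor x_i x_(i+1), a generator
  of the ideal.\<close>

lemma indic_nonsparse:
  assumes S: "S \<subseteq> {1..<n}" and "\<not> sparse n S"
  shows "indic n S \<in> H_ideal n"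
proof -
  obtain i where i: "i \<in> S" "Suc i \<in> S" using assms by (auto simp: sparse_def)
  have fin: "finite S" using S finite_subset by blast
  have pv: "prod Var S = Var i * (Var (Suc i) * prod Var (S - {i} - {Suc i}))"
    using i fin by (simp add: prod.remove[of S i] prod.remove[of "S - {i}" "Suc i"])
  have eq: "indic n S = (prod Var (S - {i} - {Suc i}) * (\<Prod>i\<in>{1..<n} - S. 1 - Var i)) * (Var i * Var (i + 1))"
    unfolding indic_def pv by (simp only: mult_ac Suc_eq_plus1)
  have "i \<in> {1..<n}" "i + 1 \<in> {1..<n}" using subsetD[OF S i(1)] subsetD[OF S i(2)] by auto
  then have "Var i * Var (i + 1) \<in> H_ideal n"
    by (intro H_gens_ideal) (unfold H_gens_def, blast)
  then show ?thesis
    unfolding eq by (rule H_ideal_mult) (intro pcarrier_mult pcarrier_prod pcarrier_diff;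
      (use S in \<open>auto intro: pcarrier_Var pcarrier_Var_subset[OF S]\<close>))
qed

text \<open>If \<open>i\<close> is in \<open>S\<close>, the factor x_i is doubled and x_i^2 - x_i
  absorbs one copy. Otherwise x_i meets the factor 1 - x_i and the product is a multiple of x_i -
  x_i^2.\<close>

lemma Var_indic:
  assumes S: "S \<subseteq> {1..<n}" and i: "i \<in> {1..<n}"
  shows "Var i * indic n S - Const (if i \<in> S then 1 else 0) * indic n S \<in> (H_ideal n :: 'f::field mpoly set)"
proof -
  have fin: "finite S" using S finite_subset by blast
  have g: "Var i * Var i - Var i \<in> (H_ideal n :: 'f mpoly set)" using i by (intro H_gens_ideal) (auto simp: H_gens_def)
  show ?thesis
  proof (cases "i \<in> S")
    case True
    define r :: "'f mpoly" where "r = prod Var (S - {i}) * (\<Prod>i\<in>{1..<n} - S. 1 - Var i)"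
    have "r \<in> pcarrier n"
      unfolding r_def using S by (intro pcarrier_mult pcarrier_prod pcarrier_diff) (auto intro: pcarrier_Var pcarrier_Var_subset[OF S])
    then have "r * (Var i * Var i - Var i) \<in> H_ideal n" using g by (intro H_ideal_mult)
    moreover have "indic n S = Var i * r"
      unfolding indic_def r_def using True fin by (simp add: prod.remove mult.assoc)
    ultimately show ?thesis using True by (simp add: cst.one algebra_simps)
  next
    case False
    define r :: "'f mpoly" where "r = prod Var S * (\<Prod>i\<in>{1..<n} - S - {i}. 1 - Var i)"
    have "r \<in> pcarrier n"
      unfolding r_def using S by (intro pcarrier_mult pcarrier_prod pcarrier_diff) (auto intro: pcarrier_Var pcarrier_Var_subset[OF S])
    then have "(- r) * (Var i * Var i - Var i) \<in> H_ideal n" using g by (intro H_ideal_mult pcarrier_uminus)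
    moreover have eq: "indic n S = (1 - Var i) * r"
    proof -
      have "(\<Prod>j\<in>{1..<n} - S. 1 - Var j) = (1 - Var i) * (\<Prod>j\<in>{1..<n} - S - {i}. 1 - (Var j :: 'f mpoly))"
        using prod.remove[of "{1..<n} - S" i "\<lambda>j. 1 - Var j"] False i by simp
      then show ?thesis unfolding indic_def r_def by (simp only: mult_ac)
    qed
    ultimately show ?thesis unfolding eq using False by (simp add: cst.zero algebra_simps)
  qed
qed

text \<open>Modulo the ideal, \<open>indic n S\<close> is a common eigenvector of all polynomials,
  the eigenvalue being the value at \<open>S\<close>. Sums and products preserve this, so the
  variables suffice.\<close>

lemma mult_indic:
  assumes p: "p \<in> pcarrier n" and S: "S \<subseteq> {1..<n}"
  shows "p * indic n S - Const (eval_at S p) * indic n S \<in> H_ideal n"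
  using p
proof (induction p rule: poly_induct)
  case (Const c) then show ?case by (simp only: ev.mp_eval_Const) (simp add: H_ideal_zero)
next
  case (Var i) then show ?case unfolding ev.mp_eval_Var by (rule Var_indic[OF S])
next
  case (add p q)
  then have "(p * indic n S - Const (eval_at S p) * indic n S) + (q * indic n S - Const (eval_at S q) * indic n S) \<in> H_ideal n"
    by (intro H_ideal_add)
  then show ?case unfolding ev.mp_eval_add cst.add by (simp add: algebra_simps)
next
  case (mult p q)
  then have "p * (q * indic n S - Const (eval_at S q) * indic n S) +
      Const (eval_at S q) * (p * indic n S - Const (eval_at S p) * indic n S) \<in> H_ideal n"
    by (intro H_ideal_add H_ideal_mult pcarrier_Const)
  then show ?case unfolding ev.mp_eval_mult cst.mult by (simp add: algebra_simps)
qed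

lemma eval_zero_ideal: "ideal {p \<in> pcarrier n. eval_at S p = (0 :: 'f::field)} (poly_ring n)"
proof (rule idealI)
  show "ring (poly_ring n :: 'f mpoly ring)" by (rule poly_ring.ring_axioms)
  show "subgroup {p \<in> pcarrier n. eval_at S p = (0 :: 'f)} (add_monoid (poly_ring n))"
  proof (rule subgroup.intro)
    fix p :: "'f mpoly" assume p: "p \<in> {p \<in> pcarrier n. eval_at S p = 0}"
    have "inv\<^bsub>add_monoid (poly_ring n)\<^esub> p = - p"
      using poly_ring_minus[of p n] p by (simp add: a_inv_def)
    then show "inv\<^bsub>add_monoid (poly_ring n)\<^esub> p \<in> {p \<in> pcarrier n. eval_at S p = 0}"
      using p by (simp add: pcarrier_uminus ev.mp_eval_uminus)
  qed (auto simp: pcarrier_add ev.mp_eval_add)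
qed (auto simp: pcarrier_mult ev.mp_eval_mult)

text \<open>A Nullstellensatz: write \<open>p\<close> as the sum of all
  \<open>p * indic n S\<close>. For nonsparse \<open>S\<close> the second factor is in the ideal;
  for sparse \<open>S\<close> the term is congruent to \<open>eval_at S p\<close> times
  \<open>indic n S\<close>, which is zero. Conversely the generators vanish at sparse
  points.\<close>

lemma H_ideal_iff:
  "p \<in> H_ideal n \<longleftrightarrow> p \<in> pcarrier n \<and> (\<forall>S. sparse n S \<longrightarrow> eval_at S p = (0 :: 'f::field))"
proof (intro iffI conjI allI impI)
  assume "p \<in> H_ideal n" then show "p \<in> pcarrier n" by (rule H_ideal_pcarrier)
next
  fix S assume p: "p \<in> H_ideal n" and S: "sparse n S"
  have "H_gens n \<subseteq> {p \<in> pcarrier n. eval_at S p = (0 :: 'f)}"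
    using H_gens_subset[of n] S
    by (auto simp: H_gens_def sparse_def ev.mp_eval_diff ev.mp_eval_mult)
  then have "H_ideal n \<subseteq> {p \<in> pcarrier n. eval_at S p = (0 :: 'f)}"
    unfolding H_ideal_eq by (rule poly_ring.genideal_minimal[OF eval_zero_ideal])
  then show "eval_at S p = 0" using p by blast
next
  assume p: "p \<in> pcarrier n \<and> (\<forall>S. sparse n S \<longrightarrow> eval_at S p = 0)"
  have "p * indic n S \<in> H_ideal n" if S: "S \<in> Pow {1..<n}" for S
  proof (cases "sparse n S")
    case True
    then have "eval_at S p = 0" using p by blast
    then show ?thesis using mult_indic[of p n S] p S by (simp add: cst.zero)
  next
    case False
    then show ?thesis using indic_nonsparse[of S n] p S by (intro H_ideal_mult) auto
  qed
  then have "(\<Sum>S\<in>Pow {1..<n}. p * indic n S) \<in> H_ideal n" by (intro H_ideal_sum)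
  then show "p \<in> H_ideal n" by (simp only: sum_distrib_left[symmetric] sum_indic mult_1_right)
qed

section \<open>Residue classes and the characters of H_n\<close>

abbreviation hcls :: "nat \<Rightarrow> 'f::field mpoly \<Rightarrow> 'f mpoly set" where
  "hcls n p \<equiv> H_ideal n +>\<^bsub>poly_ring n\<^esub> p"

lemma hcls_eq_iff:
  assumes "p \<in> pcarrier n" "q \<in> pcarrier n"
  shows "hcls n p = hcls n q \<longleftrightarrow> (\<forall>S. sparse n S \<longrightarrow> eval_at S p = eval_at S q)"
proof -
  have "hcls n p = hcls n q \<longleftrightarrow> p - q \<in> H_ideal n"
    using poly_ring.quotient_eq_iff_same_a_r_cos[OF H_ideal_ideal assms] assms
    by (simp add: a_minus_def poly_ring_minus)
  then show ?thesis using assms by (auto simp: H_ideal_iff pcarrier_diff ev.mp_eval_diff)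
qed

lemma mem_hcls:
  assumes "p \<in> pcarrier n" "q \<in> hcls n p"
  shows "q \<in> pcarrier n" "sparse n S \<Longrightarrow> eval_at S q = eval_at S p"
proof -
  obtain h where h: "h \<in> H_ideal n" "q = h + p"
    using assms(2) by (auto simp: a_r_coset_def r_coset_def)
  then show "q \<in> pcarrier n" using assms(1) H_ideal_pcarrier pcarrier_add by blast
  show "sparse n S \<Longrightarrow> eval_at S q = eval_at S p" using h H_ideal_iff[of h n] by (simp add: ev.mp_eval_add)
qed

lemma hcls_self: "p \<in> pcarrier n \<Longrightarrow> p \<in> hcls n p"
  by (rule abelian_subgroup.a_rcos_self[OF H_ideal_abelian])

text \<open>Scalars in \<open>Halg\<close> and the map \<open>H_shift\<close> are unions over all
  representatives of a class. If the values of \<open>f q\<close> at sparse points depend only on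
  those of \<open>q\<close>, the union collapses to one class.\<close>

lemma union_hcls:
  assumes p: "p \<in> pcarrier n"
    and f: "\<And>q. q \<in> pcarrier n \<Longrightarrow> f q \<in> pcarrier l"
    and cong: "\<And>q T. \<lbrakk>q \<in> pcarrier n; \<And>S. sparse n S \<Longrightarrow> eval_at S q = eval_at S p; sparse l T\<rbrakk>
      \<Longrightarrow> eval_at T (f q) = eval_at T (f p)"
  shows "(\<Union>q\<in>hcls n p. hcls l (f q)) = hcls l (f p)"
proof -
  have "hcls l (f q) = hcls l (f p)" if "q \<in> hcls n p" for q
    using mem_hcls[OF p that] p by (subst hcls_eq_iff) (auto intro!: f cong)
  then show ?thesis using hcls_self[OF p] by blast
qed

lemma Halg_carrier: "carrier (Halg n) = hcls n ` pcarrier n"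
  by (auto simp: Halg_def Let_def FactRing_def A_RCOSETS_def')

lemma Halg_cases:
  assumes "X \<in> carrier (Halg n)"
  obtains p where "p \<in> pcarrier n" "X = hcls n p"
  using assms by (auto simp: Halg_carrier)

lemma Halg_mult: "\<lbrakk>p \<in> pcarrier n; q \<in> pcarrier n\<rbrakk> \<Longrightarrow> hcls n p \<otimes>\<^bsub>Halg n\<^esub> hcls n q = hcls n (p * q)"
  using ideal.rcoset_mult_add[OF H_ideal_ideal, of p n q] by (simp add: Halg_def Let_def FactRing_def)

lemma Halg_add: "\<lbrakk>p \<in> pcarrier n; q \<in> pcarrier n\<rbrakk> \<Longrightarrow> hcls n p \<oplus>\<^bsub>Halg n\<^esub> hcls n q = hcls n (p + q)"
  using abelian_subgroup.a_rcos_sum[OF H_ideal_abelian, of p n q] by (simp add: Halg_def Let_def FactRing_def)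

lemma Halg_one: "\<one>\<^bsub>Halg n\<^esub> = hcls n 1"
  by (simp add: Halg_def Let_def FactRing_def)

lemma Halg_zero: "\<zero>\<^bsub>Halg n\<^esub> = hcls n (0 :: 'f::field mpoly)"
proof -
  have "hcls n (0 :: 'f mpoly) = H_ideal n"
    by (rule poly_ring.a_coset_join2[OF _ additive_subgroup.a_subgroup[OF H_ideal_additive] H_ideal_zero]) simp
  then show ?thesis by (simp add: Halg_def Let_def FactRing_def)
qed

lemma Halg_smult: "p \<in> pcarrier n \<Longrightarrow> c \<odot>\<^bsub>Halg n\<^esub> hcls n p = hcls n (Const c * p)"
  using union_hcls[of p n "\<lambda>q. Const c * q" n]
  by (simp add: Halg_def Let_def pcarrier_mult ev.mp_eval_mult)

definition hchar :: "nat list \<Rightarrow> 'f::field mpoly set \<Rightarrow> 'f" where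
  "hchar \<alpha> X = the_elem (eval_at (descents \<alpha>) ` X)"

lemma inner_gt1_sparse: "inner_gt1 n \<alpha> \<longleftrightarrow> composition n \<alpha> \<and> sparse n (descents \<alpha>)"
  using descents_bounds by (auto simp: inner_gt1_iff sparse_def)

lemma sparse_obtains:
  assumes "sparse n S"
  obtains \<alpha> where "inner_gt1 n \<alpha>" "descents \<alpha> = S"
  using assms descents_surj[of S n] inner_gt1_sparse by (metis sparse_def)

lemma hchar_hcls:
  assumes "inner_gt1 n \<alpha>" "p \<in> pcarrier n"
  shows "hchar \<alpha> (hcls n p) = eval_at (descents \<alpha>) p"
proof -
  have sp: "sparse n (descents \<alpha>)" using assms(1) by (simp add: inner_gt1_sparse)
  have "eval_at (descents \<alpha>) ` hcls n p = {eval_at (descents \<alpha>) p}"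
  proof
    show "eval_at (descents \<alpha>) ` hcls n p \<subseteq> {eval_at (descents \<alpha>) p}"
      using mem_hcls(2)[OF assms(2) _ sp] by blast
    show "{eval_at (descents \<alpha>) p} \<subseteq> eval_at (descents \<alpha>) ` hcls n p"
      using imageI[OF hcls_self[OF assms(2)], of "eval_at (descents \<alpha>)"] by simp
  qed
  then show ?thesis by (simp add: hchar_def)
qed

theorem Halg_split: "split_algebra (Halg n :: ('f::field, 'f mpoly set) module) {\<alpha>. inner_gt1 n \<alpha>} hchar"
proof
  show "finite {\<alpha>. inner_gt1 n \<alpha>}" by (rule finite_inner_gt1)
next
  fix X Y :: "'f mpoly set" assume X: "X \<in> carrier (Halg n)" and Y: "Y \<in> carrier (Halg n)"
    and eq: "\<And>\<alpha>. \<alpha> \<in> {\<alpha>. inner_gt1 n \<alpha>} \<Longrightarrow> hchar \<alpha> X = hchar \<alpha> Y"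
  obtain p q where pq: "p \<in> pcarrier n" "X = hcls n p" "q \<in> pcarrier n" "Y = hcls n q"
    using X Y by (metis Halg_cases)
  have "eval_at S p = eval_at S q" if S: "sparse n S" for S
  proof -
    obtain \<alpha> where "inner_gt1 n \<alpha>" "descents \<alpha> = S" using S by (rule sparse_obtains)
    then show ?thesis using eq[of \<alpha>] pq by (simp add: hchar_hcls)
  qed
  then show "X = Y" using pq by (simp add: hcls_eq_iff)
next
  fix v :: "nat list \<Rightarrow> 'f"
  \<comment> \<open>Interpolation: \<open>indic n S\<close> is 1 at \<open>S\<close> and 0 at the
    other subsets, so the coefficients are the prescribed values.\<close>
  let ?p = "\<Sum>S\<in>Pow {1..<n}. Const (v (comp_of n S)) * indic n S"
  have p: "?p \<in> pcarrier n"
    by (intro pcarrier_sum pcarrier_mult pcarrier_Const indic_pcarrier) auto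
  have "hchar \<alpha> (hcls n ?p) = v \<alpha>" if \<alpha>: "inner_gt1 n \<alpha>" for \<alpha>
  proof -
    have D: "descents \<alpha> \<subseteq> {1..<n}" using \<alpha> by (intro descents_bounds inner_gt1_composition)
    have "hchar \<alpha> (hcls n ?p) = (\<Sum>S\<in>Pow {1..<n}. if S = descents \<alpha> then v (comp_of n S) else 0)"
      unfolding hchar_hcls[OF \<alpha> p] ev.mp_eval_sum
      by (intro sum.cong) (auto simp: ev.mp_eval_mult eval_indic[OF _ D])
    also have "\<dots> = v (comp_of n (descents \<alpha>))" using D by simp
    also have "comp_of n (descents \<alpha>) = \<alpha>" using \<alpha> by (intro comp_of_eqI inner_gt1_composition) auto
    finally show ?thesis .
  qed
  then show "\<exists>X\<in>carrier (Halg n). \<forall>\<alpha>\<in>{\<alpha>. inner_gt1 n \<alpha>}. hchar \<alpha> X = v \<alpha>"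
    using p by (intro bexI[of _ "hcls n ?p"]) (auto simp: Halg_carrier)
qed (auto elim!: Halg_cases simp: Halg_mult Halg_add Halg_one Halg_zero Halg_smult hchar_hcls
      pcarrier_mult pcarrier_add Halg_carrier ev.mp_eval_mult ev.mp_eval_add)

lemma Csimple_eq: "Csimple \<alpha> = char_module (hchar \<alpha>)"
  by (simp add: Csimple_def char_module_def hchar_def[abs_def])

text \<open>A sparse set pulls back under i -> k + i to a sparse set (\<open>sp\<close>), so
  polynomials congruent before the shift remain congruent after it.\<close>

lemma H_shift_hcls:
  assumes p: "p \<in> pcarrier n" and kl: "k + n \<le> l"
  shows "H_shift l k (hcls n p) = hcls l (mp_eval Const (\<lambda>i. Var (k + i)) p)"
proof -
  let ?f = "mp_eval Const (\<lambda>i. Var (k + i))"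
  have f: "?f q \<in> pcarrier l" if "q \<in> pcarrier n" for q :: "'a mpoly"
    using that
  proof (induction q rule: poly_induct)
    case (Var i) then show ?case using kl by (auto intro!: pcarrier_Var)
  qed (simp_all add: cst.mp_eval_add cst.mp_eval_mult pcarrier_add pcarrier_mult)
  have e: "eval_at T (?f q) = eval_at {i \<in> {1..<n}. k + i \<in> T} q" if "q \<in> pcarrier n" for q :: "'a mpoly" and T
    unfolding mp_eval_compose
  proof (rule mp_eval_cong)
    fix m i assume "m \<in> Poly_Mapping.keys q" "i \<in> Poly_Mapping.keys m"
    then have "i \<in> {1..<n}" using that unfolding pcarrier_iff by blast
    then show "eval_at T (Var (k + i)) = (if i \<in> {i \<in> {1..<n}. k + i \<in> T} then 1 else (0 :: 'a))" by simp
  qed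
  have sp: "sparse n {i \<in> {1..<n}. k + i \<in> T}" if "sparse l T" for T
    using that by (auto simp: sparse_def)
  show ?thesis
    unfolding H_shift_def
  proof (rule union_hcls[OF p f])
    fix q T assume q: "q \<in> pcarrier n" and eq: "\<And>S. sparse n S \<Longrightarrow> eval_at S q = eval_at S p" and T: "sparse l T"
    show "eval_at T (?f q) = eval_at T (?f p)"
      unfolding e[OF q] e[OF p] by (rule eq[OF sp[OF T]])
  qed
qed

lemma H_shift_closed:
  assumes "X \<in> carrier (Halg n)" "k + n \<le> l"
  shows "H_shift l k X \<in> carrier (Halg l)"
proof -
  obtain p where p: "p \<in> pcarrier n" "X = hcls n p" using assms(1) by (rule Halg_cases)
  have "mp_eval Const (\<lambda>i. Var (k + i)) p \<in> pcarrier l" using p(1)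
  proof (induction p rule: poly_induct)
    case (Var i) then show ?case using assms(2) by (auto intro!: pcarrier_Var)
  qed (simp_all add: cst.mp_eval_add cst.mp_eval_mult pcarrier_add pcarrier_mult)
  then show ?thesis using p H_shift_hcls[OF p(1) assms(2)] by (auto simp: Halg_carrier)
qed

text \<open>A character restricts along the shift to the one that sees only the descents in the
  window k+1, ..., k+n-1. With \<open>k = 0\<close> and \<open>k = m\<close> these are the two cuts
  of \<gamma> at \<open>m\<close>.\<close>

lemma hchar_H_shift:
  assumes X: "X \<in> carrier (Halg n)" and kl: "k + n \<le> l"
    and \<gamma>: "inner_gt1 l \<gamma>" and \<alpha>: "inner_gt1 n \<alpha>"
    and D: "descents \<alpha> = {i \<in> {1..<n}. k + i \<in> descents \<gamma>}"
  shows "hchar \<gamma> (H_shift l k X) = hchar \<alpha> X"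
proof -
  obtain p where p: "p \<in> pcarrier n" "X = hcls n p" using X by (rule Halg_cases)
  have c: "mp_eval Const (\<lambda>i. Var (k + i)) p \<in> pcarrier l" using p(1)
  proof (induction p rule: poly_induct)
    case (Var i) then show ?case using kl by (auto intro!: pcarrier_Var)
  qed (simp_all add: cst.mp_eval_add cst.mp_eval_mult pcarrier_add pcarrier_mult)
  have "eval_at (descents \<gamma>) (mp_eval Const (\<lambda>i. Var (k + i)) p) = eval_at (descents \<alpha>) p"
    unfolding mp_eval_compose
  proof (rule mp_eval_cong)
    fix m i assume "m \<in> Poly_Mapping.keys p" "i \<in> Poly_Mapping.keys m"
    then have "i \<in> {1..<n}" using p(1) unfolding pcarrier_iff by blast
    then show "eval_at (descents \<gamma>) (Var (k + i)) = (if i \<in> descents \<alpha> then 1 else (0 :: 'a))"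
      by (simp add: D)
  qed
  then show ?thesis unfolding p(2) H_shift_hcls[OF p(1) kl] using p(1) c \<alpha> \<gamma> by (simp add: hchar_hcls)
qed

section \<open>Tensor products of split algebras\<close>

abbreviation Fmod :: "('f::field, 'f) module" where "Fmod \<equiv> char_module (\<lambda>c. c)"

lemma vector_spaceI:
  fixes V :: "('f::field, 'v) module"
  assumes "abelian_group V" "\<And>c x. x \<in> carrier V \<Longrightarrow> c \<odot>\<^bsub>V\<^esub> x \<in> carrier V"
    and "\<And>c d x. x \<in> carrier V \<Longrightarrow> (c + d) \<odot>\<^bsub>V\<^esub> x = c \<odot>\<^bsub>V\<^esub> x \<oplus>\<^bsub>V\<^esub> d \<odot>\<^bsub>V\<^esub> x"
    and "\<And>c x y. \<lbrakk>x \<in> carrier V; y \<in> carrier V\<rbrakk> \<Longrightarrow> c \<odot>\<^bsub>V\<^esub> (x \<oplus>\<^bsub>V\<^esub> y) = c \<odot>\<^bsub>V\<^esub> x \<oplus>\<^bsub>V\<^esub> c \<odot>\<^bsub>V\<^esub> y"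
    and "\<And>c d x. x \<in> carrier V \<Longrightarrow> (c * d) \<odot>\<^bsub>V\<^esub> x = c \<odot>\<^bsub>V\<^esub> (d \<odot>\<^bsub>V\<^esub> x)"
    and "\<And>x. x \<in> carrier V \<Longrightarrow> 1 \<odot>\<^bsub>V\<^esub> x = x"
  shows "module base_field V"
  using assms by (intro moduleI) (auto simp: base_field_cring)

lemma abelian_group_char_module: "abelian_group (char_module f)"
proof (rule abelian_groupI)
  fix x :: 'a assume "x \<in> carrier (char_module f)"
  then show "\<exists>y\<in>carrier (char_module f). y \<oplus>\<^bsub>char_module f\<^esub> x = \<zero>\<^bsub>char_module f\<^esub>"
    by (intro bexI[of _ "- x"]) auto
qed (auto simp: add_ac)

lemma Fmod_module: "module base_field Fmod"
  by (rule vector_spaceI) (auto simp: abelian_group_char_module algebra_simps)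

lemma (in split_algebra) chi_finsum:
  assumes "finite K" "\<And>k. k \<in> K \<Longrightarrow> u k \<in> carrier A" "i \<in> I"
  shows "\<chi> i (\<Oplus>\<^bsub>A\<^esub>k\<in>K. u k) = (\<Sum>k\<in>K. \<chi> i (u k))"
  using assms(1,2)
proof (induction K rule: finite_induct)
  case empty then show ?case by (simp add: chi_zero assms(3))
next
  case (insert k K)
  then have "u \<in> K \<rightarrow> carrier A" by auto
  then show ?case using insert by (simp add: chi_add assms(3))
qed

lemma (in split_algebra) expand:
  assumes "a \<in> carrier A"
  shows "a = (\<Oplus>\<^bsub>A\<^esub>i\<in>I. \<chi> i a \<odot>\<^bsub>A\<^esub> idem i)"
proof (rule chi_inj)
  show "(\<Oplus>\<^bsub>A\<^esub>i\<in>I. \<chi> i a \<odot>\<^bsub>A\<^esub> idem i) \<in> carrier A" by (intro A.finsum_closed) (auto simp: smult_closed)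
  fix i assume i: "i \<in> I"
  have "\<chi> i (\<Oplus>\<^bsub>A\<^esub>i\<in>I. \<chi> i a \<odot>\<^bsub>A\<^esub> idem i) = (\<Sum>j\<in>I. if j = i then \<chi> i a else 0)"
    using i by (subst chi_finsum[OF finite_I]) (auto simp: smult_closed chi_smult intro!: sum.cong)
  then show "\<chi> i a = \<chi> i (\<Oplus>\<^bsub>A\<^esub>i\<in>I. \<chi> i a \<odot>\<^bsub>A\<^esub> idem i)" using i finite_I by simp
qed (rule assms)

text \<open>The tensor product of \<F>^I and \<F>^J is \<F>^(I \<times> J), with the products of
  characters, named \<tau> below, as its characters.\<close>

locale split_pair = A: split_algebra A I \<chi> + B: split_algebra B J \<psi>
  for A :: "('f::field, 'a) module" and I :: "'i set" and \<chi> and B :: "('f, 'b) module" and J :: "'j set" and \<psi>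
begin

sublocale TP: tensor_product base_field A B
  by (intro tensor_product.intro A.A_module B.A_module)

abbreviation "TA \<equiv> tensor_algebra base_field A B"

lemma TA_simps:
  "carrier TA = carrier TP.T" "add TA = add TP.T" "\<zero>\<^bsub>TA\<^esub> = \<zero>\<^bsub>TP.T\<^esub>" "smult TA = smult TP.T"
  "\<one>\<^bsub>TA\<^esub> = TP.tns \<one>\<^bsub>A\<^esub> \<one>\<^bsub>B\<^esub>"
  by (simp_all add: tensor_algebra_def)

definition \<tau> :: "'i \<times> 'j \<Rightarrow> ('a \<times> 'b \<Rightarrow>\<^sub>0 int) set \<Rightarrow> 'f" where
  "\<tau> = (\<lambda>(i, j). tensor_lift base_field A B Fmod (\<lambda>a b. \<chi> i a * \<psi> j b))"

lemma tau:
  assumes "i \<in> I" "j \<in> J"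
  shows "\<tau> (i, j) \<in> mod_hom base_field TP.T Fmod"
    "\<lbrakk>a \<in> carrier A; b \<in> carrier B\<rbrakk> \<Longrightarrow> \<tau> (i, j) (TP.tns a b) = \<chi> i a * \<psi> j b"
  unfolding \<tau>_def prod.case using assms
  by (intro TP.tensor_lift[OF Fmod_module];
      simp add: A.chi_add B.chi_add A.chi_smult B.chi_smult algebra_simps)+

lemma tau_add: "\<lbrakk>i \<in> I; j \<in> J; X \<in> carrier TP.T; Y \<in> carrier TP.T\<rbrakk> \<Longrightarrow> \<tau> (i, j) (X \<oplus>\<^bsub>TP.T\<^esub> Y) = \<tau> (i, j) X + \<tau> (i, j) Y"
  using mod_hom_add[OF tau(1)] by simp

lemma tau_smult: "\<lbrakk>i \<in> I; j \<in> J; X \<in> carrier TP.T\<rbrakk> \<Longrightarrow> \<tau> (i, j) (c \<odot>\<^bsub>TP.T\<^esub> X) = c * \<tau> (i, j) X"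
  using mod_hom_smult[OF tau(1)] by simp

lemma tau_zero: "\<lbrakk>i \<in> I; j \<in> J\<rbrakk> \<Longrightarrow> \<tau> (i, j) \<zero>\<^bsub>TP.T\<^esub> = 0"
  using mod_hom_zero[OF TP.T_module Fmod_module tau(1)] by simp

lemma tau_finsum:
  assumes "i \<in> I" "j \<in> J" "finite K" "\<And>k. k \<in> K \<Longrightarrow> u k \<in> carrier TP.T"
  shows "\<tau> (i, j) (\<Oplus>\<^bsub>TP.T\<^esub>k\<in>K. u k) = (\<Sum>k\<in>K. \<tau> (i, j) (u k))"
  using assms(3,4)
proof (induction K rule: finite_induct)
  case empty then show ?case by (simp add: tau_zero assms)
next
  case (insert k K)
  then have "u \<in> K \<rightarrow> carrier TP.T" by auto
  then show ?case using insert by (simp add: tau_add assms TP.T.finsum_closed)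
qed

text \<open>The idempotents are a basis of \<open>A\<close>, so the tensor product is a sum of
  copies of \<open>B\<close>, one for each \<open>idem i\<close>.\<close>

lemma T_normal_form:
  assumes "X \<in> carrier TP.T"
  shows "\<exists>y. (\<forall>i. y i \<in> carrier B) \<and> X = (\<Oplus>\<^bsub>TP.T\<^esub>i\<in>I. TP.tns (A.idem i) (y i))"
  using assms
proof (induction X rule: TP.tensor_induct)
  case (tens a b)
  have h: "(\<lambda>x. TP.tns x b) \<in> mod_hom base_field A TP.T"
    using tens by (intro mod_homI) (auto simp: TP.tns_add_left TP.T_smult_tns)
  have "TP.tns a b = TP.tns (\<Oplus>\<^bsub>A\<^esub>i\<in>I. \<chi> i a \<odot>\<^bsub>A\<^esub> A.idem i) b"
    using A.expand[OF tens(1)] by (rule arg_cong)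
  also have "\<dots> = (\<Oplus>\<^bsub>TP.T\<^esub>i\<in>I. TP.tns (\<chi> i a \<odot>\<^bsub>A\<^esub> A.idem i) b)"
    by (rule mod_hom_finsum[OF A.A_module TP.T_module h A.finite_I]) (simp add: A.smult_closed)
  also have "\<dots> = (\<Oplus>\<^bsub>TP.T\<^esub>i\<in>I. TP.tns (A.idem i) (\<chi> i a \<odot>\<^bsub>B\<^esub> b))"
    using tens by (intro TP.T.finsum_cong') (auto simp: TP.tns_balanced B.smult_closed)
  finally show ?case using tens by (intro exI[of _ "\<lambda>i. \<chi> i a \<odot>\<^bsub>B\<^esub> b"]) (auto simp: B.smult_closed)
next
  case (add X Y)
  then obtain y z where y: "\<forall>i. y i \<in> carrier B" "X = (\<Oplus>\<^bsub>TP.T\<^esub>i\<in>I. TP.tns (A.idem i) (y i))"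
    and z: "\<forall>i. z i \<in> carrier B" "Y = (\<Oplus>\<^bsub>TP.T\<^esub>i\<in>I. TP.tns (A.idem i) (z i))" by blast
  have "(\<Oplus>\<^bsub>TP.T\<^esub>i\<in>I. TP.tns (A.idem i) (y i \<oplus>\<^bsub>B\<^esub> z i)) =
      (\<Oplus>\<^bsub>TP.T\<^esub>i\<in>I. TP.tns (A.idem i) (y i) \<oplus>\<^bsub>TP.T\<^esub> TP.tns (A.idem i) (z i))"
    using y z by (intro TP.T.finsum_cong') (auto simp: TP.tns_add_right)
  also have "\<dots> = X \<oplus>\<^bsub>TP.T\<^esub> Y" using y z by (subst TP.T.finsum_addf) auto
  finally show ?case using y z by (intro exI[of _ "\<lambda>i. y i \<oplus>\<^bsub>B\<^esub> z i"]) (auto simp: B.add_closed)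
qed

text \<open>On a normal form \<tau> (i, j) is the character \<open>j\<close> of the coefficient at
  \<open>i\<close>; so all coefficients agree.\<close>

lemma tau_inj:
  assumes X: "X \<in> carrier TP.T" and Y: "Y \<in> carrier TP.T"
    and eq: "\<And>i j. \<lbrakk>i \<in> I; j \<in> J\<rbrakk> \<Longrightarrow> \<tau> (i, j) X = \<tau> (i, j) Y"
  shows "X = Y"
proof -
  obtain y z where y: "\<forall>i. y i \<in> carrier B" "X = (\<Oplus>\<^bsub>TP.T\<^esub>i\<in>I. TP.tns (A.idem i) (y i))"
    and z: "\<forall>i. z i \<in> carrier B" "Y = (\<Oplus>\<^bsub>TP.T\<^esub>i\<in>I. TP.tns (A.idem i) (z i))"
    using T_normal_form[OF X] T_normal_form[OF Y] by blast
  have val: "\<tau> (i, j) (\<Oplus>\<^bsub>TP.T\<^esub>i\<in>I. TP.tns (A.idem i) (x i)) = \<psi> j (x i)"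
    if "i \<in> I" "j \<in> J" "\<forall>i. x i \<in> carrier B" for i j x
  proof -
    have "\<tau> (i, j) (\<Oplus>\<^bsub>TP.T\<^esub>i\<in>I. TP.tns (A.idem i) (x i)) = (\<Sum>k\<in>I. if k = i then \<psi> j (x i) else 0)"
      using that by (subst tau_finsum[OF that(1,2) A.finite_I]) (auto simp: tau intro!: sum.cong)
    then show ?thesis using that A.finite_I by simp
  qed
  have "y i = z i" if "i \<in> I" for i
    using eq[OF that] val[OF that] y z by (intro B.chi_inj) auto
  then show ?thesis unfolding y(2) z(2) using z by (intro TP.T.finsum_cong') auto
qed

lemma tau_surj: "\<exists>X\<in>carrier TP.T. \<forall>i\<in>I. \<forall>j\<in>J. \<tau> (i, j) X = v (i, j)"
proof -
  let ?X = "\<Oplus>\<^bsub>TP.T\<^esub>k\<in>I. TP.tns (A.idem k) (B.el (\<lambda>j. v (k, j)))"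
  have "\<tau> (i, j) ?X = v (i, j)" if "i \<in> I" "j \<in> J" for i j
  proof -
    have "\<tau> (i, j) ?X = (\<Sum>k\<in>I. if k = i then v (i, j) else 0)"
      using that by (subst tau_finsum[OF that A.finite_I]) (auto simp: tau intro!: sum.cong)
    then show ?thesis using that A.finite_I by simp
  qed
  then show ?thesis by (intro bexI[of _ ?X] TP.T.finsum_closed) auto
qed

text \<open>Multiplication by the pure tensor of \<open>a\<close> and \<open>b\<close>: the inner
  one of the two nested lifts in \<open>tensor_algebra\<close>.\<close>

definition lmult :: "'a \<Rightarrow> 'b \<Rightarrow> ('a \<times> 'b \<Rightarrow>\<^sub>0 int) set \<Rightarrow> ('a \<times> 'b \<Rightarrow>\<^sub>0 int) set" where
  "lmult a b = tensor_lift base_field A B TP.T (\<lambda>a' b'. TP.tns (a \<otimes>\<^bsub>A\<^esub> a') (b \<otimes>\<^bsub>B\<^esub> b'))"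

lemma lmult:
  assumes "a \<in> carrier A" "b \<in> carrier B"
  shows "lmult a b \<in> mod_hom base_field TP.T TP.T"
    "\<lbrakk>a' \<in> carrier A; b' \<in> carrier B\<rbrakk> \<Longrightarrow> lmult a b (TP.tns a' b') = TP.tns (a \<otimes>\<^bsub>A\<^esub> a') (b \<otimes>\<^bsub>B\<^esub> b')"
proof -
  have sA: "a \<otimes>\<^bsub>A\<^esub> (c \<odot>\<^bsub>A\<^esub> x) = c \<odot>\<^bsub>A\<^esub> (a \<otimes>\<^bsub>A\<^esub> x)" if "x \<in> carrier A" for c x
    using that assms by (intro A.chi_inj) (auto simp: A.smult_closed A.chi_mult A.chi_smult)
  have sB: "b \<otimes>\<^bsub>B\<^esub> (c \<odot>\<^bsub>B\<^esub> x) = c \<odot>\<^bsub>B\<^esub> (b \<otimes>\<^bsub>B\<^esub> x)" if "x \<in> carrier B" for c x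
    using that assms by (intro B.chi_inj) (auto simp: B.smult_closed B.chi_mult B.chi_smult)
  have pre: "\<And>x y. x \<in> carrier A \<Longrightarrow> y \<in> carrier B \<Longrightarrow> TP.tns (a \<otimes>\<^bsub>A\<^esub> x) (b \<otimes>\<^bsub>B\<^esub> y) \<in> carrier TP.T"
    "\<And>x x' y. x \<in> carrier A \<Longrightarrow> x' \<in> carrier A \<Longrightarrow> y \<in> carrier B \<Longrightarrow>
      TP.tns (a \<otimes>\<^bsub>A\<^esub> (x \<oplus>\<^bsub>A\<^esub> x')) (b \<otimes>\<^bsub>B\<^esub> y) = TP.tns (a \<otimes>\<^bsub>A\<^esub> x) (b \<otimes>\<^bsub>B\<^esub> y) \<oplus>\<^bsub>TP.T\<^esub> TP.tns (a \<otimes>\<^bsub>A\<^esub> x') (b \<otimes>\<^bsub>B\<^esub> y)"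
    "\<And>x y y'. x \<in> carrier A \<Longrightarrow> y \<in> carrier B \<Longrightarrow> y' \<in> carrier B \<Longrightarrow>
      TP.tns (a \<otimes>\<^bsub>A\<^esub> x) (b \<otimes>\<^bsub>B\<^esub> (y \<oplus>\<^bsub>B\<^esub> y')) = TP.tns (a \<otimes>\<^bsub>A\<^esub> x) (b \<otimes>\<^bsub>B\<^esub> y) \<oplus>\<^bsub>TP.T\<^esub> TP.tns (a \<otimes>\<^bsub>A\<^esub> x) (b \<otimes>\<^bsub>B\<^esub> y')"
    "\<And>r x y. r \<in> carrier base_field \<Longrightarrow> x \<in> carrier A \<Longrightarrow> y \<in> carrier B \<Longrightarrow>
      TP.tns (a \<otimes>\<^bsub>A\<^esub> (r \<odot>\<^bsub>A\<^esub> x)) (b \<otimes>\<^bsub>B\<^esub> y) = r \<odot>\<^bsub>TP.T\<^esub> TP.tns (a \<otimes>\<^bsub>A\<^esub> x) (b \<otimes>\<^bsub>B\<^esub> y)"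
    "\<And>r x y. r \<in> carrier base_field \<Longrightarrow> x \<in> carrier A \<Longrightarrow> y \<in> carrier B \<Longrightarrow>
      TP.tns (a \<otimes>\<^bsub>A\<^esub> x) (b \<otimes>\<^bsub>B\<^esub> (r \<odot>\<^bsub>B\<^esub> y)) = r \<odot>\<^bsub>TP.T\<^esub> TP.tns (a \<otimes>\<^bsub>A\<^esub> x) (b \<otimes>\<^bsub>B\<^esub> y)"
    using assms
    by (simp_all add: A.A.r_distr B.A.r_distr TP.tns_add_left TP.tns_add_right sA sB TP.T_smult_tns
        TP.tns_balanced[symmetric])
  show "lmult a b \<in> mod_hom base_field TP.T TP.T"
    unfolding lmult_def by (rule TP.tensor_lift(1)[OF TP.T_module]) (rule pre; assumption)+
  show "\<lbrakk>a' \<in> carrier A; b' \<in> carrier B\<rbrakk> \<Longrightarrow> lmult a b (TP.tns a' b') = TP.tns (a \<otimes>\<^bsub>A\<^esub> a') (b \<otimes>\<^bsub>B\<^esub> b')"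
    unfolding lmult_def by (rule TP.tensor_lift(2)[OF TP.T_module]) (rule pre; assumption)+
qed

lemma lmult_closed: "\<lbrakk>a \<in> carrier A; b \<in> carrier B; Y \<in> carrier TP.T\<rbrakk> \<Longrightarrow> lmult a b Y \<in> carrier TP.T"
  by (rule mod_hom_closed[OF lmult(1)])

lemma tau_lmult:
  assumes ij: "i \<in> I" "j \<in> J" and ab: "a \<in> carrier A" "b \<in> carrier B" and Y: "Y \<in> carrier TP.T"
  shows "\<tau> (i, j) (lmult a b Y) = \<chi> i a * \<psi> j b * \<tau> (i, j) Y"
  using Y
proof (induction Y rule: TP.tensor_induct)
  case (tens x y) then show ?case using ij ab
    by (simp add: lmult tau A.chi_mult B.chi_mult)
next
  case (add X Y) then show ?case using ij ab
    by (simp add: mod_hom_add[OF lmult(1)] tau_add lmult_closed distrib_left)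
qed

text \<open>The outer lift needs \<open>lmult a b Y\<close> to be bilinear in \<open>a\<close> and
  \<open>b\<close>. As \<open>tau_lmult\<close> gives its characters, \<open>tau_inj\<close> reduces
  this to an identity in the field.\<close>

lemma TA_mult:
  assumes X: "X \<in> carrier TP.T" and Y: "Y \<in> carrier TP.T"
  shows "X \<otimes>\<^bsub>TA\<^esub> Y \<in> carrier TP.T" "\<lbrakk>i \<in> I; j \<in> J\<rbrakk> \<Longrightarrow> \<tau> (i, j) (X \<otimes>\<^bsub>TA\<^esub> Y) = \<tau> (i, j) X * \<tau> (i, j) Y"
proof -
  let ?h = "tensor_lift base_field A B TP.T (\<lambda>a b. lmult a b Y)"
  have eq: "X \<otimes>\<^bsub>TA\<^esub> Y = ?h X" by (simp add: tensor_algebra_def lmult_def)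
  note s = lmult_closed tau_lmult tau_add tau_smult A.chi_add B.chi_add A.chi_smult B.chi_smult Y algebra_simps
  have pre: "\<And>x y. x \<in> carrier A \<Longrightarrow> y \<in> carrier B \<Longrightarrow> lmult x y Y \<in> carrier TP.T"
    "\<And>x x' y. x \<in> carrier A \<Longrightarrow> x' \<in> carrier A \<Longrightarrow> y \<in> carrier B \<Longrightarrow> lmult (x \<oplus>\<^bsub>A\<^esub> x') y Y = lmult x y Y \<oplus>\<^bsub>TP.T\<^esub> lmult x' y Y"
    "\<And>x y y'. x \<in> carrier A \<Longrightarrow> y \<in> carrier B \<Longrightarrow> y' \<in> carrier B \<Longrightarrow> lmult x (y \<oplus>\<^bsub>B\<^esub> y') Y = lmult x y Y \<oplus>\<^bsub>TP.T\<^esub> lmult x y' Y"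
    "\<And>r x y. r \<in> carrier base_field \<Longrightarrow> x \<in> carrier A \<Longrightarrow> y \<in> carrier B \<Longrightarrow> lmult (r \<odot>\<^bsub>A\<^esub> x) y Y = r \<odot>\<^bsub>TP.T\<^esub> lmult x y Y"
    "\<And>r x y. r \<in> carrier base_field \<Longrightarrow> x \<in> carrier A \<Longrightarrow> y \<in> carrier B \<Longrightarrow> lmult x (r \<odot>\<^bsub>B\<^esub> y) Y = r \<odot>\<^bsub>TP.T\<^esub> lmult x y Y"
    by (simp add: lmult_closed Y; fail | rule tau_inj; simp add: s)+
  have h: "?h \<in> mod_hom base_field TP.T TP.T" "\<And>a b. \<lbrakk>a \<in> carrier A; b \<in> carrier B\<rbrakk> \<Longrightarrow> ?h (TP.tns a b) = lmult a b Y"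
    by (rule TP.tensor_lift(1)[OF TP.T_module]; (rule pre; assumption))
      (rule TP.tensor_lift(2)[OF TP.T_module]; (rule pre; assumption)?; assumption?)
  show "X \<otimes>\<^bsub>TA\<^esub> Y \<in> carrier TP.T" unfolding eq by (rule mod_hom_closed[OF h(1) X])
  show "\<tau> (i, j) (X \<otimes>\<^bsub>TA\<^esub> Y) = \<tau> (i, j) X * \<tau> (i, j) Y" if ij: "i \<in> I" "j \<in> J"
    unfolding eq using X
  proof (induction X rule: TP.tensor_induct)
    case (tens x y) then show ?case using ij Y by (simp add: h tau_lmult tau)
  next
    case (add X Z) then show ?case using ij Y
      by (simp add: mod_hom_add[OF h(1)] mod_hom_closed[OF h(1)] tau_add distrib_right)
  qed
qed

theorem TA_split: "split_algebra TA (I \<times> J) \<tau>"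
proof
  show "finite (I \<times> J)" using A.finite_I B.finite_I by simp
  show "\<exists>X\<in>carrier TA. \<forall>p\<in>I \<times> J. \<tau> p X = v p" for v using tau_surj[of v] by (auto simp: TA_simps)
  show "X = Y" if "X \<in> carrier TA" "Y \<in> carrier TA" "\<And>p. p \<in> I \<times> J \<Longrightarrow> \<tau> p X = \<tau> p Y" for X Y
    using that by (intro tau_inj) (auto simp: TA_simps)
qed (auto simp: TA_simps TA_mult tau tau_add tau_smult tau_zero A.chi_one B.chi_one A.one_closed B.one_closed TP.T_smult_closed)

sublocale TA: split_algebra TA "I \<times> J" \<tau> by (rule TA_split)

text \<open>The abstract form of \<open>H_embed\<close>. If the character \<open>l\<close> of
  \<open>C\<close> restricts to \<open>r l\<close> on \<open>A\<close> and to \<open>s l\<close> on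
  \<open>B\<close>, it restricts on the tensor product to the pair.\<close>

lemma tensor_lift_mult:
  assumes C: "split_algebra C L \<omega>"
    and f: "\<And>a. a \<in> carrier A \<Longrightarrow> f a \<in> carrier C" and g: "\<And>b. b \<in> carrier B \<Longrightarrow> g b \<in> carrier C"
    and r: "\<And>l. l \<in> L \<Longrightarrow> r l \<in> I" and s: "\<And>l. l \<in> L \<Longrightarrow> s l \<in> J"
    and wf: "\<And>l a. \<lbrakk>l \<in> L; a \<in> carrier A\<rbrakk> \<Longrightarrow> \<omega> l (f a) = \<chi> (r l) a"
    and wg: "\<And>l b. \<lbrakk>l \<in> L; b \<in> carrier B\<rbrakk> \<Longrightarrow> \<omega> l (g b) = \<psi> (s l) b"
    and X: "X \<in> carrier TA"
  shows "tensor_lift base_field A B C (\<lambda>a b. f a \<otimes>\<^bsub>C\<^esub> g b) X \<in> carrier C"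
    "l \<in> L \<Longrightarrow> \<omega> l (tensor_lift base_field A B C (\<lambda>a b. f a \<otimes>\<^bsub>C\<^esub> g b) X) = \<tau> (r l, s l) X"
proof -
  interpret C: split_algebra C L \<omega> by (rule C)
  let ?h = "tensor_lift base_field A B C (\<lambda>a b. f a \<otimes>\<^bsub>C\<^esub> g b)"
  note t = C.mult_closed C.add_closed C.smult_closed C.chi_mult C.chi_add C.chi_smult wf wg f g r s
    A.chi_add B.chi_add A.chi_smult B.chi_smult A.add_closed B.add_closed A.smult_closed B.smult_closed algebra_simps
  have pre: "\<And>x y. x \<in> carrier A \<Longrightarrow> y \<in> carrier B \<Longrightarrow> f x \<otimes>\<^bsub>C\<^esub> g y \<in> carrier C"
    "\<And>x x' y. x \<in> carrier A \<Longrightarrow> x' \<in> carrier A \<Longrightarrow> y \<in> carrier B \<Longrightarrow> f (x \<oplus>\<^bsub>A\<^esub> x') \<otimes>\<^bsub>C\<^esub> g y = f x \<otimes>\<^bsub>C\<^esub> g y \<oplus>\<^bsub>C\<^esub> f x' \<otimes>\<^bsub>C\<^esub> g y"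
    "\<And>x y y'. x \<in> carrier A \<Longrightarrow> y \<in> carrier B \<Longrightarrow> y' \<in> carrier B \<Longrightarrow> f x \<otimes>\<^bsub>C\<^esub> g (y \<oplus>\<^bsub>B\<^esub> y') = f x \<otimes>\<^bsub>C\<^esub> g y \<oplus>\<^bsub>C\<^esub> f x \<otimes>\<^bsub>C\<^esub> g y'"
    "\<And>c x y. c \<in> carrier base_field \<Longrightarrow> x \<in> carrier A \<Longrightarrow> y \<in> carrier B \<Longrightarrow> f (c \<odot>\<^bsub>A\<^esub> x) \<otimes>\<^bsub>C\<^esub> g y = c \<odot>\<^bsub>C\<^esub> (f x \<otimes>\<^bsub>C\<^esub> g y)"
    "\<And>c x y. c \<in> carrier base_field \<Longrightarrow> x \<in> carrier A \<Longrightarrow> y \<in> carrier B \<Longrightarrow> f x \<otimes>\<^bsub>C\<^esub> g (c \<odot>\<^bsub>B\<^esub> y) = c \<odot>\<^bsub>C\<^esub> (f x \<otimes>\<^bsub>C\<^esub> g y)"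
    by (simp add: f g; fail | rule C.chi_inj; simp add: t)+
  have h: "?h \<in> mod_hom base_field TP.T C" "\<And>a b. \<lbrakk>a \<in> carrier A; b \<in> carrier B\<rbrakk> \<Longrightarrow> ?h (TP.tns a b) = f a \<otimes>\<^bsub>C\<^esub> g b"
    by (rule TP.tensor_lift(1)[OF C.A_module]; (rule pre; assumption))
      (rule TP.tensor_lift(2)[OF C.A_module]; (rule pre; assumption)?; assumption?)
  have X': "X \<in> carrier TP.T" using X by (simp add: TA_simps)
  show "?h X \<in> carrier C" by (rule mod_hom_closed[OF h(1) X'])
  show "\<omega> l (?h X) = \<tau> (r l, s l) X" if l: "l \<in> L" using X'
  proof (induction X rule: TP.tensor_induct)
    case (tens x y) then show ?case using l by (simp add: h tau t)
  next
    case (add X Z) then show ?case using l r[OF l] s[OF l]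
      by (simp add: mod_hom_add[OF h(1)] mod_hom_closed[OF h(1)] tau_add C.chi_add)
  qed
qed

text \<open>The field acts through its multiples of the unit of \<open>D\<close>, on which
  \<open>f\<close> takes the scalar itself as value; what results is the field over itself.\<close>

lemma base_module_char:
  assumes "\<And>c. f (c \<odot>\<^bsub>D\<^esub> \<one>\<^bsub>D\<^esub>) = (c :: 'f)"
  shows "carrier (base_module D (char_module f)) = UNIV" "x \<oplus>\<^bsub>base_module D (char_module f)\<^esub> y = x + y"
    "\<zero>\<^bsub>base_module D (char_module f)\<^esub> = 0" "c \<odot>\<^bsub>base_module D (char_module f)\<^esub> x = c * x"
    "module base_field (base_module D (char_module f))"
proof -
  show *: "carrier (base_module D (char_module f)) = UNIV" "x \<oplus>\<^bsub>base_module D (char_module f)\<^esub> y = x + y"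
    "\<zero>\<^bsub>base_module D (char_module f)\<^esub> = 0" "c \<odot>\<^bsub>base_module D (char_module f)\<^esub> x = c * x" for x y c
    by (simp_all add: base_module_def restrict_scalars_def assms)
  have "abelian_group (base_module D (char_module f))"
  proof (rule abelian_groupI)
    fix x :: 'f
    show "\<exists>y\<in>carrier (base_module D (char_module f)). y \<oplus>\<^bsub>base_module D (char_module f)\<^esub> x = \<zero>\<^bsub>base_module D (char_module f)\<^esub>"
      by (intro bexI[of _ "- x"]) (auto simp: *)
  qed (auto simp: * add_ac)
  then show "module base_field (base_module D (char_module f))"
    by (rule vector_spaceI) (auto simp: * algebra_simps)
qed

text \<open>Over the field both modules are lines, so their tensor product is a line, identified
  with the field by multiplication; an element \<open>T\<close> acts on it by \<tau> (i, j)
  T.\<close>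

theorem outer_tensor_coord:
  assumes ij: "i \<in> I" "j \<in> J"
  shows "\<exists>\<theta>. coord_module TA (I \<times> J) \<tau>
    (outer_tensor base_field A B (char_module (\<chi> i)) (char_module (\<psi> j))) {()} (\<lambda>_. (i, j)) \<theta>"
proof -
  define M' where "M' = base_module A (char_module (\<chi> i))"
  define N' where "N' = base_module B (char_module (\<psi> j))"
  have M': "carrier M' = UNIV" "x \<oplus>\<^bsub>M'\<^esub> y = x + y" "\<zero>\<^bsub>M'\<^esub> = 0" "c \<odot>\<^bsub>M'\<^esub> x = c * x" "module base_field M'" for x y c
    unfolding M'_def using ij by (simp_all add: base_module_char A.chi_smult A.chi_one A.one_closed)
  have N': "carrier N' = UNIV" "x \<oplus>\<^bsub>N'\<^esub> y = x + y" "\<zero>\<^bsub>N'\<^esub> = 0" "c \<odot>\<^bsub>N'\<^esub> x = c * x" "module base_field N'" for x y c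
    unfolding N'_def using ij by (simp_all add: base_module_char B.chi_smult B.chi_one B.one_closed)
  interpret Q: tensor_product base_field M' N' by (intro tensor_product.intro M'(5) N'(5))
  let ?O = "outer_tensor base_field A B (char_module (\<chi> i)) (char_module (\<psi> j))"
  define \<theta> where "\<theta> = tensor_lift base_field M' N' Fmod (\<lambda>c d. c * d)"
  have \<theta>: "\<theta> \<in> mod_hom base_field Q.T Fmod" "\<theta> (Q.tns c d) = c * d" for c d
    unfolding \<theta>_def by (intro Q.tensor_lift[OF Fmod_module]; simp add: M' N' algebra_simps)+
  have th_add: "\<theta> (X \<oplus>\<^bsub>Q.T\<^esub> Y) = \<theta> X + \<theta> Y" if "X \<in> carrier Q.T" "Y \<in> carrier Q.T" for X Y
    using mod_hom_add[OF \<theta>(1) that] by simp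
  have sm: "\<theta> (c \<odot>\<^bsub>Q.T\<^esub> X) = c * \<theta> X" if "X \<in> carrier Q.T" for X c
    using mod_hom_smult[OF \<theta>(1) _ that, of c] by simp
  \<comment> \<open>Scalars of the left factor move to the right by balancing, so every tensor is a
    pure one with 1 on the left.\<close>
  have normal: "X = Q.tns 1 (\<theta> X)" if "X \<in> carrier Q.T" for X using that
  proof (induction X rule: Q.tensor_induct)
    case (tens c d) then show ?case using Q.tns_balanced[of c 1 d] by (simp add: \<theta> M' N')
  next
    case (add X Y)
    then have "X \<oplus>\<^bsub>Q.T\<^esub> Y = Q.tns 1 (\<theta> X) \<oplus>\<^bsub>Q.T\<^esub> Q.tns 1 (\<theta> Y)" by metis
    also have "\<dots> = Q.tns 1 (\<theta> X + \<theta> Y)" using Q.tns_add_right[of 1 "\<theta> X" "\<theta> Y"] by (simp add: M' N')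
    finally have eq: "X \<oplus>\<^bsub>Q.T\<^esub> Y = Q.tns 1 (\<theta> X + \<theta> Y)" .
    show ?case unfolding th_add[OF add(1,2)] by (rule eq)
  qed
  have O: "carrier ?O = carrier Q.T" "add ?O = add Q.T" "\<zero>\<^bsub>?O\<^esub> = \<zero>\<^bsub>Q.T\<^esub>"
    by (simp_all add: outer_tensor_def Let_def M'_def N'_def)
  \<comment> \<open>The action is given by two nested lifts; each is evaluated by exhibiting the
    linear map that it must equal.\<close>
  have O_smult: "T \<odot>\<^bsub>?O\<^esub> Z = \<tau> (i, j) T \<odot>\<^bsub>Q.T\<^esub> Z" if T: "T \<in> carrier TA" and Z: "Z \<in> carrier Q.T" for T Z
  proof -
    have inner: "tensor_lift base_field M' N' Q.T (\<lambda>u v. Q.tns (a \<odot>\<^bsub>char_module (\<chi> i)\<^esub> u) (b \<odot>\<^bsub>char_module (\<psi> j)\<^esub> v)) Z =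
        (\<chi> i a * \<psi> j b) \<odot>\<^bsub>Q.T\<^esub> Z" for a b
    proof (rule Q.tensor_lift_eq[OF _ _ Z])
      show "(\<lambda>Z. (\<chi> i a * \<psi> j b) \<odot>\<^bsub>Q.T\<^esub> Z) \<in> mod_hom base_field Q.T Q.T"
        by (rule mod_homI) (auto simp: Q.T_smult_closed Q.T_smult_add Q.Tm.smult_assoc1[symmetric, simplified] mult_ac)
      fix u v
      have "(\<chi> i a * \<psi> j b) \<odot>\<^bsub>Q.T\<^esub> Q.tns u v = Q.tns (\<psi> j b \<odot>\<^bsub>M'\<^esub> (\<chi> i a * u)) v"
        by (simp add: Q.T_smult_tns M' N' mult_ac)
      also have "\<dots> = Q.tns (\<chi> i a * u) (\<psi> j b * v)"
        using Q.tns_balanced[of "\<psi> j b" "\<chi> i a * u" v] by (simp add: M' N')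
      finally show "(\<chi> i a * \<psi> j b) \<odot>\<^bsub>Q.T\<^esub> Q.tns u v =
        Q.tns (a \<odot>\<^bsub>char_module (\<chi> i)\<^esub> u) (b \<odot>\<^bsub>char_module (\<psi> j)\<^esub> v)" by simp
    qed
    have "T \<odot>\<^bsub>?O\<^esub> Z = tensor_lift base_field A B Q.T (\<lambda>a b.
        tensor_lift base_field M' N' Q.T (\<lambda>u v. Q.tns (a \<odot>\<^bsub>char_module (\<chi> i)\<^esub> u) (b \<odot>\<^bsub>char_module (\<psi> j)\<^esub> v)) Z) T"
      by (simp add: outer_tensor_def Let_def M'_def N'_def)
    also have "\<dots> = \<tau> (i, j) T \<odot>\<^bsub>Q.T\<^esub> Z"
      unfolding inner
    proof (rule TP.tensor_lift_eq)
      show "(\<lambda>T. \<tau> (i, j) T \<odot>\<^bsub>Q.T\<^esub> Z) \<in> mod_hom base_field TP.T Q.T"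
        using ij Z by (intro mod_homI)
          (auto simp: Q.T_smult_closed tau_add tau_smult Q.Tm.smult_l_distr[simplified] Q.Tm.smult_assoc1[simplified])
    qed (use T ij in \<open>auto simp: tau TA_simps\<close>)
    finally show ?thesis .
  qed
  have "coord_module TA (I \<times> J) \<tau> ?O {()} (\<lambda>_. (i, j)) (\<lambda>_. \<theta>)"
  proof
    show "\<exists>x\<in>carrier ?O. \<forall>k\<in>{()}. \<theta> x = v k" for v
      by (rule bexI[of _ "Q.tns 1 (v ())"]) (auto simp: O \<theta> M' N')
    show "x = y" if "x \<in> carrier ?O" "y \<in> carrier ?O" "\<And>k. k \<in> {()} \<Longrightarrow> \<theta> x = \<theta> y" for x y
      using that normal[of x] normal[of y] by (simp add: O)
    show "\<theta> \<zero>\<^bsub>?O\<^esub> = 0" using mod_hom_zero[OF Q.T_module Fmod_module \<theta>(1)] by (simp add: O)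
  qed (use ij in \<open>auto simp: O O_smult th_add sm Q.T_smult_closed\<close>)
  then show ?thesis by blast
qed

end

lemma (in split_algebra) restrict_char_coord:
  assumes "i \<in> I" "\<And>a. a \<in> carrier A \<Longrightarrow> f (\<phi> a) = \<chi> i a"
  shows "coord_module A I \<chi> (restrict_scalars \<phi> (char_module f)) {()} (\<lambda>_. i) (\<lambda>_ c. c)"
  by unfold_locales (use assms in \<open>auto simp: restrict_scalars_def\<close>)

text \<open>As an \<open>A\<close>-module \<open>B\<close> is a sum of lines, one for each
  \<open>j\<close>, with character \<open>r j\<close>. Tensoring over \<open>A\<close> with a line
  of character \<kappa> k kills every \<open>j\<close> whose character differs and keeps the
  others.\<close>

theorem induced_coord:
  fixes A :: "('f::field, 'a) module" and B :: "('f, 'b) module"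
  assumes A: "split_algebra A I \<chi>" and B: "split_algebra B J \<psi>"
    and \<phi>: "\<And>a. a \<in> carrier A \<Longrightarrow> \<phi> a \<in> carrier B"
    and r: "\<And>j. j \<in> J \<Longrightarrow> r j \<in> I"
    and \<psi>\<phi>: "\<And>j a. \<lbrakk>j \<in> J; a \<in> carrier A\<rbrakk> \<Longrightarrow> \<psi> j (\<phi> a) = \<chi> (r j) a"
    and M: "coord_module A I \<chi> M {k} \<kappa> \<theta>"
  shows "\<exists>\<Theta>. coord_module B J \<psi> (induced_module A B \<phi> M) {j \<in> J. r j = \<kappa> k} (\<lambda>j. j) \<Theta>"
proof -
  interpret A: split_algebra A I \<chi> by (rule A)
  interpret B: split_algebra B J \<psi> by (rule B)
  interpret M: coord_module A I \<chi> M "{k}" \<kappa> \<theta> by (rule M)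
  define i where "i = \<kappa> k"
  have i: "i \<in> I" by (simp add: i_def M.kappa)
  \<comment> \<open>The left factor of the tensor product in \<open>induced_module\<close>:
    \<open>B\<close> as an \<open>A\<close>-module through \<phi>.\<close>
  define B' :: "('a, 'b) module" where "B' = \<lparr>carrier = carrier B, monoid.mult = monoid.mult B, monoid.one = monoid.one B,
               ring.zero = ring.zero B, add = add B, smult = (\<lambda>a b. \<phi> a \<otimes>\<^bsub>B\<^esub> b)\<rparr>"
  have B': "carrier B' = carrier B" "\<zero>\<^bsub>B'\<^esub> = \<zero>\<^bsub>B\<^esub>" "x \<oplus>\<^bsub>B'\<^esub> y = x \<oplus>\<^bsub>B\<^esub> y" "a \<odot>\<^bsub>B'\<^esub> x = \<phi> a \<otimes>\<^bsub>B\<^esub> x" for x y a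
    by (simp_all add: B'_def)
  note s = B.mult_closed B.add_closed \<phi> B.chi_mult B.chi_add \<psi>\<phi> r A.chi_mult A.chi_add A.chi_one
    A.mult_closed A.add_closed A.one_closed
  have agB': "abelian_group B'"
  proof (rule abelian_groupI)
    fix x assume "x \<in> carrier B'"
    then show "\<exists>y\<in>carrier B'. y \<oplus>\<^bsub>B'\<^esub> x = \<zero>\<^bsub>B'\<^esub>"
      unfolding B' by (intro bexI[of _ "\<ominus>\<^bsub>B\<^esub> x"]) (auto simp: B.A.l_neg)
  qed (auto simp: B' B.A.a_ac)
  have mB': "module A B'"
    by (rule moduleI; (simp add: A.A_cring agB'; fail | simp add: B' s; fail | unfold B'; rule B.chi_inj; simp add: s algebra_simps))
  interpret Q: tensor_product A B' M by (intro tensor_product.intro mB' M.M_module)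
  interpret C: coord_module A I \<chi> "char_module (\<chi> i)" "{()}" "\<lambda>_. i" "\<lambda>_ c. c"
    by (rule A.char_module_coord[OF i])
  let ?w = "M.bas k"
  \<comment> \<open>The coordinate at \<open>j\<close>; it is balanced because for
    \<open>r j = i\<close> both factors see \<open>A\<close> through the same character.\<close>
  define \<Theta> where "\<Theta> j = tensor_lift A B' M (char_module (\<chi> i)) (\<lambda>b u. \<psi> j b * \<theta> k u)" for j
  have \<Theta>: "\<Theta> j \<in> mod_hom A Q.T (char_module (\<chi> i))"
    "\<lbrakk>b \<in> carrier B; u \<in> carrier M\<rbrakk> \<Longrightarrow> \<Theta> j (Q.tns b u) = \<psi> j b * \<theta> k u" if "j \<in> J" "r j = i" for j b u
    unfolding \<Theta>_def using that
    by (intro Q.tensor_lift[OF C.M_module];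
        simp add: B' s M.theta_add M.theta_smult i_def[symmetric] algebra_simps)+
  have \<Theta>_add: "\<Theta> j (X \<oplus>\<^bsub>Q.T\<^esub> Y) = \<Theta> j X + \<Theta> j Y" if "j \<in> J" "r j = i" "X \<in> carrier Q.T" "Y \<in> carrier Q.T" for j X Y
    using mod_hom_add[OF \<Theta>(1)[OF that(1,2)] that(3,4)] by simp
  have normal: "\<exists>b\<in>carrier B. X = Q.tns b ?w \<and> (\<forall>j\<in>J. r j \<noteq> i \<longrightarrow> \<psi> j b = 0)" if "X \<in> carrier Q.T" for X
    using that
  proof (induction X rule: Q.tensor_induct)
    case (tens b u)
    \<comment> \<open>Supported at \<open>i\<close>, this element carries the basis vector
      \<open>?w\<close> to \<open>u\<close>. Moved across the tensor sign, it kills the characters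
      of \<open>b\<close> at all \<open>j\<close> with \<open>r j\<close> different from
      \<open>i\<close>.\<close>
    define a where "a = A.el (\<lambda>l. if l = i then \<theta> k u else 0)"
    have a: "a \<in> carrier A" by (simp add: a_def)
    have b: "b \<in> carrier B" using tens by (simp add: B')
    have "u = a \<odot>\<^bsub>M\<^esub> ?w"
      using tens i by (intro M.theta_inj) (auto simp: a_def M.M_smult_closed M.theta_smult i_def[symmetric])
    then have "Q.tns b u = Q.tns (\<phi> a \<otimes>\<^bsub>B\<^esub> b) ?w"
      using Q.tns_balanced[of a b ?w] tens a by (simp add: B')
    moreover have "\<psi> j (\<phi> a \<otimes>\<^bsub>B\<^esub> b) = 0" if "j \<in> J" "r j \<noteq> i" for j
    proof -
      have "\<chi> (r j) a = 0" unfolding a_def using A.chi_el[OF r[OF that(1)]] that(2) by simp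
      then show ?thesis using that a b by (simp add: B.chi_mult \<phi> \<psi>\<phi>)
    qed
    ultimately show ?case using a b by (intro bexI[of _ "\<phi> a \<otimes>\<^bsub>B\<^esub> b"]) (auto simp: s)
  next
    case (add X Y)
    then obtain b c where "b \<in> carrier B" "X = Q.tns b ?w" "\<forall>j\<in>J. r j \<noteq> i \<longrightarrow> \<psi> j b = 0"
      "c \<in> carrier B" "Y = Q.tns c ?w" "\<forall>j\<in>J. r j \<noteq> i \<longrightarrow> \<psi> j c = 0" by blast
    then show ?case using Q.tns_add_left[of b c ?w]
      by (intro bexI[of _ "b \<oplus>\<^bsub>B\<^esub> c"]) (auto simp: B' s)
  qed
  let ?I = "induced_module A B \<phi> M"
  have I: "carrier ?I = carrier Q.T" "add ?I = add Q.T" "\<zero>\<^bsub>?I\<^esub> = \<zero>\<^bsub>Q.T\<^esub>"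
    "b \<odot>\<^bsub>?I\<^esub> X = tensor_lift A B' M Q.T (\<lambda>b' u. Q.tns (b \<otimes>\<^bsub>B\<^esub> b') u) X" for b X
    by (simp_all add: induced_module_def Let_def B'_def)
  have sm: "tensor_lift A B' M Q.T (\<lambda>b' u. Q.tns (b \<otimes>\<^bsub>B\<^esub> b') u) \<in> mod_hom A Q.T Q.T"
    "\<lbrakk>b' \<in> carrier B; u \<in> carrier M\<rbrakk> \<Longrightarrow> b \<odot>\<^bsub>?I\<^esub> (Q.tns b' u) = Q.tns (b \<otimes>\<^bsub>B\<^esub> b') u"
    if b: "b \<in> carrier B" for b b' u
  proof -
    have ml: "b \<otimes>\<^bsub>B\<^esub> (x \<oplus>\<^bsub>B\<^esub> y) = b \<otimes>\<^bsub>B\<^esub> x \<oplus>\<^bsub>B\<^esub> b \<otimes>\<^bsub>B\<^esub> y" if "x \<in> carrier B" "y \<in> carrier B" for x y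
      using b that by (simp add: B.A.r_distr)
    have mc: "b \<otimes>\<^bsub>B\<^esub> (\<phi> a \<otimes>\<^bsub>B\<^esub> x) = \<phi> a \<otimes>\<^bsub>B\<^esub> (b \<otimes>\<^bsub>B\<^esub> x)" if "x \<in> carrier B" "a \<in> carrier A" for x a
      using b that by (intro B.chi_inj) (auto simp: s)
    have pre: "\<And>x y. x \<in> carrier B' \<Longrightarrow> y \<in> carrier M \<Longrightarrow> Q.tns (b \<otimes>\<^bsub>B\<^esub> x) y \<in> carrier Q.T"
      "\<And>x x' y. x \<in> carrier B' \<Longrightarrow> x' \<in> carrier B' \<Longrightarrow> y \<in> carrier M \<Longrightarrow>
        Q.tns (b \<otimes>\<^bsub>B\<^esub> (x \<oplus>\<^bsub>B'\<^esub> x')) y = Q.tns (b \<otimes>\<^bsub>B\<^esub> x) y \<oplus>\<^bsub>Q.T\<^esub> Q.tns (b \<otimes>\<^bsub>B\<^esub> x') y"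
      "\<And>x y y'. x \<in> carrier B' \<Longrightarrow> y \<in> carrier M \<Longrightarrow> y' \<in> carrier M \<Longrightarrow>
        Q.tns (b \<otimes>\<^bsub>B\<^esub> x) (y \<oplus>\<^bsub>M\<^esub> y') = Q.tns (b \<otimes>\<^bsub>B\<^esub> x) y \<oplus>\<^bsub>Q.T\<^esub> Q.tns (b \<otimes>\<^bsub>B\<^esub> x) y'"
      "\<And>a x y. a \<in> carrier A \<Longrightarrow> x \<in> carrier B' \<Longrightarrow> y \<in> carrier M \<Longrightarrow>
        Q.tns (b \<otimes>\<^bsub>B\<^esub> (a \<odot>\<^bsub>B'\<^esub> x)) y = a \<odot>\<^bsub>Q.T\<^esub> Q.tns (b \<otimes>\<^bsub>B\<^esub> x) y"
      "\<And>a x y. a \<in> carrier A \<Longrightarrow> x \<in> carrier B' \<Longrightarrow> y \<in> carrier M \<Longrightarrow>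
        Q.tns (b \<otimes>\<^bsub>B\<^esub> x) (a \<odot>\<^bsub>M\<^esub> y) = a \<odot>\<^bsub>Q.T\<^esub> Q.tns (b \<otimes>\<^bsub>B\<^esub> x) y"
      using b
      by (simp_all add: B' ml mc Q.tns_add_left[unfolded B'] Q.tns_add_right Q.T_smult_tns Q.tns_balanced[symmetric] s)
    show "tensor_lift A B' M Q.T (\<lambda>b' u. Q.tns (b \<otimes>\<^bsub>B\<^esub> b') u) \<in> mod_hom A Q.T Q.T"
      by (rule Q.tensor_lift(1)[OF Q.T_module]) (rule pre; assumption)+
    show "\<lbrakk>b' \<in> carrier B; u \<in> carrier M\<rbrakk> \<Longrightarrow> b \<odot>\<^bsub>?I\<^esub> (Q.tns b' u) = Q.tns (b \<otimes>\<^bsub>B\<^esub> b') u"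
      unfolding I(4) using Q.tensor_lift(2)[OF Q.T_module pre] by (simp add: B')
  qed
  have \<Theta>_smult: "\<Theta> j (b \<odot>\<^bsub>?I\<^esub> X) = \<psi> j b * \<Theta> j X" if j: "j \<in> J" "r j = i" and b: "b \<in> carrier B" and X: "X \<in> carrier Q.T" for j b X
    using X
  proof (induction X rule: Q.tensor_induct)
    case (tens x y) then show ?case using j b by (simp add: sm \<Theta> B' s)
  next
    case (add X Y)
    then have "b \<odot>\<^bsub>?I\<^esub> (X \<oplus>\<^bsub>Q.T\<^esub> Y) = b \<odot>\<^bsub>?I\<^esub> X \<oplus>\<^bsub>Q.T\<^esub> b \<odot>\<^bsub>?I\<^esub> Y"
      unfolding I(4) by (intro mod_hom_add[OF sm(1)[OF b]])
    moreover have "b \<odot>\<^bsub>?I\<^esub> X \<in> carrier Q.T" "b \<odot>\<^bsub>?I\<^esub> Y \<in> carrier Q.T"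
      unfolding I(4) using add by (auto intro: mod_hom_closed[OF sm(1)[OF b]])
    ultimately show ?case using add j by (simp add: \<Theta>_add distrib_left)
  qed
  have "coord_module B J \<psi> ?I {j \<in> J. r j = \<kappa> k} (\<lambda>j. j) \<Theta>"
    unfolding i_def[symmetric]
  proof
    show "finite {j \<in> J. r j = i}" using B.finite_I by simp
    show "\<Theta> j \<zero>\<^bsub>?I\<^esub> = 0" if "j \<in> {j \<in> J. r j = i}" for j
      using mod_hom_zero[OF Q.T_module C.M_module \<Theta>(1)[of j]] that by (simp add: I)
    show "x \<in> carrier ?I \<Longrightarrow> b \<in> carrier B \<Longrightarrow> b \<odot>\<^bsub>?I\<^esub> x \<in> carrier ?I" for b x
      unfolding I by (rule mod_hom_closed[OF sm(1)])
    show "X = Y" if X: "X \<in> carrier ?I" and Y: "Y \<in> carrier ?I" and eq: "\<And>j. j \<in> {j \<in> J. r j = i} \<Longrightarrow> \<Theta> j X = \<Theta> j Y" for X Y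
    proof -
      obtain b where b: "b \<in> carrier B" "X = Q.tns b ?w" "\<forall>j\<in>J. r j \<noteq> i \<longrightarrow> \<psi> j b = 0"
        using normal X unfolding I by blast
      obtain c where c: "c \<in> carrier B" "Y = Q.tns c ?w" "\<forall>j\<in>J. r j \<noteq> i \<longrightarrow> \<psi> j c = 0"
        using normal Y unfolding I by blast
      have "\<psi> j b = \<psi> j c" if "j \<in> J" for j
        using eq[of j] b c \<Theta>(2)[of j b ?w] \<Theta>(2)[of j c ?w] that by (cases "r j = i") auto
      then have "b = c" using b c by (intro B.chi_inj) auto
      then show ?thesis using b c by simp
    qed
    show "\<exists>X\<in>carrier ?I. \<forall>j\<in>{j \<in> J. r j = i}. \<Theta> j X = v j" for v
      by (rule bexI[of _ "Q.tns (B.el v) ?w"]) (auto simp: I \<Theta> B')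
  qed (auto simp: I \<Theta>_add \<Theta>_smult[unfolded I(4)])
  then show ?thesis by blast
qed

section \<open>Free \<open>\<int>\<close>-modules with a chosen basis\<close>

text \<open>Independence of the basis is expressed by a coordinate homomorphism \<open>\<Phi>\<close>.\<close>

locale zbasis = G: comm_group G for G :: "('a, 'm) monoid_scheme" +
  fixes S :: "'s set" and g :: "'s \<Rightarrow> 'a" and \<Phi> :: "'a \<Rightarrow> 's \<Rightarrow>\<^sub>0 int"
  assumes g_closed: "\<And>s. s \<in> S \<Longrightarrow> g s \<in> carrier G"
    and Phi_hom: "\<Phi> \<in> hom G (free_Abelian_group S)"
    and Phi_g: "\<And>s. s \<in> S \<Longrightarrow> \<Phi> (g s) = frag_of s"
    and gen: "carrier G \<subseteq> generate G (g ` S)"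
begin

abbreviation "H \<equiv> Zmod G"

lemma H_module: "module \<Z> H"
  by (rule Zmod_module) (rule G.comm_group_axioms)

sublocale Hm: module \<Z> H by (rule H_module)

sublocale T: tensor_product \<Z> H H
  by (intro tensor_product.intro H_module)

lemma H_eqI:
  assumes P: "module \<Z> P" and h: "h \<in> mod_hom \<Z> H P" and h': "h' \<in> mod_hom \<Z> H P"
    and eq: "\<And>s. s \<in> S \<Longrightarrow> h (g s) = h' (g s)" and x: "x \<in> carrier H"
  shows "h x = h' x"
proof -
  interpret P: module \<Z> P by (rule P)
  have "x \<in> generate G (g ` S)" using gen x by auto
  then show ?thesis
  proof (induction x rule: generate.induct)
    case one then show ?case using mod_hom_zero[OF H_module P h] mod_hom_zero[OF H_module P h'] by simp
  next
    case (incl y) then show ?case using eq by auto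
  next
    case (inv y)
    then have y: "y \<in> carrier G" and hy: "h y = h' y" using g_closed eq by auto
    have "inv\<^bsub>G\<^esub> y = (-1) \<odot>\<^bsub>H\<^esub> y" using y by (simp add: G.int_pow_neg)
    then show ?case using mod_hom_smult[OF h, of "-1" y] mod_hom_smult[OF h', of "-1" y] y hy by simp
  next
    case (eng y z)
    have sub: "g ` S \<subseteq> carrier G" using g_closed by auto
    have "y \<in> carrier H" "z \<in> carrier H" using eng G.generate_in_carrier[OF sub] by auto
    then show ?case using eng mod_hom_add[OF h, of y z] mod_hom_add[OF h', of y z] by simp
  qed
qed

definition ext :: "(int, 'p) module \<Rightarrow> ('s \<Rightarrow> 'p) \<Rightarrow> 'a \<Rightarrow> 'p" where
  "ext P v = lin_ext \<Z> H P S g v"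

lemma ext:
  assumes P: "module \<Z> P" and v: "\<And>s. s \<in> S \<Longrightarrow> v s \<in> carrier P"
  shows "ext P v \<in> mod_hom \<Z> H P" "s \<in> S \<Longrightarrow> ext P v (g s) = v s"
proof -
  interpret P: module \<Z> P by (rule P)
  have "v ` S \<subseteq> carrier (add_monoid P)" using v by auto
  then obtain h where h: "h \<in> hom (free_Abelian_group S) (add_monoid P)" "\<And>s. s \<in> S \<Longrightarrow> h (frag_of s) = v s"
    using comm_group.free_Abelian_group_universal[OF P.M.a_comm_group] by blast
  have "h \<circ> \<Phi> \<in> hom G (add_monoid P)" using Phi_hom h(1) by (rule hom_compose)
  then have "h \<circ> \<Phi> \<in> mod_hom \<Z> H P"
    unfolding Zmod_hom_iff[OF H_module P] by (simp add: hom_def)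
  then have ex: "\<exists>h\<in>mod_hom \<Z> H P. \<forall>i\<in>S. h (g i) = v i"
    using h(2) Phi_g by (intro bexI[of _ "h \<circ> \<Phi>"]) auto
  show "ext P v \<in> mod_hom \<Z> H P" "s \<in> S \<Longrightarrow> ext P v (g s) = v s"
    unfolding ext_def by (rule lin_extI[OF ex]; assumption?)+
qed

text \<open>Two extensions in succession: in \<open>y\<close> for each basis element
  \<open>s\<close>, then in \<open>x\<close>. Additivity in \<open>y\<close> is an equality of two
  linear maps of \<open>x\<close>, hence can be tested on the basis.\<close>

lemma bilinear_ext:
  assumes P: "module \<Z> P" and v: "\<And>s t. \<lbrakk>s \<in> S; t \<in> S\<rbrakk> \<Longrightarrow> v s t \<in> carrier P"
  shows "lin_ext \<Z> T.T P (S \<times> S) (\<lambda>(s, t). T.tns (g s) (g t)) (\<lambda>(s, t). v s t) \<in> mod_hom \<Z> T.T P" (is "?l \<in> _")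
    "\<lbrakk>s \<in> S; t \<in> S\<rbrakk> \<Longrightarrow>
      lin_ext \<Z> T.T P (S \<times> S) (\<lambda>(s, t). T.tns (g s) (g t)) (\<lambda>(s, t). v s t) (T.tns (g s) (g t)) = v s t"
proof -
  interpret P: module \<Z> P by (rule P)
  define b where "b x y = ext P (\<lambda>s. ext P (v s) y) x" for x y
  have e1: "ext P (v s) \<in> mod_hom \<Z> H P" if "s \<in> S" for s using ext(1)[OF P] v that by blast
  have e1c: "ext P (v s) y \<in> carrier P" if "s \<in> S" "y \<in> carrier H" for s y
    using mod_hom_closed[OF e1[OF that(1)] that(2)] .
  have b1: "(\<lambda>x. b x y) \<in> mod_hom \<Z> H P" if "y \<in> carrier H" for y
    unfolding b_def using ext(1)[OF P, of "\<lambda>s. ext P (v s) y"] e1c that by simp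
  have bg: "b (g s) y = ext P (v s) y" if "s \<in> S" "y \<in> carrier H" for s y
    unfolding b_def using ext(2)[OF P, of "\<lambda>s. ext P (v s) y"] e1c that by simp
  have sum_hom: "(\<lambda>x. h x \<oplus>\<^bsub>P\<^esub> h' x) \<in> mod_hom \<Z> H P" if "h \<in> mod_hom \<Z> H P" "h' \<in> mod_hom \<Z> H P" for h h'
    using mod_hom_closed[OF that(1)] mod_hom_closed[OF that(2)]
    by (intro mod_homI) (simp_all add: mod_hom_add[OF that(1)] mod_hom_add[OF that(2)]
        mod_hom_smult[OF that(1)] mod_hom_smult[OF that(2)] P.M.a_ac P.smult_r_distr del: Zmod_simps)
  have b2: "b x (y \<oplus>\<^bsub>H\<^esub> z) = b x y \<oplus>\<^bsub>P\<^esub> b x z" if x: "x \<in> carrier H" and y: "y \<in> carrier H" and z: "z \<in> carrier H" for x y z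
  proof (rule H_eqI[OF P b1 sum_hom[OF b1 b1] _ x])
    show "y \<oplus>\<^bsub>H\<^esub> z \<in> carrier H" using y z by (rule Hm.M.a_closed)
    fix s assume s: "s \<in> S"
    show "b (g s) (y \<oplus>\<^bsub>H\<^esub> z) = b (g s) y \<oplus>\<^bsub>P\<^esub> b (g s) z"
      using y z mod_hom_add[OF e1[OF s] y z] bg[OF s] Hm.M.a_closed[OF y z] by simp
  qed (use y z in auto)
  have b2h: "b x \<in> mod_hom \<Z> H P" if x: "x \<in> carrier H" for x
    unfolding Zmod_hom_iff[OF H_module P] hom_def
    using b2[OF x] mod_hom_closed[OF b1 x] by auto
  have ex: "\<exists>h\<in>mod_hom \<Z> T.T P. \<forall>x\<in>carrier H. \<forall>y\<in>carrier H. h (T.tns x y) = b x y"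
    by (rule T.tensor_hom_exists[OF P])
      (simp_all add: mod_hom_closed[OF b2h] mod_hom_add[OF b1] mod_hom_add[OF b2h] mod_hom_smult[OF b1] mod_hom_smult[OF b2h] del: Zmod_simps)
  then obtain h where h: "h \<in> mod_hom \<Z> T.T P" "\<And>x y. \<lbrakk>x \<in> carrier H; y \<in> carrier H\<rbrakk> \<Longrightarrow> h (T.tns x y) = b x y" by blast
  have "h (T.tns (g s) (g t)) = v s t" if "s \<in> S" "t \<in> S" for s t
    using that g_closed h(2)[of "g s" "g t"] bg[of s "g t"] ext(2)[OF P, of "v s" t] v by simp
  then have ex': "\<exists>h\<in>mod_hom \<Z> T.T P. \<forall>i\<in>S \<times> S. h ((\<lambda>(s, t). T.tns (g s) (g t)) i) = (\<lambda>(s, t). v s t) i"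
    using h(1) by (intro bexI[of _ h]) auto
  show "?l \<in> mod_hom \<Z> T.T P" by (rule lin_extI(1)[OF ex'])
  show "\<lbrakk>s \<in> S; t \<in> S\<rbrakk> \<Longrightarrow> ?l (T.tns (g s) (g t)) = v s t" using lin_extI(2)[OF ex', of "(s, t)"] by simp
qed

lemma tensor_map_hom:
  assumes f: "f \<in> mod_hom \<Z> H H" and f': "f' \<in> mod_hom \<Z> H H"
  shows "tensor_map \<Z> H H H H f f' \<in> mod_hom \<Z> T.T T.T"
    "\<lbrakk>x \<in> carrier H; y \<in> carrier H\<rbrakk> \<Longrightarrow> tensor_map \<Z> H H H H f f' (T.tns x y) = T.tns (f x) (f' y)"
proof -
  note s = mod_hom_closed[OF f] mod_hom_closed[OF f'] mod_hom_add[OF f] mod_hom_add[OF f']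
    mod_hom_smult[OF f] mod_hom_smult[OF f'] T.tns_add_left T.tns_add_right T.T_smult_tns T.tns_balanced[symmetric]
  show "tensor_map \<Z> H H H H f f' \<in> mod_hom \<Z> T.T T.T"
    unfolding tensor_map_def by (rule T.tensor_lift(1)[OF T.T_module]) (simp_all add: s del: Zmod_simps)
  show "\<lbrakk>x \<in> carrier H; y \<in> carrier H\<rbrakk> \<Longrightarrow> tensor_map \<Z> H H H H f f' (T.tns x y) = T.tns (f x) (f' y)"
    unfolding tensor_map_def by (rule T.tensor_lift(2)[OF T.T_module]) (simp_all add: s del: Zmod_simps)
qed

lemma mod_hom_id: "id \<in> mod_hom R M M"
  by (rule mod_homI) auto

lemma mod_hom_comp: "\<lbrakk>f \<in> mod_hom R M N; h \<in> mod_hom R N P\<rbrakk> \<Longrightarrow> h \<circ> f \<in> mod_hom R M P"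
  by (rule mod_homI) (auto simp: mod_hom_closed mod_hom_add mod_hom_smult)

text \<open>Both sides of each antipode identity are linear, so basis elements suffice. The
  coproduct is a sum over pairs \<open>l s i\<close>, \<open>r s i\<close>, the form common to both
  coalgebras, where the pairs are cuts.\<close>

lemma is_antipodeI:
  assumes mu: "\<mu> \<in> mod_hom \<Z> T.T H" and Delta: "\<Delta> \<in> mod_hom \<Z> H T.T" and eps: "\<epsilon> \<in> mod_hom \<Z> H Zself"
    and Sa: "Sa \<in> mod_hom \<Z> H H" and e: "e \<in> S"
    and u: "\<And>k. u k = k \<odot>\<^bsub>H\<^esub> g e"
    and eps_g: "\<And>s. s \<in> S \<Longrightarrow> \<epsilon> (g s) = (if s = e then 1 else 0)"
    and l: "\<And>s i. \<lbrakk>s \<in> S; i \<in> I s\<rbrakk> \<Longrightarrow> l s i \<in> S" and r: "\<And>s i. \<lbrakk>s \<in> S; i \<in> I s\<rbrakk> \<Longrightarrow> r s i \<in> S"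
    and fin: "\<And>s. finite (I s)"
    and Delta_g: "\<And>s. s \<in> S \<Longrightarrow> \<Delta> (g s) = (\<Oplus>\<^bsub>T.T\<^esub>i\<in>I s. T.tns (g (l s i)) (g (r s i)))"
    and left: "\<And>s. s \<in> S \<Longrightarrow> (\<Oplus>\<^bsub>H\<^esub>i\<in>I s. \<mu> (T.tns (Sa (g (l s i))) (g (r s i)))) = (if s = e then g e else \<zero>\<^bsub>H\<^esub>)"
    and right: "\<And>s. s \<in> S \<Longrightarrow> (\<Oplus>\<^bsub>H\<^esub>i\<in>I s. \<mu> (T.tns (g (l s i)) (Sa (g (r s i))))) = (if s = e then g e else \<zero>\<^bsub>H\<^esub>)"
  shows "is_antipode H \<mu> u \<Delta> \<epsilon> Sa"
proof -
  have conv: "convolution H \<mu> \<Delta> f f' \<in> mod_hom \<Z> H H"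
    "s \<in> S \<Longrightarrow> convolution H \<mu> \<Delta> f f' (g s) = (\<Oplus>\<^bsub>H\<^esub>i\<in>I s. \<mu> (T.tns (f (g (l s i))) (f' (g (r s i)))))"
    if f: "f \<in> mod_hom \<Z> H H" and f': "f' \<in> mod_hom \<Z> H H" for f f' s
  proof -
    note tm = tensor_map_hom[OF f f']
    have c: "\<mu> \<circ> tensor_map \<Z> H H H H f f' \<in> mod_hom \<Z> T.T H" using tm(1) mu by (rule mod_hom_comp)
    show "convolution H \<mu> \<Delta> f f' \<in> mod_hom \<Z> H H"
      unfolding convolution_def using Delta c by (rule mod_hom_comp)
    assume s: "s \<in> S"
    have lr: "g (l s i) \<in> carrier H" "g (r s i) \<in> carrier H" if "i \<in> I s" for i
      using l[OF s that] r[OF s that] g_closed by auto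
    have "convolution H \<mu> \<Delta> f f' (g s) = (\<mu> \<circ> tensor_map \<Z> H H H H f f') (\<Oplus>\<^bsub>T.T\<^esub>i\<in>I s. T.tns (g (l s i)) (g (r s i)))"
      by (simp add: convolution_def Delta_g[OF s])
    also have "\<dots> = (\<Oplus>\<^bsub>H\<^esub>i\<in>I s. (\<mu> \<circ> tensor_map \<Z> H H H H f f') (T.tns (g (l s i)) (g (r s i))))"
      by (rule mod_hom_finsum[OF T.T_module H_module c fin]) (rule T.tns_closed; rule lr; assumption)
    also have "\<dots> = (\<Oplus>\<^bsub>H\<^esub>i\<in>I s. \<mu> (T.tns (f (g (l s i))) (f' (g (r s i)))))"
    proof (rule Hm.M.finsum_cong')
      show "(\<lambda>i. \<mu> (T.tns (f (g (l s i))) (f' (g (r s i))))) \<in> I s \<rightarrow> carrier H"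
        by (rule Pi_I, rule mod_hom_closed[OF mu], rule T.tns_closed;
            (rule mod_hom_closed[OF f] mod_hom_closed[OF f'], rule lr, assumption))
    qed (use tm(2) lr in auto)
    finally show "convolution H \<mu> \<Delta> f f' (g s) = (\<Oplus>\<^bsub>H\<^esub>i\<in>I s. \<mu> (T.tns (f (g (l s i))) (f' (g (r s i)))))" .
  qed
  have ue: "(\<lambda>x. u (\<epsilon> x)) \<in> mod_hom \<Z> H H"
    unfolding Zmod_hom_iff[OF H_module H_module] hom_def
    using g_closed[OF e] mod_hom_add[OF eps] by (auto simp: u Zself_def G.int_pow_mult)
  have ueg: "u (\<epsilon> (g s)) = (if s = e then g e else \<zero>\<^bsub>H\<^esub>)" if "s \<in> S" for s
    using that g_closed[OF e] by (auto simp: u eps_g)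
  have "convolution H \<mu> \<Delta> Sa id x = u (\<epsilon> x)" if x: "x \<in> carrier H" for x
    by (rule H_eqI[OF H_module conv(1)[OF Sa mod_hom_id] ue _ x])
      (simp add: conv(2)[OF Sa mod_hom_id] ueg left del: Zmod_simps)
  moreover have "convolution H \<mu> \<Delta> id Sa x = u (\<epsilon> x)" if x: "x \<in> carrier H" for x
    by (rule H_eqI[OF H_module conv(1)[OF mod_hom_id Sa] ue _ x])
      (simp add: conv(2)[OF mod_hom_id Sa] ueg right del: Zmod_simps)
  ultimately show ?thesis unfolding is_antipode_def using Sa by blast
qed

end

lemma Zself_module: "module \<Z> Zself"
proof (rule moduleI)
  show "abelian_group Zself"
  proof (rule abelian_groupI)
    fix x assume "x \<in> carrier Zself"
    then show "\<exists>y\<in>carrier Zself. y \<oplus>\<^bsub>Zself\<^esub> x = \<zero>\<^bsub>Zself\<^esub>"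
      by (intro bexI[of _ "- x"]) (auto simp: Zself_def)
  qed (auto simp: Zself_def)
qed (auto simp: Zself_def int.is_cring algebra_simps)

section \<open>The antipode of \<open>Comp\<close>\<close>

interpretation C: zbasis "free_Abelian_group compositions" compositions frag_of id
proof (intro zbasis.intro zbasis_axioms.intro)
  show "Group.comm_group (free_Abelian_group compositions)" by (rule abelian_free_Abelian_group)
  show "id \<in> hom (free_Abelian_group compositions) (free_Abelian_group compositions)" by (simp add: hom_def)
  show "carrier (free_Abelian_group compositions) \<subseteq> generate (free_Abelian_group compositions) (frag_of ` compositions)"
  proof
    fix x :: "nat list \<Rightarrow>\<^sub>0 int" assume "x \<in> carrier (free_Abelian_group compositions)"
    then have "Poly_Mapping.keys x \<subseteq> compositions" by simp
    then show "x \<in> generate (free_Abelian_group compositions) (frag_of ` compositions)"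
    proof (induction x rule: free_Abelian_group_induct[consumes 1, case_names zero diff of])
      case zero then show ?case using generate.one[of "free_Abelian_group compositions"] by simp
    next
      case (diff x y)
      have sub: "frag_of ` compositions \<subseteq> carrier (free_Abelian_group compositions)" by auto
      have "inv\<^bsub>free_Abelian_group compositions\<^esub> y \<in> generate (free_Abelian_group compositions) (frag_of ` compositions)"
        using diff by (intro group.generate_m_inv_closed[OF group_free_Abelian_group sub]) auto
      then have "x \<otimes>\<^bsub>free_Abelian_group compositions\<^esub> (- y) \<in> generate (free_Abelian_group compositions) (frag_of ` compositions)"
        using diff by (intro generate.eng) auto
      then show ?case by simp
    next
      case (of a) then show ?case by (intro generate.incl) auto
    qed
  qed
qed auto

section \<open>The structure maps of Comp on basis elements\<close>

lemma compositions_iff: "\<alpha> \<in> compositions \<longleftrightarrow> composition (sum_list \<alpha>) \<alpha>"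
  by (simp add: compositions_def)

lemma composition_compositions: "composition n \<alpha> \<Longrightarrow> \<alpha> \<in> compositions"
  by (simp add: compositions_iff composition_sum_list)

lemma Nil_compositions: "[] \<in> compositions"
  by (simp add: compositions_iff)

lemma Comp_simps:
  "x \<in> carrier Comp \<longleftrightarrow> Poly_Mapping.keys x \<subseteq> compositions" "x \<oplus>\<^bsub>Comp\<^esub> y = x + y" "\<zero>\<^bsub>Comp\<^esub> = 0"
  "Poly_Mapping.keys x \<subseteq> compositions \<Longrightarrow> k \<odot>\<^bsub>Comp\<^esub> x = frag_cmul k x"
  by (simp_all add: Comp_def)

lemma Comp_module: "module \<Z> Comp"
  unfolding Comp_def by (rule C.H_module)

lemma Comp_finsum:
  assumes "finite I" "\<And>i. i \<in> I \<Longrightarrow> f i \<in> carrier Comp"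
  shows "(\<Oplus>\<^bsub>Comp\<^esub>i\<in>I. f i) = (\<Sum>i\<in>I. f i)"
proof -
  interpret Cm: module \<Z> Comp by (rule Comp_module)
  show ?thesis using assms
  proof (induction I rule: finite_induct)
    case (insert i I)
    then have "f \<in> I \<rightarrow> carrier Comp" by auto
    then show ?case using insert by (simp add: Comp_simps(2))
  qed (simp add: Comp_simps)
qed

lemma comp_upto_compositions:
  assumes "\<alpha> \<in> compositions" "i \<in> {0..sum_list \<alpha>}"
  shows "comp_upto \<alpha> i \<in> compositions" "comp_after \<alpha> i \<in> compositions"
    "sum_list (comp_upto \<alpha> i) = i" "sum_list (comp_after \<alpha> i) = sum_list \<alpha> - i"
  using comp_upto[of "sum_list \<alpha>" \<alpha> i] comp_after[of "sum_list \<alpha>" \<alpha> i] assms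
  by (auto simp: compositions_iff[of \<alpha>] intro: composition_compositions composition_sum_list)

lemma comp_compl_compositions:
  assumes "\<alpha> \<in> compositions"
  shows "comp_compl \<alpha> \<in> compositions" "sum_list (comp_compl \<alpha>) = sum_list \<alpha>"
  using comp_compl[of "sum_list \<alpha>" \<alpha>] assms
  by (auto simp: compositions_iff[of \<alpha>] intro: composition_compositions composition_sum_list)

lemma comp_prod_closed:
  assumes "\<alpha> \<in> compositions" "\<beta> \<in> compositions"
  shows "Poly_Mapping.keys (comp_prod \<alpha> \<beta>) \<subseteq> compositions"
proof (cases "\<alpha> = [] \<or> \<beta> = []")
  case False
  have "\<alpha> @ \<beta> \<in> compositions" "near_concat \<alpha> \<beta> \<in> compositions"
    using composition_compositions[OF composition_append[of "sum_list \<alpha>" \<alpha> "sum_list \<beta>" \<beta>]]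
      composition_compositions[OF composition_near_concat[of \<alpha> \<beta> "sum_list \<alpha>" "sum_list \<beta>"]] False assms
    by (auto simp: compositions_iff[of \<alpha>] compositions_iff[of \<beta>])
  then show ?thesis
    using False keys_add[of "frag_of (\<alpha> @ \<beta>)" "frag_of (near_concat \<alpha> \<beta>)"] by (auto simp: comp_prod_def)
qed (use assms in \<open>auto simp: comp_prod_def\<close>)

lemma Comp_mult:
  "Comp_mult \<in> mod_hom \<Z> (tensor \<Z> Comp Comp) Comp"
  "\<lbrakk>\<alpha> \<in> compositions; \<beta> \<in> compositions\<rbrakk> \<Longrightarrow>
    Comp_mult (tens \<Z> Comp Comp (frag_of \<alpha>) (frag_of \<beta>)) = comp_prod \<alpha> \<beta>"
proof -
  have c: "comp_prod \<alpha> \<beta> \<in> carrier (Zmod (free_Abelian_group compositions))"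
    if "\<alpha> \<in> compositions" "\<beta> \<in> compositions" for \<alpha> \<beta>
    using comp_prod_closed[OF that] by simp
  show "Comp_mult \<in> mod_hom \<Z> (tensor \<Z> Comp Comp) Comp"
    unfolding Comp_mult_def Comp_def by (rule C.bilinear_ext(1)[OF C.H_module c])
  show "\<lbrakk>\<alpha> \<in> compositions; \<beta> \<in> compositions\<rbrakk> \<Longrightarrow>
    Comp_mult (tens \<Z> Comp Comp (frag_of \<alpha>) (frag_of \<beta>)) = comp_prod \<alpha> \<beta>"
    unfolding Comp_mult_def Comp_def by (rule C.bilinear_ext(2)[OF C.H_module c])
qed

lemma Comp_comult:
  "Comp_comult \<in> mod_hom \<Z> Comp (tensor \<Z> Comp Comp)"
  "\<alpha> \<in> compositions \<Longrightarrow> Comp_comult (frag_of \<alpha>) =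
    (\<Oplus>\<^bsub>tensor \<Z> Comp Comp\<^esub>i\<in>{0..sum_list \<alpha>}. tens \<Z> Comp Comp (frag_of (comp_upto \<alpha> i)) (frag_of (comp_after \<alpha> i)))"
proof -
  let ?v = "\<lambda>\<alpha>. \<Oplus>\<^bsub>tensor \<Z> Comp Comp\<^esub>i\<in>{0..sum_list \<alpha>}. tens \<Z> Comp Comp (frag_of (comp_upto \<alpha> i)) (frag_of (comp_after \<alpha> i))"
  have v: "?v \<alpha> \<in> carrier C.T.T" if "\<alpha> \<in> compositions" for \<alpha>
    unfolding Comp_def using comp_upto_compositions[OF that] by (intro C.T.T.finsum_closed Pi_I C.T.tns_closed) auto
  show "Comp_comult \<in> mod_hom \<Z> Comp (tensor \<Z> Comp Comp)"
    using C.ext(1)[OF C.T.T_module v] unfolding Comp_comult_def C.ext_def Comp_def .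
  show "\<alpha> \<in> compositions \<Longrightarrow> Comp_comult (frag_of \<alpha>) = ?v \<alpha>"
    using C.ext(2)[OF C.T.T_module v] unfolding Comp_comult_def C.ext_def Comp_def .
qed

lemma Comp_counit:
  "Comp_counit \<in> mod_hom \<Z> Comp Zself"
  "\<alpha> \<in> compositions \<Longrightarrow> Comp_counit (frag_of \<alpha>) = (if \<alpha> = [] then 1 else 0)"
proof -
  have v: "(if \<alpha> = [] then 1 else 0) \<in> carrier Zself" for \<alpha> :: "nat list" by (simp add: Zself_def)
  show "Comp_counit \<in> mod_hom \<Z> Comp Zself"
    using C.ext(1)[OF Zself_module v] unfolding Comp_counit_def C.ext_def Comp_def .
  show "\<alpha> \<in> compositions \<Longrightarrow> Comp_counit (frag_of \<alpha>) = (if \<alpha> = [] then 1 else 0)"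
    using C.ext(2)[OF Zself_module v] unfolding Comp_counit_def C.ext_def Comp_def .
qed

lemma Comp_S:
  "Comp_S \<in> mod_hom \<Z> Comp Comp"
  "\<alpha> \<in> compositions \<Longrightarrow> Comp_S (frag_of \<alpha>) = frag_cmul ((-1) ^ sum_list \<alpha>) (frag_of (comp_compl \<alpha>))"
proof -
  let ?v = "\<lambda>\<alpha>. (-1) ^ sum_list \<alpha> \<odot>\<^bsub>Comp\<^esub> frag_of (comp_compl \<alpha>)"
  have eq: "?v \<alpha> = frag_cmul ((-1) ^ sum_list \<alpha>) (frag_of (comp_compl \<alpha>))" if "\<alpha> \<in> compositions" for \<alpha>
    using comp_compl_compositions[OF that] by (simp add: Comp_simps)
  have v: "?v \<alpha> \<in> carrier C.H" if "\<alpha> \<in> compositions" for \<alpha>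
    using comp_compl_compositions[OF that] keys_cmul[of "(-1) ^ sum_list \<alpha>" "frag_of (comp_compl \<alpha>)"]
    unfolding eq[OF that] by auto
  show "Comp_S \<in> mod_hom \<Z> Comp Comp"
    using C.ext(1)[OF C.H_module v] unfolding Comp_S_def C.ext_def Comp_def .
  show "\<alpha> \<in> compositions \<Longrightarrow> Comp_S (frag_of \<alpha>) = frag_cmul ((-1) ^ sum_list \<alpha>) (frag_of (comp_compl \<alpha>))"
    using C.ext(2)[OF C.H_module v] eq unfolding Comp_S_def C.ext_def Comp_def by simp
qed

lemma comp_compl_Nil: "comp_compl [] = []"
  using comp_compl(1)[of 0 "[]"] composition_eq_Nil_iff[of 0 "comp_compl []"] by simp

text \<open>This is \<open>telescoping\<close> with the complement of the descent set in front and
  the descent set behind, since complementing a prefix is cutting the complement.\<close>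

lemma comp_left_cancel:
  assumes "\<alpha> \<in> compositions"
  shows "(\<Sum>i\<in>{0..sum_list \<alpha>}. frag_cmul ((-1) ^ i) (comp_prod (comp_compl (comp_upto \<alpha> i)) (comp_after \<alpha> i))) =
    (if \<alpha> = [] then frag_of [] else 0)"
proof (cases "\<alpha> = []")
  case True
  then show ?thesis by (simp add: comp_prod_def comp_compl_Nil)
next
  case False
  define n where "n = sum_list \<alpha>"
  have c: "composition n \<alpha>" using assms by (simp add: n_def compositions_iff)
  note D = descents_bounds[OF c]
  have n: "0 < n" using False composition_eq_Nil_iff[OF c] by simp
  let ?A = "{1..<n} - descents \<alpha>"
  have "comp_compl (comp_upto \<alpha> i) = comp_of i {d \<in> ?A. d < i}"
    "comp_after \<alpha> i = comp_of (n - i) {d. d > 0 \<and> d + i \<in> descents \<alpha>}" if "i \<in> {0..n}" for i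
  proof -
    have i: "i \<le> n" using that by simp
    have "{1..<i} - descents (comp_upto \<alpha> i) = {d \<in> ?A. d < i}"
      unfolding conjunct2[OF comp_upto[OF c i]] using i by auto
    then show "comp_compl (comp_upto \<alpha> i) = comp_of i {d \<in> ?A. d < i}"
      using comp_compl_eq[OF conjunct1[OF comp_upto[OF c i]]] by simp
    show "comp_after \<alpha> i = comp_of (n - i) {d. d > 0 \<and> d + i \<in> descents \<alpha>}"
      by (intro comp_of_eqI[symmetric] conjunct1[OF comp_after[OF c i]] conjunct2[OF comp_after[OF c i]])
  qed
  then have "(\<Sum>i\<in>{0..n}. frag_cmul ((-1) ^ i) (comp_prod (comp_compl (comp_upto \<alpha> i)) (comp_after \<alpha> i))) =
      (\<Sum>i\<in>{0..n}. frag_cmul ((-1) ^ i)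
        (comp_prod (comp_of i {d \<in> ?A. d < i}) (comp_of (n - i) {d. d > 0 \<and> d + i \<in> descents \<alpha>})))"
    by (intro sum.cong refl) (simp only:)
  also have "\<dots> = 0" by (rule telescoping[OF n]) (use D in auto)
  finally show ?thesis using False by (simp add: n_def)
qed

text \<open>Here the descent set is in front and its complement behind. The sign comes from the
  second piece, and (-1)^(n-i) = (-1)^n (-1)^i brings the sum into the form of
  \<open>telescoping\<close>.\<close>

lemma comp_right_cancel:
  assumes "\<alpha> \<in> compositions"
  shows "(\<Sum>i\<in>{0..sum_list \<alpha>}. frag_cmul ((-1) ^ (sum_list \<alpha> - i)) (comp_prod (comp_upto \<alpha> i) (comp_compl (comp_after \<alpha> i)))) =
    (if \<alpha> = [] then frag_of [] else 0)"
proof (cases "\<alpha> = []")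
  case True
  then show ?thesis by (simp add: comp_prod_def comp_compl_Nil)
next
  case False
  define n where "n = sum_list \<alpha>"
  have c: "composition n \<alpha>" using assms by (simp add: n_def compositions_iff)
  note D = descents_bounds[OF c]
  have n: "0 < n" using False composition_eq_Nil_iff[OF c] by simp
  let ?B = "{1..<n} - descents \<alpha>"
  let ?t = "\<lambda>i. comp_prod (comp_of i {d \<in> descents \<alpha>. d < i}) (comp_of (n - i) {d. d > 0 \<and> d + i \<in> ?B})"
  have "frag_cmul ((-1) ^ (n - i)) (comp_prod (comp_upto \<alpha> i) (comp_compl (comp_after \<alpha> i))) =
      frag_cmul ((-1) ^ n) (frag_cmul ((-1) ^ i) (?t i))" if "i \<in> {0..n}" for i
  proof -
    have i: "i \<le> n" using that by simp
    have "{1..<n - i} - descents (comp_after \<alpha> i) = {d. d > 0 \<and> d + i \<in> ?B}"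
      unfolding conjunct2[OF comp_after[OF c i]] using i by auto
    then have "comp_compl (comp_after \<alpha> i) = comp_of (n - i) {d. d > 0 \<and> d + i \<in> ?B}"
      using comp_compl_eq[OF conjunct1[OF comp_after[OF c i]]] by simp
    moreover have "comp_upto \<alpha> i = comp_of i {d \<in> descents \<alpha>. d < i}"
      by (intro comp_of_eqI[symmetric] conjunct1[OF comp_upto[OF c i]] conjunct2[OF comp_upto[OF c i]])
    moreover have "((-1) :: int) ^ (n - i) = (-1) ^ n * (-1) ^ i"
    proof -
      have "((-1) :: int) ^ n = (-1) ^ (n - i) * (-1) ^ i"
        unfolding power_add[symmetric] using i by simp
      moreover have "((-1) :: int) ^ i * (-1) ^ i = 1"
        unfolding power_mult_distrib[symmetric] by simp
      ultimately show ?thesis by (simp only: mult.assoc mult_1_right)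
    qed
    ultimately show ?thesis by simp
  qed
  then have "(\<Sum>i\<in>{0..n}. frag_cmul ((-1) ^ (n - i)) (comp_prod (comp_upto \<alpha> i) (comp_compl (comp_after \<alpha> i)))) =
      frag_cmul ((-1) ^ n) (\<Sum>i\<in>{0..n}. frag_cmul ((-1) ^ i) (?t i))"
    unfolding frag_cmul_sum by (rule sum.cong[OF refl])
  also have "\<dots> = frag_cmul ((-1) ^ n) 0" by (rule arg_cong, rule telescoping[OF n]) (use D in auto)
  finally show ?thesis using False by (simp add: n_def)
qed

text \<open>The antipode produces signed basis elements, and the sign has to pass through the
  product in either factor.\<close>

lemma mult_scaled:
  assumes h: "h \<in> mod_hom \<Z> (tensor \<Z> M M) P" and M: "module \<Z> M" and xy: "x \<in> carrier M" "y \<in> carrier M"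
  shows "h (tens \<Z> M M (k \<odot>\<^bsub>M\<^esub> x) y) = k \<odot>\<^bsub>P\<^esub> h (tens \<Z> M M x y)"
    "h (tens \<Z> M M x (k \<odot>\<^bsub>M\<^esub> y)) = k \<odot>\<^bsub>P\<^esub> h (tens \<Z> M M x y)"
proof -
  interpret T: tensor_product \<Z> M M by (intro tensor_product.intro M)
  have e: "tens \<Z> M M (k \<odot>\<^bsub>M\<^esub> x) y = k \<odot>\<^bsub>T.T\<^esub> tens \<Z> M M x y"
    using T.T_smult_tns[of k x y] xy by simp
  then show "h (tens \<Z> M M (k \<odot>\<^bsub>M\<^esub> x) y) = k \<odot>\<^bsub>P\<^esub> h (tens \<Z> M M x y)"
    using mod_hom_smult[OF h, of k "tens \<Z> M M x y"] xy by simp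
  then show "h (tens \<Z> M M x (k \<odot>\<^bsub>M\<^esub> y)) = k \<odot>\<^bsub>P\<^esub> h (tens \<Z> M M x y)"
    using T.tns_balanced[of k x y] xy by simp
qed

text \<open>On a composition each convolution term is a sign times \<open>comp_prod\<close>. The
  exponent is the size of the piece that \<open>Comp_S\<close> meets: \<open>i\<close> on the left,
  \<open>sum_list \<alpha> - i\<close> on the right.\<close>

theorem Comp_antipode: "is_antipode Comp Comp_mult Comp_unit Comp_comult Comp_counit Comp_S"
  unfolding Comp_def
proof (rule C.is_antipodeI[where e = "[]" and I = "\<lambda>\<alpha>. {0..sum_list \<alpha>}" and l = comp_upto and r = comp_after];
    (unfold Comp_def[symmetric])?)
  fix \<alpha> assume \<alpha>: "\<alpha> \<in> compositions"
  note cc = comp_upto_compositions[OF \<alpha>]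
  have cl: "Comp_mult (tens \<Z> Comp Comp (Comp_S (frag_of (comp_upto \<alpha> i))) (frag_of (comp_after \<alpha> i))) =
      frag_cmul ((-1) ^ i) (comp_prod (comp_compl (comp_upto \<alpha> i)) (comp_after \<alpha> i))" if i: "i \<in> {0..sum_list \<alpha>}" for i
  proof -
    note k = comp_compl_compositions[OF cc(1)[OF i]]
    have "Comp_S (frag_of (comp_upto \<alpha> i)) = (-1) ^ i \<odot>\<^bsub>Comp\<^esub> frag_of (comp_compl (comp_upto \<alpha> i))"
      using k cc[OF i] by (simp add: Comp_S(2) Comp_simps)
    then show ?thesis
      using mult_scaled(1)[OF Comp_mult(1) Comp_module, of "frag_of (comp_compl (comp_upto \<alpha> i))" "frag_of (comp_after \<alpha> i)" "(-1) ^ i"]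
        k cc[OF i] comp_prod_closed[OF k(1) cc(2)[OF i]] by (simp add: Comp_simps Comp_mult(2))
  qed
  have cr: "Comp_mult (tens \<Z> Comp Comp (frag_of (comp_upto \<alpha> i)) (Comp_S (frag_of (comp_after \<alpha> i)))) =
      frag_cmul ((-1) ^ (sum_list \<alpha> - i)) (comp_prod (comp_upto \<alpha> i) (comp_compl (comp_after \<alpha> i)))" if i: "i \<in> {0..sum_list \<alpha>}" for i
  proof -
    note k = comp_compl_compositions[OF cc(2)[OF i]]
    have "Comp_S (frag_of (comp_after \<alpha> i)) = (-1) ^ (sum_list \<alpha> - i) \<odot>\<^bsub>Comp\<^esub> frag_of (comp_compl (comp_after \<alpha> i))"
      using k cc[OF i] by (simp add: Comp_S(2) Comp_simps)
    then show ?thesis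
      using mult_scaled(2)[OF Comp_mult(1) Comp_module, of "frag_of (comp_upto \<alpha> i)" "frag_of (comp_compl (comp_after \<alpha> i))" "(-1) ^ (sum_list \<alpha> - i)"]
        k cc[OF i] comp_prod_closed[OF cc(1)[OF i] k(1)] by (simp add: Comp_simps Comp_mult(2))
  qed
  have keys_scaled: "frag_cmul k x \<in> carrier Comp" if "Poly_Mapping.keys x \<subseteq> compositions" for k x
    using that keys_cmul[of k x] by (auto simp: Comp_simps(1))
  have c1: "frag_cmul ((-1) ^ i) (comp_prod (comp_compl (comp_upto \<alpha> i)) (comp_after \<alpha> i)) \<in> carrier Comp"
    and c2: "frag_cmul ((-1) ^ (sum_list \<alpha> - i)) (comp_prod (comp_upto \<alpha> i) (comp_compl (comp_after \<alpha> i))) \<in> carrier Comp"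
    if "i \<in> {0..sum_list \<alpha>}" for i
    by (intro keys_scaled comp_prod_closed comp_compl_compositions cc that)+
  have "(\<Oplus>\<^bsub>Comp\<^esub>i\<in>{0..sum_list \<alpha>}. Comp_mult (tens \<Z> Comp Comp (Comp_S (frag_of (comp_upto \<alpha> i))) (frag_of (comp_after \<alpha> i)))) =
      (\<Sum>i\<in>{0..sum_list \<alpha>}. frag_cmul ((-1) ^ i) (comp_prod (comp_compl (comp_upto \<alpha> i)) (comp_after \<alpha> i)))"
    using c1 by (subst Comp_finsum) (auto simp only: cl finite_atLeastAtMost intro!: sum.cong)
  then show "(\<Oplus>\<^bsub>Comp\<^esub>i\<in>{0..sum_list \<alpha>}. Comp_mult (tens \<Z> Comp Comp (Comp_S (frag_of (comp_upto \<alpha> i))) (frag_of (comp_after \<alpha> i)))) =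
      (if \<alpha> = [] then frag_of [] else \<zero>\<^bsub>Comp\<^esub>)"
    by (simp add: comp_left_cancel[OF \<alpha>] Comp_simps)
  have "(\<Oplus>\<^bsub>Comp\<^esub>i\<in>{0..sum_list \<alpha>}. Comp_mult (tens \<Z> Comp Comp (frag_of (comp_upto \<alpha> i)) (Comp_S (frag_of (comp_after \<alpha> i))))) =
      (\<Sum>i\<in>{0..sum_list \<alpha>}. frag_cmul ((-1) ^ (sum_list \<alpha> - i)) (comp_prod (comp_upto \<alpha> i) (comp_compl (comp_after \<alpha> i))))"
    using c2 by (subst Comp_finsum) (auto simp only: cr finite_atLeastAtMost intro!: sum.cong)
  then show "(\<Oplus>\<^bsub>Comp\<^esub>i\<in>{0..sum_list \<alpha>}. Comp_mult (tens \<Z> Comp Comp (frag_of (comp_upto \<alpha> i)) (Comp_S (frag_of (comp_after \<alpha> i))))) =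
      (if \<alpha> = [] then frag_of [] else \<zero>\<^bsub>Comp\<^esub>)"
    by (simp add: comp_right_cancel[OF \<alpha>] Comp_simps)
qed (simp_all add: Comp_mult(1) Comp_comult Comp_counit Comp_S(1) Nil_compositions Comp_unit_def comp_upto_compositions)

section \<open>The basis of simple classes of \<open>G\<^sub>0(\<H>\<^sub>\<bullet>)\<close>\<close>

abbreviation G0H :: "nat \<Rightarrow> 'f::field mpoly set G0_elem monoid" where
  "G0H n \<equiv> G0 (Halg n :: ('f, 'f mpoly set) module)"

abbreviation hclass :: "nat \<Rightarrow> nat list \<Rightarrow> 'f::field mpoly set G0_elem" where
  "hclass n \<alpha> \<equiv> G0_class (Halg n :: ('f, 'f mpoly set) module) (Csimple \<alpha>)"

definition GHgrp :: "'f::field GH_elem monoid" where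
  "GHgrp = sum_group UNIV G0H"

lemma GH_eq: "GH = Zmod GHgrp"
  by (simp add: GH_def GHgrp_def)

lemma G0H_comm_group: "comm_group (G0H n :: 'f::field mpoly set G0_elem monoid)"
  by (rule split_algebra.G0_comm_group[OF Halg_split])

lemma G0H_group: "group (G0H n :: 'f::field mpoly set G0_elem monoid)"
  using G0H_comm_group by (rule comm_group.axioms)

lemma G0H_monoid: "monoid (G0H n :: 'f::field mpoly set G0_elem monoid)"
  using G0H_group by (rule group.is_monoid)

lemma hclass_simple:
  "split_algebra.simple_class (Halg n :: ('f::field, 'f mpoly set) module) hchar \<alpha> = hclass n \<alpha>"
  by (simp add: split_algebra.simple_class_def[OF Halg_split] Csimple_eq)

lemma hclass_closed: "inner_gt1 n \<alpha> \<Longrightarrow> (hclass n \<alpha> :: 'f::field mpoly set G0_elem) \<in> carrier (G0H n)"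
  using split_algebra.simple_class_closed[OF Halg_split, of \<alpha> n] by (simp add: hclass_simple)

lemma GHgrp_carrier:
  "x \<in> carrier (GHgrp :: 'f::field GH_elem monoid) \<longleftrightarrow> (\<forall>n. x n \<in> carrier (G0H n)) \<and> finite {n. x n \<noteq> \<one>\<^bsub>G0H n\<^esub>}"
  using carrier_sum_group[of UNIV "G0H :: nat \<Rightarrow> 'f mpoly set G0_elem monoid"] G0H_group
  by (auto simp: GHgrp_def PiE_iff)

lemma GHgrp_mult: "x \<otimes>\<^bsub>GHgrp\<^esub> y = (\<lambda>n. x n \<otimes>\<^bsub>G0H n\<^esub> (y n :: 'f::field mpoly set G0_elem))"
  and GHgrp_one: "\<one>\<^bsub>GHgrp\<^esub> = (\<lambda>n. \<one>\<^bsub>G0H n\<^esub> :: 'f::field mpoly set G0_elem)"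
  by (auto simp: GHgrp_def)

lemma GHgrp_comm_group: "comm_group (GHgrp :: 'f::field GH_elem monoid)"
proof (rule group.group_comm_groupI)
  show "group (GHgrp :: 'f GH_elem monoid)" unfolding GHgrp_def using G0H_group by (intro sum_group) auto
  fix x y :: "'f GH_elem" assume "x \<in> carrier GHgrp" "y \<in> carrier GHgrp"
  then show "x \<otimes>\<^bsub>GHgrp\<^esub> y = y \<otimes>\<^bsub>GHgrp\<^esub> x"
    unfolding GHgrp_mult GHgrp_carrier
    by (intro ext comm_monoid.m_comm[OF comm_group.axioms(1)[OF G0H_comm_group]]) auto
qed

definition in_degree :: "nat \<Rightarrow> 'f::field mpoly set G0_elem \<Rightarrow> 'f GH_elem" where
  "in_degree n X = (\<lambda>k. if k = n then X else \<one>\<^bsub>G0H k\<^esub>)"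

lemma in_degree_hom: "in_degree n \<in> hom (G0H n) (GHgrp :: 'f::field GH_elem monoid)"
proof (rule homI)
  have one: "\<one>\<^bsub>G0H k\<^esub> \<in> carrier (G0H k :: 'f mpoly set G0_elem monoid)" for k
    by (rule monoid.one_closed[OF G0H_monoid])
  fix X :: "'f mpoly set G0_elem" assume X: "X \<in> carrier (G0H n)"
  have "{k. in_degree n X k \<noteq> \<one>\<^bsub>G0H k\<^esub>} \<subseteq> {n}" by (auto simp: in_degree_def)
  then show "in_degree n X \<in> carrier GHgrp"
    using X one finite_subset by (auto simp: GHgrp_carrier in_degree_def)
next
  fix X Y :: "'f mpoly set G0_elem" assume "X \<in> carrier (G0H n)" "Y \<in> carrier (G0H n)"
  then show "in_degree n (X \<otimes>\<^bsub>G0H n\<^esub> Y) = in_degree n X \<otimes>\<^bsub>GHgrp\<^esub> in_degree n Y"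
    by (auto simp: GHgrp_mult in_degree_def fun_eq_iff monoid.l_one[OF G0H_monoid] monoid.one_closed[OF G0H_monoid])
qed

lemma GH_class_eq: "GH_class n M = in_degree n (G0_class (Halg n) M)"
  by (simp add: GH_class_def in_degree_def)

lemma Cclass_eq: "inner_gt1 n \<alpha> \<Longrightarrow> Cclass \<alpha> = in_degree n (hclass n \<alpha>)"
  by (simp add: Cclass_def GH_class_eq inner_gt1_sum_list)

lemma Cclass_closed: "\<alpha> \<in> simple_index \<Longrightarrow> Cclass \<alpha> \<in> carrier (GHgrp :: 'f::field GH_elem monoid)"
  using hom_in_carrier[OF in_degree_hom hclass_closed] by (simp add: simple_index_iff Cclass_eq)

definition G0_coord :: "nat \<Rightarrow> 'f::field mpoly set G0_elem \<Rightarrow> nat list \<Rightarrow>\<^sub>0 int" where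
  "G0_coord n = (SOME h. h \<in> hom (G0H n) (free_Abelian_group simple_index) \<and>
     (\<forall>\<alpha>. inner_gt1 n \<alpha> \<longrightarrow> h (hclass n \<alpha>) = frag_of \<alpha>))"

lemma G0_coord:
  "(G0_coord n :: 'f::field mpoly set G0_elem \<Rightarrow> _) \<in> hom (G0H n) (free_Abelian_group simple_index)"
  "inner_gt1 n \<alpha> \<Longrightarrow> G0_coord n (hclass n \<alpha> :: 'f mpoly set G0_elem) = frag_of \<alpha>"
proof -
  have "\<exists>h\<in>hom (G0H n) (free_Abelian_group simple_index). \<forall>\<alpha>\<in>{\<alpha>. inner_gt1 n \<alpha>}.
      h (split_algebra.simple_class (Halg n :: ('f, 'f mpoly set) module) hchar \<alpha>) = frag_of \<alpha>"
    by (rule split_algebra.G0_universal[OF Halg_split abelian_free_Abelian_group])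
      (auto simp: inner_gt1_simple_index)
  then have "\<exists>h. h \<in> hom (G0H n) (free_Abelian_group simple_index) \<and>
     (\<forall>\<alpha>. inner_gt1 n \<alpha> \<longrightarrow> h (hclass n \<alpha> :: 'f mpoly set G0_elem) = frag_of \<alpha>)"
    unfolding hclass_simple by auto
  from someI_ex[OF this, folded G0_coord_def]
  show "(G0_coord n :: 'f mpoly set G0_elem \<Rightarrow> _) \<in> hom (G0H n) (free_Abelian_group simple_index)"
    "inner_gt1 n \<alpha> \<Longrightarrow> G0_coord n (hclass n \<alpha> :: 'f mpoly set G0_elem) = frag_of \<alpha>" by auto
qed

text \<open>A member of the direct sum is trivial in almost all degrees, and \<open>gfinprod\<close>
  multiplies only over the indices with nontrivial value.\<close>

definition GH_coord :: "'f::field GH_elem \<Rightarrow> nat list \<Rightarrow>\<^sub>0 int" where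
  "GH_coord x = gfinprod (free_Abelian_group simple_index) (\<lambda>n. G0_coord n (x n)) UNIV"

lemma GH_coord_in_degree:
  assumes "X \<in> carrier (G0H n)"
  shows "GH_coord (in_degree n X :: 'f::field GH_elem) = G0_coord n X"
proof -
  interpret FA: comm_group "free_Abelian_group simple_index" by (rule abelian_free_Abelian_group)
  have one: "G0_coord k (\<one>\<^bsub>G0H k\<^esub> :: 'f mpoly set G0_elem) = \<one>\<^bsub>free_Abelian_group simple_index\<^esub>" for k
    by (rule hom_one[OF G0_coord(1) G0H_group FA.is_group])
  have c: "G0_coord n X \<in> carrier (free_Abelian_group simple_index)"
    by (rule hom_in_carrier[OF G0_coord(1) assms])
  have "GH_coord (in_degree n X) = gfinprod (free_Abelian_group simple_index) (\<lambda>k. G0_coord k (in_degree n X k)) {n}"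
    unfolding GH_coord_def
  proof (rule FA.gfinprod_mono_neutral_cong_right)
    show "(\<lambda>k. G0_coord k (in_degree n X k)) \<in> UNIV \<rightarrow> carrier (free_Abelian_group simple_index)"
      using c one FA.one_closed by (auto simp: in_degree_def simp del: carrier_free_Abelian_group_iff one_free_Abelian_group)
  qed (auto simp: in_degree_def one simp del: one_free_Abelian_group)
  also have "\<dots> = G0_coord n X"
    using c by (subst FA.gfinprod_eq_finprod) (auto simp: in_degree_def simp del: carrier_free_Abelian_group_iff)
  finally show ?thesis .
qed

text \<open>Induction on a finite set of degrees containing the support, splitting off one degree at
  a time; within a degree \<open>G0_induct\<close> applies.\<close>

lemma GHgrp_generated:
  "carrier (GHgrp :: 'f::field GH_elem monoid) \<subseteq> generate GHgrp (Cclass ` simple_index)"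
proof
  interpret S: comm_group "GHgrp :: 'f GH_elem monoid" by (rule GHgrp_comm_group)
  let ?E = "generate GHgrp (Cclass ` simple_index) :: 'f GH_elem set"
  have sub: "Cclass ` simple_index \<subseteq> carrier (GHgrp :: 'f GH_elem monoid)" using Cclass_closed by auto
  have deg: "in_degree n X \<in> ?E" if "X \<in> carrier (G0H n)" for n X
  proof -
    interpret H: split_algebra "Halg n :: ('f, 'f mpoly set) module" "{\<alpha>. inner_gt1 n \<alpha>}" hchar by (rule Halg_split)
    interpret gh: group_hom "G0H n :: 'f mpoly set G0_elem monoid" GHgrp "in_degree n"
      by unfold_locales (rule in_degree_hom)
    show ?thesis using that
    proof (induction X rule: H.G0_induct)
      case (simple \<alpha>)
      then have "in_degree n (H.simple_class \<alpha>) = Cclass \<alpha>" by (simp add: hclass_simple Cclass_eq)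
      then show ?case using simple by (auto intro!: generate.incl simp: inner_gt1_simple_index)
    next
      case (mult X Y) then show ?case using generate.eng by (simp add: gh.hom_mult)
    next
      case (inv X) then show ?case using S.generate_m_inv_closed[OF sub] by (simp add: gh.hom_inv)
    next
      case one then show ?case using generate.one by (simp add: gh.hom_one)
    qed
  qed
  have "x \<in> ?E" if "finite T" "x \<in> carrier GHgrp" "{n. x n \<noteq> \<one>\<^bsub>G0H n\<^esub>} \<subseteq> T" for T and x :: "'f GH_elem"
    using that
  proof (induction T arbitrary: x rule: finite_induct)
    case empty
    then have "x = \<one>\<^bsub>GHgrp\<^esub>" by (auto simp: GHgrp_one)
    then show ?case by (simp only: generate.one)
  next
    case (insert n T)
    define y where "y = x(n := \<one>\<^bsub>G0H n\<^esub>)"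
    have xc: "\<And>k. x k \<in> carrier (G0H k)" using insert.prems by (simp add: GHgrp_carrier)
    have one: "\<one>\<^bsub>G0H k\<^esub> \<in> carrier (G0H k :: 'f mpoly set G0_elem monoid)" for k
      by (rule monoid.one_closed[OF G0H_monoid])
    have sup: "{k. y k \<noteq> \<one>\<^bsub>G0H k\<^esub>} \<subseteq> T" using insert.prems by (auto simp: y_def)
    then have "y \<in> carrier GHgrp"
      using xc one finite_subset[OF sup insert.hyps(1)] by (auto simp: GHgrp_carrier y_def)
    then have "y \<in> ?E" using sup by (rule insert.IH)
    moreover have "x = in_degree n (x n) \<otimes>\<^bsub>GHgrp\<^esub> y"
      using xc by (auto simp: GHgrp_mult in_degree_def y_def fun_eq_iff monoid.l_one[OF G0H_monoid] monoid.r_one[OF G0H_monoid])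
    ultimately show ?case using generate.eng[OF deg[OF xc]] by metis
  qed
  then show "x \<in> ?E" if "x \<in> carrier GHgrp" for x
    using that GHgrp_carrier by blast
qed

interpretation B: zbasis "GHgrp :: 'f::field GH_elem monoid" simple_index Cclass GH_coord
proof (intro zbasis.intro zbasis_axioms.intro)
  show "Group.comm_group (GHgrp :: 'f GH_elem monoid)" by (rule GHgrp_comm_group)
  show "(GH_coord :: 'f GH_elem \<Rightarrow> _) \<in> hom GHgrp (free_Abelian_group simple_index)"
    unfolding GH_coord_def[abs_def] GHgrp_def
    by (rule comm_group.hom_group_sum[OF abelian_free_Abelian_group G0_coord(1) G0H_group])
  show "GH_coord (Cclass \<alpha> :: 'f GH_elem) = frag_of \<alpha>" if "\<alpha> \<in> simple_index" for \<alpha>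
    using that by (simp add: simple_index_iff Cclass_eq GH_coord_in_degree hclass_closed G0_coord(2))
qed (simp_all add: Cclass_closed GHgrp_generated)

lemma GH_module: "module \<Z> (GH :: (int, 'f::field GH_elem) module)"
  unfolding GH_eq by (rule B.H_module)

lemma in_degree_finprod:
  assumes "finite K" "\<And>k. k \<in> K \<Longrightarrow> f k \<in> carrier (G0H n)"
  shows "in_degree n (\<Otimes>\<^bsub>G0H n\<^esub>k\<in>K. f k) = (\<Oplus>\<^bsub>GH\<^esub>k\<in>K. in_degree n (f k) :: 'f::field GH_elem)"
proof -
  interpret G: comm_group "G0H n :: 'f mpoly set G0_elem monoid" by (rule G0H_comm_group)
  interpret M: module \<Z> "GH :: (int, 'f GH_elem) module" by (rule GH_module)
  interpret gh: group_hom "G0H n :: 'f mpoly set G0_elem monoid" GHgrp "in_degree n"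
    by (intro group_hom.intro group_hom_axioms.intro in_degree_hom G.is_group comm_group.axioms(2) GHgrp_comm_group)
  show ?thesis using assms
  proof (induction K rule: finite_induct)
    case empty then show ?case using gh.hom_one by (simp add: GH_eq)
  next
    case (insert k K)
    then have "f \<in> K \<rightarrow> carrier (G0H n)" "(\<lambda>k. in_degree n (f k)) \<in> K \<rightarrow> carrier (GH :: (int, 'f GH_elem) module)"
      by (auto simp: GH_eq gh.hom_closed)
    then show ?case using insert
      by (simp add: GH_eq gh.hom_closed gh.hom_mult)
  qed
qed

section \<open>Evaluating the structure maps of \<open>G\<^sub>0(\<H>\<^sub>\<bullet>)\<close>\<close>

text \<open>The variable x_m is missed by the embedding. Restricting the character of \<gamma> thus
  keeps the descents below and above \<open>m\<close>, which are those of the two cuts, and forgets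
  whether \<open>m\<close> is a descent.\<close>

lemma H_embed_char:
  assumes X: "X \<in> carrier (HHalg m n :: ('f::field, 'f HH_elem) module)"
  shows "H_embed m n X \<in> carrier (Halg (m + n))"
    "inner_gt1 (m + n) \<gamma> \<Longrightarrow> hchar \<gamma> (H_embed m n X) =
      split_pair.\<tau> (Halg m) hchar (Halg n) hchar (comp_upto \<gamma> m, comp_after \<gamma> m) X"
proof -
  interpret SP: split_pair "Halg m :: ('f, 'f mpoly set) module" "{\<alpha>. inner_gt1 m \<alpha>}" hchar
    "Halg n :: ('f, 'f mpoly set) module" "{\<alpha>. inner_gt1 n \<alpha>}" hchar
    by (intro split_pair.intro Halg_split)
  have X': "X \<in> carrier SP.TA" using X by (simp add: HHalg_def)
  have cu: "comp_upto \<gamma> m \<in> {\<alpha>. inner_gt1 m \<alpha>}" "comp_after \<gamma> m \<in> {\<alpha>. inner_gt1 n \<alpha>}"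
    if "\<gamma> \<in> {\<gamma>. inner_gt1 (m + n) \<gamma>}" for \<gamma>
    using that inner_gt1_upto[of "m + n" \<gamma> m] by auto
  have w1: "hchar \<gamma> (H_shift (m + n) 0 a) = hchar (comp_upto \<gamma> m) a"
    if "\<gamma> \<in> {\<gamma>. inner_gt1 (m + n) \<gamma>}" "a \<in> carrier (Halg m :: ('f, 'f mpoly set) module)" for \<gamma> a
  proof (rule hchar_H_shift[OF that(2)])
    have g: "composition (m + n) \<gamma>" using that by (simp add: inner_gt1_composition)
    show "descents (comp_upto \<gamma> m) = {i \<in> {1..<m}. 0 + i \<in> descents \<gamma>}"
      unfolding conjunct2[OF comp_upto[OF g le_add1]] using descents_bounds[OF g] by auto
  qed (use that cu[OF that(1)] in auto)
  have w2: "hchar \<gamma> (H_shift (m + n) m b) = hchar (comp_after \<gamma> m) b"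
    if "\<gamma> \<in> {\<gamma>. inner_gt1 (m + n) \<gamma>}" "b \<in> carrier (Halg n :: ('f, 'f mpoly set) module)" for \<gamma> b
  proof (rule hchar_H_shift[OF that(2)])
    have g: "composition (m + n) \<gamma>" using that by (simp add: inner_gt1_composition)
    show "descents (comp_after \<gamma> m) = {i \<in> {1..<n}. m + i \<in> descents \<gamma>}"
      unfolding conjunct2[OF comp_after[OF g le_add1]] using descents_bounds[OF g] by (auto simp: add.commute)
  qed (use that cu[OF that(1)] in auto)
  note tl = SP.tensor_lift_mult[OF Halg_split[of "m + n"] _ _ cu(1) cu(2) w1 w2 X', folded H_embed_def]
  show "H_embed m n X \<in> carrier (Halg (m + n))"
    by (rule tl(1)) (auto intro: H_shift_closed)
  show "inner_gt1 (m + n) \<gamma> \<Longrightarrow> hchar \<gamma> (H_embed m n X) = SP.\<tau> (comp_upto \<gamma> m, comp_after \<gamma> m) X"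
    by (rule tl(2)) (auto intro: H_shift_closed)
qed

lemma Ctensor_coord:
  assumes "inner_gt1 m \<alpha>" "inner_gt1 n \<beta>"
  shows "\<exists>\<theta>. coord_module (HHalg m n :: ('f::field, 'f HH_elem) module) ({\<alpha>. inner_gt1 m \<alpha>} \<times> {\<beta>. inner_gt1 n \<beta>})
    (split_pair.\<tau> (Halg m) hchar (Halg n) hchar) (Ctensor \<alpha> \<beta>) {()} (\<lambda>_. (\<alpha>, \<beta>)) \<theta>"
  using split_pair.outer_tensor_coord[OF split_pair.intro[OF Halg_split Halg_split], of \<alpha> m \<beta> n] assms
  by (simp add: HHalg_def Ctensor_def Csimple_eq inner_gt1_sum_list)

lemma HHalg_split:
  "split_algebra (HHalg m n :: ('f::field, 'f HH_elem) module) ({\<alpha>. inner_gt1 m \<alpha>} \<times> {\<beta>. inner_gt1 n \<beta>})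
    (split_pair.\<tau> (Halg m) hchar (Halg n) hchar)"
  unfolding HHalg_def by (rule split_pair.TA_split[OF split_pair.intro[OF Halg_split Halg_split]])

text \<open>A form of Frobenius reciprocity: by \<open>induced_coord\<close> the induced module
  contains C_\<gamma> exactly once for each \<gamma> whose restriction has the character of the
  given pair.\<close>

lemma GH_induced:
  assumes \<alpha>: "inner_gt1 m \<alpha>" and \<beta>: "inner_gt1 n \<beta>"
  shows "GH_class (m + n) (induced_module (HHalg m n) (Halg (m + n) :: ('f::field, 'f mpoly set) module)
      (H_embed m n) (Ctensor \<alpha> \<beta>)) =
    (\<Oplus>\<^bsub>GH\<^esub>\<gamma>\<in>{\<gamma>. inner_gt1 (m + n) \<gamma> \<and> comp_upto \<gamma> m = \<alpha> \<and> comp_after \<gamma> m = \<beta>}. Cclass \<gamma>)"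
proof -
  let ?K = "{\<gamma>. inner_gt1 (m + n) \<gamma> \<and> comp_upto \<gamma> m = \<alpha> \<and> comp_after \<gamma> m = \<beta>}"
  let ?M = "induced_module (HHalg m n) (Halg (m + n) :: ('f, 'f mpoly set) module) (H_embed m n) (Ctensor \<alpha> \<beta>)"
  obtain \<theta> where \<theta>: "coord_module (HHalg m n :: ('f, 'f HH_elem) module) ({\<alpha>. inner_gt1 m \<alpha>} \<times> {\<beta>. inner_gt1 n \<beta>})
    (split_pair.\<tau> (Halg m) hchar (Halg n) hchar) (Ctensor \<alpha> \<beta>) {()} (\<lambda>_. (\<alpha>, \<beta>)) \<theta>"
    using Ctensor_coord[OF \<alpha> \<beta>] by blast
  have K: "{\<gamma> \<in> {\<gamma>. inner_gt1 (m + n) \<gamma>}. (comp_upto \<gamma> m, comp_after \<gamma> m) = (\<alpha>, \<beta>)} = ?K" by auto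
  have "\<exists>\<Theta>. coord_module (Halg (m + n)) {\<gamma>. inner_gt1 (m + n) \<gamma>} hchar ?M
      {\<gamma> \<in> {\<gamma>. inner_gt1 (m + n) \<gamma>}. (comp_upto \<gamma> m, comp_after \<gamma> m) = (\<alpha>, \<beta>)} (\<lambda>\<gamma>. \<gamma>) \<Theta>"
  proof (rule induced_coord[OF HHalg_split Halg_split _ _ _ \<theta>])
    show "(comp_upto \<gamma> m, comp_after \<gamma> m) \<in> {\<alpha>. inner_gt1 m \<alpha>} \<times> {\<beta>. inner_gt1 n \<beta>}"
      if "\<gamma> \<in> {\<gamma>. inner_gt1 (m + n) \<gamma>}" for \<gamma>
      using that inner_gt1_upto[of "m + n" \<gamma> m] by auto
  qed (use H_embed_char in auto)
  then obtain \<Theta> where \<Theta>: "coord_module (Halg (m + n)) {\<gamma>. inner_gt1 (m + n) \<gamma>} hchar ?M ?K (\<lambda>\<gamma>. \<gamma>) \<Theta>"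
    unfolding K by blast
  have fin: "finite ?K" using finite_inner_gt1[of "m + n"] by (rule finite_subset[rotated]) auto
  have "G0_class (Halg (m + n)) ?M = (\<Otimes>\<^bsub>G0H (m + n)\<^esub>\<gamma>\<in>?K. hclass (m + n) \<gamma>)"
    using split_algebra.G0_class_coord[OF Halg_split \<Theta>] by (simp add: hclass_simple)
  then have "GH_class (m + n) ?M = (\<Oplus>\<^bsub>GH\<^esub>\<gamma>\<in>?K. in_degree (m + n) (hclass (m + n) \<gamma>))"
    using in_degree_finprod[OF fin, of "hclass (m + n)" "m + n"] by (simp add: GH_class_eq hclass_closed)
  also have "\<dots> = (\<Oplus>\<^bsub>GH\<^esub>\<gamma>\<in>?K. Cclass \<gamma>)"
  proof -
    interpret M: module \<Z> "GH :: (int, 'f GH_elem) module" by (rule GH_module)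
    show ?thesis
      by (rule M.M.finsum_cong') (auto simp: Cclass_eq[symmetric] GH_eq Cclass_closed inner_gt1_simple_index)
  qed
  finally show ?thesis .
qed

section \<open>Projection, inclusion, and the product of G_0\<close>

lemma GH_proj:
  "(GH_proj :: _ \<Rightarrow> 'f::field GH_elem) \<in> mod_hom \<Z> Comp GH"
  "\<alpha> \<in> compositions \<Longrightarrow> GH_proj (frag_of \<alpha>) = (if \<alpha> \<in> simple_index then Cclass \<alpha> else \<zero>\<^bsub>GH :: (int, 'f GH_elem) module\<^esub>)"
proof -
  have v: "(if \<alpha> \<in> simple_index then Cclass \<alpha> else \<zero>\<^bsub>GH\<^esub>) \<in> carrier (GH :: (int, 'f GH_elem) module)" for \<alpha>
    using Cclass_closed monoid.one_closed[OF group.is_monoid[OF comm_group.axioms(2)[OF GHgrp_comm_group]]]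
    by (auto simp: GH_eq)
  show "(GH_proj :: _ \<Rightarrow> 'f GH_elem) \<in> mod_hom \<Z> Comp GH"
    using C.ext(1)[OF GH_module v] unfolding GH_proj_def C.ext_def Comp_def .
  show "\<alpha> \<in> compositions \<Longrightarrow> GH_proj (frag_of \<alpha>) = (if \<alpha> \<in> simple_index then Cclass \<alpha> else \<zero>\<^bsub>GH :: (int, 'f GH_elem) module\<^esub>)"
    using C.ext(2)[OF GH_module v] unfolding GH_proj_def C.ext_def Comp_def .
qed

lemma GH_incl:
  "(GH_incl :: 'f::field GH_elem \<Rightarrow> _) \<in> mod_hom \<Z> GH Comp"
  "\<alpha> \<in> simple_index \<Longrightarrow> GH_incl (Cclass \<alpha> :: 'f GH_elem) = frag_of \<alpha>"
proof -
  have v: "frag_of \<alpha> \<in> carrier Comp" if "\<alpha> \<in> simple_index" for \<alpha>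
    using that simple_index_compositions by (simp add: Comp_simps)
  show "(GH_incl :: 'f GH_elem \<Rightarrow> _) \<in> mod_hom \<Z> GH Comp"
    using B.ext(1)[OF Comp_module v] unfolding GH_incl_def B.ext_def GH_eq .
  show "\<alpha> \<in> simple_index \<Longrightarrow> GH_incl (Cclass \<alpha> :: 'f GH_elem) = frag_of \<alpha>"
    using B.ext(2)[OF Comp_module v] unfolding GH_incl_def B.ext_def GH_eq .
qed

text \<open>The two cuts fix every descent of \<gamma> except possibly \<open>m\<close>. Having it
  or not is the difference between concatenation and near-concatenation.\<close>

lemma cut_append:
  assumes "\<alpha> \<noteq> []" "\<beta> \<noteq> []" "composition m \<alpha>" "composition n \<beta>" "composition (m + n) \<gamma>"
  shows "comp_upto \<gamma> m = \<alpha> \<and> comp_after \<gamma> m = \<beta> \<longleftrightarrow> \<gamma> = \<alpha> @ \<beta> \<or> \<gamma> = near_concat \<alpha> \<beta>"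
proof -
  have sum: "sum_list \<alpha> = m" using assms(3) by (rule composition_sum_list)
  have m: "m \<notin> descents \<alpha>" "0 < m" "0 < n"
    using descents_bounds[OF assms(3)] composition_eq_Nil_iff[OF assms(3)] composition_eq_Nil_iff[OF assms(4)] assms by auto
  note ba = descents_bounds[OF assms(3)] and bb = descents_bounds[OF assms(4)] and bg = descents_bounds[OF assms(5)]
  note cu = comp_upto[OF assms(5) le_add1] and ca = comp_after[OF assms(5) le_add1, simplified]
  have "comp_upto \<gamma> m = \<alpha> \<longleftrightarrow> {d \<in> descents \<gamma>. d < m} = descents \<alpha>"
    using descents_inj[OF conjunct1[OF cu] assms(3)] cu by auto
  moreover have "comp_after \<gamma> m = \<beta> \<longleftrightarrow> {d. d > 0 \<and> d + m \<in> descents \<gamma>} = descents \<beta>"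
    using descents_inj[OF conjunct1[OF ca] assms(4)] ca by auto
  moreover have "\<gamma> = \<alpha> @ \<beta> \<longleftrightarrow> descents \<gamma> = descents \<alpha> \<union> {m} \<union> (+) m ` descents \<beta>"
    using descents_inj[OF assms(5) composition_append[OF assms(3,4)]] descents_append[OF assms(1,2)] sum by auto
  moreover have "\<gamma> = near_concat \<alpha> \<beta> \<longleftrightarrow> descents \<gamma> = descents \<alpha> \<union> (+) m ` descents \<beta>"
    using descents_inj[OF assms(5) composition_near_concat[OF assms(1-4)]] descents_near_concat[OF assms(1,2)] sum by auto
  moreover have "{d \<in> descents \<gamma>. d < m} = descents \<alpha> \<and> {d. d > 0 \<and> d + m \<in> descents \<gamma>} = descents \<beta> \<longleftrightarrow>
      descents \<gamma> = descents \<alpha> \<union> {m} \<union> (+) m ` descents \<beta> \<or> descents \<gamma> = descents \<alpha> \<union> (+) m ` descents \<beta>"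
  proof -
    have low: "d \<in> descents \<alpha> \<Longrightarrow> d < m" and pos: "d \<in> descents \<beta> \<Longrightarrow> 0 < d" for d using ba bb by auto
    have img: "d \<in> (+) m ` descents \<beta> \<longleftrightarrow> m < d \<and> d - m \<in> descents \<beta>" for d
    proof
      assume "m < d \<and> d - m \<in> descents \<beta>"
      then show "d \<in> (+) m ` descents \<beta>" by (intro image_eqI[of _ _ "d - m"]) auto
    qed (use pos in auto)
    show ?thesis (is "?P \<longleftrightarrow> ?Q")
    proof
      assume P: ?P
      \<comment> \<open>Away from \<open>m\<close> membership is decided by the pieces alone; at
        \<open>m\<close> it remains open.\<close>
      have mem: "d \<in> descents \<gamma> \<longleftrightarrow> (d < m \<and> d \<in> descents \<alpha>) \<or> (d = m \<and> m \<in> descents \<gamma>) \<or> (m < d \<and> d - m \<in> descents \<beta>)" for d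
      proof (cases "m < d")
        case True
        then have "d - m \<in> {d. d > 0 \<and> d + m \<in> descents \<gamma>} \<longleftrightarrow> d \<in> descents \<gamma>" by simp
        then show ?thesis using P True by simp
      next
        case False
        have "d \<in> {d \<in> descents \<gamma>. d < m} \<longleftrightarrow> d \<in> descents \<alpha>" using P by simp
        then show ?thesis using False low[of d] by (cases "d = m") auto
      qed
      show ?Q
      proof (cases "m \<in> descents \<gamma>")
        case True
        have "descents \<gamma> = descents \<alpha> \<union> {m} \<union> (+) m ` descents \<beta>"
        proof (rule Set.set_eqI)
          fix d show "d \<in> descents \<gamma> \<longleftrightarrow> d \<in> descents \<alpha> \<union> {m} \<union> (+) m ` descents \<beta>"
            unfolding mem[of d] Un_iff img using True low[of d] by auto
        qed
        then show ?thesis by blast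
      next
        case False
        have "descents \<gamma> = descents \<alpha> \<union> (+) m ` descents \<beta>"
        proof (rule Set.set_eqI)
          fix d show "d \<in> descents \<gamma> \<longleftrightarrow> d \<in> descents \<alpha> \<union> (+) m ` descents \<beta>"
            unfolding mem[of d] Un_iff img using False low[of d] by auto
        qed
        then show ?thesis by blast
      qed
    next
      assume ?Q
      then show ?P
        using low pos m(1) by (elim disjE) (auto simp: img)
    qed
  qed
  ultimately show ?thesis by simp
qed

lemma comp_cut_ends:
  assumes "composition n \<gamma>"
  shows "comp_upto \<gamma> 0 = []" "comp_after \<gamma> 0 = \<gamma>" "comp_upto \<gamma> n = \<gamma>" "comp_after \<gamma> n = []"
proof -
  have u0: "composition 0 (comp_upto \<gamma> 0)" and an: "composition (n - n) (comp_after \<gamma> n)"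
    using comp_upto[OF assms, of 0] comp_after[OF assms, of n] by auto
  show "comp_upto \<gamma> 0 = []" using composition_eq_Nil_iff[OF u0] by simp
  show "comp_after \<gamma> n = []" using composition_eq_Nil_iff[OF an] by simp
  have "{d. d > 0 \<and> d + 0 \<in> descents \<gamma>} = descents \<gamma>" "{d \<in> descents \<gamma>. d < n} = descents \<gamma>"
    using descents_bounds[OF assms] by auto
  then show "comp_after \<gamma> 0 = \<gamma>" "comp_upto \<gamma> n = \<gamma>"
    using comp_upto[OF assms, of n] comp_after[OF assms, of 0] descents_inj[OF _ assms] by auto
qed

lemma GH_proj_add:
  assumes "Poly_Mapping.keys x \<subseteq> compositions" "Poly_Mapping.keys y \<subseteq> compositions"
  shows "GH_proj (x + y) = GH_proj x \<oplus>\<^bsub>GH\<^esub> (GH_proj y :: 'f::field GH_elem)"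
  using mod_hom_add[OF GH_proj(1), of x y] assms by (simp add: Comp_simps)

text \<open>By \<open>cut_append\<close> the constituents of the induced module are the summands of
  the product that satisfy \<propto>, and these are what \<open>GH_proj\<close> keeps. With an empty
  factor the product has one term and the cut is at an end.\<close>

lemma GH_proj_comp_prod:
  assumes \<alpha>: "inner_gt1 m \<alpha>" and \<beta>: "inner_gt1 n \<beta>"
  shows "GH_proj (comp_prod \<alpha> \<beta>) =
    (\<Oplus>\<^bsub>GH\<^esub>\<gamma>\<in>{\<gamma>. inner_gt1 (m + n) \<gamma> \<and> comp_upto \<gamma> m = \<alpha> \<and> comp_after \<gamma> m = \<beta>}. Cclass \<gamma> :: 'f::field GH_elem)"
    (is "_ = finsum GH Cclass ?K")
proof -
  interpret M: module \<Z> "GH :: (int, 'f GH_elem) module" by (rule GH_module)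
  have ca: "composition m \<alpha>" and cb: "composition n \<beta>" using \<alpha> \<beta> by (auto intro: inner_gt1_composition)
  have Cc: "(Cclass \<gamma> :: 'f GH_elem) \<in> carrier GH" if "inner_gt1 k \<gamma>" for \<gamma> k
    using that by (simp add: GH_eq Cclass_closed inner_gt1_simple_index)
  have val: "GH_proj (frag_of \<gamma>) = (if inner_gt1 k \<gamma> then Cclass \<gamma> else \<zero>\<^bsub>GH :: (int, 'f GH_elem) module\<^esub>)"
    if "composition k \<gamma>" for \<gamma> k
    using that GH_proj(2)[OF composition_compositions[OF that]] by (simp add: inner_gt1_simple_index composition_sum_list)
  \<comment> \<open>Written as a sum over an empty or one-element set, so that the two summands
    combine by disjoint union.\<close>
  have single: "GH_proj (frag_of \<gamma>) = finsum (GH :: (int, 'f GH_elem) module) Cclass {\<gamma>' \<in> {\<gamma>}. inner_gt1 k \<gamma>'}"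
    if "composition k \<gamma>" for \<gamma> k
    unfolding val[OF that] using Cc[of k \<gamma>] by (auto simp: Collect_conv_if)
  consider "\<alpha> = []" | "\<beta> = []" | "\<alpha> \<noteq> []" "\<beta> \<noteq> []" by blast
  then show ?thesis
  proof cases
    case 1
    then have m: "m = 0" using ca by simp
    have "comp_upto \<gamma> 0 = [] \<and> comp_after \<gamma> 0 = \<gamma>" if "inner_gt1 n \<gamma>" for \<gamma>
      using comp_cut_ends(1,2)[OF inner_gt1_composition[OF that]] by simp
    then have "?K = {\<gamma>' \<in> {\<beta>}. inner_gt1 n \<gamma>'}" using \<beta> by (auto simp: m 1)
    then show ?thesis using single[OF cb] by (simp add: comp_prod_def 1)
  next
    case 2
    then have n: "n = 0" using cb by simp
    have "comp_upto \<gamma> m = \<gamma> \<and> comp_after \<gamma> m = []" if "inner_gt1 m \<gamma>" for \<gamma>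
      using comp_cut_ends(3,4)[OF inner_gt1_composition[OF that]] by simp
    then have "?K = {\<gamma>' \<in> {\<alpha>}. inner_gt1 m \<gamma>'}" using \<alpha> by (auto simp: n 2)
    moreover have "comp_prod \<alpha> \<beta> = frag_of \<alpha>" by (simp add: comp_prod_def 2)
    ultimately show ?thesis using single[OF ca] by simp
  next
    case 3
    have c1: "composition (m + n) (\<alpha> @ \<beta>)" and c2: "composition (m + n) (near_concat \<alpha> \<beta>)"
      using composition_append[OF ca cb] composition_near_concat[OF 3 ca cb] by auto
    \<comment> \<open>The joint separates the two summands, so neither class is counted
      twice.\<close>
    have "m \<notin> descents (near_concat \<alpha> \<beta>)" "m \<in> descents (\<alpha> @ \<beta>)"
      using descents_bounds[OF ca] descents_bounds[OF cb]
      by (auto simp: descents_near_concat[OF 3] descents_append[OF 3] composition_sum_list[OF ca])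
    then have ne: "\<alpha> @ \<beta> \<noteq> near_concat \<alpha> \<beta>" by metis
    have K: "?K = {\<gamma>' \<in> {\<alpha> @ \<beta>}. inner_gt1 (m + n) \<gamma>'} \<union> {\<gamma>' \<in> {near_concat \<alpha> \<beta>}. inner_gt1 (m + n) \<gamma>'}"
      using cut_append[OF 3 ca cb] inner_gt1_composition by blast
    have "GH_proj (comp_prod \<alpha> \<beta>) = GH_proj (frag_of (\<alpha> @ \<beta>)) \<oplus>\<^bsub>GH\<^esub> (GH_proj (frag_of (near_concat \<alpha> \<beta>)) :: 'f GH_elem)"
      using 3 GH_proj_add[of "frag_of (\<alpha> @ \<beta>)" "frag_of (near_concat \<alpha> \<beta>)"] composition_compositions[OF c1] composition_compositions[OF c2]
      by (simp add: comp_prod_def)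
    also have "\<dots> = finsum GH Cclass ?K"
      unfolding K single[OF c1] single[OF c2] using ne Cc
      by (intro M.M.finsum_Un_disjoint[symmetric]) auto
    finally show ?thesis .
  qed
qed

lemma GH_mult:
  "(GH_mult :: 'f::field GH_tensor \<Rightarrow> _) \<in> mod_hom \<Z> (tensor \<Z> GH GH) GH"
  "\<lbrakk>\<alpha> \<in> simple_index; \<beta> \<in> simple_index\<rbrakk> \<Longrightarrow>
    GH_mult (tens \<Z> GH GH (Cclass \<alpha>) (Cclass \<beta>)) = (GH_proj (comp_prod \<alpha> \<beta>) :: 'f GH_elem)"
proof -
  let ?v = "\<lambda>\<alpha> \<beta>. let m = sum_list \<alpha>; n = sum_list \<beta> in GH_class (m + n)
          (induced_module (HHalg m n) (Halg (m + n) :: ('f, 'f mpoly set) module) (H_embed m n) (Ctensor \<alpha> \<beta>))"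
  have eq: "?v \<alpha> \<beta> = GH_proj (comp_prod \<alpha> \<beta>)" if "\<alpha> \<in> simple_index" "\<beta> \<in> simple_index" for \<alpha> \<beta>
    using that GH_induced[where 'f = 'f, of "sum_list \<alpha>" \<alpha> "sum_list \<beta>" \<beta>] GH_proj_comp_prod[where 'f = 'f, of "sum_list \<alpha>" \<alpha> "sum_list \<beta>" \<beta>]
    by (simp add: simple_index_iff Let_def)
  have v: "?v \<alpha> \<beta> \<in> carrier B.H" if "\<alpha> \<in> simple_index" "\<beta> \<in> simple_index" for \<alpha> \<beta>
    unfolding eq[OF that] GH_eq[symmetric]
    by (rule mod_hom_closed[OF GH_proj(1)])
      (simp add: Comp_simps comp_prod_closed that simple_index_compositions)
  show "(GH_mult :: 'f GH_tensor \<Rightarrow> _) \<in> mod_hom \<Z> (tensor \<Z> GH GH) GH"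
    using B.bilinear_ext(1)[OF B.H_module v] unfolding GH_mult_def GH_eq .
  assume ab: "\<alpha> \<in> simple_index" "\<beta> \<in> simple_index"
  have "GH_mult (tens \<Z> GH GH (Cclass \<alpha>) (Cclass \<beta>)) = ?v \<alpha> \<beta>"
    using B.bilinear_ext(2)[OF B.H_module v ab] unfolding GH_mult_def GH_eq .
  then show "GH_mult (tens \<Z> GH GH (Cclass \<alpha>) (Cclass \<beta>)) = (GH_proj (comp_prod \<alpha> \<beta>) :: 'f GH_elem)"
    using eq[OF ab] by simp
qed

section \<open>The coproduct of G_0\<close>

lemma GH_split:
  assumes \<alpha>: "inner_gt1 i \<alpha>" and \<beta>: "inner_gt1 j \<beta>"
  shows "GH_split i j (G0_class (HHalg i j :: ('f::field, 'f HH_elem) module) (Ctensor \<alpha> \<beta>)) =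
    tens \<Z> GH GH (Cclass \<alpha>) (Cclass \<beta>)"
proof -
  let ?A = "HHalg i j :: ('f, 'f HH_elem) module"
  interpret A: split_algebra ?A "{\<alpha>. inner_gt1 i \<alpha>} \<times> {\<beta>. inner_gt1 j \<beta>}" "split_pair.\<tau> (Halg i) hchar (Halg j) hchar"
    by (rule HHalg_split)
  have cls: "G0_class ?A (Ctensor a b) = A.simple_class (a, b)" if "inner_gt1 i a" "inner_gt1 j b" for a b
  proof -
    from Ctensor_coord[OF that] obtain \<theta> where "coord_module ?A ({\<alpha>. inner_gt1 i \<alpha>} \<times> {\<beta>. inner_gt1 j \<beta>})
      (split_pair.\<tau> (Halg i) hchar (Halg j) hchar) (Ctensor a b) {()} (\<lambda>_. (a, b)) \<theta>"
      by blast
    from A.G0_class_coord[OF this] show ?thesis using A.simple_class_closed[of "(a, b)"] that by simp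
  qed
  let ?T = "tensor \<Z> (GH :: (int, 'f GH_elem) module) (GH :: (int, 'f GH_elem) module)"
  have T: "module \<Z> ?T" unfolding GH_eq by (rule B.T.T_module)
  then interpret T: module \<Z> ?T .
  have tc: "tens \<Z> GH GH (Cclass a) (Cclass b) \<in> carrier ?T" if "inner_gt1 i a" "inner_gt1 j b" for a b
    unfolding GH_eq using that by (intro B.T.tns_closed) (auto simp: Cclass_closed inner_gt1_simple_index)
  obtain h where h: "h \<in> hom (G0 ?A) (add_monoid ?T)"
    "\<forall>p\<in>{\<alpha>. inner_gt1 i \<alpha>} \<times> {\<beta>. inner_gt1 j \<beta>}. h (A.simple_class p) = (\<lambda>(a, b). tens \<Z> GH GH (Cclass a) (Cclass b)) p"
    using A.G0_universal[OF T.M.a_comm_group, of "\<lambda>(a, b). tens \<Z> GH GH (Cclass a) (Cclass b)"] tc by fastforce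
  have "h \<in> mod_hom \<Z> (Zmod (G0 ?A)) ?T"
    unfolding Zmod_hom_iff[OF Zmod_module[OF A.G0_comm_group] T] using h(1) by (simp add: hom_def)
  then have ex: "\<exists>h\<in>mod_hom \<Z> (Zmod (G0 ?A)) ?T. \<forall>p\<in>{\<alpha>. inner_gt1 i \<alpha>} \<times> {\<beta>. inner_gt1 j \<beta>}.
      h ((\<lambda>(a, b). G0_class ?A (Ctensor a b)) p) = (\<lambda>(a, b). tens \<Z> GH GH (Cclass a) (Cclass b)) p"
    using h(2) cls by (intro bexI[of _ h]) auto
  show ?thesis unfolding GH_split_def using lin_extI(2)[OF ex, of "(\<alpha>, \<beta>)"] \<alpha> \<beta> by simp
qed

text \<open>The restricted module and the tensor product of the two cuts are both one-dimensional
  with the same character, hence have the same class.\<close>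

lemma GH_split_restrict:
  assumes \<alpha>: "inner_gt1 n \<alpha>" and i: "i \<le> n"
  shows "GH_split i (n - i) (G0_class (HHalg i (n - i) :: ('f::field, 'f HH_elem) module)
      (restrict_scalars (H_embed i (n - i)) (Csimple \<alpha>))) =
    tens \<Z> GH GH (Cclass (comp_upto \<alpha> i)) (Cclass (comp_after \<alpha> i))"
proof -
  let ?A = "HHalg i (n - i) :: ('f, 'f HH_elem) module"
  let ?p = "(comp_upto \<alpha> i, comp_after \<alpha> i)"
  interpret A: split_algebra ?A "{\<alpha>. inner_gt1 i \<alpha>} \<times> {\<beta>. inner_gt1 (n - i) \<beta>}" "split_pair.\<tau> (Halg i) hchar (Halg (n - i)) hchar"
    by (rule HHalg_split)
  note c = inner_gt1_upto[OF \<alpha> i]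
  have "coord_module ?A ({\<alpha>. inner_gt1 i \<alpha>} \<times> {\<beta>. inner_gt1 (n - i) \<beta>}) (split_pair.\<tau> (Halg i) hchar (Halg (n - i)) hchar)
      (restrict_scalars (H_embed i (n - i)) (Csimple \<alpha>)) {()} (\<lambda>_. ?p) (\<lambda>_ c. c)"
    unfolding Csimple_eq
  proof (rule A.restrict_char_coord)
    show "?p \<in> {\<alpha>. inner_gt1 i \<alpha>} \<times> {\<beta>. inner_gt1 (n - i) \<beta>}" using c by simp
    fix X assume "X \<in> carrier ?A"
    then show "hchar \<alpha> (H_embed i (n - i) X) = split_pair.\<tau> (Halg i) hchar (Halg (n - i)) hchar ?p X"
      using H_embed_char(2)[of X i "n - i" \<alpha>] \<alpha> i by simp
  qed
  from A.G0_class_coord[OF this]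
  have r: "G0_class ?A (restrict_scalars (H_embed i (n - i)) (Csimple \<alpha>)) = (\<Otimes>\<^bsub>G0 ?A\<^esub>k\<in>{()}. A.simple_class ?p)" .
  obtain \<theta> where "coord_module ?A ({\<alpha>. inner_gt1 i \<alpha>} \<times> {\<beta>. inner_gt1 (n - i) \<beta>})
      (split_pair.\<tau> (Halg i) hchar (Halg (n - i)) hchar) (Ctensor (comp_upto \<alpha> i) (comp_after \<alpha> i)) {()} (\<lambda>_. ?p) \<theta>"
    using Ctensor_coord[OF c] by blast
  from A.G0_class_coord[OF this]
  have "G0_class ?A (Ctensor (comp_upto \<alpha> i) (comp_after \<alpha> i)) = (\<Otimes>\<^bsub>G0 ?A\<^esub>k\<in>{()}. A.simple_class ?p)" .
  then show ?thesis using r GH_split[where 'f = 'f, OF c] by (simp only:)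
qed

lemma GH_comult:
  "(GH_comult :: 'f::field GH_elem \<Rightarrow> _) \<in> mod_hom \<Z> GH (tensor \<Z> GH GH)"
  "\<alpha> \<in> simple_index \<Longrightarrow> GH_comult (Cclass \<alpha> :: 'f GH_elem) =
    (\<Oplus>\<^bsub>tensor \<Z> GH GH\<^esub>i\<in>{0..sum_list \<alpha>}. tens \<Z> GH GH (Cclass (comp_upto \<alpha> i)) (Cclass (comp_after \<alpha> i)))"
proof -
  let ?T = "tensor \<Z> (GH :: (int, 'f GH_elem) module) (GH :: (int, 'f GH_elem) module)"
  let ?v = "\<lambda>\<alpha>. let m = sum_list \<alpha> in \<Oplus>\<^bsub>?T\<^esub>i\<in>{0..m}. GH_split i (m - i)
          (G0_class (HHalg i (m - i) :: ('f, 'f HH_elem) module) (restrict_scalars (H_embed i (m - i)) (Csimple \<alpha>)))"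
  let ?w = "\<lambda>\<alpha>. \<Oplus>\<^bsub>?T\<^esub>i\<in>{0..sum_list \<alpha>}. tens \<Z> GH GH (Cclass (comp_upto \<alpha> i)) (Cclass (comp_after \<alpha> i))"
  have tc: "tens \<Z> GH GH (Cclass (comp_upto \<alpha> i)) (Cclass (comp_after \<alpha> i)) \<in> carrier ?T"
    if "\<alpha> \<in> simple_index" "i \<in> {0..sum_list \<alpha>}" for \<alpha> i
  proof -
    have "inner_gt1 (sum_list \<alpha>) \<alpha>" "i \<le> sum_list \<alpha>" using that by (auto simp: simple_index_iff)
    then have "comp_upto \<alpha> i \<in> simple_index" "comp_after \<alpha> i \<in> simple_index"
      using inner_gt1_upto[of "sum_list \<alpha>" \<alpha> i] by (auto simp: inner_gt1_simple_index)
    then show ?thesis unfolding GH_eq by (intro B.T.tns_closed) (auto simp: Cclass_closed)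
  qed
  have T: "module \<Z> ?T" unfolding GH_eq by (rule B.T.T_module)
  then interpret T: module \<Z> ?T .
  have eq: "?v \<alpha> = ?w \<alpha>" if "\<alpha> \<in> simple_index" for \<alpha>
    unfolding Let_def
  proof (rule T.M.finsum_cong'[OF refl])
    show "(\<lambda>i. tens \<Z> GH GH (Cclass (comp_upto \<alpha> i)) (Cclass (comp_after \<alpha> i))) \<in> {0..sum_list \<alpha>} \<rightarrow> carrier ?T"
      using tc[OF that] by blast
    fix i assume "i \<in> {0..sum_list \<alpha>}"
    then show "GH_split i (sum_list \<alpha> - i) (G0_class (HHalg i (sum_list \<alpha> - i) :: ('f, 'f HH_elem) module)
        (restrict_scalars (H_embed i (sum_list \<alpha> - i)) (Csimple \<alpha>))) =
      tens \<Z> GH GH (Cclass (comp_upto \<alpha> i)) (Cclass (comp_after \<alpha> i))"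
      using that by (intro GH_split_restrict) (auto simp: simple_index_iff)
  qed
  have v: "?v \<alpha> \<in> carrier ?T" if "\<alpha> \<in> simple_index" for \<alpha>
    unfolding eq[OF that] using tc[OF that] by (intro T.M.finsum_closed) blast
  show "(GH_comult :: 'f GH_elem \<Rightarrow> _) \<in> mod_hom \<Z> GH ?T"
    using B.ext(1)[OF T v] unfolding GH_comult_def B.ext_def GH_eq .
  show "\<alpha> \<in> simple_index \<Longrightarrow> GH_comult (Cclass \<alpha> :: 'f GH_elem) = ?w \<alpha>"
    using B.ext(2)[OF T v] eq unfolding GH_comult_def B.ext_def GH_eq by simp
qed

lemma GH_counit:
  "(GH_counit :: 'f::field GH_elem \<Rightarrow> _) \<in> mod_hom \<Z> GH Zself"
  "\<alpha> \<in> simple_index \<Longrightarrow> GH_counit (Cclass \<alpha> :: 'f GH_elem) = (if \<alpha> = [] then 1 else 0)"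
proof -
  have v: "(if \<alpha> = [] then 1 else 0) \<in> carrier Zself" for \<alpha> :: "nat list" by (simp add: Zself_def)
  show "(GH_counit :: 'f GH_elem \<Rightarrow> _) \<in> mod_hom \<Z> GH Zself"
    using B.ext(1)[OF Zself_module v] unfolding GH_counit_def B.ext_def GH_eq .
  show "\<alpha> \<in> simple_index \<Longrightarrow> GH_counit (Cclass \<alpha> :: 'f GH_elem) = (if \<alpha> = [] then 1 else 0)"
    using B.ext(2)[OF Zself_module v] unfolding GH_counit_def B.ext_def GH_eq .
qed

section \<open>The antipode of \<open>G\<^sub>0(\<H>\<^sub>\<bullet>)\<close>\<close>

abbreviation GH_S :: "'f::field GH_elem \<Rightarrow> 'f GH_elem" where
  "GH_S \<equiv> GH_proj \<circ> Comp_S \<circ> GH_incl"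

lemma GH_S_hom: "(GH_S :: 'f::field GH_elem \<Rightarrow> _) \<in> mod_hom \<Z> GH GH"
  using B.mod_hom_comp[OF B.mod_hom_comp[OF GH_incl(1) Comp_S(1)] GH_proj(1)] by (simp add: comp_assoc)

lemma GH_proj_scale:
  assumes "Poly_Mapping.keys x \<subseteq> compositions"
  shows "GH_proj (frag_cmul k x) = k \<odot>\<^bsub>GH\<^esub> (GH_proj x :: 'f::field GH_elem)"
  using mod_hom_smult[OF GH_proj(1), of k x] assms by (simp add: Comp_simps)

lemma GH_S_Cclass:
  assumes "\<alpha> \<in> simple_index"
  shows "(GH_proj \<circ> Comp_S \<circ> GH_incl) (Cclass \<alpha> :: 'f::field GH_elem) =
    (-1) ^ sum_list \<alpha> \<odot>\<^bsub>GH\<^esub> (GH_proj (frag_of (comp_compl \<alpha>)) :: 'g::field GH_elem)"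
  using assms simple_index_compositions[OF assms] comp_compl_compositions[of \<alpha>]
  by (simp add: GH_incl(2) Comp_S(2) GH_proj_scale)

lemma consecutive_comp_prod:
  assumes \<alpha>: "\<alpha> \<in> compositions" and \<beta>: "\<beta> \<in> compositions"
    and ns: "\<alpha> \<notin> simple_index \<or> \<beta> \<notin> simple_index"
  shows "GH_proj (comp_prod \<alpha> \<beta>) = \<zero>\<^bsub>GH :: (int, 'f::field GH_elem) module\<^esub>"
proof -
  interpret M: module \<Z> "GH :: (int, 'f GH_elem) module" by (rule GH_module)
  have zero: "GH_proj (frag_of \<gamma>) = \<zero>\<^bsub>GH :: (int, 'f GH_elem) module\<^esub>" if "\<gamma> \<in> compositions" "\<gamma> \<notin> simple_index" for \<gamma>
    using that by (simp add: GH_proj(2))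
  have Nil: "[] \<in> simple_index" by (simp add: simple_index_iff inner_gt1_def)
  have cons: "\<exists>d\<in>descents \<gamma>. Suc d \<in> descents \<gamma>" if "\<gamma> \<in> compositions" "\<gamma> \<notin> simple_index" for \<gamma>
    using that by (auto simp: simple_index_iff inner_gt1_iff compositions_iff)
  have not_simple: "\<gamma> \<notin> simple_index" if "d \<in> descents \<gamma>" "Suc d \<in> descents \<gamma>" for \<gamma> d
    using that by (auto simp: simple_index_iff inner_gt1_iff)
  show ?thesis
  proof (cases "\<alpha> = [] \<or> \<beta> = []")
    case True
    then show ?thesis using ns Nil zero[OF \<alpha>] zero[OF \<beta>] by (auto simp: comp_prod_def)
  next
    case False
    then have ne: "\<alpha> \<noteq> []" "\<beta> \<noteq> []" by auto
    have keys: "\<alpha> @ \<beta> \<in> compositions" "near_concat \<alpha> \<beta> \<in> compositions"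
      using composition_compositions[OF composition_append[of "sum_list \<alpha>" \<alpha> "sum_list \<beta>" \<beta>]]
        composition_compositions[OF composition_near_concat[OF ne, of "sum_list \<alpha>" "sum_list \<beta>"]] \<alpha> \<beta>
      by (auto simp: compositions_iff[of \<alpha>] compositions_iff[of \<beta>])
    \<comment> \<open>A consecutive pair inside \<alpha> stays in place and one inside \<beta> is
      shifted by |\<alpha>|; the union here is contained in the descent sets of both
      summands.\<close>
    obtain d where d: "d \<in> descents \<alpha> \<union> (+) (sum_list \<alpha>) ` descents \<beta>"
      "Suc d \<in> descents \<alpha> \<union> (+) (sum_list \<alpha>) ` descents \<beta>"
    proof (cases "\<alpha> \<in> simple_index")
      case True
      then obtain d where "d \<in> descents \<beta>" "Suc d \<in> descents \<beta>" using ns cons[OF \<beta>] by blast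
      then show thesis
        by (intro that[of "sum_list \<alpha> + d"] UnI2) (auto intro: image_eqI[of _ _ "Suc d"])
    next
      case False then show thesis using cons[OF \<alpha>] that by blast
    qed
    have "\<alpha> @ \<beta> \<notin> simple_index"
      by (rule not_simple[of d]) (use d descents_append[OF ne] in auto)
    moreover have "near_concat \<alpha> \<beta> \<notin> simple_index"
      by (rule not_simple[of d]) (use d descents_near_concat[OF ne] in auto)
    ultimately show ?thesis
      using keys ne by (simp add: comp_prod_def GH_proj_add zero)
  qed
qed

text \<open>For two simple indices this is \<open>GH_mult\<close>. Otherwise a factor on the left is
  zero, and the right side is zero by \<open>consecutive_comp_prod\<close>.\<close>

lemma GH_mult_proj:
  assumes \<alpha>: "\<alpha> \<in> compositions" and \<beta>: "\<beta> \<in> compositions"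
  shows "GH_mult (tens \<Z> GH GH (GH_proj (frag_of \<alpha>)) (GH_proj (frag_of \<beta>))) = (GH_proj (comp_prod \<alpha> \<beta>) :: 'f::field GH_elem)"
proof (cases "\<alpha> \<in> simple_index \<and> \<beta> \<in> simple_index")
  case True
  then show ?thesis using \<alpha> \<beta> by (simp add: GH_proj(2) GH_mult(2))
next
  case False
  let ?G = "GH :: (int, 'f GH_elem) module"
  interpret M: module \<Z> ?G by (rule GH_module)
  interpret T: tensor_product \<Z> ?G ?G by (intro tensor_product.intro GH_module)
  have p: "(GH_proj (frag_of \<gamma>) :: 'f GH_elem) \<in> carrier ?G" if "\<gamma> \<in> compositions" for \<gamma>
    using mod_hom_closed[OF GH_proj(1), of "frag_of \<gamma>"] that by (simp add: Comp_simps)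
  have z: "(GH_proj (frag_of \<alpha>) :: 'f GH_elem) = \<zero>\<^bsub>?G\<^esub> \<or> GH_proj (frag_of \<beta>) = \<zero>\<^bsub>?G\<^esub>"
    using False \<alpha> \<beta> by (auto simp: GH_proj(2))
  have tz: "T.tns x \<zero>\<^bsub>?G\<^esub> = \<zero>\<^bsub>T.T\<^esub>" if "x \<in> carrier ?G" for x
    using T.tns_balanced[of 0 x "\<zero>\<^bsub>?G\<^esub>"] T.tns_zero_left[of "\<zero>\<^bsub>?G\<^esub>"] M.smult_l_null[of x] M.smult_r_null[of 0] that by simp
  have "T.tns (GH_proj (frag_of \<alpha>)) (GH_proj (frag_of \<beta>)) = \<zero>\<^bsub>T.T\<^esub>"
    using z
  proof
    assume "(GH_proj (frag_of \<alpha>) :: 'f GH_elem) = \<zero>\<^bsub>?G\<^esub>"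
    then show ?thesis using T.tns_zero_left[OF p[OF \<beta>]] by (simp only:)
  next
    assume "(GH_proj (frag_of \<beta>) :: 'f GH_elem) = \<zero>\<^bsub>?G\<^esub>"
    then show ?thesis using tz[OF p[OF \<alpha>]] by (simp only:)
  qed
  then have "GH_mult (T.tns (GH_proj (frag_of \<alpha>)) (GH_proj (frag_of \<beta>))) = \<zero>\<^bsub>?G\<^esub>"
    using mod_hom_zero[OF T.T_module GH_module GH_mult(1)] by (simp only:)
  then show ?thesis using consecutive_comp_prod[OF \<alpha> \<beta>, where 'f = 'f] False by metis
qed

lemma GH_proj_sum:
  assumes "finite I" "\<And>i. i \<in> I \<Longrightarrow> Poly_Mapping.keys (f i) \<subseteq> compositions"
  shows "(\<Oplus>\<^bsub>GH\<^esub>i\<in>I. k i \<odot>\<^bsub>GH\<^esub> GH_proj (f i)) = (GH_proj (\<Sum>i\<in>I. frag_cmul (k i) (f i)) :: 'f::field GH_elem)"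
proof -
  interpret M: module \<Z> "GH :: (int, 'f GH_elem) module" by (rule GH_module)
  have c: "frag_cmul (k i) (f i) \<in> carrier Comp" if "i \<in> I" for i
    using assms(2)[OF that] keys_cmul[of "k i" "f i"] by (auto simp: Comp_simps(1))
  have "GH_proj (\<Sum>i\<in>I. frag_cmul (k i) (f i)) = (GH_proj (\<Oplus>\<^bsub>Comp\<^esub>i\<in>I. frag_cmul (k i) (f i)) :: 'f GH_elem)"
    using Comp_finsum[OF assms(1) c] by simp
  also have "\<dots> = (\<Oplus>\<^bsub>GH\<^esub>i\<in>I. GH_proj (frag_cmul (k i) (f i)))"
    by (rule mod_hom_finsum[OF Comp_module GH_module GH_proj(1) assms(1) c])
  also have "\<dots> = (\<Oplus>\<^bsub>GH\<^esub>i\<in>I. k i \<odot>\<^bsub>GH\<^esub> GH_proj (f i))"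
  proof (rule M.M.finsum_cong'[OF refl])
    show "(\<lambda>i. k i \<odot>\<^bsub>GH\<^esub> (GH_proj (f i) :: 'f GH_elem)) \<in> I \<rightarrow> carrier GH"
      using mod_hom_closed[OF GH_proj(1)] assms(2) by (auto simp: Comp_simps(1))
  qed (simp add: GH_proj_scale assms(2))
  finally show ?thesis by (rule sym)
qed

lemma GH_proj_Nil: "GH_proj (if \<alpha> = [] then frag_of [] else 0) =
    (if \<alpha> = [] then Cclass [] else \<zero>\<^bsub>GH :: (int, 'f::field GH_elem) module\<^esub>)"
proof -
  have "[] \<in> simple_index" by (simp add: simple_index_iff inner_gt1_def)
  moreover have "GH_proj 0 = \<zero>\<^bsub>GH :: (int, 'f GH_elem) module\<^esub>"
    using mod_hom_zero[OF Comp_module GH_module GH_proj(1)] by (simp add: Comp_simps)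
  ultimately show ?thesis by (simp add: GH_proj(2) Nil_compositions)
qed

text \<open>Every factor of a convolution term is, up to sign, a projection: a cut by
  \<open>C\<close>, which says that projection after inclusion is the identity, and an antipode
  value by \<open>GH_S_Cclass\<close>. So \<open>GH_mult_proj\<close> moves \<open>GH_proj\<close>
  outside, and the sum left inside is the one already evaluated for \<open>Comp\<close>.\<close>

theorem GH_antipode:
  "is_antipode (GH :: (int, 'f::field GH_elem) module) GH_mult GH_unit GH_comult GH_counit GH_S"
  unfolding GH_eq
proof (rule B.is_antipodeI[where e = "[]" and I = "\<lambda>\<alpha>. {0..sum_list \<alpha>}" and l = comp_upto and r = comp_after];
    (unfold GH_eq[symmetric])?)
  show Nil: "[] \<in> simple_index" by (simp add: simple_index_iff inner_gt1_def)
  show cut: "comp_upto \<alpha> i \<in> simple_index" "comp_after \<alpha> i \<in> simple_index"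
    if "\<alpha> \<in> simple_index" "i \<in> {0..sum_list \<alpha>}" for \<alpha> i
  proof -
    have "inner_gt1 (sum_list \<alpha>) \<alpha>" "i \<le> sum_list \<alpha>" using that by (auto simp: simple_index_iff)
    then show "comp_upto \<alpha> i \<in> simple_index" "comp_after \<alpha> i \<in> simple_index"
      using inner_gt1_upto[of "sum_list \<alpha>" \<alpha> i] by (auto simp: inner_gt1_simple_index)
  qed
  fix \<alpha> assume \<alpha>: "\<alpha> \<in> simple_index"
  let ?G = "GH :: (int, 'f GH_elem) module"
  interpret M: module \<Z> ?G by (rule GH_module)
  have \<alpha>c: "\<alpha> \<in> compositions" using \<alpha> by (rule simple_index_compositions)
  note cc = comp_upto_compositions[OF \<alpha>c]
  have p: "(GH_proj (frag_of \<gamma>) :: 'f GH_elem) \<in> carrier ?G" if "\<gamma> \<in> compositions" for \<gamma>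
    using mod_hom_closed[OF GH_proj(1), of "frag_of \<gamma>"] that by (simp add: Comp_simps)
  have pc: "(k \<odot>\<^bsub>GH\<^esub> GH_proj (comp_prod \<beta> \<gamma>) :: 'f GH_elem) \<in> carrier ?G" if "\<beta> \<in> compositions" "\<gamma> \<in> compositions" for \<beta> \<gamma> k
    by (rule M.smult_closed) (use mod_hom_closed[OF GH_proj(1), of "comp_prod \<beta> \<gamma>"] comp_prod_closed[OF that] in \<open>simp_all add: Comp_simps(1)\<close>)
  have C: "(Cclass \<gamma> :: 'f GH_elem) = GH_proj (frag_of \<gamma>)" if "\<gamma> \<in> simple_index" for \<gamma>
    using that simple_index_compositions[OF that] by (simp add: GH_proj(2))
  have cl: "GH_mult (tens \<Z> GH GH (GH_S (Cclass (comp_upto \<alpha> i))) (Cclass (comp_after \<alpha> i))) =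
      (-1) ^ i \<odot>\<^bsub>?G\<^esub> GH_proj (comp_prod (comp_compl (comp_upto \<alpha> i)) (comp_after \<alpha> i))" if i: "i \<in> {0..sum_list \<alpha>}" for i
    unfolding GH_S_Cclass[OF cut(1)[OF \<alpha> i]] cc(3)[OF i] C[OF cut(2)[OF \<alpha> i]]
    using mult_scaled(1)[OF GH_mult(1) GH_module p p] GH_mult_proj comp_compl_compositions(1)[OF cc(1)[OF i]] cc(2)[OF i]
    by metis
  have cr: "GH_mult (tens \<Z> GH GH (Cclass (comp_upto \<alpha> i)) (GH_S (Cclass (comp_after \<alpha> i)))) =
      (-1) ^ (sum_list \<alpha> - i) \<odot>\<^bsub>?G\<^esub> GH_proj (comp_prod (comp_upto \<alpha> i) (comp_compl (comp_after \<alpha> i)))" if i: "i \<in> {0..sum_list \<alpha>}" for i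
    unfolding GH_S_Cclass[OF cut(2)[OF \<alpha> i]] cc(4)[OF i] C[OF cut(1)[OF \<alpha> i]]
    using mult_scaled(2)[OF GH_mult(1) GH_module p p] GH_mult_proj comp_compl_compositions(1)[OF cc(2)[OF i]] cc(1)[OF i]
    by metis
  have kl: "Poly_Mapping.keys (comp_prod (comp_compl (comp_upto \<alpha> i)) (comp_after \<alpha> i)) \<subseteq> compositions"
    and kr: "Poly_Mapping.keys (comp_prod (comp_upto \<alpha> i) (comp_compl (comp_after \<alpha> i))) \<subseteq> compositions"
    if "i \<in> {0..sum_list \<alpha>}" for i
    by (intro comp_prod_closed comp_compl_compositions cc that)+
  have "(\<Oplus>\<^bsub>?G\<^esub>i\<in>{0..sum_list \<alpha>}. GH_mult (tens \<Z> GH GH (GH_S (Cclass (comp_upto \<alpha> i))) (Cclass (comp_after \<alpha> i)))) =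
      (\<Oplus>\<^bsub>?G\<^esub>i\<in>{0..sum_list \<alpha>}. (-1) ^ i \<odot>\<^bsub>?G\<^esub> GH_proj (comp_prod (comp_compl (comp_upto \<alpha> i)) (comp_after \<alpha> i)))"
    by (rule M.M.finsum_cong'[OF refl Pi_I cl]) (intro pc comp_compl_compositions cc)
  also have "\<dots> = (if \<alpha> = [] then Cclass [] else \<zero>\<^bsub>?G\<^esub>)"
    by (subst GH_proj_sum[OF _ kl]) (simp_all only: finite_atLeastAtMost comp_left_cancel[OF \<alpha>c] GH_proj_Nil)
  finally show "(\<Oplus>\<^bsub>?G\<^esub>i\<in>{0..sum_list \<alpha>}. GH_mult (tens \<Z> GH GH (GH_S (Cclass (comp_upto \<alpha> i))) (Cclass (comp_after \<alpha> i)))) =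
      (if \<alpha> = [] then Cclass [] else \<zero>\<^bsub>?G\<^esub>)" .
  have "(\<Oplus>\<^bsub>?G\<^esub>i\<in>{0..sum_list \<alpha>}. GH_mult (tens \<Z> GH GH (Cclass (comp_upto \<alpha> i)) (GH_S (Cclass (comp_after \<alpha> i))))) =
      (\<Oplus>\<^bsub>?G\<^esub>i\<in>{0..sum_list \<alpha>}. (-1) ^ (sum_list \<alpha> - i) \<odot>\<^bsub>?G\<^esub> GH_proj (comp_prod (comp_upto \<alpha> i) (comp_compl (comp_after \<alpha> i))))"
    by (rule M.M.finsum_cong'[OF refl Pi_I cr]) (intro pc comp_compl_compositions cc)
  also have "\<dots> = (if \<alpha> = [] then Cclass [] else \<zero>\<^bsub>?G\<^esub>)"
    by (subst GH_proj_sum[OF _ kr]) (simp_all only: finite_atLeastAtMost comp_right_cancel[OF \<alpha>c] GH_proj_Nil)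
  finally show "(\<Oplus>\<^bsub>?G\<^esub>i\<in>{0..sum_list \<alpha>}. GH_mult (tens \<Z> GH GH (Cclass (comp_upto \<alpha> i)) (GH_S (Cclass (comp_after \<alpha> i))))) =
      (if \<alpha> = [] then Cclass [] else \<zero>\<^bsub>?G\<^esub>)" .
qed (simp_all only: GH_mult(1) GH_comult GH_counit GH_S_hom GH_unit_def finite_atLeastAtMost)

theorem proposition7p8:
  shows "is_antipode Comp Comp_mult Comp_unit Comp_comult Comp_counit Comp_S \<and>
    is_antipode (GH :: (int, 'f::field GH_elem) module)
      GH_mult GH_unit GH_comult GH_counit (GH_proj \<circ> Comp_S \<circ> GH_incl) \<and>
    (\<forall>n \<alpha>. inner_gt1 n \<alpha> \<longrightarrow>
      (GH_proj \<circ> Comp_S \<circ> GH_incl) (Cclass \<alpha> :: 'f GH_elem) =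
        (if inner_gt1 n (comp_compl \<alpha>)
         then (-1) ^ n \<odot>\<^bsub>GH\<^esub> Cclass (comp_compl \<alpha>) else \<zero>\<^bsub>GH\<^esub>)) \<and>
    (\<forall>n \<alpha>. inner_gt1 n \<alpha> \<longrightarrow>
      (inner_gt1 n (comp_compl \<alpha>) \<longleftrightarrow>
        (\<exists>k. \<alpha> \<in> {replicate k 2, 1 # replicate k 2,
                  replicate k 2 @ [1], 1 # replicate k 2 @ [1]})))"
proof (intro conjI allI impI)
  fix n \<alpha> assume \<alpha>: "inner_gt1 n \<alpha>"
  have "\<alpha> \<in> simple_index" "sum_list \<alpha> = n" "\<alpha> \<in> compositions"
    using \<alpha> simple_index_compositions by (auto simp: inner_gt1_simple_index)
  then show "(GH_proj \<circ> Comp_S \<circ> GH_incl) (Cclass \<alpha> :: 'f GH_elem) =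
      (if inner_gt1 n (comp_compl \<alpha>) then (-1) ^ n \<odot>\<^bsub>GH\<^esub> Cclass (comp_compl \<alpha>) else \<zero>\<^bsub>GH\<^esub>)"
    using comp_compl_compositions[of \<alpha>]
    unfolding GH_S_Cclass[OF \<open>\<alpha> \<in> simple_index\<close>]
    by (simp add: GH_proj(2) inner_gt1_simple_index module.smult_r_null[OF GH_module])
qed (rule Comp_antipode GH_antipode inner_gt1_compl_classification; assumption?)+

end
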